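(* Let $k\ge2$ and let $f$ be a dominating quasi-algebraically stable (QAS) meromorphic self-map of $\mathbb{P}^k$. Then its first dynamical degree $\lambda_1(f)=\lim_{n\to\infty}\mathrm{d}(f^n)^{1/n}$ is an algebraic integer. Moreover, $$\lim_{n\to\infty}\frac{\mathrm{d}(f^{n+1})}{\mathrm{d}(f^n)}=\lambda_1(f).$$
   Context: Algebraic degree. A meromorphic self-map $f$ of $\mathbb{P}^k$ can be written $f=[F_0:\cdots:F_k]$ with $F_j$ homogeneous polynomials in $z_0,\ldots,z_k$, all of the same degree $d$, with no nontrivial common factor; $\mathrm{d}(f):=d$ is the algebraic degree of $f$. The map $f$ is dominating if its Jacobian determinant does not vanish identically in any local chart. The indeterminacy locus $\mathcal{I}(f)$ is the common zero set of $F_0,\ldots,F_k$ in $\mathbb{P}^k$; it has codimension at least $2$. The iterates $f^n$ are the meromorphic self-maps obtained by composition: the graph of $f^n$ is the closure of the graph of $f^{n-1}\circ f$ over the set where this composition is defined (i.e. $z\notin\mathcal{I}(f)$, $f(z)\notin\mathcal{I}(f^{n-1})$); $f^0=\mathrm{Id}$. The limit defining $\lambda_1(f)$ always exists. Images. For an analytic set $A\subset\mathbb{P}^k$ and a meromorphic self-map $g$, $g(A):=\overline{g(A\setminus\mathcal{I}(g))}$. In particular $f^m(A)$ denotes the image of $A$ under the meromorphic map $g=f^m$. A hypersurface is an analytic subset of pure codimension $1$. Algebraic stability. $f$ is algebraically stable (AS) if there are no hypersurface $\mathcal{H}$ and integer $N\ge1$ with $f^N(\mathcal{H})\subset\mathcal{I}(f)$;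 equivalently $\mathrm{d}(f^n)=\mathrm{d}(f)^n$ for all $n$. Degree lowering hypersurfaces. A hypersurface $\mathcal{H}$ is degree lowering for $f$ if $f^n(\mathcal{H})\subset\mathcal{I}(f)$ for some $n\ge1$; the smallest such $n$ is the height of $\mathcal{H}$. Consider the (finite) family $\mathcal{F}$ of all irreducible degree lowering hypersurfaces $\mathcal{H}$ such that, with $n$ the height of $\mathcal{H}$, $\operatorname{codim} f^m(\mathcal{H})>1$ for $1\le m\le n$. For each integer $n$ occurring as a height of an element of $\mathcal{F}$, the union of all elements of $\mathcal{F}$ of height $n$ is called the primitive degree lowering hypersurface of $f$ with height $n$. Quasi-algebraic stability. $f$ is quasi-algebraically stable (QAS) if either it is AS or it satisfies: (i) there is exactly one primitive degree lowering hypersurface, denoted $\mathcal{H}_0$, with height denoted $n_0$; (ii) for every irreducible component $\mathcal{H}$ of $\mathcal{H}_0$ and every $m=1,\ldots,n_0$, $f^m(\mathcal{H})\not\subset\mathcal{H}_0$; (iii) for every irreducible component $\mathcal{H}$ of $\mathcal{H}_0$, one of the following holds: (iii)$_1$ $f^m(\mathcal{H})\not\subset\mathcal{I}(f)$ for all $m\ge n_0+1$; (iii)$_2$ there is $m_0\ge n_0$ such that $f^{m_0+1}(\mathcal{H})$ is a hypersurface and $f^m(\mathcal{H})\not\subset\mathcal{I}(f)$ for all $m$ with $n_0+1\le m\le m_0$. *)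

theory Defs
  imports
    "HOL-Analysis.Analysis"
    "HOL-Library.Poly_Mapping"
    "HOL-Library.Extended_Nat"
    "HOL-Computational_Algebra.Polynomial"
begin

section \<open>Complex projective space\<close>

text \<open>
  For a finite type \<open>'k\<close> with \<open>k = CARD('k)\<close> elements, \<open>'k proj\<close> is the complex projective space
  of dimension \<open>k\<close>. The \<open>k + 1\<close> homogeneous coordinates are indexed by \<open>'k option\<close>.
\<close>

definition proj_rel :: "complex ^ 'k::finite option \<Rightarrow> complex ^ 'k option \<Rightarrow> bool" where
  "proj_rel v w \<longleftrightarrow> v \<noteq> 0 \<and> w \<noteq> 0 \<and> (\<exists>c. w = c *s v)"

lemma proj_rel_refl: "v \<noteq> 0 \<Longrightarrow> proj_rel v v"
  unfolding proj_rel_def by (metis vector_smult_lid)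

lemma proj_rel_sym: "proj_rel v w \<Longrightarrow> proj_rel w v"
  unfolding proj_rel_def
proof (elim conjE exE)
  fix c assume *: "v \<noteq> 0" "w \<noteq> 0" "w = c *s v"
  then have "c \<noteq> 0" by auto
  then have "v = inverse c *s w" using * by (simp add: vector_smult_assoc)
  with * show "w \<noteq> 0 \<and> v \<noteq> 0 \<and> (\<exists>c. v = c *s w)" by blast
qed

lemma part_equivp_proj_rel: "part_equivp (proj_rel :: complex ^ 'k::finite option \<Rightarrow> _)"
proof (rule part_equivpI)
  have "proj_rel (axis None 1 :: complex ^ 'k option) (axis None 1)"
    unfolding proj_rel_def by (intro conjI exI[of _ 1]) (auto simp: axis_eq_0_iff)
  then show "\<exists>x :: complex ^ 'k option. proj_rel x x" by blast
  show "symp (proj_rel :: complex ^ 'k option \<Rightarrow> _)"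
    by (rule sympI) (rule proj_rel_sym)
  show "transp (proj_rel :: complex ^ 'k option \<Rightarrow> _)"
    by (rule transpI) (auto simp: proj_rel_def vector_smult_assoc)
qed

quotient_type (overloaded) 'k proj = "complex ^ 'k::finite option" / partial: proj_rel
  by (rule part_equivp_proj_rel)

lemma abs_proj_eq_iff:
  "v \<noteq> 0 \<Longrightarrow> w \<noteq> 0 \<Longrightarrow> abs_proj v = abs_proj w \<longleftrightarrow> (\<exists>c. w = c *s v)"
  using Quotient_rel[OF Quotient_proj, of v w] proj_rel_def[of v v] proj_rel_def[of w w]
    proj_rel_def[of v w] vector_smult_lid by metis

instantiation proj :: (finite) topological_space
begin

definition open_proj :: "'a proj set \<Rightarrow> bool" where
  "open_proj U \<longleftrightarrow> open {v. v \<noteq> 0 \<and> abs_proj v \<in> U}"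

instance
proof
  have "{v :: complex ^ 'a option. v \<noteq> 0} = - {0}" by auto
  then show "open (UNIV :: 'a proj set)" by (simp add: open_proj_def open_Compl)
next
  fix S T :: "'a proj set" assume "open S" "open T"
  moreover have "{v. v \<noteq> 0 \<and> abs_proj v \<in> S \<inter> T}
      = {v. v \<noteq> 0 \<and> abs_proj v \<in> S} \<inter> {v. v \<noteq> 0 \<and> abs_proj v \<in> T}" by auto
  ultimately show "open (S \<inter> T)" by (simp add: open_proj_def open_Int)
next
  fix K :: "'a proj set set" assume "\<forall>S\<in>K. open S"
  moreover have "{v. v \<noteq> 0 \<and> abs_proj v \<in> \<Union>K} = (\<Union>S\<in>K. {v. v \<noteq> 0 \<and> abs_proj v \<in> S})" by auto
  ultimately show "open (\<Union>K)" by (simp add: open_proj_def open_UN)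
qed

end

text \<open>
  The standard affine charts, one for each numbering \<open>\<sigma>\<close> of the homogeneous coordinates
  (a permutation of \<open>'k option\<close>): the coordinate \<open>\<sigma> None\<close> is the one divided by.
\<close>

lift_definition chart_dom :: "('k option \<Rightarrow> 'k option) \<Rightarrow> 'k::finite proj \<Rightarrow> bool" is
  "\<lambda>\<sigma> v. v $ \<sigma> None \<noteq> 0"
  by (auto simp: proj_rel_def vec_eq_iff)

lift_definition chart :: "('k option \<Rightarrow> 'k option) \<Rightarrow> 'k::finite proj \<Rightarrow> complex ^ 'k" is
  "\<lambda>\<sigma> v. \<chi> j. v $ \<sigma> (Some j) / v $ \<sigma> None"
  by (auto simp: proj_rel_def vec_eq_iff)

definition chart_inv :: "('k option \<Rightarrow> 'k option) \<Rightarrow> complex ^ 'k \<Rightarrow> 'k::finite proj" where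
  "chart_inv \<sigma> w = abs_proj (\<chi> i. case inv \<sigma> i of None \<Rightarrow> 1 | Some j \<Rightarrow> w $ j)"

lemma chart_chart_inv:
  fixes \<sigma> :: "'k::finite option \<Rightarrow> 'k option"
  assumes "bij \<sigma>"
  shows "chart_dom \<sigma> (chart_inv \<sigma> w)" and "chart \<sigma> (chart_inv \<sigma> w) = w"
proof -
  let ?v = "(\<chi> i. case inv \<sigma> i of None \<Rightarrow> 1 | Some j \<Rightarrow> w $ j) :: complex ^ 'k option"
  have *: "?v $ \<sigma> i = (case i of None \<Rightarrow> 1 | Some j \<Rightarrow> w $ j)" for i
    using assms by (simp add: bij_is_inj)
  have "?v $ \<sigma> None = 1" unfolding * by simp
  then have nz: "?v \<noteq> 0" by (metis zero_index zero_neq_one)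
  then have rel: "proj_rel ?v ?v" by (rule proj_rel_refl)
  show "chart_dom \<sigma> (chart_inv \<sigma> w)"
    unfolding chart_inv_def chart_dom.abs_eq[OF rel] * by simp
  show "chart \<sigma> (chart_inv \<sigma> w) = w"
    unfolding chart_inv_def chart.abs_eq[OF rel] * by (simp add: vec_eq_iff)
qed


section \<open>Analytic sets, codimension, hypersurfaces\<close>

definition holomorphic_fun :: "(complex ^ 'k) set \<Rightarrow> (complex ^ 'k::finite \<Rightarrow> complex) \<Rightarrow> bool" where
  "holomorphic_fun U g \<longleftrightarrow>
     (\<forall>z\<in>U. \<exists>D. (g has_derivative D) (at z) \<and> (\<forall>c v. D (c *s v) = c * D v))"

definition local_analytic :: "(complex ^ 'k::finite) set \<Rightarrow> bool" where
  "local_analytic X \<longleftrightarrow>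
     (\<forall>p. \<exists>U G. open U \<and> p \<in> U \<and> finite G \<and> (\<forall>g\<in>G. holomorphic_fun U g) \<and>
                X \<inter> U = {z\<in>U. \<forall>g\<in>G. g z = 0})"

definition analytic_set :: "'k::finite proj set \<Rightarrow> bool" where
  "analytic_set A \<longleftrightarrow> (\<forall>\<sigma>. bij \<sigma> \<longrightarrow> local_analytic (chart_inv \<sigma> -` A))"

text \<open>
  \<open>p\<close> is a regular point of \<open>X\<close> of codimension \<open>c\<close>: near \<open>p\<close>, \<open>X\<close> is the complex submanifold cut out
  by \<open>c\<close> holomorphic equations with linearly independent differentials at \<open>p\<close>.
\<close>

definition regular_point :: "(complex ^ 'k::finite) set \<Rightarrow> complex ^ 'k \<Rightarrow> nat \<Rightarrow> bool" where
  "regular_point X p c \<longleftrightarrow>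
     p \<in> X \<and>
     (\<exists>U (g :: nat \<Rightarrow> complex ^ 'k \<Rightarrow> complex).
        open U \<and> p \<in> U \<and> (\<forall>i<c. holomorphic_fun U (g i)) \<and>
        X \<inter> U = {z\<in>U. \<forall>i<c. g i z = 0} \<and>
        (\<forall>a. (\<forall>v. (\<Sum>i<c. a i * frechet_derivative (g i) (at p) v) = 0) \<longrightarrow> (\<forall>i<c. a i = 0)))"

text \<open>
  The dimension of an analytic set is the largest dimension of a regular point, so its
  codimension is the smallest codimension of one; the codimension of the empty set is \<open>\<infinity>\<close>.
\<close>

definition codim :: "'k::finite proj set \<Rightarrow> enat" where
  "codim A = Inf {enat c | c \<sigma> p. bij \<sigma> \<and> regular_point (chart_inv \<sigma> -` A) p c}"

text \<open>
  Purity: the codimension is \<open>1\<close> near every point. The empty set is not a hypersurface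
  (otherwise no map would be algebraically stable).
\<close>

definition hypersurface :: "'k::finite proj set \<Rightarrow> bool" where
  "hypersurface A \<longleftrightarrow>
     analytic_set A \<and> A \<noteq> {} \<and> (\<forall>U. open U \<and> A \<inter> U \<noteq> {} \<longrightarrow> codim (A \<inter> U) = 1)"

definition irreducible_analytic :: "'k::finite proj set \<Rightarrow> bool" where
  "irreducible_analytic A \<longleftrightarrow>
     analytic_set A \<and> A \<noteq> {} \<and>
     (\<forall>B C. analytic_set B \<and> analytic_set C \<and> A = B \<union> C \<longrightarrow> B = A \<or> C = A)"

definition irreducible_component :: "'k::finite proj set \<Rightarrow> 'k proj set \<Rightarrow> bool" where
  "irreducible_component H A \<longleftrightarrow>
     irreducible_analytic H \<and> H \<subseteq> A \<and>
     (\<forall>B. irreducible_analytic B \<and> H \<subseteq> B \<and> B \<subseteq> A \<longrightarrow> B = H)"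


section \<open>Meromorphic self-maps\<close>

type_synonym 'k hpoly = "('k option \<Rightarrow>\<^sub>0 nat) \<Rightarrow>\<^sub>0 complex"

definition hpoly_eval :: "'k::finite hpoly \<Rightarrow> complex ^ 'k option \<Rightarrow> complex" where
  "hpoly_eval P z =
     (\<Sum>m\<in>Poly_Mapping.keys P. Poly_Mapping.lookup P m * (\<Prod>i\<in>UNIV. (z $ i) ^ Poly_Mapping.lookup m i))"

definition homogeneous_of_degree :: "'k::finite hpoly \<Rightarrow> nat \<Rightarrow> bool" where
  "homogeneous_of_degree P d \<longleftrightarrow>
     (\<forall>m\<in>Poly_Mapping.keys P. (\<Sum>i\<in>UNIV. Poly_Mapping.lookup m i) = d)"

text \<open>
  The last condition excludes \<open>F = 0\<close>, since every polynomial divides \<open>0\<close>.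
\<close>

definition reduced_form :: "('k option \<Rightarrow> 'k::finite hpoly) \<Rightarrow> nat \<Rightarrow> bool" where
  "reduced_form F d \<longleftrightarrow>
     (\<forall>j. homogeneous_of_degree (F j) d) \<and> (\<forall>G. (\<forall>j. G dvd F j) \<longrightarrow> G dvd 1)"

text \<open>
  A meromorphic self-map is represented by a partial function, which is undefined exactly on the
  indeterminacy locus.
\<close>

definition eval_form :: "('k option \<Rightarrow> 'k hpoly) \<Rightarrow> complex ^ 'k option \<Rightarrow> complex ^ 'k::finite option" where
  "eval_form F v = (\<chi> j. hpoly_eval (F j) v)"

definition form_map :: "('k option \<Rightarrow> 'k hpoly) \<Rightarrow> 'k::finite proj \<rightharpoonup> 'k proj" where
  "form_map F p =
     (let w = eval_form F (rep_proj p) in if w = 0 then None else Some (abs_proj w))"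

lemma hpoly_eval_scale:
  assumes "homogeneous_of_degree P d"
  shows "hpoly_eval P (c *s z) = c ^ d * hpoly_eval P z"
proof -
  have "(\<Prod>i\<in>UNIV. ((c *s z) $ i) ^ Poly_Mapping.lookup m i)
      = c ^ d * (\<Prod>i\<in>UNIV. (z $ i) ^ Poly_Mapping.lookup m i)" if "m \<in> Poly_Mapping.keys P" for m
  proof -
    have "(\<Prod>i\<in>UNIV. ((c *s z) $ i) ^ Poly_Mapping.lookup m i)
        = (\<Prod>i\<in>UNIV. c ^ Poly_Mapping.lookup m i) * (\<Prod>i\<in>UNIV. (z $ i) ^ Poly_Mapping.lookup m i)"
      by (simp add: power_mult_distrib prod.distrib)
    also have "(\<Prod>i\<in>UNIV. c ^ Poly_Mapping.lookup m i) = c ^ d"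
      using assms that by (simp add: homogeneous_of_degree_def flip: power_sum)
    finally show ?thesis .
  qed
  then show ?thesis
    unfolding hpoly_eval_def sum_distrib_left by (intro sum.cong) (auto simp: mult.left_commute)
qed

text \<open>For homogeneous forms the value does not depend on the representative.\<close>

lemma form_map_abs_proj:
  assumes hom: "\<And>j. homogeneous_of_degree (F j) d" and v: "v \<noteq> 0"
  shows "form_map F (abs_proj v) = (if eval_form F v = 0 then None else Some (abs_proj (eval_form F v)))"
proof -
  have "proj_rel v v" using v by (rule proj_rel_refl)
  then have "proj_rel v (rep_proj (abs_proj v))"
    by (rule rep_abs_rsp[OF Quotient3_proj])
  then obtain c where c: "rep_proj (abs_proj v) = c *s v" and "c *s v \<noteq> 0"
    unfolding proj_rel_def by metis
  then have c0: "c \<noteq> 0" by auto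
  have scale: "eval_form F (c *s v) = c ^ d *s eval_form F v"
    by (simp add: eval_form_def vec_eq_iff hpoly_eval_scale[OF hom])
  show ?thesis
  proof (cases "eval_form F v = 0")
    case True
    then show ?thesis unfolding form_map_def c scale Let_def by simp
  next
    case False
    with c0 have nz: "c ^ d *s eval_form F v \<noteq> 0" by (simp add: vec.scale_eq_0_iff)
    have "abs_proj (eval_form F v) = abs_proj (c ^ d *s eval_form F v)"
      unfolding abs_proj_eq_iff[OF False nz] by blast
    with False nz show ?thesis unfolding form_map_def c scale Let_def by presburger
  qed
qed

definition meromorphic_map :: "('k::finite proj \<rightharpoonup> 'k proj) \<Rightarrow> bool" where
  "meromorphic_map f \<longleftrightarrow> (\<exists>F d. reduced_form F d \<and> f = form_map F)"

definition alg_degree :: "('k::finite proj \<rightharpoonup> 'k proj) \<Rightarrow> nat" where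
  "alg_degree f = (THE d. \<exists>F. reduced_form F d \<and> f = form_map F)"

definition indeterminacy :: "('k::finite proj \<rightharpoonup> 'k proj) \<Rightarrow> 'k proj set" where
  "indeterminacy f = - dom f"

definition dominating :: "('k::finite proj \<rightharpoonup> 'k proj) \<Rightarrow> bool" where
  "dominating f \<longleftrightarrow>
     (\<forall>\<sigma> \<tau>. bij \<sigma> \<and> bij \<tau> \<longrightarrow>
        (\<exists>w q. f (chart_inv \<sigma> w) = Some q \<and> chart_dom \<tau> q \<and>
           det (matrix (frechet_derivative (\<lambda>z. chart \<tau> (the (f (chart_inv \<sigma> z)))) (at w))) \<noteq> 0))"

text \<open>
  \<open>g \<circ>\<^sub>m f\<close> is defined exactly at the \<open>z\<close> outside the indeterminacy locus of \<open>f\<close> with \<open>f z\<close> outside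
  that of \<open>g\<close>; the composite is the meromorphic map whose graph is the closure of its graph.
\<close>

definition mero_graph :: "('k::finite proj \<rightharpoonup> 'k proj) \<Rightarrow> ('k proj \<times> 'k proj) set" where
  "mero_graph f = closure (Map.graph f)"

definition mero_comp ::
    "('k::finite proj \<rightharpoonup> 'k proj) \<Rightarrow> ('k proj \<rightharpoonup> 'k proj) \<Rightarrow> ('k proj \<rightharpoonup> 'k proj)" where
  "mero_comp g f =
     (THE h. meromorphic_map h \<and> mero_graph h = closure (Map.graph (g \<circ>\<^sub>m f)))"

primrec mero_iter :: "('k::finite proj \<rightharpoonup> 'k proj) \<Rightarrow> nat \<Rightarrow> ('k proj \<rightharpoonup> 'k proj)" where
  "mero_iter f 0 = Some"
| "mero_iter f (Suc n) = mero_comp (mero_iter f n) f"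

definition mero_image :: "('k::finite proj \<rightharpoonup> 'k proj) \<Rightarrow> 'k proj set \<Rightarrow> 'k proj set" where
  "mero_image g A = closure {w. \<exists>z\<in>A. g z = Some w}"

definition dyn_degree1 :: "('k::finite proj \<rightharpoonup> 'k proj) \<Rightarrow> real" where
  "dyn_degree1 f = lim (\<lambda>n. real (alg_degree (mero_iter f n)) powr (1 / real n))"


section \<open>Algebraic and quasi-algebraic stability\<close>

definition alg_stable :: "('k::finite proj \<rightharpoonup> 'k proj) \<Rightarrow> bool" where
  "alg_stable f \<longleftrightarrow>
     \<not> (\<exists>H N. hypersurface H \<and> N \<ge> 1 \<and> mero_image (mero_iter f N) H \<subseteq> indeterminacy f)"

definition degree_lowering :: "('k::finite proj \<rightharpoonup> 'k proj) \<Rightarrow> 'k proj set \<Rightarrow> bool" where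
  "degree_lowering f H \<longleftrightarrow>
     hypersurface H \<and> (\<exists>n\<ge>1. mero_image (mero_iter f n) H \<subseteq> indeterminacy f)"

definition dl_height :: "('k::finite proj \<rightharpoonup> 'k proj) \<Rightarrow> 'k proj set \<Rightarrow> nat" where
  "dl_height f H = (LEAST n. n \<ge> 1 \<and> mero_image (mero_iter f n) H \<subseteq> indeterminacy f)"

definition dl_family :: "('k::finite proj \<rightharpoonup> 'k proj) \<Rightarrow> 'k proj set set" where
  "dl_family f =
     {H. irreducible_analytic H \<and> degree_lowering f H \<and>
         (\<forall>m\<in>{1..dl_height f H}. codim (mero_image (mero_iter f m) H) > 1)}"

definition primitive_dl :: "('k::finite proj \<rightharpoonup> 'k proj) \<Rightarrow> 'k proj set \<Rightarrow> nat \<Rightarrow> bool" where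
  "primitive_dl f H0 n \<longleftrightarrow>
     (\<exists>H\<in>dl_family f. dl_height f H = n) \<and> H0 = \<Union>{H\<in>dl_family f. dl_height f H = n}"

definition quasi_alg_stable :: "('k::finite proj \<rightharpoonup> 'k proj) \<Rightarrow> bool" where
  "quasi_alg_stable f \<longleftrightarrow>
     alg_stable f \<or>
     (\<exists>H0 n0.
        (\<forall>H n. primitive_dl f H n \<longleftrightarrow> H = H0 \<and> n = n0) \<and>
        (\<forall>H. irreducible_component H H0 \<longrightarrow>
           (\<forall>m\<in>{1..n0}. \<not> mero_image (mero_iter f m) H \<subseteq> H0)) \<and>
        (\<forall>H. irreducible_component H H0 \<longrightarrow>
           (\<forall>m\<ge>n0 + 1. \<not> mero_image (mero_iter f m) H \<subseteq> indeterminacy f) \<or>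
           (\<exists>m0\<ge>n0. hypersurface (mero_image (mero_iter f (m0 + 1)) H) \<and>
              (\<forall>m\<in>{n0 + 1..m0}. \<not> mero_image (mero_iter f m) H \<subseteq> indeterminacy f))))"

end

theory Submission
  imports Defs "HOL-Complex_Analysis.Complex_Analysis"
    "HOL-Computational_Algebra.Polynomial_Factorial" "HOL-Computational_Algebra.Field_as_Ring"
    "HOL-Computational_Algebra.Fundamental_Theorem_Algebra"
begin

text \<open>
  Let \<open>F\<^sub>n\<close> be the reduced form of \<open>f\<^sup>n\<close>. Then \<open>F \<circ> F\<^sub>n = L\<^sub>n F\<^bsub>n+1\<^esub>\<close> for a form \<open>L\<^sub>n\<close>, so
  \<open>d(f\<^bsup>n+1\<^esup>) = d(f) d(f\<^sup>n) - deg L\<^sub>n\<close>, and an irreducible \<open>P\<close> divides \<open>L\<^sub>n\<close> exactly when \<open>f\<^sup>n\<close> maps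
  \<open>{P = 0}\<close> into the indeterminacy locus. If \<open>f\<close> is algebraically stable, all \<open>L\<^sub>n\<close> are constant.
  Otherwise \<open>L\<^sub>m\<close> is constant for \<open>m < n\<^sub>0\<close> and \<open>H\<^sub>0 = {L\<^bsub>n\<^sub>0\<^esub> = 0}\<close>. For \<open>n \<ge> n\<^sub>0\<close>, following \<open>{P = 0}\<close>
  with \<open>P\<close> dividing \<open>L\<^sub>n\<close> from one hypersurface in its orbit to the next leads to a component of
  \<open>H\<^sub>0\<close> after \<open>n - n\<^sub>0\<close> steps, because of (iii). With (ii), \<open>P\<close> occurs with the same multiplicity in \<open>L\<^sub>n\<close> and in
  \<open>L\<^bsub>n\<^sub>0\<^esub> \<circ> F\<^bsub>n - n\<^sub>0\<^esub>\<close>. Hence \<open>deg L\<^sub>n = h d(f\<^bsup>n - n\<^sub>0\<^esup>)\<close> with \<open>h = deg L\<^bsub>n\<^sub>0\<^esub>\<close>, and the degrees satisfy a linear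
  recurrence whose ratios decrease to a root of \<open>x\<^bsup>n\<^sub>0+1\<^esup> - d x\<^bsup>n\<^sub>0\<^esup> + h\<close>.

  The dictionary between hypersurfaces and forms rests on the Nullstellensatz for an irreducible
  hypersurface \<open>P = 0\<close>. Over the points with the generic number of roots in a fixed direction, \<open>P = 0\<close>
  splits into continuous sheets; the product over a clopen set of sheets is of polynomial growth, hence a
  polynomial factor of \<open>P\<close>. So the sheets are connected, and an analytic condition holding on an
  open piece of \<open>P = 0\<close> propagates to all of it.
\<close>

text \<open>The hypersurfaces in the definitions are analytic, whereas the losses are polynomials.
  No algebraicity theorem for analytic sets is invoked; two facts replace it. A reduced form cannot
  vanish on a non-empty open piece of a hypersurface, so a degree lowering hypersurface lies in the
  zero set of a loss. And a set with a regular point of codimension at most one lies in the zero set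
  of at most one irreducible form, so an image of such codimension determines that form.
  Multiplicities are never defined. Equal multiplicity of \<open>P\<close> in \<open>A\<close> and
  \<open>B\<close> is expressed by an identity \<open>C A = C' B\<close> with \<open>P\<close>
  dividing neither \<open>C\<close> nor \<open>C'\<close>. These factors arise when compositions of
  reduced forms are reduced; they are prime to \<open>P\<close> because the image of
  \<open>P = 0\<close> is dense in a hypersurface, on which a reduced form does not vanish
  identically. Condition (ii) serves to show that a divisor of the pullback of the first loss
  divides the later loss. The direction is chosen with \<open>P v\<close> non-zero: up to a
  constant, \<open>P\<close> is then monic in that direction over every base point, and no root
  escapes to infinity.\<close>

no_notation fps_nth (infixl \<open>$\<close> 75)

section \<open>Polynomial functions\<close>

text \<open>Homogeneous polynomials are handled as functions; over the complex numbers they are determined by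
  their values.\<close>

inductive polyfun :: "(complex ^ 'k::finite option \<Rightarrow> complex) \<Rightarrow> bool" where
  polyfun_const: "polyfun (\<lambda>z. c)"
| polyfun_coord: "polyfun (\<lambda>z. z $ i)"
| polyfun_add: "polyfun f \<Longrightarrow> polyfun g \<Longrightarrow> polyfun (\<lambda>z. f z + g z)"
| polyfun_mult: "polyfun f \<Longrightarrow> polyfun g \<Longrightarrow> polyfun (\<lambda>z. f z * g z)"

lemma polyfun_uminus: "polyfun f \<Longrightarrow> polyfun (\<lambda>z. - f z)"
  using polyfun_mult[OF polyfun_const[of "-1"], of f] by simp

lemma polyfun_diff: "polyfun f \<Longrightarrow> polyfun g \<Longrightarrow> polyfun (\<lambda>z. f z - g z)"
  using polyfun_add[OF _ polyfun_uminus] by fastforce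

lemma polyfun_sum: "(\<And>i. i \<in> I \<Longrightarrow> polyfun (f i)) \<Longrightarrow> polyfun (\<lambda>z. \<Sum>i\<in>I. f i z)"
  by (induction I rule: infinite_finite_induct) (auto intro: polyfun.intros)

lemma polyfun_prod: "(\<And>i. i \<in> I \<Longrightarrow> polyfun (f i)) \<Longrightarrow> polyfun (\<lambda>z. \<Prod>i\<in>I. f i z)"
  by (induction I rule: infinite_finite_induct) (auto intro: polyfun.intros)

lemma polyfun_power: "polyfun f \<Longrightarrow> polyfun (\<lambda>z. f z ^ n)"
  by (induction n) (auto intro: polyfun.intros)

lemmas polyfun_intros = polyfun.intros polyfun_uminus polyfun_diff polyfun_sum polyfun_prod polyfun_power

lemma polyfun_compose:
  assumes "polyfun R" "\<And>i. polyfun (\<lambda>z. E z $ i)"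
  shows "polyfun (\<lambda>z. R (E z))"
  using assms(1) by induction (auto intro: polyfun.intros assms(2))

section \<open>Formal polynomials and their values\<close>

lemma hpoly_eval_superset:
  assumes "finite K" "Poly_Mapping.keys P \<subseteq> K"
  shows "hpoly_eval P z =
    (\<Sum>m\<in>K. Poly_Mapping.lookup P m * (\<Prod>i\<in>UNIV. (z $ i) ^ Poly_Mapping.lookup m i))"
  unfolding hpoly_eval_def
  by (intro sum.mono_neutral_left) (use assms in \<open>auto simp: in_keys_iff\<close>)

lemma hpoly_eval_zero [simp]: "hpoly_eval 0 z = 0"
  by (simp add: hpoly_eval_def)

lemma hpoly_eval_add: "hpoly_eval (P + Q) z = hpoly_eval P z + hpoly_eval Q z"
proof -
  let ?K = "Poly_Mapping.keys P \<union> Poly_Mapping.keys Q"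
  have "hpoly_eval (P + Q) z =
      (\<Sum>m\<in>?K. Poly_Mapping.lookup (P + Q) m * (\<Prod>i\<in>UNIV. (z $ i) ^ Poly_Mapping.lookup m i))"
    by (rule hpoly_eval_superset) (auto dest!: subsetD[OF Poly_Mapping.keys_add])
  also have "\<dots> = hpoly_eval P z + hpoly_eval Q z"
    by (subst (1 2) hpoly_eval_superset[of ?K]) (auto simp: lookup_add algebra_simps sum.distrib)
  finally show ?thesis .
qed

lemma poly_ext: "(\<And>x. poly p x = poly q x) \<Longrightarrow> p = (q :: complex poly)"
  using poly_eq_poly_eq_iff[THEN iffD1, OF ext] by blast

lemma coeff_sum_monom: "coeff (\<Sum>e\<le>N. monom (g e) e) l = (if l \<le> N then g l else 0)"
  by (simp add: coeff_sum)

lemma hpoly_eval_single: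
  "hpoly_eval (Poly_Mapping.single m c) z = c * (\<Prod>i\<in>UNIV. (z $ i) ^ Poly_Mapping.lookup m i)"
  by (subst hpoly_eval_superset[of "{m}"]) auto

lemma hpoly_induct [case_names single add]:
  fixes P :: "'k::finite hpoly"
  assumes single: "\<And>m c. \<Phi> (Poly_Mapping.single m c)"
    and add: "\<And>P Q. \<Phi> P \<Longrightarrow> \<Phi> Q \<Longrightarrow> \<Phi> (P + Q)"
  shows "\<Phi> P"
proof -
  have "\<Phi> (\<Sum>m\<in>K. Poly_Mapping.single m (Poly_Mapping.lookup P m))" for K
  proof (induction K rule: infinite_finite_induct)
    case empty
    then show ?case using single[of 0 0] by simp
  next
    case (infinite A)
    then show ?case using single[of 0 0] by simp
  qed (auto intro: single add)
  moreover have "(\<Sum>m\<in>Poly_Mapping.keys P. Poly_Mapping.single m (Poly_Mapping.lookup P m)) = P"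
    by (rule poly_mapping_eqI) (auto simp: lookup_sum lookup_single when_def in_keys_iff)
  ultimately show ?thesis by metis
qed

lemma hpoly_eval_mult: "hpoly_eval (P * Q) z = hpoly_eval P z * hpoly_eval Q z"
proof (induction P rule: hpoly_induct)
  case (single m c)
  show ?case
  proof (induction Q rule: hpoly_induct)
    case (single n d)
    show ?case
      by (simp add: mult_single hpoly_eval_single lookup_add power_add prod.distrib)
  qed (simp add: distrib_left hpoly_eval_add)
qed (simp add: distrib_right hpoly_eval_add)

text \<open>Doubling a coordinate \<open>i\<close> in which \<open>m\<close> and some
  \<open>n\<close> differ multiplies every monomial by a power of 2. Subtracting the multiple of the
  relation that cancels \<open>m\<close> leaves a relation over the smaller set, in which
  \<open>n\<close> keeps its coefficient up to a non-zero factor.\<close>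

lemma monomials_independent:
  fixes c :: "('k::finite option \<Rightarrow>\<^sub>0 nat) \<Rightarrow> complex"
  assumes "finite K"
    and "\<And>z. (\<Sum>m\<in>K. c m * (\<Prod>i\<in>UNIV. (z $ i) ^ Poly_Mapping.lookup m i)) = 0"
  shows "\<forall>m\<in>K. c m = 0"
  using assms
proof (induction K arbitrary: c rule: finite_induct)
  case (insert m K)
  define mono where "mono n z = (\<Prod>i\<in>UNIV. ((z :: complex ^ 'k option) $ i) ^ Poly_Mapping.lookup n i)" for n z
  have sum0: "(\<Sum>n\<in>insert m K. c n * mono n z) = 0" for z
    using insert.prems by (simp add: mono_def)
  have K0: "c n = 0" if "n \<in> K" for n
  proof -
    from that insert.hyps have "m \<noteq> n" by auto
    then obtain i where i: "Poly_Mapping.lookup m i \<noteq> Poly_Mapping.lookup n i"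
      by (auto simp: poly_mapping_eq_iff fun_eq_iff)
    define w :: "complex ^ 'k option" where "w = (\<chi> j. if j = i then 2 else 1)"
    have mw: "mono l (\<chi> j. w $ j * z $ j) = 2 ^ Poly_Mapping.lookup l i * mono l z" for l z
    proof -
      have "(\<Prod>j\<in>UNIV. (w $ j) ^ Poly_Mapping.lookup l j) = (\<Prod>j\<in>UNIV. if j = i then 2 ^ Poly_Mapping.lookup l j else 1)"
        by (intro prod.cong) (auto simp: w_def)
      also have "\<dots> = 2 ^ Poly_Mapping.lookup l i" by simp
      finally show ?thesis
        unfolding mono_def by (simp add: power_mult_distrib prod.distrib)
    qed
    let ?c' = "\<lambda>n. c n * (2 ^ Poly_Mapping.lookup n i - 2 ^ Poly_Mapping.lookup m i)"
    have "(\<Sum>n\<in>K. ?c' n * mono n z) = 0" for z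
    proof -
      have "(\<Sum>n\<in>insert m K. c n * mono n (\<chi> j. w $ j * z $ j))
          - 2 ^ Poly_Mapping.lookup m i * (\<Sum>n\<in>insert m K. c n * mono n z)
          = (\<Sum>n\<in>K. ?c' n * mono n z)"
        using insert.hyps by (simp add: mw sum_distrib_left algebra_simps sum_subtractf)
      then show ?thesis unfolding sum0 by simp
    qed
    then have "?c' n = 0"
      using insert.IH[of ?c'] that unfolding mono_def by blast
    moreover have "(2::complex) ^ Poly_Mapping.lookup n i \<noteq> 2 ^ Poly_Mapping.lookup m i"
    proof
      assume "(2::complex) ^ Poly_Mapping.lookup n i = 2 ^ Poly_Mapping.lookup m i"
      then have "norm ((2::complex) ^ Poly_Mapping.lookup n i) = norm ((2::complex) ^ Poly_Mapping.lookup m i)"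
        by simp
      then have "(2::real) ^ Poly_Mapping.lookup n i = 2 ^ Poly_Mapping.lookup m i"
        by (simp add: norm_power)
      then show False using i by simp
    qed
    ultimately show ?thesis by simp
  qed
  have "c m * mono m (\<chi> i. 1) = 0"
    using sum0[of "\<chi> i. 1"] insert.hyps K0 by simp
  then show ?case using K0 by (auto simp: mono_def)
qed simp

text \<open>Lets identities and divisibilities between formal polynomials be proved
  pointwise.\<close>

lemma hpoly_eval_inj: "hpoly_eval P = hpoly_eval Q \<longleftrightarrow> P = Q"
proof
  assume eq: "hpoly_eval P = hpoly_eval Q"
  let ?K = "Poly_Mapping.keys P \<union> Poly_Mapping.keys Q"
  have "\<forall>m\<in>?K. Poly_Mapping.lookup P m - Poly_Mapping.lookup Q m = 0"
  proof (rule monomials_independent)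
    fix z
    have "hpoly_eval P z - hpoly_eval Q z = 0" using eq by simp
    then show "(\<Sum>m\<in>?K. (Poly_Mapping.lookup P m - Poly_Mapping.lookup Q m) *
        (\<Prod>i\<in>UNIV. (z $ i) ^ Poly_Mapping.lookup m i)) = 0"
      by (subst (asm) (1 2) hpoly_eval_superset[of ?K]) (auto simp: left_diff_distrib sum_subtractf)
  qed simp
  then have *: "\<And>m. m \<in> ?K \<Longrightarrow> Poly_Mapping.lookup P m - Poly_Mapping.lookup Q m = 0" by blast
  have "Poly_Mapping.lookup P m = Poly_Mapping.lookup Q m" for m
  proof (cases "m \<in> ?K")
    case True
    show ?thesis using *[OF True] by (simp only: right_minus_eq)
  next
    case False
    then show ?thesis by (metis UnCI in_keys_iff)
  qed
  then show "P = Q" by (rule poly_mapping_eqI)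
qed simp

lemma polyfun_hpoly_eval: "polyfun (hpoly_eval P)"
proof -
  have "polyfun (\<lambda>z. hpoly_eval P z)"
    unfolding hpoly_eval_def by (intro polyfun_intros)
  then show ?thesis by simp
qed

lemma polyfun_imp_hpoly_eval: "polyfun g \<Longrightarrow> \<exists>P. g = hpoly_eval P"
proof (induction rule: polyfun.induct)
  case (polyfun_const c)
  have "(\<lambda>z. c) = hpoly_eval (Poly_Mapping.single 0 c)"
    by (simp add: fun_eq_iff hpoly_eval_single)
  then show ?case by blast
next
  case (polyfun_coord i)
  have "z $ i = hpoly_eval (Poly_Mapping.single (Poly_Mapping.single i 1) 1) z" for z
  proof -
    have "(\<Prod>j\<in>UNIV. (z $ j) ^ Poly_Mapping.lookup (Poly_Mapping.single i 1) j)
        = (\<Prod>j\<in>UNIV. if j = i then z $ j else 1)"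
      by (intro prod.cong) (auto simp: lookup_single when_def)
    then show ?thesis by (simp add: hpoly_eval_single)
  qed
  then have "(\<lambda>z. z $ i) = hpoly_eval (Poly_Mapping.single (Poly_Mapping.single i 1) 1)" by blast
  then show ?case by blast
next
  case (polyfun_add f g)
  then obtain P Q where "f = hpoly_eval P" "g = hpoly_eval Q" by blast
  then have "(\<lambda>z. f z + g z) = hpoly_eval (P + Q)" by (simp add: hpoly_eval_add fun_eq_iff)
  then show ?case by blast
next
  case (polyfun_mult f g)
  then obtain P Q where "f = hpoly_eval P" "g = hpoly_eval Q" by blast
  then have "(\<lambda>z. f z * g z) = hpoly_eval (P * Q)" by (simp add: hpoly_eval_mult fun_eq_iff)
  then show ?case by blast
qed

section \<open>Restriction of polynomial functions to lines and planes\<close>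

lemma polyfun_line:
  fixes g :: "complex ^ 'k::finite option \<Rightarrow> complex"
  assumes "polyfun g"
  shows "\<exists>N. \<forall>a b. \<exists>p. degree p \<le> N \<and> (\<forall>t. g (a + t *s b) = poly p t)"
  using assms
proof (induction rule: polyfun.induct)
  case (polyfun_const c)
  then show ?case by (intro exI[of _ 0] allI exI[of _ "[:c:]"]) auto
next
  case (polyfun_coord i)
  show ?case
  proof (rule exI[of _ 1], intro allI)
    fix a b :: "complex ^ 'k option"
    show "\<exists>p. degree p \<le> 1 \<and> (\<forall>t. (a + t *s b) $ i = poly p t)"
      by (rule exI[of _ "[:a $ i, b $ i:]"]) (auto simp: degree_pCons_eq_if)
  qed
next
  case (polyfun_add f g)
  then obtain M N where MN: "\<forall>a b. \<exists>p. degree p \<le> M \<and> (\<forall>t. f (a + t *s b) = poly p t)"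
     "\<forall>a b. \<exists>p. degree p \<le> N \<and> (\<forall>t. g (a + t *s b) = poly p t)" by blast
  show ?case
  proof (rule exI[of _ "max M N"], intro allI)
    fix a b
    obtain p q where "degree p \<le> M" "\<forall>t. f (a + t *s b) = poly p t" "degree q \<le> N" "\<forall>t. g (a + t *s b) = poly q t"
      using MN by meson
    then show "\<exists>p. degree p \<le> max M N \<and> (\<forall>t. f (a + t *s b) + g (a + t *s b) = poly p t)"
      by (intro exI[of _ "p + q"]) (auto intro!: degree_add_le)
  qed
next
  case (polyfun_mult f g)
  then obtain M N where MN: "\<forall>a b. \<exists>p. degree p \<le> M \<and> (\<forall>t. f (a + t *s b) = poly p t)"
     "\<forall>a b. \<exists>p. degree p \<le> N \<and> (\<forall>t. g (a + t *s b) = poly p t)" by blast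
  show ?case
  proof (rule exI[of _ "M + N"], intro allI)
    fix a b
    obtain p q where "degree p \<le> M" "\<forall>t. f (a + t *s b) = poly p t" "degree q \<le> N" "\<forall>t. g (a + t *s b) = poly q t"
      using MN by meson
    then show "\<exists>p. degree p \<le> M + N \<and> (\<forall>t. f (a + t *s b) * g (a + t *s b) = poly p t)"
      by (intro exI[of _ "p * q"]) (auto intro!: order_trans[OF degree_mult_le])
  qed
qed

lemma polyfun_lineE:
  assumes "polyfun g"
  obtains p where "\<And>t. g (a + t *s b) = poly p t"
  using polyfun_line[OF assms] by meson

text \<open>The outer variable of \<open>p\<close> is the coordinate \<open>y\<close> along
  \<open>v\<close>; its coefficients are polynomials in the parameter \<open>t\<close> of the base
  line. This is the convention of \<open>ev2\<close> and \<open>spec\<close> below.\<close>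

lemma polyfun_plane:
  assumes "polyfun g"
  shows "\<exists>p :: complex poly poly. \<forall>t y. g (a + t *s b + y *s v) = poly (poly p [:y:]) t"
  using assms
proof (induction rule: polyfun.induct)
  case (polyfun_const c)
  then show ?case by (intro exI[of _ "[:[:c:]:]"]) auto
next
  case (polyfun_coord i)
  show ?case
    by (rule exI[of _ "[:[:a $ i, b $ i:], [:v $ i:]:]"]) (auto simp: algebra_simps)
next
  case (polyfun_add f g)
  then obtain p q where "\<forall>t y. f (a + t *s b + y *s v) = poly (poly p [:y:]) t"
    "\<forall>t y. g (a + t *s b + y *s v) = poly (poly q [:y:]) t" by blast
  then show ?case by (intro exI[of _ "p + q"]) auto
next
  case (polyfun_mult f g)
  then obtain p q where "\<forall>t y. f (a + t *s b + y *s v) = poly (poly p [:y:]) t"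
    "\<forall>t y. g (a + t *s b + y *s v) = poly (poly q [:y:]) t" by blast
  then show ?case by (intro exI[of _ "p * q"]) auto
qed

lemma continuous_on_smult [continuous_intros]:
  fixes f :: "'a::topological_space \<Rightarrow> complex" and g :: "'a \<Rightarrow> complex ^ 'n::finite"
  assumes "continuous_on S f" "continuous_on S g"
  shows "continuous_on S (\<lambda>x. f x *s g x)"
proof -
  have "continuous_on S (\<lambda>x. \<chi> i. f x * g x $ i)"
    by (intro continuous_intros assms)
  then show ?thesis by (simp add: vector_scalar_mult_def)
qed

lemma polyfun_continuous: "polyfun g \<Longrightarrow> continuous_on S g"
  by (induction rule: polyfun.induct) (auto intro!: continuous_intros)

lemma polyfun_continuous_compose:
  assumes "polyfun g" "continuous_on S f"
  shows "continuous_on S (\<lambda>x. g (f x))"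
  using continuous_on_compose2[OF polyfun_continuous[OF assms(1), of UNIV] assms(2)] by simp

lemma open_polyfun_nonzero: "polyfun g \<Longrightarrow> open {z. g z \<noteq> 0}"
  by (intro open_Collect_neq continuous_on_const polyfun_continuous)

text \<open>On the line through \<open>a\<close> and \<open>b\<close> both functions become non-zero
  polynomials in one variable, and their product has a non-root.\<close>

lemma polyfun_zero_divisors:
  assumes "polyfun f" "polyfun g" "f a \<noteq> 0" "g b \<noteq> 0"
  shows "\<exists>z. f z \<noteq> 0 \<and> g z \<noteq> 0"
proof -
  obtain p where p: "\<And>t. f (a + t *s (b - a)) = poly p t" using polyfun_lineE[OF assms(1)] by blast
  obtain q where q: "\<And>t. g (a + t *s (b - a)) = poly q t" using polyfun_lineE[OF assms(2)] by blast
  have "p \<noteq> 0" using p[of 0] assms(3) by auto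
  moreover have "q \<noteq> 0" using q[of 1] assms(4) by auto
  ultimately have "p * q \<noteq> 0" by simp
  then obtain t where "poly (p * q) t \<noteq> 0" using poly_all_0_iff_0 by blast
  then show ?thesis using p[of t] q[of t] by (intro exI[of _ "a + t *s (b - a)"]) auto
qed

subsection \<open>Homogeneity and divisibility\<close>

text \<open>The zero function satisfies this for every \<open>d\<close>. Statements about the degree
  of a form therefore come with a point where the form is non-zero.\<close>

definition hom_fun :: "nat \<Rightarrow> (complex ^ 'k::finite option \<Rightarrow> complex) \<Rightarrow> bool" where
  "hom_fun d g \<longleftrightarrow> polyfun g \<and> (\<forall>c z. g (c *s z) = c ^ d * g z)"

definition pdvd :: "(complex ^ 'k::finite option \<Rightarrow> complex) \<Rightarrow> (complex ^ 'k option \<Rightarrow> complex) \<Rightarrow> bool" where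
  "pdvd P R \<longleftrightarrow> (\<exists>A. polyfun A \<and> R = (\<lambda>z. A z * P z))"

text \<open>Only factorizations into forms are tested, which is no restriction, since factors of a
  non-zero form are forms (\<open>hom_fun_factor\<close>). Degree 0 stands for a unit.\<close>

definition irr_form :: "(complex ^ 'k::finite option \<Rightarrow> complex) \<Rightarrow> nat \<Rightarrow> bool" where
  "irr_form P d \<longleftrightarrow> hom_fun d P \<and> d \<ge> 1 \<and> (\<exists>z. P z \<noteq> 0) \<and>
     (\<forall>A B a b. hom_fun a A \<and> hom_fun b B \<and> P = (\<lambda>z. A z * B z) \<longrightarrow> a = 0 \<or> b = 0)"

lemma hom_funD: "hom_fun d g \<Longrightarrow> polyfun g" "hom_fun d g \<Longrightarrow> g (c *s z) = c ^ d * g z"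
  by (auto simp: hom_fun_def)

lemma hom_fun_homogeneous: "homogeneous_of_degree P d \<Longrightarrow> hom_fun d (hpoly_eval P)"
  by (simp add: hom_fun_def polyfun_hpoly_eval hpoly_eval_scale)

lemma hom_fun_mult: "hom_fun a A \<Longrightarrow> hom_fun b B \<Longrightarrow> hom_fun (a + b) (\<lambda>z. A z * B z)"
  by (auto simp: hom_fun_def polyfun_mult power_add)

lemma hom_fun_compose:
  assumes "hom_fun e R" "\<And>i. hom_fun d (\<lambda>z. E z $ i)"
  shows "hom_fun (d * e) (\<lambda>z. R (E z))"
proof -
  have "E (c *s z) = c ^ d *s E z" for c z
    using assms(2) by (simp add: hom_fun_def vec_eq_iff)
  then have "R (E (c *s z)) = c ^ (d * e) * R (E z)" for c z
    using hom_funD(2)[OF assms(1)] by (simp add: power_mult)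
  moreover have "polyfun (\<lambda>z. R (E z))"
    by (rule polyfun_compose[OF hom_funD(1)[OF assms(1)] hom_funD(1)[OF assms(2)]])
  ultimately show ?thesis by (simp add: hom_fun_def)
qed

lemma hom_fun_degree_unique:
  assumes "hom_fun a g" "hom_fun b g" "g z \<noteq> 0" shows "a = b"
proof -
  have "(2::complex) ^ a * g z = 2 ^ b * g z" using assms by (metis hom_funD(2))
  then have "(2::complex) ^ a = 2 ^ b" using assms by simp
  then have "norm ((2::complex) ^ a) = norm ((2::complex) ^ b)" by simp
  then have "(2::real) ^ a = 2 ^ b" by (simp add: norm_power)
  then show ?thesis by simp
qed

text \<open>Homogeneity with \<open>c = 0\<close>, where \<open>0 ^ 0 = 1\<close>.\<close>

lemma hom_fun_0: "hom_fun 0 g \<Longrightarrow> g z = g 0"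
  using hom_funD(2)[of 0 g 0 z] by simp

lemma hom_fun_at_0: "hom_fun d g \<Longrightarrow> d \<ge> 1 \<Longrightarrow> g 0 = 0"
  using hom_funD(2)[of d g 0 0] by (auto simp: power_0_left)

section \<open>Homogeneous parts, and the factors of a form\<close>

definition hom_part :: "nat \<Rightarrow> 'k::finite hpoly \<Rightarrow> 'k hpoly" where
  "hom_part e P = (\<Sum>m\<in>{m \<in> Poly_Mapping.keys P. (\<Sum>i\<in>UNIV. Poly_Mapping.lookup m i) = e}.
      Poly_Mapping.single m (Poly_Mapping.lookup P m))"

lemma hpoly_eval_sum: "hpoly_eval (\<Sum>i\<in>I. f i) z = (\<Sum>i\<in>I. hpoly_eval (f i) z)"
  by (induction I rule: infinite_finite_induct) (auto simp: hpoly_eval_add)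

lemma homogeneous_hom_part: "homogeneous_of_degree (hom_part e P) e"
proof -
  let ?K = "{m \<in> Poly_Mapping.keys P. (\<Sum>i\<in>UNIV. Poly_Mapping.lookup m i) = e}"
  have "Poly_Mapping.keys (hom_part e P) \<subseteq> ?K"
    unfolding hom_part_def by (rule order_trans[OF Poly_Mapping.keys_sum]) (auto split: if_splits)
  then show ?thesis
    unfolding homogeneous_of_degree_def by auto
qed

lemma hpoly_eval_scale_hom_parts:
  "\<exists>N. \<forall>z c. hpoly_eval P (c *s z) = (\<Sum>e\<le>N. hpoly_eval (hom_part e P) z * c ^ e)"
proof -
  define deg where "deg m = (\<Sum>i\<in>UNIV. Poly_Mapping.lookup m i)" for m :: "'a option \<Rightarrow>\<^sub>0 nat"
  define N where "N = (\<Sum>m\<in>Poly_Mapping.keys P. deg m)"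
  define mono where "mono n z = (\<Prod>i\<in>UNIV. ((z :: complex ^ 'a option) $ i) ^ Poly_Mapping.lookup n i)" for n z
  have le: "deg m \<le> N" if "m \<in> Poly_Mapping.keys P" for m
    unfolding N_def by (rule member_le_sum) (use that in auto)
  have "hpoly_eval P (c *s z) = (\<Sum>e\<le>N. hpoly_eval (hom_part e P) z * c ^ e)" for z c
  proof -
    have "(\<Sum>e\<le>N. hpoly_eval (hom_part e P) z * c ^ e)
        = (\<Sum>e\<le>N. \<Sum>m\<in>{m \<in> Poly_Mapping.keys P. deg m = e}. Poly_Mapping.lookup P m * mono m z * c ^ deg m)"
      unfolding hom_part_def hpoly_eval_sum hpoly_eval_single deg_def[symmetric] mono_def[symmetric]
      by (intro sum.cong refl) (auto simp: sum_distrib_right intro!: sum.cong)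
    also have "\<dots> = (\<Sum>m\<in>Poly_Mapping.keys P. Poly_Mapping.lookup P m * mono m z * c ^ deg m)"
      by (rule sum.group) (auto simp: le)
    also have "\<dots> = hpoly_eval P (c *s z)"
      unfolding hpoly_eval_def mono_def deg_def
      by (intro sum.cong refl) (simp add: power_mult_distrib prod.distrib power_sum)
    finally show ?thesis by simp
  qed
  then show ?thesis by blast
qed

text \<open>As a polynomial in \<open>c\<close>, \<open>P (c z)\<close> has the homogeneous parts of
  \<open>P\<close> as coefficients, and the functional equation leaves only the one of degree
  \<open>d\<close>. This is the way back from functions to the \<open>reduced_form\<close> of the
  definitions.\<close>

lemma homogeneous_of_hom_fun:
  assumes "hom_fun d (hpoly_eval P)"
  shows "homogeneous_of_degree P d"
proof -
  obtain N where N: "\<And>z c. hpoly_eval P (c *s z) = (\<Sum>e\<le>N. hpoly_eval (hom_part e P) z * c ^ e)"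
    using hpoly_eval_scale_hom_parts by blast
  have "hpoly_eval (hom_part d P) z = hpoly_eval P z" for z
  proof -
    let ?p = "\<Sum>e\<le>N. monom (hpoly_eval (hom_part e P) z) e"
    have "poly ?p c = poly (monom (hpoly_eval P z) d) c" for c
      using N[of c z] hom_funD(2)[OF assms, of c z] by (simp add: poly_sum poly_monom mult.commute)
    then have eq: "?p = monom (hpoly_eval P z) d" by (rule poly_ext)
    have "coeff ?p d = (if d \<le> N then hpoly_eval (hom_part d P) z else 0)"
      by (rule coeff_sum_monom)
    then have *: "hpoly_eval P z = (if d \<le> N then hpoly_eval (hom_part d P) z else 0)"
      using eq by simp
    show ?thesis
    proof (cases "d \<le> N")
      \<comment> \<open>Here \<open>c ^ d\<close> does not occur among the homogeneous parts, so
        \<open>P\<close> is zero.\<close>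
      case False
      have 0: "hom_part d P = 0"
      proof -
        have "hpoly_eval P w = 0" for w
        proof -
          let ?p = "\<Sum>e\<le>N. monom (hpoly_eval (hom_part e P) w) e"
          have "poly ?p c = poly (monom (hpoly_eval P w) d) c" for c
            using N[of c w] hom_funD(2)[OF assms, of c w] by (simp add: poly_sum poly_monom mult.commute)
          then have eq: "?p = monom (hpoly_eval P w) d" by (rule poly_ext)
          have "coeff ?p d = 0" using False by (simp only: coeff_sum_monom if_False)
          then show ?thesis using eq by simp
        qed
        then have "P = 0" using hpoly_eval_inj[of P 0] by (auto simp: fun_eq_iff)
        then show ?thesis by (simp add: hom_part_def)
      qed
      then show ?thesis using * False by simp
    qed (use * in simp)
  qed
  then have "hom_part d P = P" using hpoly_eval_inj[of "hom_part d P" P] by blast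
  then show ?thesis using homogeneous_hom_part[of d P] by simp
qed

lemma hom_fun_imp_homogeneous:
  assumes "hom_fun d g"
  obtains P where "g = hpoly_eval P" "homogeneous_of_degree P d"
proof -
  obtain P where "g = hpoly_eval P" using polyfun_imp_hpoly_eval hom_funD(1)[OF assms] by blast
  then show ?thesis using that homogeneous_of_hom_fun assms by blast
qed

lemma dvd_monom_imp_monom:
  fixes p q :: "complex poly"
  assumes "p * q = monom c d" "c \<noteq> 0"
  shows "\<exists>e a. p = monom a e"
  using assms
proof (induction d arbitrary: p q c)
  case 0
  have pq: "p \<noteq> 0" "q \<noteq> 0" using 0 by (auto simp: monom_0)
  have "degree p + degree q = degree (p * q)" using pq by (simp add: degree_mult_eq)
  also have "\<dots> = 0" using 0 by (simp add: monom_0)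
  finally obtain a where "p = [:a:]" by (auto elim!: degree_eq_zeroE)
  then show ?case by (metis monom_0)
next
  case (Suc d)
  have "poly p 0 * poly q 0 = 0" using Suc.prems(1) by (metis poly_mult poly_monom mult_zero_right power_0_Suc)
  then consider "poly p 0 = 0" | "poly q 0 = 0" by auto
  then show ?case
  proof cases
    case 1
    then obtain p' where p': "p = [:0, 1:] * p'" by (metis dvd_def poly_eq_0_iff_dvd minus_zero)
    have "[:0,1:] * (p' * q) = [:0,1:] * monom c d"
      using Suc.prems(1) p' by (simp add: monom_Suc mult.assoc)
    then have "p' * q = monom c d" by simp
    then obtain e a where "p' = monom a e" using Suc.IH Suc.prems(2) by blast
    then have "p = monom a (Suc e)" by (simp add: p' monom_Suc)
    then show ?thesis by blast
  next
    case 2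
    then obtain q' where q': "q = [:0, 1:] * q'" by (metis dvd_def poly_eq_0_iff_dvd minus_zero)
    have "[:0,1:] * (p * q') = [:0,1:] * monom c d"
      using Suc.prems(1) q' by (simp add: monom_Suc mult.left_commute)
    then have "p * q' = monom c d" by simp
    then show ?thesis using Suc.IH Suc.prems(2) by blast
  qed
qed

text \<open>Along the ray through a point with \<open>F z\<close> non-zero, \<open>F\<close> is a
  monomial in \<open>c\<close>, and so is its factor \<open>g\<close>
  (\<open>dvd_monom_imp_monom\<close>): only one homogeneous part of \<open>g\<close> survives at
  \<open>z\<close>. As there are no zero divisors, two different parts cannot survive at different
  points.\<close>

lemma hom_fun_factor:
  assumes F: "hom_fun d F" "F z0 \<noteq> 0" and g: "polyfun g" and h: "polyfun h"
    and eq: "F = (\<lambda>z. g z * h z)"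
  shows "\<exists>e. hom_fun e g"
proof -
  obtain P where P: "g = hpoly_eval P" using polyfun_imp_hpoly_eval g by blast
  obtain N where N: "\<And>z c. hpoly_eval P (c *s z) = (\<Sum>e\<le>N. hpoly_eval (hom_part e P) z * c ^ e)"
    using hpoly_eval_scale_hom_parts by blast
  define gp where "gp e = hpoly_eval (hom_part e P)" for e
  have gp: "hom_fun e (gp e)" for e
    unfolding gp_def by (rule hom_fun_homogeneous[OF homogeneous_hom_part])
  have single: "i = j" if F0: "F z \<noteq> 0" and ij: "gp i z \<noteq> 0" "gp j z \<noteq> 0" "i \<le> N" "j \<le> N" for i j z
  proof -
    obtain q where q: "\<And>t. h (0 + t *s z) = poly q t" using polyfun_lineE[OF h] by blast
    let ?p = "\<Sum>e\<le>N. monom (gp e z) e"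
    have "poly (?p * q) c = poly (monom (F z) d) c" for c
      using N[of c z] hom_funD(2)[OF F(1), of c z] q[of c] eq
      by (simp add: poly_sum poly_monom P gp_def mult.commute)
    then have "?p * q = monom (F z) d" by (rule poly_ext)
    then obtain e a where ea: "?p = monom a e" using dvd_monom_imp_monom F0 by blast
    have co: "coeff ?p l = (if l \<le> N then gp l z else 0)" for l
      by (rule coeff_sum_monom)
    from co[of i] co[of j] ij ea show ?thesis
      by (metis coeff_monom)
  qed
  have "g z0 \<noteq> 0" using F(2) eq by auto
  moreover have "g z0 = (\<Sum>e\<le>N. gp e z0)" using N[of 1 z0] by (simp add: P gp_def)
  ultimately obtain i where i: "i \<le> N" "gp i z0 \<noteq> 0"
    by (metis (no_types, lifting) atMost_iff sum.neutral)
  have zero: "gp j z = 0" if "j \<le> N" "j \<noteq> i" for j z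
  proof (rule ccontr)
    assume "gp j z \<noteq> 0"
    then obtain w where w: "gp j w \<noteq> 0" "gp i w \<noteq> 0"
      using polyfun_zero_divisors[of "gp j" "gp i"] hom_funD(1)[OF gp] i by blast
    then obtain u where "(gp j u * gp i u) \<noteq> 0" "F u \<noteq> 0"
      using polyfun_zero_divisors[of "\<lambda>z. gp j z * gp i z" F w z0] hom_funD(1)[OF gp] polyfun_mult hom_funD(1)[OF F(1)] F(2)
      by (metis mult_eq_0_iff)
    then show False using single[of u i j] i that by auto
  qed
  have "g z = gp i z" for z
  proof -
    have "g z = (\<Sum>e\<le>N. gp e z)" using N[of 1 z] by (simp add: P gp_def)
    also have "\<dots> = (\<Sum>e\<in>{i}. gp e z)"
      by (rule sum.mono_neutral_right) (use i zero in auto)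
    finally show ?thesis by simp
  qed
  then have "g = gp i" by blast
  then show ?thesis using gp by blast
qed

section \<open>Line-cofinite sets\<close>

text \<open>A substitute for the complement of a proper algebraic subset: such sets are dense and
  stable under intersection, and a line that meets one of them loses only finitely many points, so
  that one-variable removable singularities apply. Maximality of a number of roots yields such a set
  without an explicit discriminant.\<close>

definition cothin :: "(complex ^ 'k::finite option) set \<Rightarrow> bool" where
  "cothin \<Omega> \<longleftrightarrow> open \<Omega> \<and> \<Omega> \<noteq> {} \<and>
     (\<forall>a b. (\<exists>t. a + t *s b \<in> \<Omega>) \<longrightarrow> finite {t. a + t *s b \<notin> \<Omega>})"

lemma cothinD:
  assumes "cothin \<Omega>"
  shows "open \<Omega>" "\<Omega> \<noteq> {}" "a + t *s b \<in> \<Omega> \<Longrightarrow> finite {t. a + t *s b \<notin> \<Omega>}"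
  using assms unfolding cothin_def by (simp_all, blast)

lemma open_line:
  fixes a b :: "complex ^ 'n::finite"
  assumes "open U" shows "open {t. a + t *s b \<in> U}"
proof -
  have "continuous_on UNIV (\<lambda>t. a + t *s b)" by (intro continuous_intros)
  then have "open ((\<lambda>t. a + t *s b) -` U)" using assms by (simp add: open_vimage)
  then show ?thesis by (simp add: vimage_def)
qed

lemma open_diff_finite_nonempty:
  fixes T :: "complex set"
  assumes "open T" "T \<noteq> {}" "finite B" shows "T - B \<noteq> {}"
proof
  assume "T - B = {}"
  then have "finite T" using assms(3) by (metis Diff_eq_empty_iff finite_subset)
  then show False using assms(1,2) finite_imp_not_open by blast
qed

text \<open>The line from a point of \<open>U\<close> to a point of \<open>\<Omega>\<close> leaves
  \<open>\<Omega>\<close> at finitely many parameters only, while those near 0 stay in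
  \<open>U\<close>.\<close>

lemma cothin_dense:
  assumes \<Omega>: "cothin \<Omega>" and U: "open U" "U \<noteq> {}"
  shows "U \<inter> \<Omega> \<noteq> {}"
proof -
  obtain x o' where x: "x \<in> U" and o': "o' \<in> \<Omega>" using assms by (auto simp: cothin_def)
  have "x + 1 *s (o' - x) \<in> \<Omega>" by (simp add: o')
  then have fin: "finite {t. x + t *s (o' - x) \<notin> \<Omega>}" by (rule cothinD(3)[OF \<Omega>])
  have "0 \<in> {t. x + t *s (o' - x) \<in> U}" using x by simp
  then have "{t. x + t *s (o' - x) \<in> U} - {t. x + t *s (o' - x) \<notin> \<Omega>} \<noteq> {}"
    by (intro open_diff_finite_nonempty open_line U fin) blast
  then show ?thesis by blast
qed

lemma cothin_Int:
  assumes A: "cothin A" and B: "cothin B" shows "cothin (A \<inter> B)"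
  unfolding cothin_def
proof (intro conjI allI impI)
  show "open (A \<inter> B)" using A B by (auto simp: cothin_def)
  show "A \<inter> B \<noteq> {}" using cothin_dense[OF B, of A] A by (auto simp: cothin_def)
  fix a b assume "\<exists>t. a + t *s b \<in> A \<inter> B"
  then have "finite ({t. a + t *s b \<notin> A} \<union> {t. a + t *s b \<notin> B})"
    using cothinD(3)[OF A] cothinD(3)[OF B] by blast
  then show "finite {t. a + t *s b \<notin> A \<inter> B}" by (rule rev_finite_subset) auto
qed

lemma cothin_polyfun_nonzero:
  assumes "polyfun Q" "Q z \<noteq> 0" shows "cothin {x. Q x \<noteq> 0}"
  unfolding cothin_def
proof (intro conjI allI impI)
  show "open {x. Q x \<noteq> 0}" by (rule open_polyfun_nonzero) fact
  show "{x. Q x \<noteq> 0} \<noteq> {}" using assms by auto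
  fix a b assume *: "\<exists>t. a + t *s b \<in> {x. Q x \<noteq> 0}"
  obtain p where p: "\<And>t. Q (a + t *s b) = poly p t" using polyfun_lineE assms(1) by blast
  with * have "p \<noteq> 0" by auto
  then show "finite {t. a + t *s b \<notin> {x. Q x \<noteq> 0}}" by (simp add: p poly_roots_finite)
qed

lemma cothin_polyfun_zero:
  assumes "cothin \<Omega>" "polyfun g" "\<And>x. x \<in> \<Omega> \<Longrightarrow> g x = 0" shows "g x = 0"
  using cothin_dense[OF assms(1) open_polyfun_nonzero[OF assms(2)]] assms(3) by auto

lemma cothin_polyfun_eq:
  assumes "cothin \<Omega>" "polyfun f" "polyfun g" "\<And>x. x \<in> \<Omega> \<Longrightarrow> f x = g x" shows "f = g"
proof
  fix x show "f x = g x"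
    using cothin_polyfun_zero[OF assms(1) polyfun_diff[OF assms(2,3)], of x] assms(4) by simp
qed

lemma poly_eq_infinite:
  fixes p q :: "complex poly"
  assumes "infinite {t. poly p t = poly q t}" shows "p = q"
  using poly_roots_finite[of "p - q"] assms by auto

text \<open>Lagrange interpolation in one coordinate at a time, inside a polydisc contained in \<open>\<Omega>\<close>.\<close>

lemma polyfun_of_lines:
  fixes g :: "complex ^ 'k::finite option \<Rightarrow> complex"
  assumes \<Omega>: "cothin \<Omega>"
    and lines: "\<And>a b. \<exists>t. a + t *s b \<in> \<Omega> \<Longrightarrow>
      \<exists>p. degree p \<le> N \<and> (\<forall>t. a + t *s b \<in> \<Omega> \<longrightarrow> g (a + t *s b) = poly p t)"
  shows "\<exists>G. polyfun G \<and> (\<forall>x\<in>\<Omega>. G x = g x)"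
proof -
  have "open \<Omega>" "\<Omega> \<noteq> {}" using \<Omega> by (auto simp: cothin_def)
  then obtain o' A where o': "o' \<in> \<Omega>" and A: "\<And>i. open (A i)" "\<And>i. o' $ i \<in> A i"
    and A\<Omega>: "\<And>y. (\<And>i. y $ i \<in> A i) \<Longrightarrow> y \<in> \<Omega>"
    unfolding open_vec_def by (metis ex_in_conv)
  have upd: "(\<chi> j. if j = i then c else x $ j) = (\<chi> j. if j = i then 0 else x $ j) + c *s axis i 1"
    for i c and x :: "complex ^ 'k option"
    by (simp add: vec_eq_iff axis_def)
  \<comment> \<open>\<open>X\<close> is the set of coordinates in which \<open>x\<close> may vary,
    the others being frozen at those of \<open>u\<close>; the case \<open>X = UNIV\<close> covers
    the whole polydisc.\<close>
  have "\<forall>u. (\<forall>i. u $ i \<in> A i) \<longrightarrow> (\<exists>G. polyfun G \<and>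
      (\<forall>x. (\<forall>i. x $ i \<in> A i) \<and> (\<forall>i. i \<notin> X \<longrightarrow> x $ i = u $ i) \<longrightarrow> g x = G x))" if "finite X" for X
    using that
  proof (induction X rule: finite_induct)
    case empty
    show ?case
    proof (intro allI impI)
      fix u :: "complex ^ 'k option"
      have "g x = g u" if "\<forall>i. i \<notin> {} \<longrightarrow> x $ i = u $ i" for x
      proof -
        have "x = u" using that by (simp add: vec_eq_iff)
        then show ?thesis by simp
      qed
      then show "\<exists>G. polyfun G \<and> (\<forall>x. (\<forall>i. x $ i \<in> A i) \<and> (\<forall>i. i \<notin> {} \<longrightarrow> x $ i = u $ i) \<longrightarrow> g x = G x)"
        by (intro exI[of _ "\<lambda>x. g u"] conjI polyfun_const) blast
    qed
  next
    case (insert i X)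
    show ?case
    proof (intro allI impI)
      fix u :: "complex ^ 'k option" assume u: "\<forall>i. u $ i \<in> A i"
      \<comment> \<open>An open subset of the plane contains the \<open>N + 1\<close> nodes that
        determine a polynomial of degree at most \<open>N\<close>.\<close>
      have "infinite (A i)" using A(1)[of i] A(2)[of i] finite_imp_not_open[of "A i"] by auto
      then obtain C where C: "finite C" "card C = Suc N" "C \<subseteq> A i"
        using infinite_arbitrarily_large by blast
      have "\<forall>c\<in>C. \<exists>G. polyfun G \<and> (\<forall>x. (\<forall>j. x $ j \<in> A j) \<and> (\<forall>j. j \<notin> X \<longrightarrow> x $ j = (\<chi> j. if j = i then c else u $ j) $ j) \<longrightarrow> g x = G x)"
        by (intro ballI insert.IH[rule_format]) (use u C(3) in auto)
      from bchoice[OF this] obtain G where G0: "\<forall>c\<in>C. polyfun (G c) \<and> (\<forall>x. (\<forall>j. x $ j \<in> A j) \<and> (\<forall>j. j \<notin> X \<longrightarrow> x $ j = (\<chi> j. if j = i then c else u $ j) $ j) \<longrightarrow> g x = G c x)" ..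
      have G: "\<And>c. c \<in> C \<Longrightarrow> polyfun (G c)"
        "\<And>c x. c \<in> C \<Longrightarrow> (\<forall>j. x $ j \<in> A j) \<Longrightarrow>
           (\<forall>j. j \<notin> X \<longrightarrow> x $ j = (\<chi> j. if j = i then c else u $ j) $ j) \<Longrightarrow> g x = G c x"
        using G0 by blast+
      define \<Lambda> where "\<Lambda> c y = (\<Prod>c'\<in>C - {c}. (y - c') * inverse (c - c'))" for c y :: complex
      define L where "L c = (\<Prod>c'\<in>C - {c}. smult (inverse (c - c')) [:- c', 1:])" for c :: complex
      have L: "poly (L c) y = \<Lambda> c y" for c y
        by (simp add: L_def \<Lambda>_def poly_prod algebra_simps)
      have degL: "degree (L c) \<le> N" if "c \<in> C" for c
      proof -
        have "degree (L c) \<le> (\<Sum>c'\<in>C - {c}. degree (smult (inverse (c - c')) [:- c', 1:]))"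
          unfolding L_def by (rule degree_prod_sum_le[unfolded o_def]) (use C in auto)
        also have "\<dots> \<le> (\<Sum>c'\<in>C - {c}. 1)" by (intro sum_mono) auto
        also have "\<dots> = N" using C that by simp
        finally show ?thesis .
      qed
      have \<Lambda>: "\<Lambda> c c' = (if c = c' then 1 else 0)" if "c \<in> C" "c' \<in> C" for c c'
      proof (cases "c = c'")
        case True
        have "(c' - x) * inverse (c - x) = 1" if "x \<in> C - {c}" for x
          using True that right_inverse[of "c - x"] by auto
        then show ?thesis unfolding \<Lambda>_def using True by (simp add: prod.neutral)
      next
        case False
        then have "c' \<in> C - {c}" using that by auto
        then have "\<Lambda> c c' = 0" unfolding \<Lambda>_def using C(1) by (intro prod_zero) auto
        then show ?thesis using False by simp
      qed
      have interp: "poly p y = (\<Sum>c\<in>C. poly p c * \<Lambda> c y)" if p: "degree p \<le> N" for p y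
      proof -
        have "p = (\<Sum>c\<in>C. smult (poly p c) (L c))"
        proof (rule poly_eqI_degree[of C])
          fix x assume x: "x \<in> C"
          have "poly (\<Sum>c\<in>C. smult (poly p c) (L c)) x = (\<Sum>c\<in>C. if c = x then poly p c else 0)"
            unfolding poly_sum by (intro sum.cong) (auto simp: L \<Lambda> x)
          also have "\<dots> = poly p x" using x C(1) by simp
          finally show "poly p x = poly (\<Sum>c\<in>C. smult (poly p c) (L c)) x" by simp
        next
          have "degree (\<Sum>c\<in>C. smult (poly p c) (L c)) \<le> N"
            by (intro degree_sum_le C(1)) (use degL in \<open>auto intro: order_trans[OF degree_smult_le]\<close>)
          then show "card C > degree (\<Sum>c\<in>C. smult (poly p c) (L c))" using C(2) by simp
        qed (use p C(2) in simp)
        then have "poly p y = poly (\<Sum>c\<in>C. smult (poly p c) (L c)) y" by simp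
        then show ?thesis by (simp add: poly_sum L)
      qed
      let ?E = "\<lambda>c x. \<chi> j. if j = i then c else (x :: complex ^ 'k option) $ j"
      define G' where "G' x = (\<Sum>c\<in>C. G c (?E c x) * \<Lambda> c (x $ i))" for x
      have pE: "polyfun (\<lambda>x. ?E c x $ j)" for c j
        by (cases "j = i") (auto intro: polyfun.intros)
      have "polyfun (\<lambda>x. G c (?E c x))" if "c \<in> C" for c
        by (rule polyfun_compose[OF G(1)[OF that] pE])
      moreover have "polyfun (\<lambda>x. \<Lambda> c (x $ i))" for c
        unfolding \<Lambda>_def by (intro polyfun_prod polyfun_mult polyfun_diff polyfun_coord polyfun_const)
      ultimately have "polyfun (\<lambda>x. \<Sum>c\<in>C. G c (?E c x) * \<Lambda> c (x $ i))"
        by (intro polyfun_sum polyfun_mult)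
      then have G': "polyfun G'" unfolding G'_def[abs_def] .
      have "g x = G' x" if x: "\<forall>j. x $ j \<in> A j" "\<forall>j. j \<notin> insert i X \<longrightarrow> x $ j = u $ j" for x
      proof -
        have in\<Omega>: "?E c x \<in> \<Omega>" if "c \<in> A i" for c by (rule A\<Omega>) (use x that in auto)
        have "x \<in> \<Omega>" by (rule A\<Omega>) (use x in auto)
        have xE: "?E (x $ i) x = x" by (simp add: vec_eq_iff)
        have "\<exists>t. (\<chi> j. if j = i then 0 else x $ j) + t *s axis i 1 \<in> \<Omega>"
          unfolding upd[symmetric] by (rule exI[of _ "x $ i"]) (simp add: xE \<open>x \<in> \<Omega>\<close>)
        from lines[OF this] obtain p where p: "degree p \<le> N" "\<And>t. ?E t x \<in> \<Omega> \<Longrightarrow> g (?E t x) = poly p t"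
          unfolding upd[symmetric] by blast
        have "g x = poly p (x $ i)" using p(2)[of "x $ i"] \<open>x \<in> \<Omega>\<close> xE by simp
        also have "\<dots> = (\<Sum>c\<in>C. poly p c * \<Lambda> c (x $ i))" by (rule interp[OF p(1)])
        also have "\<dots> = (\<Sum>c\<in>C. G c (?E c x) * \<Lambda> c (x $ i))"
        proof (intro sum.cong refl arg_cong2[where f = "(*)"])
          fix c assume c: "c \<in> C"
          have "poly p c = g (?E c x)" using p(2)[of c] in\<Omega>[of c] c C(3) by auto
          also have "\<dots> = G c (?E c x)"
            by (rule G(2)[OF c]) (use x c C(3) in auto)
          finally show "poly p c = G c (?E c x)" .
        qed
        finally show ?thesis unfolding G'_def .
      qed
      with G' show "\<exists>G. polyfun G \<and> (\<forall>x. (\<forall>j. x $ j \<in> A j) \<and> (\<forall>j. j \<notin> insert i X \<longrightarrow> x $ j = u $ j) \<longrightarrow> g x = G x)"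
        by blast
    qed
  qed
  from this[of UNIV] A(2) obtain G where G: "polyfun G" "\<And>x. (\<And>i. x $ i \<in> A i) \<Longrightarrow> g x = G x"
    by auto
  \<comment> \<open>On the line from the centre \<open>o'\<close> of the polydisc to
    \<open>x\<close>, both sides are polynomials where they are compared, and they agree near the
    centre. The line may leave \<open>\<Omega>\<close> in between.\<close>
  have "G x = g x" if x: "x \<in> \<Omega>" for x
  proof -
    have ex: "\<exists>t. o' + t *s (x - o') \<in> \<Omega>" by (rule exI[of _ 0]) (simp add: o')
    from lines[OF this] obtain p where p: "\<And>t. o' + t *s (x - o') \<in> \<Omega> \<Longrightarrow> g (o' + t *s (x - o')) = poly p t"
      by blast
    obtain q where q: "\<And>t. G (o' + t *s (x - o')) = poly q t" using polyfun_lineE G(1) by blast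
    let ?U = "\<Inter>i. (\<lambda>y. y $ i) -` A i"
    have "open ?U" by (intro open_INT ballI finite open_vimage_vec_nth A(1))
    then have op: "open {t. o' + t *s (x - o') \<in> ?U}" by (rule open_line)
    have "0 \<in> {t. o' + t *s (x - o') \<in> ?U}" using A(2) by simp
    then have "infinite {t. o' + t *s (x - o') \<in> ?U}" using finite_imp_not_open[OF _ op] by blast
    moreover have "{t. o' + t *s (x - o') \<in> ?U} \<subseteq> {t. poly p t = poly q t}"
      using p q G(2) A\<Omega> by fastforce
    ultimately have "p = q" using poly_eq_infinite finite_subset by blast
    then show ?thesis using p[of 1] q[of 1] x by simp
  qed
  with G(1) show ?thesis by blast
qed

section \<open>Entire functions of polynomial growth\<close>

lemma holomorphic_extend_finite:
  assumes "finite S" "h holomorphic_on - S" "\<And>\<xi>. \<xi> \<in> S \<Longrightarrow> \<exists>B. \<forall>\<^sub>F z in at \<xi>. norm (h z) \<le> B"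
  shows "\<exists>g. g holomorphic_on UNIV \<and> (\<forall>z. z \<notin> S \<longrightarrow> g z = h z)"
  using assms
proof (induction S arbitrary: h rule: finite_induct)
  case empty
  then show ?case by auto
next
  case (insert \<xi> S)
  have op: "open (- S)" using insert.hyps finite_imp_closed by blast
  have "\<xi> \<in> interior (- S)" using op insert.hyps by (simp add: interior_open)
  moreover have "h holomorphic_on (- S) - {\<xi>}" using insert.prems(1) by (rule holomorphic_on_subset) auto
  ultimately obtain g where g: "g holomorphic_on - S" "\<forall>z\<in>- S - {\<xi>}. g z = h z"
    using holomorphic_on_extend_bounded insert.prems(2)[of \<xi>] by blast
  have "\<exists>B. \<forall>\<^sub>F z in at \<zeta>. norm (g z) \<le> B" if "\<zeta> \<in> S" for \<zeta>
  proof -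
    have "\<zeta> \<in> insert \<xi> S" using that by simp
    from insert.prems(2)[OF this] obtain B where B: "\<forall>\<^sub>F z in at \<zeta>. norm (h z) \<le> B" ..
    have "open (- insert \<xi> (S - {\<zeta>}))" using insert.hyps by (intro open_Compl finite_imp_closed) auto
    moreover have "\<zeta> \<in> - insert \<xi> (S - {\<zeta>})" using that insert.hyps by auto
    ultimately have "\<forall>\<^sub>F z in at \<zeta>. z \<in> - insert \<xi> (S - {\<zeta>}) \<and> z \<noteq> \<zeta>"
      unfolding eventually_at_topological by blast
    with B have "\<forall>\<^sub>F z in at \<zeta>. norm (g z) \<le> B"
      by eventually_elim (use g(2) in auto)
    then show ?thesis by blast
  qed
  then obtain g' where "g' holomorphic_on UNIV" "\<forall>z. z \<notin> S \<longrightarrow> g' z = g z"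
    using insert.IH g(1) by blast
  then show ?case using g(2) by (intro exI[of _ g']) auto
qed

text \<open>The bound holds up to the points of \<open>S\<close>, so these singularities are
  removable, and an entire function of polynomial growth is a polynomial by the extended Liouville
  theorem.\<close>

lemma polynomial_of_growth:
  fixes h :: "complex \<Rightarrow> complex" and C :: real
  assumes S: "finite S" and h: "h holomorphic_on - S"
    and growth: "\<And>t. t \<notin> S \<Longrightarrow> norm (h t) \<le> C * (1 + norm t) ^ N"
  shows "\<exists>p. degree p \<le> N \<and> (\<forall>t. t \<notin> S \<longrightarrow> h t = poly p t)"
proof -
  have "\<exists>B. \<forall>\<^sub>F z in at \<xi>. norm (h z) \<le> B" for \<xi>
  proof -
    have "open (- (S - {\<xi>}))" using S by (intro open_Compl finite_imp_closed) auto
    then have "\<forall>\<^sub>F z in at \<xi>. z \<in> - (S - {\<xi>}) \<and> z \<noteq> \<xi>"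
      unfolding eventually_at_topological by blast
    moreover have "\<forall>\<^sub>F z in at \<xi>. dist z \<xi> < 1"
      unfolding eventually_at by (intro exI[of _ 1]) auto
    ultimately have "\<forall>\<^sub>F z in at \<xi>. norm (h z) \<le> \<bar>C\<bar> * (2 + norm \<xi>) ^ N"
    proof eventually_elim
      case (elim z)
      then have "norm (h z) \<le> C * (1 + norm z) ^ N" by (intro growth) auto
      also have "\<dots> \<le> \<bar>C\<bar> * (1 + norm z) ^ N" by (intro mult_right_mono) auto
      also have "norm z \<le> norm \<xi> + 1"
        using elim norm_triangle_sub[of z \<xi>] by (simp add: dist_norm)
      then have "\<bar>C\<bar> * (1 + norm z) ^ N \<le> \<bar>C\<bar> * (2 + norm \<xi>) ^ N"
        by (intro mult_left_mono power_mono) auto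
      finally show ?case .
    qed
    then show ?thesis by blast
  qed
  then obtain g where g: "g holomorphic_on UNIV" "\<And>z. z \<notin> S \<Longrightarrow> g z = h z"
    using holomorphic_extend_finite[OF S h] by blast
  obtain R where R: "\<And>z. z \<in> S \<Longrightarrow> norm z \<le> R" using finite_imp_bounded[OF S] bounded_iff by blast
  \<comment> \<open>Beyond this radius there are no points of \<open>S\<close>, and
    \<open>1 + norm z\<close> is at most \<open>2 * norm z\<close>, whence the factor
    \<open>2 ^ N\<close>.\<close>
  have bd: "norm (g z) \<le> (\<bar>C\<bar> * 2 ^ N) * norm z ^ N" if z: "max 1 (R + 1) \<le> norm z" for z
  proof -
    have "z \<notin> S" using R[of z] z by auto
    then have "norm (g z) \<le> C * (1 + norm z) ^ N" using growth g(2) by simp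
    also have "\<dots> \<le> \<bar>C\<bar> * (1 + norm z) ^ N" by (intro mult_right_mono) auto
    also have "\<dots> \<le> \<bar>C\<bar> * (2 * norm z) ^ N" using z by (intro mult_left_mono power_mono) auto
    finally show ?thesis by (simp add: power_mult_distrib mult.assoc)
  qed
  let ?p = "\<Sum>k\<le>N. monom ((deriv ^^ k) g 0 / fact k) k"
  have "g \<xi> = poly ?p \<xi>" for \<xi>
    using Liouville_polynomial[OF g(1), of "max 1 (R + 1)" "\<bar>C\<bar> * 2 ^ N" N \<xi>] bd by (simp add: poly_sum poly_monom)
  moreover have "degree ?p \<le> N"
    by (rule degree_sum_le) (auto intro: order_trans[OF degree_monom_le])
  ultimately show ?thesis using g(2) by metis
qed

section \<open>Roots along a direction\<close>

definition upoly :: "(complex ^ 'k::finite option \<Rightarrow> complex) \<Rightarrow> complex ^ 'k option \<Rightarrow> complex ^ 'k option \<Rightarrow> complex poly" where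
  "upoly P v x = (THE p. \<forall>y. poly p y = P (x + y *s v))"

definition roots_along :: "(complex ^ 'k::finite option \<Rightarrow> complex) \<Rightarrow> complex ^ 'k option \<Rightarrow> complex ^ 'k option \<Rightarrow> complex set" where
  "roots_along P v x = {y. P (x + y *s v) = 0}"

lemma norm_smult:
  fixes x :: "complex ^ 'n::finite" shows "norm (c *s x) = norm c * norm x"
  unfolding norm_vec_def by (simp add: norm_mult L2_set_right_distrib)

lemma poly_upoly:
  assumes "polyfun P" shows "poly (upoly P v x) y = P (x + y *s v)"
proof -
  obtain p where p: "\<And>t. P (x + t *s v) = poly p t" using polyfun_lineE[OF assms] by blast
  have "upoly P v x = p"
    unfolding upoly_def by (rule the_equality) (use p in \<open>auto intro!: poly_ext\<close>)
  then show ?thesis using p by simp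
qed

text \<open>By homogeneity \<open>P (x + y v) = y ^ m P (v + x / y)\<close>, so the restriction to
  the line is, up to powers of \<open>y\<close>, the reversal of the polynomial
  \<open>P (v + t x)\<close> in \<open>t\<close>, whose constant term is \<open>P v\<close>. Degree
  and leading coefficient are thus the same for all \<open>x\<close>.\<close>

lemma upoly_degree:
  assumes P: "hom_fun m P" and v: "P v \<noteq> 0"
  shows "degree (upoly P v x) = m" "lead_coeff (upoly P v x) = P v"
proof -
  let ?p = "upoly P v x"
  obtain r where r: "\<And>t. P (v + t *s x) = poly r t" using polyfun_lineE[OF hom_funD(1)[OF P]] by blast
  let ?M = "degree r"
  have r0: "coeff r 0 = P v" using r[of 0] by (simp add: poly_0_coeff_0)
  \<comment> \<open>\<open>reflect_poly\<close> reverses with respect to the degree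
    \<open>?M\<close> of \<open>r\<close>, which may differ from \<open>m\<close>; powers of the
    variable on both sides balance the two.\<close>
  have "poly (monom 1 ?M * ?p) y = poly (monom 1 m * reflect_poly r) y" if y: "y \<noteq> 0" for y
  proof -
    have "x + y *s v = y *s (v + inverse y *s x)"
      using y by (simp add: vec_eq_iff algebra_simps)
    then have "poly ?p y = y ^ m * poly r (inverse y)"
      using poly_upoly[OF hom_funD(1)[OF P], of v x y] hom_funD(2)[OF P] r by metis
    then show ?thesis by (simp add: poly_monom poly_reflect_poly_nz y)
  qed
  then have "- {0} \<subseteq> {y. poly (monom 1 ?M * ?p) y = poly (monom 1 m * reflect_poly r) y}" by auto
  moreover have "infinite (- {0} :: complex set)"
    by (simp add: infinite_UNIV_char_0 Compl_eq_Diff_UNIV)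
  ultimately have eq: "monom 1 ?M * ?p = monom 1 m * reflect_poly r"
    using poly_eq_infinite finite_subset by blast
  have rn: "reflect_poly r \<noteq> 0" using r0 v by auto
  then have pn: "?p \<noteq> 0" using eq by auto
  have "degree (reflect_poly r) = ?M" using r0 v by (intro degree_reflect_poly_eq) auto
  then have "?M + degree ?p = m + ?M"
    using arg_cong[OF eq, of degree] rn pn by (simp add: degree_mult_eq degree_monom_eq)
  then show "degree ?p = m" by simp
  have "lead_coeff (monom 1 ?M * ?p) = lead_coeff (monom 1 m * reflect_poly r)" using eq by simp
  moreover have "lead_coeff (reflect_poly r) = P v" using r0 v by (simp add: coeff_reflect_poly degree_reflect_poly_eq)
  ultimately show "lead_coeff ?p = P v" unfolding lead_coeff_mult by (simp add: degree_monom_eq)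
qed

lemma upoly_nonzero: "hom_fun m P \<Longrightarrow> P v \<noteq> 0 \<Longrightarrow> upoly P v x \<noteq> 0"
  using upoly_degree(2)[of m P v x] by auto

lemma roots_along_upoly: "polyfun P \<Longrightarrow> roots_along P v x = {y. poly (upoly P v x) y = 0}"
  by (simp add: roots_along_def poly_upoly)

lemma finite_roots_along:
  assumes "hom_fun m P" "P v \<noteq> 0" shows "finite (roots_along P v x)" "card (roots_along P v x) \<le> m"
  using poly_roots_finite[OF upoly_nonzero[OF assms]] card_poly_roots_bound[OF upoly_nonzero[OF assms], of x]
    upoly_degree(1)[OF assms, of x] roots_along_upoly[OF hom_funD(1)[OF assms(1)]]
  by metis+

text \<open>In norm, \<open>P (x + y v)\<close> is \<open>P v\<close> times the product of the
  distances from \<open>y\<close> to the \<open>m\<close> roots, counted with multiplicity.\<close>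

lemma norm_lower_bound:
  assumes P: "hom_fun m P" and v: "P v \<noteq> 0" and \<delta>: "\<delta> \<ge> 0"
    and far: "\<And>r. r \<in> roots_along P v x \<Longrightarrow> \<delta> \<le> norm (y - r)"
  shows "norm (P v) * \<delta> ^ m \<le> norm (P (x + y *s v))"
proof -
  let ?p = "upoly P v x"
  obtain root where root: "smult (lead_coeff ?p) (\<Prod>i<degree ?p. [:- root i, 1:]) = ?p"
    using complex_poly_decompose' by metis
  have p: "poly ?p y = P v * (\<Prod>i<m. y - root i)" for y
    using arg_cong[OF root, of "\<lambda>p. poly p y"] upoly_degree[OF P v, of x] by (simp add: poly_prod)
  have "root i \<in> roots_along P v x" if "i < m" for i
    unfolding roots_along_upoly[OF hom_funD(1)[OF P]] using that by (auto simp: p)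
  then have "\<delta> ^ m \<le> (\<Prod>i<m. norm (y - root i))"
    using prod_mono[of "{..<m}" "\<lambda>_. \<delta>" "\<lambda>i. norm (y - root i)"] far \<delta> by auto
  then have "norm (P v) * \<delta> ^ m \<le> norm (poly ?p y)"
    by (simp add: p norm_mult prod_norm mult_left_mono)
  then show ?thesis by (simp add: poly_upoly[OF hom_funD(1)[OF P]])
qed

text \<open>\<open>P\<close> has no zero within \<open>e\<close> of \<open>v\<close>, and division
  by \<open>y\<close> turns a root over \<open>x\<close> into a zero at \<open>v + x / y\<close>.
  Hence \<open>norm x / norm y\<close> is at least \<open>e\<close>, and \<open>K = 1 / e\<close>
  works.\<close>

lemma root_bound:
  assumes P: "hom_fun m P" and v: "P v \<noteq> 0"
  shows "\<exists>K\<ge>0. \<forall>x y. P (x + y *s v) = 0 \<longrightarrow> norm y \<le> K * norm x"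
proof -
  have "open {z. P z \<noteq> 0}" using open_polyfun_nonzero hom_funD(1)[OF P] by blast
  then obtain e where e: "e > 0" "\<And>u. dist u v < e \<Longrightarrow> P u \<noteq> 0"
    using v unfolding open_dist by blast
  have "norm y \<le> 1 / e * norm x" if "P (x + y *s v) = 0" for x y
  proof (cases "y = 0")
    case False
    have "x + y *s v = y *s (v + inverse y *s x)"
      using False by (simp add: vec_eq_iff algebra_simps)
    then have "y ^ m * P (v + inverse y *s x) = 0" using that hom_funD(2)[OF P] by metis
    then have "P (v + inverse y *s x) = 0" using False by simp
    then have "e \<le> norm (inverse y *s x)" using e(2)[of "v + inverse y *s x"] by (force simp: dist_norm)
    then have "e \<le> norm x / norm y" by (simp add: norm_smult norm_inverse divide_inverse mult.commute)
    then have "e * norm y \<le> norm x" using False by (simp add: pos_le_divide_eq)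
    then show ?thesis using e(1) by (simp add: field_simps)
  qed (use e(1) in simp)
  then show ?thesis using e(1) by (intro exI[of _ "1 / e"]) auto
qed

text \<open>If no root over \<open>x\<close> were within \<delta> of \<open>y0\<close>,
  \<open>norm_lower_bound\<close> would keep \<open>P (x + y0 v)\<close> away from 0, against
  continuity at \<open>x0\<close>. This stands in for Rouche's theorem.\<close>

lemma root_persists:
  assumes P: "hom_fun m P" and v: "P v \<noteq> 0" and z: "P (x0 + y0 *s v) = 0" and \<delta>: "\<delta> > 0"
  shows "\<forall>\<^sub>F x in nhds x0. \<exists>y. P (x + y *s v) = 0 \<and> dist y y0 < \<delta>"
proof -
  have "continuous_on UNIV (\<lambda>x. norm (P (x + y0 *s v)))"
    by (intro continuous_intros polyfun_continuous_compose hom_funD(1)[OF P])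
  then have "((\<lambda>x. norm (P (x + y0 *s v))) \<longlongrightarrow> norm (P (x0 + y0 *s v))) (nhds x0)"
    unfolding continuous_on_def using tendsto_at_iff_tendsto_nhds by fastforce
  moreover have "norm (P (x0 + y0 *s v)) < norm (P v) * \<delta> ^ m" using z v \<delta> by simp
  ultimately have "\<forall>\<^sub>F x in nhds x0. norm (P (x + y0 *s v)) < norm (P v) * \<delta> ^ m"
    by (rule order_tendstoD)
  then show ?thesis
  proof eventually_elim
    case (elim x)
    then obtain r where "r \<in> roots_along P v x" "norm (y0 - r) < \<delta>"
      using norm_lower_bound[OF P v, of \<delta> x y0] \<delta> by (metis linorder_not_less less_imp_le)
    then show ?case by (auto simp: roots_along_def dist_norm norm_minus_commute)
  qed
qed

text \<open>Over the ball, the roots of \<open>P\<close> in direction \<open>v\<close> are the values of the distinct continuous sheets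
  \<open>\<phi> r\<close>, labelled by the roots \<open>r\<close> over the centre.\<close>

locale root_sheets =
  fixes P :: "complex ^ 'k::finite option \<Rightarrow> complex" and v x0 :: "complex ^ 'k option" and \<epsilon> \<rho> :: real
    and \<phi> :: "complex \<Rightarrow> complex ^ 'k option \<Rightarrow> complex"
  assumes eps_pos: "\<epsilon> > 0" and rho_pos: "\<rho> > 0"
    and sheet_root: "r \<in> roots_along P v x0 \<Longrightarrow> x \<in> ball x0 \<epsilon> \<Longrightarrow> P (x + \<phi> r x *s v) = 0 \<and> dist (\<phi> r x) r < \<rho>"
    and sheet_unique: "r \<in> roots_along P v x0 \<Longrightarrow> x \<in> ball x0 \<epsilon> \<Longrightarrow> P (x + y *s v) = 0 \<Longrightarrow> dist y r < \<rho> \<Longrightarrow> y = \<phi> r x"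
    and roots_sheets: "x \<in> ball x0 \<epsilon> \<Longrightarrow> roots_along P v x = (\<lambda>r. \<phi> r x) ` roots_along P v x0"
    and sheets_inj: "x \<in> ball x0 \<epsilon> \<Longrightarrow> inj_on (\<lambda>r. \<phi> r x) (roots_along P v x0)"
    and sheet_centre: "r \<in> roots_along P v x0 \<Longrightarrow> \<phi> r x0 = r"
    and sheet_continuous: "r \<in> roots_along P v x0 \<Longrightarrow> continuous_on (ball x0 \<epsilon>) (\<phi> r)"

text \<open>Each root over \<open>x0\<close> has a root nearby over every close \<open>x\<close>,
  and the discs of radius \<rho> are disjoint. As \<open>x0\<close> has the largest possible number
  of roots, each disc contains exactly one root and there are no others; uniqueness in the disc
  makes the selection continuous.\<close>

lemma root_sheets_exist:
  assumes P: "hom_fun m P" and v: "P v \<noteq> 0"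
    and maxi: "\<And>x. card (roots_along P v x) \<le> card (roots_along P v x0)"
  shows "\<exists>\<epsilon> \<rho> \<phi>. root_sheets P v x0 \<epsilon> \<rho> \<phi>"
proof -
  let ?F = "roots_along P v x0"
  have fin: "finite ?F" using finite_roots_along[OF P v] by blast
  \<comment> \<open>The additional 1 keeps \<open>D\<close> non-empty when there is at most one
    root.\<close>
  define D where "D = insert 1 ((\<lambda>(r, r'). dist r r') ` {(r, r') \<in> ?F \<times> ?F. r \<noteq> r'})"
  have "finite {(r, r') \<in> ?F \<times> ?F. r \<noteq> r'}" by (rule finite_subset[of _ "?F \<times> ?F"]) (use fin in auto)
  then have D: "finite D" "D \<noteq> {}" "\<And>d. d \<in> D \<Longrightarrow> d > 0" by (auto simp: D_def)
  define \<rho> where "\<rho> = Min D / 2"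
  have \<rho>: "\<rho> > 0" using D by (simp add: \<rho>_def)
  have sep: "r = r'" if "r \<in> ?F" "r' \<in> ?F" "dist y r < \<rho>" "dist y r' < \<rho>" for r r' y
  proof (rule ccontr)
    assume "r \<noteq> r'"
    then have "dist r r' \<in> D" using that by (auto simp: D_def)
    then have "Min D \<le> dist r r'" using D by simp
    moreover have "dist r r' < 2 * \<rho>" using that dist_triangle_less_add[of r y \<rho> r' \<rho>] by (simp add: dist_commute)
    ultimately show False by (simp add: \<rho>_def)
  qed
  have "\<forall>\<^sub>F x in nhds x0. \<forall>r\<in>?F. \<exists>y. P (x + y *s v) = 0 \<and> dist y r < \<rho>"
    by (rule eventually_ball_finite[OF fin]) (use root_persists[OF P v _ \<rho>] in \<open>auto simp: roots_along_def\<close>)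
  then obtain \<epsilon> where \<epsilon>: "\<epsilon> > 0" and
    ex: "\<And>r x. r \<in> ?F \<Longrightarrow> x \<in> ball x0 \<epsilon> \<Longrightarrow> \<exists>y. P (x + y *s v) = 0 \<and> dist y r < \<rho>"
    unfolding eventually_nhds_metric by (auto simp: dist_commute)
  define \<phi> where "\<phi> r x = (SOME y. P (x + y *s v) = 0 \<and> dist y r < \<rho>)" for r x
  have \<phi>: "P (x + \<phi> r x *s v) = 0 \<and> dist (\<phi> r x) r < \<rho>" if "r \<in> ?F" "x \<in> ball x0 \<epsilon>" for r x
    unfolding \<phi>_def by (rule someI_ex[OF ex[OF that]])
  have inj: "inj_on (\<lambda>r. \<phi> r x) ?F" if x: "x \<in> ball x0 \<epsilon>" for x
    using sep \<phi>[OF _ x] by (intro inj_onI) metis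
  have im: "roots_along P v x = (\<lambda>r. \<phi> r x) ` ?F" if x: "x \<in> ball x0 \<epsilon>" for x
  proof (rule card_subset_eq[symmetric])
    show "finite (roots_along P v x)" using finite_roots_along[OF P v] by blast
    show sub: "(\<lambda>r. \<phi> r x) ` ?F \<subseteq> roots_along P v x" using \<phi> x by (auto simp: roots_along_def)
    show "card ((\<lambda>r. \<phi> r x) ` ?F) = card (roots_along P v x)"
      using card_mono[OF _ sub] finite_roots_along[OF P v] maxi[of x] card_image[OF inj[OF x]] by fastforce
  qed
  have uniq: "y = \<phi> r x" if r: "r \<in> ?F" and x: "x \<in> ball x0 \<epsilon>" and y: "P (x + y *s v) = 0" "dist y r < \<rho>" for r x y
  proof -
    have "y \<in> (\<lambda>r. \<phi> r x) ` ?F" using y im[OF x] by (auto simp: roots_along_def)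
    then obtain r' where "r' \<in> ?F" "y = \<phi> r' x" by blast
    then show ?thesis using sep[OF r, of r' y] \<phi>[OF _ x] y(2) by blast
  qed
  have cont: "continuous_on (ball x0 \<epsilon>) (\<phi> r)" if r: "r \<in> ?F" for r
    unfolding continuous_on_iff
  proof (intro ballI allI impI)
    fix x1 e assume x1: "x1 \<in> ball x0 \<epsilon>" and e: "(e :: real) > 0"
    let ?e = "min e (\<rho> - dist (\<phi> r x1) r)"
    have "?e > 0" using \<phi>[OF r x1] e by simp
    then have "\<forall>\<^sub>F x in nhds x1. \<exists>y. P (x + y *s v) = 0 \<and> dist y (\<phi> r x1) < ?e"
      using root_persists[OF P v] \<phi>[OF r x1] by blast
    then obtain d where d: "d > 0" "\<And>x. dist x x1 < d \<Longrightarrow> \<exists>y. P (x + y *s v) = 0 \<and> dist y (\<phi> r x1) < ?e"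
      unfolding eventually_nhds_metric by blast
    have "dist (\<phi> r x) (\<phi> r x1) < e" if x: "x \<in> ball x0 \<epsilon>" "dist x x1 < d" for x
    proof -
      obtain y where y: "P (x + y *s v) = 0" "dist y (\<phi> r x1) < ?e" using d(2) x by blast
      have "dist y r < \<rho>" using y(2) dist_triangle[of y r "\<phi> r x1"] by simp
      then show ?thesis using uniq[OF r x(1) y(1)] y(2) by simp
    qed
    then show "\<exists>d>0. \<forall>x\<in>ball x0 \<epsilon>. dist x x1 < d \<longrightarrow> dist (\<phi> r x) (\<phi> r x1) < e" using d(1) by blast
  qed
  have centre: "\<phi> r x0 = r" if "r \<in> ?F" for r
    using uniq[OF that, of x0 r] that \<epsilon> \<rho> by (simp add: roots_along_def)
  have "root_sheets P v x0 \<epsilon> \<rho> \<phi>"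
    by unfold_locales
      (rule \<epsilon> | rule \<rho> | (rule \<phi>; assumption) | (rule uniq; assumption) | (rule im; assumption) |
        (rule inj; assumption) | (rule centre; assumption) | (rule cont; assumption))+
  then show ?thesis by blast
qed

section \<open>Families of one-variable polynomials over a line\<close>

definition ev2 :: "complex poly poly \<Rightarrow> complex \<Rightarrow> complex \<Rightarrow> complex" where
  "ev2 p t y = poly (poly p [:y:]) t"

definition spec :: "complex \<Rightarrow> complex poly poly \<Rightarrow> complex poly" where
  "spec t p = map_poly (\<lambda>c. poly c t) p"

lemma coeff_spec: "coeff (spec t p) i = poly (coeff p i) t"
  by (simp add: spec_def coeff_map_poly)

lemma poly_spec: "poly (spec t p) y = ev2 p t y"
  unfolding ev2_def
proof (induction p)
  case (pCons a p)
  have "spec t (pCons a p) = pCons (poly a t) (spec t p)"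
    by (intro poly_eqI) (simp add: coeff_spec coeff_pCons split: nat.split)
  then show ?case using pCons by simp
qed (simp add: spec_def)

lemma spec_mult: "spec t (p * q) = spec t p * spec t q"
  by (rule poly_ext) (simp add: poly_spec ev2_def)

lemma spec_pderiv: "spec t (pderiv p) = pderiv (spec t p)"
  by (rule poly_eqI) (simp add: coeff_spec coeff_pderiv)

lemma spec_monic:
  assumes "lead_coeff q = 1" shows "degree (spec t q) = degree q" "lead_coeff (spec t q) = 1" "spec t q \<noteq> 0"
proof -
  have "degree (spec t q) \<le> degree q" by (rule degree_le) (simp add: coeff_spec coeff_eq_0)
  moreover have "coeff (spec t q) (degree q) = 1" using assms by (simp add: coeff_spec)
  ultimately show d: "degree (spec t q) = degree q" by (metis le_antisym le_degree zero_neq_one)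
  show l: "lead_coeff (spec t q) = 1" using d assms by (simp add: coeff_spec)
  show "spec t q \<noteq> 0" using l by auto
qed

text \<open>A form of Gauss's lemma: primitive parts are multiplicative, and \<open>smult a\<close>
  changes them by a unit only.\<close>

lemma primitive_part_dvd_of_smult:
  fixes q u k :: "complex poly poly"
  assumes "smult a q = u * k" "a \<noteq> 0" shows "primitive_part u dvd q"
proof -
  have "smult (unit_factor a) (primitive_part q) = primitive_part u * primitive_part k"
    using arg_cong[OF assms(1), of primitive_part] by (simp add: primitive_part_smult primitive_part_mult)
  moreover obtain e where e: "e * unit_factor a = 1"
    using unit_factor_is_unit[OF assms(2)] by (metis dvdE mult.commute)
  ultimately have "primitive_part q = primitive_part u * smult e (primitive_part k)"
    by (metis mult_smult_right smult_1_left smult_smult)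
  then have "primitive_part u dvd primitive_part q" by (rule dvdI)
  then show ?thesis
    by (metis content_times_primitive_part dvd_smult)
qed

text \<open>A monic polynomial with the given zero set and of least degree must be coprime to its
  derivative: a common factor could be cancelled without changing the zero set.\<close>

lemma squarefree_zero_set:
  fixes p :: "complex poly poly"
  assumes "lead_coeff p = [:c:]" "c \<noteq> 0"
  shows "\<exists>q r. lead_coeff q = 1 \<and> r \<noteq> 0 \<and> (\<forall>t y. ev2 q t y = 0 \<longleftrightarrow> ev2 p t y = 0) \<and>
    (\<exists>A B. A * q + B * pderiv q = [:r:])"
proof -
  define M where "M q \<longleftrightarrow> lead_coeff q = 1 \<and> (\<forall>t y. ev2 q t y = 0 \<longleftrightarrow> ev2 p t y = 0)" for q
  have "M (smult [:inverse c:] p)"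
    using assms by (simp add: M_def ev2_def one_pCons)
  then obtain q where q: "M q" and qmin: "\<And>q'. M q' \<Longrightarrow> degree q \<le> degree q'"
    using ex_has_least_nat[of M _ degree] by blast
  have lq: "lead_coeff q = 1" using q by (simp add: M_def)
  then have q0: "q \<noteq> 0" by auto
  \<comment> \<open>The ideal generated by \<open>q\<close> and its derivative. Over a coefficient
    ring of polynomials its element \<open>u\<close> of least degree need not generate it, but
    pseudo-division shows that the primitive part of \<open>u\<close> divides every element.\<close>
  define I where "I u \<longleftrightarrow> (\<exists>A B. u = A * q + B * pderiv q)" for u
  have Iq: "I q" unfolding I_def by (rule exI[of _ 1], rule exI[of _ 0]) simp
  have Iq': "I (pderiv q)" unfolding I_def by (rule exI[of _ 0], rule exI[of _ 1]) simp
  obtain u where u: "I u" "u \<noteq> 0" and umin: "\<And>u'. I u' \<Longrightarrow> u' \<noteq> 0 \<Longrightarrow> degree u \<le> degree u'"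
    using ex_has_least_nat[of "\<lambda>u. I u \<and> u \<noteq> 0" q degree] Iq q0 by blast
  have dvd: "primitive_part u dvd x" if x: "I x" for x
  proof -
    obtain a k where a: "a \<noteq> 0" "smult a x = u * k + pseudo_mod x u" using pseudo_mod(1)[OF u(2)] by blast
    obtain A B C D where AB: "x = A * q + B * pderiv q" "u = C * q + D * pderiv q" using x u(1) unfolding I_def by blast
    have "pseudo_mod x u = smult a x - u * k" using a(2) by simp
    also have "\<dots> = (smult a A - C * k) * q + (smult a B - D * k) * pderiv q"
      by (simp add: AB algebra_simps smult_add_right)
    finally have "I (pseudo_mod x u)" unfolding I_def by blast
    then have "pseudo_mod x u = 0" using umin pseudo_mod(2)[OF u(2), of x] by fastforce
    then show ?thesis using primitive_part_dvd_of_smult a by simp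
  qed
  show ?thesis
  proof (cases "degree u = 0")
    case True
    then obtain r where "u = [:r:]" by (rule degree_eq_zeroE)
    then show ?thesis using u q unfolding I_def M_def by (metis pCons_0_0)
  next
    case False
    obtain w where w: "w = primitive_part u" by blast
    obtain v where v: "q = w * v" using dvd[OF Iq] w by blast
    obtain z where z: "pderiv q = w * z" using dvd[OF Iq'] w by blast
    have lc: "lead_coeff w * lead_coeff v = 1" using lq v by (simp add: lead_coeff_mult)
    \<comment> \<open>The leading coefficients of \<open>w\<close> and \<open>v\<close> are inverse
      units; exchanging them makes both factors monic.\<close>
    define w1 where "w1 = smult (lead_coeff v) w"
    define v1 where "v1 = smult (lead_coeff w) v"
    have wv: "q = w1 * v1" using lc v by (simp add: w1_def v1_def mult.commute)
    have wz: "pderiv q = w1 * smult (lead_coeff w) z" using lc z by (simp add: w1_def mult.commute)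
    have lw1: "lead_coeff w1 = 1" and lv1: "lead_coeff v1 = 1"
      using lc by (simp_all only: w1_def v1_def lead_coeff_smult mult.commute)
    have "lead_coeff v \<noteq> 0" using lc by auto
    then have dw1: "degree w1 > 0" using False by (simp add: w1_def w)
    have "degree q = degree w1 + degree v1"
      unfolding wv by (rule degree_mult_eq) (use lw1 lv1 in auto)
    then have less: "degree v1 < degree q" using dw1 by simp
    \<comment> \<open>Differentiating \<open>q = w1 v1\<close> shows that \<open>w1\<close> divides
      \<open>v1 w1'\<close> over every \<open>t\<close>. Differentiation lowers the order of
      \<open>w1\<close> at a zero by one, so \<open>v1\<close> vanishes there. Hence
      \<open>v1\<close> has all the zeros of \<open>q\<close>, contrary to the choice of
      \<open>q\<close>.\<close>
    have root: "ev2 v1 t y = 0" if y: "ev2 w1 t y = 0" for t y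
    proof -
      let ?W = "spec t w1" and ?V = "spec t v1"
      have W: "degree ?W = degree w1" "?W \<noteq> 0" and V0: "?V \<noteq> 0" using spec_monic lw1 lv1 by auto
      have W': "pderiv ?W \<noteq> 0" using W dw1 by (simp add: pderiv_eq_0_iff)
      have "?W * spec t (smult (lead_coeff w) z) = pderiv (?W * ?V)"
        using arg_cong[OF wz, of "spec t"] unfolding wv spec_pderiv spec_mult by (rule sym)
      also have "\<dots> = ?W * pderiv ?V + ?V * pderiv ?W" by (rule pderiv_mult)
      finally have "?V * pderiv ?W = ?W * (spec t (smult (lead_coeff w) z) - pderiv ?V)" by (simp add: algebra_simps)
      then have "?W dvd ?V * pderiv ?W" by simp
      then have "order y ?W \<le> order y (?V * pderiv ?W)"
        by (intro dvd_imp_order_le) (use V0 W' in auto)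
      also have "\<dots> = order y ?V + order y (pderiv ?W)" using V0 W' by (intro order_mult) auto
      finally have le: "order y ?W \<le> order y ?V + order y (pderiv ?W)" .
      have "order y ?W = Suc (order y (pderiv ?W))"
        by (rule order_pderiv[OF W(2)]) (use y in \<open>simp add: poly_spec\<close>)
      then have "order y ?V \<noteq> 0" using le by simp
      then show ?thesis using order_root[of ?V y] unfolding poly_spec by blast
    qed
    have "ev2 q t y = ev2 w1 t y * ev2 v1 t y" for t y by (simp add: wv ev2_def)
    then have "M v1" using q lv1 root unfolding M_def by (metis mult_eq_0_iff)
    then show ?thesis using qmin less by fastforce
  qed
qed

text \<open>\<open>r\<close> is a Bezout combination of \<open>q\<close> and its derivative and
  serves as a discriminant: off its finitely many zeros all roots of \<open>q\<close> are
  simple.\<close>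

lemma line_squarefree:
  assumes P: "hom_fun m P" and v: "P v \<noteq> 0"
  obtains q r where "lead_coeff q = 1" "r \<noteq> 0" "\<And>t y. ev2 q t y = 0 \<longleftrightarrow> P (a + t *s b + y *s v) = 0"
    "\<And>t y. poly r t \<noteq> 0 \<Longrightarrow> ev2 q t y = 0 \<Longrightarrow> ev2 (pderiv q) t y \<noteq> 0"
proof -
  obtain p where p: "\<And>t y. P (a + t *s b + y *s v) = ev2 p t y"
    using polyfun_plane[OF hom_funD(1)[OF P]] unfolding ev2_def by blast
  have sp: "spec t p = upoly P v (a + t *s b)" for t
    by (rule poly_ext) (simp add: poly_spec poly_upoly[OF hom_funD(1)[OF P]] p)
  have hi: "coeff p i = 0" if "i > m" for i
  proof (rule poly_ext)
    fix t show "poly (coeff p i) t = poly 0 t"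
      using coeff_spec[of t p i] that upoly_degree(1)[OF P v, of "a + t *s b"] by (simp add: sp coeff_eq_0)
  qed
  have m: "coeff p m = [:P v:]"
  proof (rule poly_ext)
    fix t show "poly (coeff p m) t = poly [:P v:] t"
      using coeff_spec[of t p m] upoly_degree[OF P v, of "a + t *s b"] by (simp add: sp)
  qed
  have "degree p = m" using hi m v by (intro antisym degree_le le_degree) auto
  then have "lead_coeff p = [:P v:]" using m by simp
  from squarefree_zero_set[OF this v] obtain q r A B where
    q: "lead_coeff q = 1" "r \<noteq> 0" "\<forall>t y. ev2 q t y = 0 \<longleftrightarrow> ev2 p t y = 0" "A * q + B * pderiv q = [:r:]" by blast
  have "ev2 (pderiv q) t y \<noteq> 0" if "poly r t \<noteq> 0" "ev2 q t y = 0" for t y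
  proof
    assume "ev2 (pderiv q) t y = 0"
    moreover have "ev2 (A * q + B * pderiv q) t y = ev2 A t y * ev2 q t y + ev2 B t y * ev2 (pderiv q) t y"
      by (simp add: ev2_def)
    ultimately have "ev2 [:r:] t y = 0" using that(2) q(4) by simp
    then show False using that(1) by (simp add: ev2_def)
  qed
  then show ?thesis using that q p by simp
qed

lemma card_roots_line:
  assumes P: "hom_fun m P" and v: "P v \<noteq> 0" and q: "lead_coeff q = 1"
    and zero: "\<And>y. ev2 q t y = 0 \<longleftrightarrow> P (a + t *s b + y *s v) = 0"
  shows "card (roots_along P v (a + t *s b)) \<le> degree q"
    "(\<And>y. ev2 q t y = 0 \<Longrightarrow> ev2 (pderiv q) t y \<noteq> 0) \<Longrightarrow> card (roots_along P v (a + t *s b)) = degree q"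
proof -
  have R: "roots_along P v (a + t *s b) = {y. poly (spec t q) y = 0}"
    by (simp add: roots_along_def poly_spec zero)
  show "card (roots_along P v (a + t *s b)) \<le> degree q"
    unfolding R using card_poly_roots_bound[OF spec_monic(3)[OF q], of t] spec_monic(1)[OF q] by simp
  assume simple: "\<And>y. ev2 q t y = 0 \<Longrightarrow> ev2 (pderiv q) t y \<noteq> 0"
  have "rsquarefree (spec t q)"
    unfolding rsquarefree_roots using simple by (auto simp: spec_pderiv[symmetric] poly_spec)
  from complex_poly_decompose_rsquarefree[OF this]
  have "spec t q = (\<Prod>z | poly (spec t q) z = 0. [:- z, 1:])" using spec_monic(2)[OF q] by simp
  then have "degree (spec t q) = (\<Sum>z | poly (spec t q) z = 0. degree [:- z, 1:])"
    using degree_prod_sum_eq[of "{z. poly (spec t q) z = 0}" "\<lambda>z. [:- z, 1:]"] by (metis pCons_eq_0_iff zero_neq_one)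
  then show "card (roots_along P v (a + t *s b)) = degree q" unfolding R using spec_monic(1)[OF q] by simp
qed

text \<open>The divided difference in \<open>t\<close>, with a quotient continuous in both
  variables; it supplies the numerator in \<open>implicit_root_differentiable\<close>.\<close>

lemma ev2_difference:
  "\<exists>A. continuous_on UNIV (\<lambda>(t, y). A t y) \<and> (\<forall>t y. ev2 q t y = ev2 q t0 y + (t - t0) * A t y)"
proof (induction q)
  case 0
  then show ?case by (intro exI[of _ "\<lambda>t y. 0"]) (auto simp: ev2_def)
next
  case (pCons c q)
  then obtain A where A: "continuous_on UNIV (\<lambda>(t, y). A t y)" "\<And>t y. ev2 q t y = ev2 q t0 y + (t - t0) * A t y" by blast
  have c: "poly c t = poly c t0 + (t - t0) * poly (synthetic_div c t0) t" for t
    using arg_cong[OF synthetic_div_correct'[of t0 c], of "\<lambda>p. poly p t"] by (simp add: algebra_simps)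
  have "ev2 (pCons c q) t y = ev2 (pCons c q) t0 y + (t - t0) * (poly (synthetic_div c t0) t + y * A t y)" for t y
  proof -
    have *: "ev2 (pCons c q) t y = poly c t + y * ev2 q t y" for t y by (simp add: ev2_def)
    have "ev2 (pCons c q) t y = (poly c t0 + (t - t0) * poly (synthetic_div c t0) t) + y * (ev2 q t0 y + (t - t0) * A t y)"
      by (simp only: * A(2)[of t y] c[of t])
    then show ?thesis by (simp only: *) (simp add: algebra_simps)
  qed
  moreover have "continuous_on UNIV (\<lambda>(t, y). poly (synthetic_div c t0) t + y * A t y)"
  proof -
    have "continuous_on UNIV (\<lambda>x. poly (synthetic_div c t0) (fst x) + snd x * (case x of (t, y) \<Rightarrow> A t y))"
      by (intro continuous_intros A(1))
    then show ?thesis by (simp add: case_prod_unfold)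
  qed
  ultimately show ?case by (intro exI[of _ "\<lambda>t y. poly (synthetic_div c t0) t + y * A t y"]) blast
qed

text \<open>An implicit function theorem for a branch already known to be continuous. With
  \<open>q(t0, y) = (y - \<phi> t0) B(y)\<close> and
  \<open>q(t, y) = q(t0, y) + (t - t0) A(t, y)\<close>, the difference quotient of the branch is
  \<open>- A / B\<close>, and \<open>B (\<phi> t0)\<close> is the non-zero derivative at the simple
  root.\<close>

lemma implicit_root_differentiable:
  assumes cont: "isCont \<phi> t0" and zero: "\<forall>\<^sub>F t in nhds t0. ev2 q t (\<phi> t) = 0"
    and simple: "ev2 (pderiv q) t0 (\<phi> t0) \<noteq> 0"
  shows "\<phi> field_differentiable at t0"
proof -
  obtain A where A: "continuous_on UNIV (\<lambda>(t, y). A t y)" "\<And>t y. ev2 q t y = ev2 q t0 y + (t - t0) * A t y"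
    using ev2_difference by blast
  let ?p = "spec t0 q" and ?B = "synthetic_div (spec t0 q) (\<phi> t0)"
  have z0: "ev2 q t0 (\<phi> t0) = 0" using eventually_nhds_x_imp_x[OF zero] .
  have div: "?p = [:- \<phi> t0, 1:] * ?B"
    using synthetic_div_correct'[of "\<phi> t0" ?p] z0 by (simp add: poly_spec)
  have pB: "ev2 q t0 y = (y - \<phi> t0) * poly ?B y" for y
    using arg_cong[OF div, of "\<lambda>p. poly p y"] by (simp add: poly_spec algebra_simps)
  have "pderiv ?p = [:- \<phi> t0, 1:] * pderiv ?B + ?B * pderiv [:- \<phi> t0, 1:]"
    using arg_cong[OF div, of pderiv] by (simp only: pderiv_mult)
  then have "poly (pderiv ?p) (\<phi> t0) = poly ?B (\<phi> t0)" by (simp add: pderiv_pCons)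
  then have B0: "poly ?B (\<phi> t0) \<noteq> 0" using simple by (simp add: spec_pderiv[symmetric] poly_spec)
  have Bc: "isCont (\<lambda>t. poly ?B (\<phi> t)) t0" using cont by (intro continuous_intros)
  have "isCont (\<lambda>x. case x of (t, y) \<Rightarrow> A t y) (t0, \<phi> t0)"
    using A(1) by (simp add: continuous_on_eq_continuous_at)
  then have Ac: "isCont (\<lambda>t. A t (\<phi> t)) t0"
    using isCont_o2[of t0 "\<lambda>t. (t, \<phi> t)" "\<lambda>x. case x of (t, y) \<Rightarrow> A t y"] cont
    by (simp add: continuous_Pair)
  have "\<forall>\<^sub>F t in at t0. poly ?B (\<phi> t) \<noteq> 0"
    using Bc B0 unfolding isCont_def by (intro tendsto_imp_eventually_ne) auto
  moreover have "\<forall>\<^sub>F t in at t0. ev2 q t (\<phi> t) = 0" using zero by (simp add: eventually_nhds_conv_at)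
  moreover have "\<forall>\<^sub>F t in at t0. t \<noteq> t0" by (simp add: eventually_at_filter)
  ultimately have "\<forall>\<^sub>F t in at t0. - A t (\<phi> t) / poly ?B (\<phi> t) = (\<phi> t - \<phi> t0) / (t - t0)"
  proof eventually_elim
    case (elim t)
    have "(\<phi> t - \<phi> t0) * poly ?B (\<phi> t) + (t - t0) * A t (\<phi> t) = 0"
      using A(2)[of t "\<phi> t"] pB[of "\<phi> t"] elim by simp
    then have "(\<phi> t - \<phi> t0) * poly ?B (\<phi> t) = - A t (\<phi> t) * (t - t0)"
      by (simp add: add_eq_0_iff algebra_simps)
    then show ?case using elim by (subst frac_eq_eq) auto
  qed
  moreover have "((\<lambda>t. - A t (\<phi> t) / poly ?B (\<phi> t)) \<longlongrightarrow> - A t0 (\<phi> t0) / poly ?B (\<phi> t0)) (at t0)"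
    using Ac Bc B0 unfolding isCont_def by (intro tendsto_divide tendsto_minus)
  ultimately have "((\<lambda>t. (\<phi> t - \<phi> t0) / (t - t0)) \<longlongrightarrow> - A t0 (\<phi> t0) / poly ?B (\<phi> t0)) (at t0)"
    by (rule Lim_transform_eventually[rotated])
  then show ?thesis unfolding field_differentiable_def has_field_derivative_iff by blast
qed

section \<open>The base of a hypersurface\<close>

definition maxroots :: "(complex ^ 'k::finite option \<Rightarrow> complex) \<Rightarrow> complex ^ 'k option \<Rightarrow> (complex ^ 'k option) set" where
  "maxroots P v = {x. \<forall>x'. card (roots_along P v x') \<le> card (roots_along P v x)}"

text \<open>Points over which \<open>P\<close> has the generic number of roots in the direction \<open>v\<close>; the origin is left
  out because cones over projective analytic sets need not be analytic there.\<close>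

definition root_base :: "(complex ^ 'k::finite option \<Rightarrow> complex) \<Rightarrow> complex ^ 'k option \<Rightarrow> (complex ^ 'k option) set \<Rightarrow> bool" where
  "root_base P v \<Omega> \<longleftrightarrow> cothin \<Omega> \<and> \<Omega> \<subseteq> maxroots P v \<and> (\<forall>x\<in>\<Omega>. \<forall>\<tau>. x + \<tau> *s v \<in> \<Omega>) \<and> 0 \<notin> \<Omega>"

lemma roots_along_shift: "roots_along P v (x + \<tau> *s v) = (\<lambda>y. y - \<tau>) ` roots_along P v x"
proof -
  have "x + \<tau> *s v + y *s v = x + (y + \<tau>) *s v" for y by (simp add: vec_eq_iff algebra_simps)
  then show ?thesis unfolding roots_along_def
  proof (intro set_eqI iffI)
    fix y assume "y \<in> {y. P (x + \<tau> *s v + y *s v) = 0}"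
    then have "y + \<tau> \<in> {y. P (x + y *s v) = 0}" using \<open>\<And>y. x + \<tau> *s v + y *s v = x + (y + \<tau>) *s v\<close> by simp
    moreover have "y = (y + \<tau>) - \<tau>" by simp
    ultimately show "y \<in> (\<lambda>y. y - \<tau>) ` {y. P (x + y *s v) = 0}" by (rule rev_image_eqI)
  next
    fix y assume "y \<in> (\<lambda>y. y - \<tau>) ` {y. P (x + y *s v) = 0}"
    then obtain z where "P (x + z *s v) = 0" "y = z - \<tau>" by blast
    then show "y \<in> {y. P (x + \<tau> *s v + y *s v) = 0}"
      using \<open>\<And>y. x + \<tau> *s v + y *s v = x + (y + \<tau>) *s v\<close>[of y] by simp
  qed
qed

lemma card_roots_along_shift: "card (roots_along P v (x + \<tau> *s v)) = card (roots_along P v x)"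
  unfolding roots_along_shift by (rule card_image) (auto simp: inj_on_def)

text \<open>Openness comes from the sheets. On a line that meets the set, \<open>degree q\<close>
  bounds the number of roots over every point and is attained wherever \<open>r\<close> is non-zero,
  so the exceptional points are zeros of \<open>r\<close>.\<close>

lemma maxroots_cothin:
  assumes P: "hom_fun m P" and v: "P v \<noteq> 0"
  shows "cothin (maxroots P v)"
  unfolding cothin_def
proof (intro conjI allI impI)
  show "open (maxroots P v)"
    unfolding open_contains_ball
  proof
    fix x0 assume x0: "x0 \<in> maxroots P v"
    then have *: "\<And>x. card (roots_along P v x) \<le> card (roots_along P v x0)" by (simp add: maxroots_def)
    show "\<exists>e>0. ball x0 e \<subseteq> maxroots P v"
    proof -
      obtain \<epsilon> \<rho> \<phi> where "root_sheets P v x0 \<epsilon> \<rho> \<phi>" using root_sheets_exist[OF P v *] by blast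
      then interpret root_sheets P v x0 \<epsilon> \<rho> \<phi> .
      have "card (roots_along P v x) = card (roots_along P v x0)" if "x \<in> ball x0 \<epsilon>" for x
        using roots_sheets[OF that] card_image[OF sheets_inj[OF that]] by simp
      then have "ball x0 \<epsilon> \<subseteq> maxroots P v" using * by (auto simp: maxroots_def)
      then show ?thesis using eps_pos by blast
    qed
  qed
  have "\<exists>x. \<forall>x'. card (roots_along P v x') \<le> card (roots_along P v x)"
    using ex_has_greatest_nat[of "\<lambda>x. True" 0 "\<lambda>x. card (roots_along P v x)" "Suc m"] finite_roots_along(2)[OF P v]
    by (auto simp: less_Suc_eq_le)
  then show "maxroots P v \<noteq> {}" by (auto simp: maxroots_def)
  fix a b assume "\<exists>t. a + t *s b \<in> maxroots P v"
  then obtain t1 where t1: "a + t1 *s b \<in> maxroots P v" by blast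
  obtain q r where q: "lead_coeff q = 1" "r \<noteq> 0" "\<And>t y. ev2 q t y = 0 \<longleftrightarrow> P (a + t *s b + y *s v) = 0"
    "\<And>t y. poly r t \<noteq> 0 \<Longrightarrow> ev2 q t y = 0 \<Longrightarrow> ev2 (pderiv q) t y \<noteq> 0"
    using line_squarefree[OF P v] by blast
  have "a + t *s b \<in> maxroots P v" if "poly r t \<noteq> 0" for t
  proof -
    have "card (roots_along P v (a + t *s b)) = degree q"
      using card_roots_line(2)[OF P v q(1) q(3)] q(4)[OF that] by blast
    moreover have "card (roots_along P v (a + t1 *s b)) \<le> degree q"
      using card_roots_line(1)[OF P v q(1) q(3)] by blast
    moreover have "card (roots_along P v x') \<le> card (roots_along P v (a + t1 *s b))" for x'
      using t1 by (simp add: maxroots_def)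
    ultimately have "card (roots_along P v x') \<le> card (roots_along P v (a + t *s b))" for x'
      by (metis order_trans)
    then show ?thesis by (simp add: maxroots_def)
  qed
  then have "{t. a + t *s b \<notin> maxroots P v} \<subseteq> {t. poly r t = 0}" by blast
  then show "finite {t. a + t *s b \<notin> maxroots P v}" using poly_roots_finite[OF q(2)] finite_subset by blast
qed

lemma root_base_exists:
  assumes P: "hom_fun m P" and v: "P v \<noteq> 0" and m: "m \<ge> 1"
  shows "\<exists>\<Omega>. root_base P v \<Omega>"
proof -
  have "v \<noteq> 0" using hom_fun_at_0[OF P m] v by auto
  then obtain j where j: "v $ j \<noteq> 0" by (auto simp: vec_eq_iff)
  obtain i where i: "i \<noteq> j"
    by (metis option.distinct(1))
  \<comment> \<open>A linear form that is invariant under translation along \<open>v\<close> and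
    vanishes at the origin. A second index \<open>i\<close> exists because an option type has at
    least two elements.\<close>
  define L where "L x = x $ i * v $ j - x $ j * v $ i" for x :: "complex ^ 'a option"
  have pL: "polyfun L" unfolding L_def[abs_def] by (intro polyfun_intros)
  have "L (axis i 1) \<noteq> 0" using i j by (simp add: L_def axis_def)
  then have "cothin {x. L x \<noteq> 0}" by (rule cothin_polyfun_nonzero[OF pL])
  then have "cothin (maxroots P v \<inter> {x. L x \<noteq> 0})" by (intro cothin_Int maxroots_cothin[OF P v])
  moreover have "L (x + \<tau> *s v) = L x" for x \<tau> by (simp add: L_def algebra_simps)
  moreover have "L 0 = 0" by (simp add: L_def)
  ultimately have "root_base P v (maxroots P v \<inter> {x. L x \<noteq> 0})"
    unfolding root_base_def by (auto simp: maxroots_def card_roots_along_shift)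
  then show ?thesis by blast
qed

section \<open>The Nullstellensatz for a hypersurface\<close>

lemma field_differentiable_prod:
  fixes f :: "'i \<Rightarrow> complex \<Rightarrow> complex"
  assumes "\<And>i. i \<in> I \<Longrightarrow> f i field_differentiable (at x within S)"
  shows "(\<lambda>t. \<Prod>i\<in>I. f i t) field_differentiable (at x within S)"
  using assms
  by (induction I rule: infinite_finite_induct) (auto intro: field_differentiable_mult)

lemma polyfun_growth:
  assumes "polyfun g" shows "\<exists>C M. C \<ge> 0 \<and> (\<forall>z. norm (g z) \<le> C * (1 + norm z) ^ M)"
  using assms
proof (induction rule: polyfun.induct)
  case (polyfun_const c)
  show ?case by (intro exI[of _ "norm c"] exI[of _ 0]) auto
next
  case (polyfun_coord i)
  show ?case
  proof (intro exI conjI allI)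
    fix z :: "complex ^ 'a option"
    show "norm (z $ i) \<le> 1 * (1 + norm z) ^ 1" using Finite_Cartesian_Product.norm_nth_le[of z i] by simp
  qed simp
next
  case (polyfun_add f g)
  then obtain C M D N where *: "C \<ge> 0" "\<And>z. norm (f z) \<le> C * (1 + norm z) ^ M" "D \<ge> 0" "\<And>z. norm (g z) \<le> D * (1 + norm z) ^ N" by blast
  have "norm (f z + g z) \<le> (C + D) * (1 + norm z) ^ (M + N)" for z
  proof -
    have "norm (f z + g z) \<le> C * (1 + norm z) ^ M + D * (1 + norm z) ^ N"
      using norm_triangle_ineq[of "f z" "g z"] *(2)[of z] *(4)[of z] by linarith
    also have "\<dots> \<le> C * (1 + norm z) ^ (M + N) + D * (1 + norm z) ^ (M + N)"
      using *(1,3) by (intro add_mono mult_left_mono power_increasing) auto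
    finally show ?thesis by (simp add: algebra_simps)
  qed
  then show ?case using *(1,3) by (intro exI[of _ "C + D"] exI[of _ "M + N"]) auto
next
  case (polyfun_mult f g)
  then obtain C M D N where *: "C \<ge> 0" "\<And>z. norm (f z) \<le> C * (1 + norm z) ^ M" "D \<ge> 0" "\<And>z. norm (g z) \<le> D * (1 + norm z) ^ N" by blast
  have "norm (f z * g z) \<le> (C * D) * (1 + norm z) ^ (M + N)" for z
  proof -
    have "norm (f z) * norm (g z) \<le> (C * (1 + norm z) ^ M) * (D * (1 + norm z) ^ N)"
      using *(1) by (intro mult_mono *) auto
    then show ?thesis by (simp add: norm_mult power_add algebra_simps)
  qed
  then show ?case using *(1,3) by (intro exI[of _ "C * D"] exI[of _ "M + N"]) auto
qed

text \<open>The quotient is bounded at \<open>x\<close> by its values on a large circle \<open>x + y v\<close>, hence of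
  polynomial growth.\<close>

lemma polyfun_divides:
  fixes Q R :: "complex ^ 'k::finite option \<Rightarrow> complex"
  assumes \<Omega>: "cothin \<Omega>" and Q: "polyfun Q" "Q z0 \<noteq> 0" and R: "polyfun R"
    and c: "c > 0" and K: "K > 0"
    and low: "\<And>x (y::complex). x \<in> \<Omega> \<Longrightarrow> norm y = K * (1 + norm x) \<Longrightarrow> c \<le> norm (Q (x + y *s v))"
    and div: "\<And>x. x \<in> \<Omega> \<Longrightarrow> \<exists>h. \<forall>y. R (x + y *s v) = poly h y * Q (x + y *s v)"
  shows "pdvd Q R"
proof -
  obtain C M where C: "C \<ge> 0" and CM: "\<And>z. norm (R z) \<le> C * (1 + norm z) ^ M" using polyfun_growth[OF R] by blast
  define \<Omega>' where "\<Omega>' = \<Omega> \<inter> {x. Q x \<noteq> 0}"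
  have \<Omega>': "cothin \<Omega>'" unfolding \<Omega>'_def by (intro cothin_Int \<Omega> cothin_polyfun_nonzero[OF Q])
  define A where "A x = R x / Q x" for x
  define B where "B = C * (1 + K * norm v) ^ M / c"
  have B0: "B \<ge> 0" using C c K by (simp add: B_def)
  have Abd: "norm (A x) \<le> B * (1 + norm x) ^ M" if x: "x \<in> \<Omega>'" for x
  proof -
    obtain h where h: "\<And>y. R (x + y *s v) = poly h y * Q (x + y *s v)" using div x by (auto simp: \<Omega>'_def)
    let ?\<rho> = "K * (1 + norm x)"
    have \<rho>: "?\<rho> > 0" using K by (simp add: add_pos_nonneg)
    have "norm (poly h 0) \<le> B * (1 + norm x) ^ M"
    proof (rule maximum_modulus_frontier[of "poly h" "cball 0 ?\<rho>"])
      fix y :: complex assume "y \<in> frontier (cball 0 ?\<rho>)"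
      then have y: "norm y = ?\<rho>" using \<rho> by (simp add: frontier_cball sphere_def)
      have Qy: "c \<le> norm (Q (x + y *s v))" using low[OF _ y] x by (simp add: \<Omega>'_def)
      have "norm (x + y *s v) \<le> norm x + ?\<rho> * norm v"
        using norm_triangle_ineq[of x "y *s v"] y by (simp add: norm_smult)
      also have "\<dots> \<le> (1 + K * norm v) * (1 + norm x) - 1" using K by (simp add: algebra_simps)
      finally have "1 + norm (x + y *s v) \<le> (1 + K * norm v) * (1 + norm x)" by simp
      then have "norm (R (x + y *s v)) \<le> C * ((1 + K * norm v) * (1 + norm x)) ^ M"
        using CM[of "x + y *s v"] C by (meson order_trans mult_left_mono power_mono add_nonneg_nonneg norm_ge_zero zero_le_one)
      also have "\<dots> = B * (1 + norm x) ^ M * c" using c by (simp add: B_def power_mult_distrib)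
      finally have "norm (poly h y) * norm (Q (x + y *s v)) \<le> B * (1 + norm x) ^ M * c"
        by (simp add: h norm_mult)
      moreover have "norm (poly h y) * c \<le> norm (poly h y) * norm (Q (x + y *s v))"
        using Qy by (intro mult_left_mono) auto
      ultimately have "norm (poly h y) * c \<le> B * (1 + norm x) ^ M * c" by linarith
      then show "norm (poly h y) \<le> B * (1 + norm x) ^ M" using c by simp
    next
      show "poly h holomorphic_on interior (cball 0 ?\<rho>)" using poly_holomorphic_on[OF holomorphic_on_ident] by simp
      show "continuous_on (closure (cball 0 ?\<rho>)) (poly h)" by (simp add: continuous_on_poly continuous_on_id)
      show "bounded (cball 0 ?\<rho>)" by simp
      show "(0::complex) \<in> cball 0 ?\<rho>" using \<rho> by simp
    qed
    moreover have "A x = poly h 0" using h[of 0] x by (simp add: A_def \<Omega>'_def)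
    ultimately show ?thesis by simp
  qed
  have "\<exists>G. polyfun G \<and> (\<forall>x\<in>\<Omega>'. G x = A x)"
  proof (rule polyfun_of_lines[OF \<Omega>'])
    fix a b assume "\<exists>t. a + t *s b \<in> \<Omega>'"
    then have S: "finite {t. a + t *s b \<notin> \<Omega>'}" using cothinD(3)[OF \<Omega>'] by blast
    let ?S = "{t. a + t *s b \<notin> \<Omega>'}"
    obtain p1 where p1: "\<And>t. R (a + t *s b) = poly p1 t" using polyfun_lineE[OF R] by blast
    obtain p2 where p2: "\<And>t. Q (a + t *s b) = poly p2 t" using polyfun_lineE[OF Q(1)] by blast
    have "(\<lambda>t. poly p1 t / poly p2 t) holomorphic_on - ?S"
      by (intro holomorphic_intros) (auto simp: p2[symmetric] \<Omega>'_def)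
    then have hol: "(\<lambda>t. A (a + t *s b)) holomorphic_on - ?S" by (simp add: A_def p1 p2)
    have "norm (A (a + t *s b)) \<le> (B * (1 + norm a + norm b) ^ M) * (1 + norm t) ^ M" if "t \<notin> ?S" for t
    proof -
      have "norm (a + t *s b) \<le> norm a + norm t * norm b"
        using norm_triangle_ineq[of a "t *s b"] by (simp add: norm_smult)
      also have "\<dots> \<le> (1 + norm a + norm b) * (1 + norm t) - 1" by (simp add: algebra_simps)
      finally have "1 + norm (a + t *s b) \<le> (1 + norm a + norm b) * (1 + norm t)" by simp
      then have "(1 + norm (a + t *s b)) ^ M \<le> ((1 + norm a + norm b) * (1 + norm t)) ^ M" by (intro power_mono) auto
      then have "B * (1 + norm (a + t *s b)) ^ M \<le> B * ((1 + norm a + norm b) * (1 + norm t)) ^ M"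
        using B0 by (rule mult_left_mono)
      then show ?thesis using Abd[of "a + t *s b"] that by (simp add: power_mult_distrib mult.assoc)
    qed
    from polynomial_of_growth[OF S hol this]
    show "\<exists>p. degree p \<le> M \<and> (\<forall>t. a + t *s b \<in> \<Omega>' \<longrightarrow> A (a + t *s b) = poly p t)" by auto
  qed
  then obtain G where G: "polyfun G" "\<And>x. x \<in> \<Omega>' \<Longrightarrow> G x = A x" by blast
  have "R = (\<lambda>z. G z * Q z)"
    by (rule cothin_polyfun_eq[OF \<Omega>' R polyfun_mult[OF G(1) Q(1)]]) (auto simp: G(2) A_def \<Omega>'_def)
  then show ?thesis unfolding pdvd_def using G(1) by blast
qed

lemma prod_roots_dvd:
  fixes p :: "complex poly"
  assumes "finite X" "\<And>y. y \<in> X \<Longrightarrow> poly p y = 0"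
  shows "(\<Prod>y\<in>X. [:- y, 1:]) dvd p"
  using assms
proof (induction X rule: finite_induct)
  case (insert y X)
  then obtain h where h: "p = (\<Prod>y\<in>X. [:- y, 1:]) * h" by (auto elim: dvdE)
  have "poly (\<Prod>y\<in>X. [:- y, 1:]) y \<noteq> 0" using insert.hyps by (auto simp: poly_prod)
  moreover have "poly p y = 0" using insert.prems by simp
  ultimately have "poly h y = 0" by (simp add: h)
  then have "[:- y, 1:] dvd h" by (simp add: poly_eq_0_iff_dvd)
  then have "(\<Prod>y\<in>X. [:- y, 1:]) * [:- y, 1:] dvd p" unfolding h by (rule mult_dvd_mono[OF dvd_refl])
  then show ?case using insert.hyps by (simp add: mult.commute)
qed simp

text \<open>The form in which connectedness is tested: near a point over the base, \<open>W\<close>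
  contains the sheet through it either entirely or not at all. Nothing is asked outside the base,
  where sheets may meet.\<close>

definition clopen_over :: "(complex ^ 'k::finite option \<Rightarrow> complex) \<Rightarrow> (complex ^ 'k option) set \<Rightarrow> (complex ^ 'k option) set \<Rightarrow> bool" where
  "clopen_over P \<Omega> W \<longleftrightarrow> (\<forall>x\<in>\<Omega>. P x = 0 \<longrightarrow>
     (\<exists>U. open U \<and> x \<in> U \<and> ((\<forall>z\<in>U. P z = 0 \<longrightarrow> z \<in> W) \<or> (\<forall>z\<in>U. P z = 0 \<longrightarrow> z \<notin> W))))"

text \<open>Sums over the sheets in \<open>W\<close> are holomorphic along lines, so the product of the sheets in \<open>W\<close>
  is a polynomial, and it divides \<open>P\<close>.\<close>

lemma clopen_factor:
  fixes P :: "complex ^ 'k::finite option \<Rightarrow> complex"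
  assumes P: "hom_fun m P" and v: "P v \<noteq> 0" and base: "root_base P v \<Omega>" and clopen: "clopen_over P \<Omega> W"
  shows "\<exists>Q. polyfun Q \<and> pdvd Q P \<and>
    (\<forall>x\<in>\<Omega>. \<forall>\<tau>. Q (x + \<tau> *s v) = (\<Prod>y\<in>{y \<in> roots_along P v x. x + y *s v \<in> W}. \<tau> - y))"
proof -
  note pP = hom_funD(1)[OF P]
  have \<Omega>: "cothin \<Omega>" and max\<Omega>: "\<And>x. x \<in> \<Omega> \<Longrightarrow> x \<in> maxroots P v"
    and shift: "\<And>x \<tau>. x \<in> \<Omega> \<Longrightarrow> x + \<tau> *s v \<in> \<Omega>"
    using base by (auto simp: root_base_def)
  define Wr where "Wr x = {y \<in> roots_along P v x. x + y *s v \<in> W}" for x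
  have finW: "finite (Wr x)" for x unfolding Wr_def using finite_roots_along(1)[OF P v] by simp
  \<comment> \<open>The value at 0 of the monic polynomial with root set \<open>Wr x\<close>.
    Translating \<open>x\<close> along \<open>v\<close> shifts the roots, so the values of
    \<open>q\<close> on that line recover the whole polynomial (\<open>q_shift\<close>).\<close>
  define q where "q x = (\<Prod>y\<in>Wr x. - y)" for x
  have Wr_shift: "Wr (x + \<tau> *s v) = (\<lambda>y. y - \<tau>) ` Wr x" for x \<tau>
  proof -
    have "x + \<tau> *s v + (y - \<tau>) *s v = x + y *s v" for y by (simp add: vec_eq_iff algebra_simps)
    then show ?thesis unfolding Wr_def roots_along_shift by auto
  qed
  have q_shift: "q (x + \<tau> *s v) = (\<Prod>y\<in>Wr x. \<tau> - y)" for x \<tau>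
    unfolding q_def Wr_shift by (subst prod.reindex) (auto simp: inj_on_def)
  obtain K where K: "K \<ge> 0" and Kb: "\<And>x y. P (x + y *s v) = 0 \<Longrightarrow> norm y \<le> K * norm x" using root_bound[OF P v] by blast
  have qbd: "norm (q x) \<le> (1 + K * norm x) ^ m" for x
  proof -
    have "norm (q x) = (\<Prod>y\<in>Wr x. norm y)" by (simp add: q_def prod_norm[symmetric])
    also have "\<dots> \<le> (\<Prod>y\<in>Wr x. 1 + K * norm x)"
      by (rule prod_mono) (auto simp: Wr_def roots_along_def dest!: Kb)
    also have "\<dots> = (1 + K * norm x) ^ card (Wr x)" by simp
    also have "\<dots> \<le> (1 + K * norm x) ^ m"
    proof (rule power_increasing)
      have "card (Wr x) \<le> card (roots_along P v x)"
        by (rule card_mono) (auto simp: Wr_def finite_roots_along(1)[OF P v])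
      then show "card (Wr x) \<le> m" using finite_roots_along(2)[OF P v, of x] by simp
    qed (use K in simp)
    finally show ?thesis .
  qed
  have local: "\<exists>U \<phi>. open U \<and> x0 \<in> U \<and> (\<forall>x\<in>U. q x = (\<Prod>r\<in>Wr x0. - \<phi> r x)) \<and>
      (\<forall>r\<in>Wr x0. \<phi> r x0 = r \<and> continuous_on U (\<phi> r) \<and> (\<forall>x\<in>U. P (x + \<phi> r x *s v) = 0))" if x0: "x0 \<in> \<Omega>" for x0
  proof -
    have *: "\<And>x. card (roots_along P v x) \<le> card (roots_along P v x0)" using max\<Omega>[OF x0] by (simp add: maxroots_def)
    obtain \<epsilon> \<rho> \<phi> where sh: "root_sheets P v x0 \<epsilon> \<rho> \<phi>" using root_sheets_exist[OF P v *] by blast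
    note \<epsilon> = root_sheets.eps_pos[OF sh] and zero = root_sheets.sheet_root[OF sh] and im = root_sheets.roots_sheets[OF sh]
      and inj = root_sheets.sheets_inj[OF sh] and at0 = root_sheets.sheet_centre[OF sh] and cont = root_sheets.sheet_continuous[OF sh]
    have near: "\<forall>\<^sub>F x in nhds x0. x + \<phi> r x *s v \<in> W \<longleftrightarrow> x0 + r *s v \<in> W" if r: "r \<in> roots_along P v x0" for r
    proof -
      have "P (x0 + r *s v) = 0" using r by (simp add: roots_along_def)
      then obtain U where U: "open U" "x0 + r *s v \<in> U" and
        cl: "(\<forall>z\<in>U. P z = 0 \<longrightarrow> z \<in> W) \<or> (\<forall>z\<in>U. P z = 0 \<longrightarrow> z \<notin> W)"
        using clopen shift[OF x0, of r] unfolding clopen_over_def by blast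
      have "continuous_on (ball x0 \<epsilon>) (\<lambda>x. x + \<phi> r x *s v)" by (intro continuous_intros cont[OF r])
      then have "open (ball x0 \<epsilon> \<inter> (\<lambda>x. x + \<phi> r x *s v) -` U)" using U(1) by (simp add: continuous_open_preimage)
      moreover have "x0 \<in> ball x0 \<epsilon> \<inter> (\<lambda>x. x + \<phi> r x *s v) -` U" using \<epsilon> U(2) at0[OF r] by simp
      ultimately have "\<forall>\<^sub>F x in nhds x0. x \<in> ball x0 \<epsilon> \<inter> (\<lambda>x. x + \<phi> r x *s v) -` U" by (rule eventually_nhds_in_open)
      then show ?thesis
      proof eventually_elim
        case (elim x)
        then have "P (x + \<phi> r x *s v) = 0" "x + \<phi> r x *s v \<in> U" using zero[OF r] by auto
        then show ?case using cl U(2) \<open>P (x0 + r *s v) = 0\<close> by blast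
      qed
    qed
    have "\<forall>\<^sub>F x in nhds x0. \<forall>r\<in>roots_along P v x0. x + \<phi> r x *s v \<in> W \<longleftrightarrow> x0 + r *s v \<in> W"
      by (intro eventually_ball_finite finite_roots_along(1)[OF P v] ballI near)
    moreover have "\<forall>\<^sub>F x in nhds x0. x \<in> ball x0 \<epsilon>" using \<epsilon> by (intro eventually_nhds_in_open) auto
    ultimately have "\<forall>\<^sub>F x in nhds x0. x \<in> ball x0 \<epsilon> \<and> (\<forall>r\<in>roots_along P v x0. x + \<phi> r x *s v \<in> W \<longleftrightarrow> x0 + r *s v \<in> W)"
      by eventually_elim simp
    then obtain U where U: "open U" "x0 \<in> U" "\<And>x. x \<in> U \<Longrightarrow> x \<in> ball x0 \<epsilon>"
      "\<And>x r. x \<in> U \<Longrightarrow> r \<in> roots_along P v x0 \<Longrightarrow> x + \<phi> r x *s v \<in> W \<longleftrightarrow> x0 + r *s v \<in> W"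
      unfolding eventually_nhds by blast
    have "q x = (\<Prod>r\<in>Wr x0. - \<phi> r x)" if x: "x \<in> U" for x
    proof -
      have "Wr x = (\<lambda>r. \<phi> r x) ` Wr x0"
        unfolding Wr_def im[OF U(3)[OF x]] using U(4)[OF x] by auto
      moreover have "inj_on (\<lambda>r. \<phi> r x) (Wr x0)" by (rule inj_on_subset[OF inj[OF U(3)[OF x]]]) (auto simp: Wr_def)
      ultimately show ?thesis by (simp add: q_def prod.reindex)
    qed
    moreover have "\<phi> r x0 = r \<and> continuous_on U (\<phi> r) \<and> (\<forall>x\<in>U. P (x + \<phi> r x *s v) = 0)" if "r \<in> Wr x0" for r
    proof -
      have r: "r \<in> roots_along P v x0" using that by (simp add: Wr_def)
      show ?thesis using at0[OF r] continuous_on_subset[OF cont[OF r]] zero[OF r] U(3) by blast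
    qed
    ultimately show ?thesis using U(1,2) by blast
  qed
  have qcont: "isCont q x0" if x0: "x0 \<in> \<Omega>" for x0
  proof -
    obtain U \<phi> where U: "open U" "x0 \<in> U" "\<forall>x\<in>U. q x = (\<Prod>r\<in>Wr x0. - \<phi> r x)" "\<forall>r\<in>Wr x0. continuous_on U (\<phi> r)"
      using local[OF x0] by blast
    have "continuous_on U (\<lambda>x. \<Prod>r\<in>Wr x0. - \<phi> r x)" using U(4) by (intro continuous_on_prod continuous_on_minus) blast
    then have "continuous_on U q" by (rule continuous_on_eq) (use U(3) in auto)
    then show ?thesis using U(1,2) continuous_on_eq_continuous_at by blast
  qed
  have "\<exists>Q. polyfun Q \<and> (\<forall>x\<in>\<Omega>. Q x = q x)"
  proof (rule polyfun_of_lines[OF \<Omega>])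
    fix a b assume "\<exists>t. a + t *s b \<in> \<Omega>"
    then have S1: "finite {t. a + t *s b \<notin> \<Omega>}" using cothinD(3)[OF \<Omega>] by blast
    \<comment> \<open>Multiple factors of \<open>P\<close> are still possible here, so simple roots
      are taken from the squarefree \<open>g\<close>; the zeros of \<open>r\<close> become further
      removable points.\<close>
    obtain g r where g: "lead_coeff g = 1" "r \<noteq> 0" "\<And>t y. ev2 g t y = 0 \<longleftrightarrow> P (a + t *s b + y *s v) = 0"
      "\<And>t y. poly r t \<noteq> 0 \<Longrightarrow> ev2 g t y = 0 \<Longrightarrow> ev2 (pderiv g) t y \<noteq> 0"
      using line_squarefree[OF P v] by blast
    let ?S = "{t. a + t *s b \<notin> \<Omega>} \<union> {t. poly r t = 0}"
    have S: "finite ?S" using S1 poly_roots_finite[OF g(2)] by simp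
    have hol: "(\<lambda>t. q (a + t *s b)) holomorphic_on - ?S"
      unfolding holomorphic_on_def
    proof
      fix t0 assume t0: "t0 \<in> - ?S"
      then have x0: "a + t0 *s b \<in> \<Omega>" and r0: "poly r t0 \<noteq> 0" by auto
      let ?x0 = "a + t0 *s b"
      obtain U \<phi> where U: "open U" "?x0 \<in> U" "\<forall>x\<in>U. q x = (\<Prod>r\<in>Wr ?x0. - \<phi> r x)"
        "\<forall>r\<in>Wr ?x0. \<phi> r ?x0 = r \<and> continuous_on U (\<phi> r) \<and> (\<forall>x\<in>U. P (x + \<phi> r x *s v) = 0)"
        using local[OF x0] by blast
      let ?T = "{t. a + t *s b \<in> U}"
      have T: "open ?T" "t0 \<in> ?T" using open_line[OF U(1)] U(2) by auto
      have "(\<lambda>t. \<phi> s (a + t *s b)) field_differentiable at t0" if s: "s \<in> Wr ?x0" for s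
      proof (rule implicit_root_differentiable[of _ _ g])
        have "continuous_on ?T (\<lambda>t. \<phi> s (a + t *s b))"
          by (rule continuous_on_compose2[of U "\<phi> s"]) (use U(4) s in \<open>auto intro!: continuous_intros\<close>)
        then show "isCont (\<lambda>t. \<phi> s (a + t *s b)) t0" using T continuous_on_eq_continuous_at by blast
        have "\<forall>\<^sub>F t in nhds t0. t \<in> ?T" by (rule eventually_nhds_in_open[OF T])
        then show "\<forall>\<^sub>F t in nhds t0. ev2 g t (\<phi> s (a + t *s b)) = 0"
          by eventually_elim (use U(4) s g(3) in auto)
        have "P (?x0 + \<phi> s ?x0 *s v) = 0" using U(2,4) s by blast
        then have "ev2 g t0 (\<phi> s ?x0) = 0" using g(3)[of t0 "\<phi> s ?x0"] by blast
        then show "ev2 (pderiv g) t0 (\<phi> s ?x0) \<noteq> 0" using g(4)[OF r0] by blast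
      qed
      then have "(\<lambda>t. \<Prod>s\<in>Wr ?x0. - \<phi> s (a + t *s b)) field_differentiable at t0"
        by (intro field_differentiable_prod field_differentiable_minus)
      then obtain D where "((\<lambda>t. \<Prod>s\<in>Wr ?x0. - \<phi> s (a + t *s b)) has_field_derivative D) (at t0)"
        unfolding field_differentiable_def by blast
      then have "((\<lambda>t. q (a + t *s b)) has_field_derivative D) (at t0)"
        by (rule has_field_derivative_transform_within_open[OF _ T]) (use U(3) in auto)
      then have "(\<lambda>t. q (a + t *s b)) field_differentiable at t0"
        unfolding field_differentiable_def by blast
      then show "(\<lambda>t. q (a + t *s b)) field_differentiable at t0 within - ?S"
        by (rule field_differentiable_at_within)
    qed
    have "norm (q (a + t *s b)) \<le> (1 + K * norm a + K * norm b) ^ m * (1 + norm t) ^ m" for t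
    proof -
      have "K * norm (a + t *s b) \<le> K * (norm a + norm t * norm b)"
        using norm_triangle_ineq[of a "t *s b"] K by (intro mult_left_mono) (auto simp: norm_smult)
      also have "\<dots> \<le> (1 + K * norm a + K * norm b) * (1 + norm t) - 1" using K by (simp add: algebra_simps)
      finally have "1 + K * norm (a + t *s b) \<le> (1 + K * norm a + K * norm b) * (1 + norm t)" by simp
      then have "(1 + K * norm (a + t *s b)) ^ m \<le> ((1 + K * norm a + K * norm b) * (1 + norm t)) ^ m"
        using K by (intro power_mono) auto
      then show ?thesis using qbd[of "a + t *s b"] by (simp add: power_mult_distrib)
    qed
    from polynomial_of_growth[OF S hol this]
    obtain p where p: "degree p \<le> m" "\<And>t. t \<notin> ?S \<Longrightarrow> q (a + t *s b) = poly p t" by blast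
    \<comment> \<open>The identity so far omits the points of the base where \<open>r\<close>
      vanishes; continuity of \<open>q\<close> adds them.\<close>
    have "q (a + t0 *s b) = poly p t0" if t0: "a + t0 *s b \<in> \<Omega>" for t0
    proof -
      have "isCont (\<lambda>t. q (a + t *s b)) t0"
      proof (rule isCont_o2[of t0 "\<lambda>t. a + t *s b" q])
        have "continuous_on UNIV (\<lambda>t. a + t *s b)" by (intro continuous_intros)
        then show "isCont (\<lambda>t. a + t *s b) t0" by (simp add: continuous_on_eq_continuous_at)
      qed (rule qcont[OF t0])
      then have lim1: "((\<lambda>t. q (a + t *s b)) \<longlongrightarrow> q (a + t0 *s b)) (at t0)" by (simp add: isCont_def)
      have lim2: "((\<lambda>t. poly p t) \<longlongrightarrow> poly p t0) (at t0)" using poly_isCont[of t0 p] by (simp add: isCont_def)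
      have "open (- (?S - {t0}))" using S by (intro open_Compl finite_imp_closed) auto
      then have "\<forall>\<^sub>F t in at t0. t \<in> - (?S - {t0}) \<and> t \<noteq> t0"
        unfolding eventually_at_topological by blast
      then have "\<forall>\<^sub>F t in at t0. poly p t = q (a + t *s b)" by eventually_elim (use p(2) in auto)
      then have "((\<lambda>t. q (a + t *s b)) \<longlongrightarrow> poly p t0) (at t0)" by (rule Lim_transform_eventually[OF lim2])
      then show ?thesis using lim1 LIM_unique by blast
    qed
    then show "\<exists>p. degree p \<le> m \<and> (\<forall>t. a + t *s b \<in> \<Omega> \<longrightarrow> q (a + t *s b) = poly p t)" using p(1) by blast
  qed
  then obtain Q where Q: "polyfun Q" "\<And>x. x \<in> \<Omega> \<Longrightarrow> Q x = q x" by blast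
  have Qp: "Q (x + \<tau> *s v) = (\<Prod>y\<in>Wr x. \<tau> - y)" if "x \<in> \<Omega>" for x \<tau>
    using Q(2)[OF shift[OF that]] q_shift by simp
  \<comment> \<open>All roots are bounded by \<open>K * norm x\<close>, so this circle keeps
    distance at least 1 from them and each factor of the product has norm at least 1.\<close>
  have low: "1 \<le> norm (Q (x + y *s v))" if x: "x \<in> \<Omega>" and y: "norm y = (K + 1) * (1 + norm x)" for x y
  proof -
    have "1 \<le> norm (y - r)" if "r \<in> Wr x" for r
    proof -
      have "norm r \<le> K * norm x" using that Kb by (auto simp: Wr_def roots_along_def)
      moreover have "norm y \<le> norm (y - r) + norm r" using norm_triangle_sub[of y r] by simp
      moreover have "norm y = 1 + K + norm x + K * norm x" using y by (simp add: algebra_simps)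
      ultimately show ?thesis using K norm_ge_zero[of x] by linarith
    qed
    then have "(\<Prod>r\<in>Wr x. 1) \<le> (\<Prod>r\<in>Wr x. norm (y - r))" by (intro prod_mono) auto
    then show ?thesis by (simp add: Qp[OF x] prod_norm[symmetric])
  qed
  obtain x1 where x1: "x1 \<in> \<Omega>" using cothinD(2)[OF \<Omega>] by blast
  have "(K + 1) * (1 + norm x1) \<ge> 0" using K by simp
  then obtain y1 :: complex where y1: "norm y1 = (K + 1) * (1 + norm x1)"
    using norm_of_real[of "(K + 1) * (1 + norm x1)", where ?'a = complex] by (metis abs_of_nonneg)
  have Q1: "Q (x1 + y1 *s v) \<noteq> 0" using low[OF x1 y1] by auto
  have K1: "K + 1 > 0" using K by simp
  have "pdvd Q P"
  proof (rule polyfun_divides[OF \<Omega> Q(1) Q1 pP zero_less_one K1 low])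
    fix x assume x: "x \<in> \<Omega>"
    have "(\<Prod>y\<in>Wr x. [:- y, 1:]) dvd upoly P v x"
      by (rule prod_roots_dvd[OF finW]) (simp add: Wr_def roots_along_upoly[OF pP])
    then obtain h where h: "upoly P v x = (\<Prod>y\<in>Wr x. [:- y, 1:]) * h" by (rule dvdE)
    have "P (x + y *s v) = poly h y * Q (x + y *s v)" for y
    proof -
      have "P (x + y *s v) = poly (upoly P v x) y" by (simp add: poly_upoly[OF pP])
      also have "\<dots> = poly h y * (\<Prod>r\<in>Wr x. y - r)" unfolding h by (simp add: poly_prod)
      finally show ?thesis by (simp add: Qp[OF x])
    qed
    then show "\<exists>h. \<forall>y. P (x + y *s v) = poly h y * Q (x + y *s v)" by blast
  qed
  then show ?thesis using Q(1) Qp unfolding Wr_def by blast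
qed

lemma hom_fun_cofactor:
  assumes P: "hom_fun m P" "P v \<noteq> 0" and Q: "polyfun Q" "pdvd Q P"
  shows "\<exists>A a b. hom_fun a A \<and> hom_fun b Q \<and> P = (\<lambda>z. A z * Q z)"
proof -
  obtain A where A: "polyfun A" "P = (\<lambda>z. A z * Q z)" using Q(2) unfolding pdvd_def by blast
  have "\<exists>a. hom_fun a A" by (rule hom_fun_factor[OF P A(1) Q(1) A(2)])
  moreover have "\<exists>b. hom_fun b Q" by (rule hom_fun_factor[OF P Q(1) A(1)]) (simp add: A(2) mult.commute)
  ultimately show ?thesis using A(2) by blast
qed

section \<open>Connectedness of the sheets of an irreducible form\<close>

lemma irr_formD:
  assumes "irr_form P d"
  shows "hom_fun d P" "polyfun P" "d \<ge> 1" "P 0 = 0"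
  using assms hom_fun_at_0 by (auto simp: irr_form_def hom_fun_def)

lemma irr_form_factor:
  assumes "irr_form P d" "hom_fun a A" "hom_fun b B" "P = (\<lambda>z. A z * B z)" shows "a = 0 \<or> b = 0"
  using assms unfolding irr_form_def by blast

text \<open>The factor of \<open>P\<close> made of the sheets in \<open>W\<close> vanishes at
  \<open>x0\<close> but not at \<open>v\<close>, so it is not constant, and irreducibility makes its
  cofactor constant.\<close>

lemma irr_clopen:
  assumes P: "irr_form P d" and v: "P v \<noteq> 0" and base: "root_base P v \<Omega>" and clopen: "clopen_over P \<Omega> W"
    and x0: "x0 \<in> \<Omega>" "P x0 = 0" "x0 \<in> W"
  shows "\<exists>c. c \<noteq> 0 \<and> (\<forall>x\<in>\<Omega>. \<forall>\<tau>. P (x + \<tau> *s v) = c * (\<Prod>y\<in>{y \<in> roots_along P v x. x + y *s v \<in> W}. \<tau> - y))"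
proof -
  obtain Q where Q: "polyfun Q" "pdvd Q P"
    and Qp: "\<And>x \<tau>. x \<in> \<Omega> \<Longrightarrow> Q (x + \<tau> *s v) = (\<Prod>y\<in>{y \<in> roots_along P v x. x + y *s v \<in> W}. \<tau> - y)"
    using clopen_factor[OF irr_formD(1)[OF P] v base clopen] by blast
  obtain A a b where A: "hom_fun a A" "hom_fun b Q" "P = (\<lambda>z. A z * Q z)"
    using hom_fun_cofactor[OF irr_formD(1)[OF P] v Q] by blast
  have "0 \<in> {y \<in> roots_along P v x0. x0 + y *s v \<in> W}" using x0 by (simp add: roots_along_def)
  moreover have "finite {y \<in> roots_along P v x0. x0 + y *s v \<in> W}"
    using finite_roots_along(1)[OF irr_formD(1)[OF P] v] by simp
  ultimately have "(\<Prod>y\<in>{y \<in> roots_along P v x0. x0 + y *s v \<in> W}. 0 - y) = 0"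
    by (intro prod_zero) auto
  then have "Q x0 = 0" using Qp[OF x0(1), of 0] by simp
  have "b \<noteq> 0"
  proof
    assume "b = 0"
    then have "Q v = Q x0" using hom_fun_0 A(2) by metis
    then show False using \<open>Q x0 = 0\<close> A(3) v by simp
  qed
  then have "a = 0" using irr_form_factor[OF P A] by simp
  then have "A z = A 0" for z using hom_fun_0 A(1) by blast
  then have P': "P z = A 0 * Q z" for z using A(3) by metis
  then have "A 0 \<noteq> 0" using v by auto
  then show ?thesis using P' Qp by (intro exI[of _ "A 0"]) simp
qed

text \<open>Connectedness of \<open>P = 0\<close> over the base: the product over the sheets in
  \<open>W\<close> is already \<open>P\<close> up to a constant, so a zero of \<open>P\<close> is a
  root of this product. The point \<open>x\<close> itself corresponds to the root
  \<open>y = 0\<close>.\<close>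

lemma irr_clopen_everything:
  assumes P: "irr_form P d" and v: "P v \<noteq> 0" and base: "root_base P v \<Omega>" and clopen: "clopen_over P \<Omega> W"
    and x0: "x0 \<in> \<Omega>" "P x0 = 0" "x0 \<in> W" and x: "x \<in> \<Omega>" "P x = 0"
  shows "x \<in> W"
proof -
  obtain c where "c \<noteq> 0" and c: "\<And>x \<tau>. x \<in> \<Omega> \<Longrightarrow> P (x + \<tau> *s v) = c * (\<Prod>y\<in>{y \<in> roots_along P v x. x + y *s v \<in> W}. \<tau> - y)"
    using irr_clopen[OF P v base clopen x0] by blast
  have "(\<Prod>y\<in>{y \<in> roots_along P v x. x + y *s v \<in> W}. 0 - y) = 0"
    using c[OF x(1), of 0] x(2) \<open>c \<noteq> 0\<close> by simp
  moreover have "finite {y \<in> roots_along P v x. x + y *s v \<in> W}"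
    using finite_roots_along(1)[OF irr_formD(1)[OF P] v] by simp
  ultimately obtain y where "y \<in> {y \<in> roots_along P v x. x + y *s v \<in> W}" "0 - y = 0"
    by (meson prod_zero_iff)
  then show ?thesis by simp
qed

text \<open>A base point close to \<open>z0\<close> has a root close to 0, and adding that root
  times \<open>v\<close> does not leave the base, which is a union of lines in the direction
  \<open>v\<close>.\<close>

lemma dense_root_base:
  assumes P: "hom_fun m P" and v: "P v \<noteq> 0" and base: "root_base P v \<Omega>"
    and U: "open U" "z0 \<in> U" "P z0 = 0"
  shows "\<exists>x. x \<in> \<Omega> \<and> x \<in> U \<and> P x = 0"
proof -
  have \<Omega>: "cothin \<Omega>" and shift: "\<And>x \<tau>. x \<in> \<Omega> \<Longrightarrow> x + \<tau> *s v \<in> \<Omega>" using base by (auto simp: root_base_def)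
  obtain e where e: "e > 0" "ball z0 e \<subseteq> U" using U open_contains_ball by blast
  \<comment> \<open>Chosen so that a root of norm below it moves the point by at most
    \<open>e / 2\<close>.\<close>
  define \<delta> where "\<delta> = e / (2 * (1 + norm v))"
  have nv: "1 + norm v > 0" by (simp add: add_pos_nonneg)
  then have \<delta>: "\<delta> > 0" using e by (simp add: \<delta>_def)
  have "P (z0 + 0 *s v) = 0" using U(3) by simp
  from root_persists[OF P v this \<delta>]
  have "\<forall>\<^sub>F x in nhds z0. \<exists>y. P (x + y *s v) = 0 \<and> dist y 0 < \<delta>" .
  moreover have "\<forall>\<^sub>F x in nhds z0. x \<in> ball z0 (e / 2)" using e(1) by (intro eventually_nhds_in_open) auto
  ultimately have "\<forall>\<^sub>F x in nhds z0. x \<in> ball z0 (e / 2) \<and> (\<exists>y. P (x + y *s v) = 0 \<and> norm y < \<delta>)"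
    by eventually_elim auto
  then obtain V where V: "open V" "z0 \<in> V" "\<And>x. x \<in> V \<Longrightarrow> x \<in> ball z0 (e / 2) \<and> (\<exists>y. P (x + y *s v) = 0 \<and> norm y < \<delta>)"
    unfolding eventually_nhds by blast
  obtain x where x: "x \<in> V" "x \<in> \<Omega>" using cothin_dense[OF \<Omega> V(1)] V(2) by blast
  obtain y where y: "P (x + y *s v) = 0" "norm y < \<delta>" using V(3)[OF x(1)] by blast
  have "norm y * norm v \<le> \<delta> * (1 + norm v)" using y(2) \<delta> by (intro mult_mono) auto
  also have "\<delta> * (1 + norm v) = e / 2"
  proof -
    have "e / (2 * n) * n = e / 2" if "n > 0" for n :: real using that by simp
    from this[OF nv] show ?thesis unfolding \<delta>_def .
  qed
  finally have "norm (y *s v) \<le> e / 2" by (simp add: norm_smult)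
  moreover have "dist z0 x < e / 2" using V(3)[OF x(1)] by simp
  moreover have "dist x (x + y *s v) = norm (y *s v)" by (simp add: dist_norm)
  ultimately have "dist z0 (x + y *s v) < e" using dist_triangle[of z0 "x + y *s v" x] by linarith
  then have "x + y *s v \<in> U" using e(2) by auto
  then show ?thesis using shift[OF x(2)] y(1) by blast
qed

text \<open>The case \<open>W = UNIV\<close> of \<open>irr_clopen\<close>: \<open>P\<close> is a
  constant times the product over its distinct roots, so no root over the base is multiple.\<close>

lemma irr_simple_roots:
  assumes P: "irr_form P d" and v: "P v \<noteq> 0" and base: "root_base P v \<Omega>" and x: "x \<in> \<Omega>"
  shows "upoly P v x = smult (P v) (\<Prod>y\<in>roots_along P v x. [:- y, 1:])"
    "y \<in> roots_along P v x \<Longrightarrow> poly (pderiv (upoly P v x)) y \<noteq> 0"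
proof -
  obtain x0 where x0: "x0 \<in> \<Omega>" "P x0 = 0"
    using dense_root_base[OF irr_formD(1)[OF P] v base open_UNIV UNIV_I irr_formD(4)[OF P]] by blast
  have "clopen_over P \<Omega> UNIV" unfolding clopen_over_def by blast
  from irr_clopen[OF P v base this x0] obtain c where
    c: "c \<noteq> 0" "\<And>x \<tau>. x \<in> \<Omega> \<Longrightarrow> P (x + \<tau> *s v) = c * (\<Prod>y\<in>roots_along P v x. \<tau> - y)" by auto
  have fin: "finite (roots_along P v x)" by (rule finite_roots_along(1)[OF irr_formD(1)[OF P] v])
  have up: "upoly P v x = smult c (\<Prod>y\<in>roots_along P v x. [:- y, 1:])"
    by (rule poly_ext) (simp add: poly_upoly[OF irr_formD(2)[OF P]] c(2)[OF x] poly_prod)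
  have "lead_coeff (upoly P v x) = c" unfolding up lead_coeff_smult by (simp add: lead_coeff_prod)
  then have "c = P v" using upoly_degree(2)[OF irr_formD(1)[OF P] v] by simp
  then show up': "upoly P v x = smult (P v) (\<Prod>y\<in>roots_along P v x. [:- y, 1:])" using up by simp
  assume y: "y \<in> roots_along P v x"
  define g where "g = smult (P v) (\<Prod>r\<in>roots_along P v x - {y}. [:- r, 1:])"
  have "upoly P v x = [:- y, 1:] * g"
    unfolding up' g_def prod.remove[OF fin y] by simp
  then have "pderiv (upoly P v x) = [:- y, 1:] * pderiv g + g * pderiv [:- y, 1:]" by (simp only: pderiv_mult)
  then have "poly (pderiv (upoly P v x)) y = poly g y" by (simp add: pderiv_pCons)
  also have "\<dots> \<noteq> 0" using v fin by (auto simp: g_def poly_prod)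
  finally show "poly (pderiv (upoly P v x)) y \<noteq> 0" .
qed

text \<open>Holomorphy along holomorphic curves is all that is needed of the defining functions of an analytic
  set, and it is stable under composition without any theory of several variables.\<close>

definition curve_holo :: "(complex ^ 'k::finite option) set \<Rightarrow> (complex ^ 'k option \<Rightarrow> complex) \<Rightarrow> bool" where
  "curve_holo U g \<longleftrightarrow> continuous_on U g \<and> (\<forall>\<gamma> S. open S \<and> (\<forall>i. (\<lambda>t. \<gamma> t $ i) holomorphic_on S) \<and> \<gamma> ` S \<subseteq> U \<longrightarrow>
     (\<lambda>t. g (\<gamma> t)) holomorphic_on S)"

lemma curve_holoD:
  assumes "curve_holo U g" "open S" "\<And>i. (\<lambda>t. \<gamma> t $ i) holomorphic_on S" "\<gamma> ` S \<subseteq> U"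
  shows "(\<lambda>t. g (\<gamma> t)) holomorphic_on S"
  using assms unfolding curve_holo_def by blast

definition locally_analytic_at :: "(complex ^ 'k::finite option) set \<Rightarrow> complex ^ 'k option \<Rightarrow> bool" where
  "locally_analytic_at T x \<longleftrightarrow> (\<exists>U G. open U \<and> x \<in> U \<and> finite G \<and> (\<forall>g\<in>G. curve_holo U g) \<and>
     T \<inter> U = {z\<in>U. \<forall>g\<in>G. g z = 0})"

lemma polyfun_holomorphic_curve:
  assumes "polyfun g" "\<And>i. (\<lambda>t. \<gamma> t $ i) holomorphic_on S"
  shows "(\<lambda>t. g (\<gamma> t)) holomorphic_on S"
  using assms(1) by induction (auto intro: holomorphic_intros assms(2))

lemma curve_holo_polyfun: "polyfun g \<Longrightarrow> curve_holo U g"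
  unfolding curve_holo_def using polyfun_continuous polyfun_holomorphic_curve by blast

lemma root_sheet_holomorphic:
  assumes P: "irr_form P d" and v: "P v \<noteq> 0" and base: "root_base P v \<Omega>"
    and sub: "\<And>x. x \<in> B \<Longrightarrow> x \<in> \<Omega>" and B: "open B" and cont: "continuous_on B \<phi>"
    and zero: "\<And>x. x \<in> B \<Longrightarrow> P (x + \<phi> x *s v) = 0"
  shows "(\<lambda>t. \<phi> (a + t *s b)) holomorphic_on {t. a + t *s b \<in> B}"
  unfolding holomorphic_on_def
proof
  note pP = irr_formD(2)[OF P]
  fix t0 assume t0: "t0 \<in> {t. a + t *s b \<in> B}"
  let ?T = "{t. a + t *s b \<in> B}"
  obtain p where p: "\<And>t y. P (a + t *s b + y *s v) = ev2 p t y"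
    using polyfun_plane[OF pP] unfolding ev2_def by blast
  have sp: "spec t p = upoly P v (a + t *s b)" for t
    by (rule poly_ext) (simp add: poly_spec poly_upoly[OF pP] p)
  have T: "open ?T" by (rule open_line[OF B])
  have "(\<lambda>t. \<phi> (a + t *s b)) field_differentiable at t0"
  proof (rule implicit_root_differentiable[of _ _ p])
    have "continuous_on ?T (\<lambda>t. \<phi> (a + t *s b))"
      by (rule continuous_on_compose2[OF cont]) (auto intro!: continuous_intros)
    then show "isCont (\<lambda>t. \<phi> (a + t *s b)) t0" using T t0 continuous_on_eq_continuous_at by blast
    have "\<forall>\<^sub>F t in nhds t0. t \<in> ?T" by (rule eventually_nhds_in_open[OF T t0])
    then show "\<forall>\<^sub>F t in nhds t0. ev2 p t (\<phi> (a + t *s b)) = 0"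
    proof eventually_elim
      case (elim t)
      then show ?case using zero[of "a + t *s b"] p by simp
    qed
    have "\<phi> (a + t0 *s b) \<in> roots_along P v (a + t0 *s b)" using zero t0 by (simp add: roots_along_def)
    then have "poly (pderiv (upoly P v (a + t0 *s b))) (\<phi> (a + t0 *s b)) \<noteq> 0"
      using irr_simple_roots(2)[OF P v base sub] t0 by simp
    then show "ev2 (pderiv p) t0 (\<phi> (a + t0 *s b)) \<noteq> 0"
      by (simp add: sp[symmetric] spec_pderiv[symmetric] poly_spec)
  qed
  then show "(\<lambda>t. \<phi> (a + t *s b)) field_differentiable at t0 within ?T" by (rule field_differentiable_at_within)
qed

lemma convex_line:
  fixes B :: "(complex ^ 'n::finite) set"
  assumes "convex B" shows "convex {t. a + t *s b \<in> B}"
  unfolding convex_def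
proof (intro ballI allI impI)
  fix s t :: complex and u w :: real
  assume st: "s \<in> {t. a + t *s b \<in> B}" "t \<in> {t. a + t *s b \<in> B}" and uw: "0 \<le> u" "0 \<le> w" "u + w = 1"
  have "a + (u *\<^sub>R s + w *\<^sub>R t) *s b = u *\<^sub>R (a + s *s b) + w *\<^sub>R (a + t *s b)"
  proof -
    have w: "w = 1 - u" using uw(3) by simp
    show ?thesis unfolding vec_eq_iff w
      by (simp only: vector_add_component vector_smult_component vector_scaleR_component)
        (simp add: scaleR_conv_of_real algebra_simps)
  qed
  then show "u *\<^sub>R s + w *\<^sub>R t \<in> {t. a + t *s b \<in> B}"
    using assms st uw unfolding convex_def by simp
qed

text \<open>The set of points of \<open>P = 0\<close> near which \<open>T\<close> contains the hypersurface is open and, by the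
  identity theorem on the sheets, closed over the base.\<close>

lemma clopen_of_locally_analytic:
  fixes P :: "complex ^ 'k::finite option \<Rightarrow> complex"
  assumes P: "irr_form P d" and v: "P v \<noteq> 0" and base: "root_base P v \<Omega>"
    and T: "\<And>x. x \<noteq> 0 \<Longrightarrow> P x = 0 \<Longrightarrow> locally_analytic_at T x"
  shows "clopen_over P \<Omega> {z. \<exists>V. open V \<and> z \<in> V \<and> (\<forall>w\<in>V. P w = 0 \<longrightarrow> w \<in> T)}"
  unfolding clopen_over_def
proof (intro ballI impI)
  fix x0 assume x0: "x0 \<in> \<Omega>" "P x0 = 0"
  let ?W = "{z. \<exists>V. open V \<and> z \<in> V \<and> (\<forall>w\<in>V. P w = 0 \<longrightarrow> w \<in> T)}"
  note hP = irr_formD(1)[OF P]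
  have op: "open \<Omega>" and mx: "x0 \<in> maxroots P v" and x00: "x0 \<noteq> 0"
    using base x0 by (auto simp: root_base_def cothin_def)
  show "\<exists>U. open U \<and> x0 \<in> U \<and> ((\<forall>z\<in>U. P z = 0 \<longrightarrow> z \<in> ?W) \<or> (\<forall>z\<in>U. P z = 0 \<longrightarrow> z \<notin> ?W))"
  proof (cases "x0 \<in> ?W")
    case True
    then obtain V where V: "open V" "x0 \<in> V" "\<forall>w\<in>V. P w = 0 \<longrightarrow> w \<in> T" by blast
    then have "\<forall>z\<in>V. P z = 0 \<longrightarrow> z \<in> ?W" by blast
    then show ?thesis using V by blast
  next
    case False
    obtain U G where U: "open U" "x0 \<in> U" "finite G" "\<And>g. g \<in> G \<Longrightarrow> curve_holo U g" "T \<inter> U = {z\<in>U. \<forall>g\<in>G. g z = 0}"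
      using T[OF x00 x0(2)] unfolding locally_analytic_at_def by blast
    have *: "\<And>x. card (roots_along P v x) \<le> card (roots_along P v x0)" using mx by (simp add: maxroots_def)
    obtain \<epsilon> \<rho> \<Phi> where sh: "root_sheets P v x0 \<epsilon> \<rho> \<Phi>" using root_sheets_exist[OF hP v *] by blast
    \<comment> \<open>The sheet through \<open>x0\<close> itself, labelled by the root 0.\<close>
    define \<phi> where "\<phi> = \<Phi> 0"
    have R0: "0 \<in> roots_along P v x0" using x0 by (simp add: roots_along_def)
    have c\<phi>: "continuous_on (ball x0 \<epsilon>) \<phi>" unfolding \<phi>_def by (rule root_sheets.sheet_continuous[OF sh R0])
    have \<phi>0: "\<phi> x0 = 0" unfolding \<phi>_def by (rule root_sheets.sheet_centre[OF sh R0])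
    have zero: "P (x + \<phi> x *s v) = 0" if "x \<in> ball x0 \<epsilon>" for x
      using root_sheets.sheet_root[OF sh R0 that] by (simp add: \<phi>_def)
    have uniq: "\<phi> x = 0" if "x \<in> ball x0 \<epsilon>" "P x = 0" for x
      using root_sheets.sheet_unique[OF sh R0 that(1), of 0] that(2) root_sheets.rho_pos[OF sh] by (simp add: \<phi>_def)
    have "continuous_on (ball x0 \<epsilon>) (\<lambda>x. x + \<phi> x *s v)" by (intro continuous_intros c\<phi>)
    then have "open (ball x0 \<epsilon> \<inter> (\<lambda>x. x + \<phi> x *s v) -` U)" using U(1) by (simp add: continuous_open_preimage)
    then have "open (ball x0 \<epsilon> \<inter> (\<lambda>x. x + \<phi> x *s v) -` U \<inter> \<Omega>)" using op by blast
    moreover have "x0 \<in> ball x0 \<epsilon> \<inter> (\<lambda>x. x + \<phi> x *s v) -` U \<inter> \<Omega>"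
      using root_sheets.eps_pos[OF sh] U(2) \<phi>0 x0(1) by simp
    ultimately obtain \<delta> where \<delta>: "\<delta> > 0" "ball x0 \<delta> \<subseteq> ball x0 \<epsilon> \<inter> (\<lambda>x. x + \<phi> x *s v) -` U \<inter> \<Omega>"
      using open_contains_ball by blast
    let ?B = "ball x0 \<delta>"
    have BU: "x + \<phi> x *s v \<in> U" "x \<in> ball x0 \<epsilon>" "x \<in> \<Omega>" if "x \<in> ?B" for x using \<delta>(2) that by auto
    have "z \<notin> ?W" if z: "z \<in> ?B" "P z = 0" for z
    proof
      assume "z \<in> ?W"
      then obtain V where V: "open V" "z \<in> V" "\<forall>w\<in>V. P w = 0 \<longrightarrow> w \<in> T" by blast
      \<comment> \<open>The part of the line through \<open>z\<close> and \<open>y\<close> inside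
        the ball is convex and is lifted to the sheet. There \<open>g\<close> vanishes near
        \<open>t = 0\<close>, hence also at \<open>t = 1\<close>.\<close>
      have gz: "g (y + \<phi> y *s v) = 0" if g: "g \<in> G" and y: "y \<in> ?B" for g y
      proof -
        let ?S = "{t. z + t *s (y - z) \<in> ?B}"
        let ?\<gamma> = "\<lambda>t. z + t *s (y - z) + \<phi> (z + t *s (y - z)) *s v"
        have S: "open ?S" by (rule open_line) simp
        have S2: "connected ?S" by (intro convex_connected convex_line convex_ball)
        have h\<phi>: "(\<lambda>t. \<phi> (z + t *s (y - z))) holomorphic_on ?S"
          by (rule root_sheet_holomorphic[OF P v base BU(3)]) (use BU(2) zero in \<open>auto intro: continuous_on_subset[OF c\<phi>]\<close>)
        have "(\<lambda>t. ?\<gamma> t $ i) holomorphic_on ?S" for i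
          using h\<phi> by (auto intro!: holomorphic_intros)
        moreover have "?\<gamma> ` ?S \<subseteq> U" using BU(1) by auto
        ultimately have hol: "(\<lambda>t. g (?\<gamma> t)) holomorphic_on ?S"
          by (rule curve_holoD[OF U(4)[OF g] S])
        have "continuous_on ?B (\<lambda>x. x + \<phi> x *s v)"
          by (intro continuous_intros continuous_on_subset[OF c\<phi>]) (use BU(2) in auto)
        then have "open (?B \<inter> (\<lambda>x. x + \<phi> x *s v) -` V)" using V(1) by (simp add: continuous_open_preimage)
        then have S': "open {t. z + t *s (y - z) \<in> ?B \<inter> (\<lambda>x. x + \<phi> x *s v) -` V}" by (rule open_line)
        have "\<phi> z = 0" using uniq BU(2) z by blast
        then have "0 \<in> {t. z + t *s (y - z) \<in> ?B \<inter> (\<lambda>x. x + \<phi> x *s v) -` V}" using z V(2) by simp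
        then have ne: "{t. z + t *s (y - z) \<in> ?B \<inter> (\<lambda>x. x + \<phi> x *s v) -` V} \<noteq> {}" by blast
        have near: "g (?\<gamma> t) = 0" if "t \<in> {t. z + t *s (y - z) \<in> ?B \<inter> (\<lambda>x. x + \<phi> x *s v) -` V}" for t
        proof -
          have "z + t *s (y - z) \<in> ?B" "?\<gamma> t \<in> V" using that by auto
          then have "?\<gamma> t \<in> T" "?\<gamma> t \<in> U" using zero BU V(3) by blast+
          then have "?\<gamma> t \<in> {z\<in>U. \<forall>g\<in>G. g z = 0}" unfolding U(5)[symmetric] by (rule IntI)
          then show ?thesis using g by simp
        qed
        have "1 \<in> ?S" using y by simp
        have "g (?\<gamma> 1) = 0"
          by (rule analytic_continuation_open[OF S' S ne S2 _ hol holomorphic_on_const near \<open>1 \<in> ?S\<close>]) auto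
        then show ?thesis by simp
      qed
      have "w \<in> T" if w: "w \<in> ?B" "P w = 0" for w
      proof -
        have "\<phi> w = 0" using uniq BU(2) w by blast
        then have "w \<in> U" "\<forall>g\<in>G. g w = 0" using BU(1)[OF w(1)] gz[OF _ w(1)] by auto
        then show ?thesis using U(5) by blast
      qed
      then have "x0 \<in> ?W" using \<delta>(1) by (intro CollectI exI[of _ ?B]) auto
      then show False using False by blast
    qed
    then show ?thesis using \<delta>(1) by (intro exI[of _ ?B]) auto
  qed
qed

lemma irr_connected_base:
  fixes P :: "complex ^ 'k::finite option \<Rightarrow> complex"
  assumes P: "irr_form P d" and v: "P v \<noteq> 0" and base: "root_base P v \<Omega>"
    and T: "\<And>x. x \<noteq> 0 \<Longrightarrow> P x = 0 \<Longrightarrow> locally_analytic_at T x"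
    and U: "open U" "z0 \<in> U" "P z0 = 0" "\<And>z. z \<in> U \<Longrightarrow> P z = 0 \<Longrightarrow> z \<in> T"
    and x: "x \<in> \<Omega>" "P x = 0"
  shows "x \<in> T"
proof -
  let ?W = "{z. \<exists>V. open V \<and> z \<in> V \<and> (\<forall>w\<in>V. P w = 0 \<longrightarrow> w \<in> T)}"
  obtain x1 where x1: "x1 \<in> \<Omega>" "x1 \<in> U" "P x1 = 0"
    using dense_root_base[OF irr_formD(1)[OF P] v base U(1-3)] by blast
  have x1W: "x1 \<in> ?W" using x1 U by blast
  have "x \<in> ?W"
    by (rule irr_clopen_everything[OF P v base clopen_of_locally_analytic[OF P v base T] x1(1,3) x1W x])
  then show ?thesis using x(2) by blast
qed

text \<open>Points outside the base are limits of points of \<open>P = 0\<close> over it, and the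
  local equations of \<open>T\<close> are continuous.\<close>

lemma irr_connected:
  fixes P :: "complex ^ 'k::finite option \<Rightarrow> complex"
  assumes P: "irr_form P d"
    and T: "\<And>x. x \<noteq> 0 \<Longrightarrow> P x = 0 \<Longrightarrow> locally_analytic_at T x"
    and U: "open U" "z0 \<in> U" "P z0 = 0" "\<And>z. z \<in> U \<Longrightarrow> P z = 0 \<Longrightarrow> z \<in> T"
    and x: "x \<noteq> 0" "P x = 0"
  shows "x \<in> T"
proof -
  obtain v where v: "P v \<noteq> 0" using P unfolding irr_form_def by blast
  obtain \<Omega> where base: "root_base P v \<Omega>" using root_base_exists[OF irr_formD(1)[OF P] v irr_formD(3)[OF P]] by blast
  obtain U' G where U': "open U'" "x \<in> U'" "finite G" "\<And>g. g \<in> G \<Longrightarrow> curve_holo U' g" "T \<inter> U' = {z\<in>U'. \<forall>g\<in>G. g z = 0}"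
    using T[OF x] unfolding locally_analytic_at_def by blast
  have "g x = 0" if g: "g \<in> G" for g
  proof (rule ccontr)
    assume gx: "g x \<noteq> 0"
    have "continuous_on U' g" using U'(4)[OF g] by (simp add: curve_holo_def)
    then have "open (U' \<inter> g -` (- {0}))" using U'(1) by (intro continuous_open_preimage) auto
    moreover have "x \<in> U' \<inter> g -` (- {0})" using U'(2) gx by simp
    ultimately obtain y where y: "y \<in> \<Omega>" "y \<in> U' \<inter> g -` (- {0})" "P y = 0"
      using dense_root_base[OF irr_formD(1)[OF P] v base _ _ x(2)] by blast
    have "y \<in> T" by (rule irr_connected_base[OF P v base T U y(1,3)])
    then show False using y(2) U'(5) g by blast
  qed
  then show ?thesis using U'(2,5) by blast
qed

text \<open>A local Nullstellensatz: vanishing on one open piece of \<open>P = 0\<close> suffices.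
  It spreads by connectedness, simple roots give divisibility on every line in the direction
  \<open>v\<close> over the base, and \<open>polyfun_divides\<close> assembles the
  quotients.\<close>

lemma irr_dvd_of_vanishing:
  fixes P :: "complex ^ 'k::finite option \<Rightarrow> complex"
  assumes P: "irr_form P d" and R: "polyfun R"
    and U: "open U" "z0 \<in> U" "P z0 = 0" "\<And>z. z \<in> U \<Longrightarrow> P z = 0 \<Longrightarrow> R z = 0"
  shows "pdvd P R"
proof -
  note hP = irr_formD(1)[OF P] and pP = irr_formD(2)[OF P]
  obtain v where v: "P v \<noteq> 0" using P unfolding irr_form_def by blast
  obtain \<Omega> where base: "root_base P v \<Omega>" using root_base_exists[OF hP v irr_formD(3)[OF P]] by blast
  have \<Omega>: "cothin \<Omega>" and shift: "\<And>x \<tau>. x \<in> \<Omega> \<Longrightarrow> x + \<tau> *s v \<in> \<Omega>" using base by (auto simp: root_base_def)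
  have T: "locally_analytic_at {z. R z = 0} x" for x
    unfolding locally_analytic_at_def
    by (rule exI[of _ UNIV], rule exI[of _ "{R}"]) (auto intro: curve_holo_polyfun R)
  have van: "R x = 0" if "x \<in> \<Omega>" "P x = 0" for x
    using irr_connected_base[OF P v base T U(1-3) _ that] U(4) by blast
  obtain K where K: "K \<ge> 0" and Kb: "\<And>x y. P (x + y *s v) = 0 \<Longrightarrow> norm y \<le> K * norm x" using root_bound[OF hP v] by blast
  have K1: "K + 1 > 0" using K by simp
  have low: "norm (P v) \<le> norm (P (x + y *s v))" if "x \<in> \<Omega>" and y: "norm y = (K + 1) * (1 + norm x)" for x y
  proof -
    have "1 \<le> norm (y - r)" if "r \<in> roots_along P v x" for r
    proof -
      have "norm r \<le> K * norm x" using that Kb by (auto simp: roots_along_def)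
      moreover have "norm y \<le> norm (y - r) + norm r" using norm_triangle_sub[of y r] by simp
      moreover have "norm y = 1 + K + norm x + K * norm x" using y by (simp add: algebra_simps)
      ultimately show ?thesis using K norm_ge_zero[of x] by linarith
    qed
    from norm_lower_bound[OF hP v zero_le_one this] show ?thesis by simp
  qed
  have v': "norm (P v) > 0" using v by simp
  show ?thesis
  proof (rule polyfun_divides[OF \<Omega> pP v R v' K1 low])
    fix x assume x: "x \<in> \<Omega>"
    have "(\<Prod>y\<in>roots_along P v x. [:- y, 1:]) dvd upoly R v x"
    proof (rule prod_roots_dvd[OF finite_roots_along(1)[OF hP v]])
      fix y assume "y \<in> roots_along P v x"
      then have "R (x + y *s v) = 0" using van[OF shift[OF x]] by (simp add: roots_along_def)
      then show "poly (upoly R v x) y = 0" by (simp add: poly_upoly[OF R])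
    qed
    then have "upoly P v x dvd upoly R v x" using irr_simple_roots(1)[OF P v base x] v by (simp add: smult_dvd_iff)
    then obtain h where h: "upoly R v x = upoly P v x * h" by (rule dvdE)
    have "R (x + y *s v) = poly h y * P (x + y *s v)" for y
      using arg_cong[OF h, of "\<lambda>p. poly p y"] by (simp add: poly_upoly[OF R] poly_upoly[OF pP])
    then show "\<exists>h. \<forall>y. R (x + y *s v) = poly h y * P (x + y *s v)" by blast
  qed
qed

section \<open>Unique factorization\<close>

lemma pdvd_mult: "polyfun B \<Longrightarrow> pdvd P A \<Longrightarrow> pdvd P (\<lambda>z. B z * A z)"
  unfolding pdvd_def by (elim exE conjE, rule_tac x = "\<lambda>z. B z * Aa z" in exI) (auto intro: polyfun_mult)

lemma pdvd_mult2: "polyfun B \<Longrightarrow> pdvd P A \<Longrightarrow> pdvd P (\<lambda>z. A z * B z)"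
  using pdvd_mult[of B P A] by (simp add: mult.commute)

lemma pdvd_trans: "pdvd P A \<Longrightarrow> pdvd A B \<Longrightarrow> pdvd P B"
  unfolding pdvd_def by (elim exE conjE, rule_tac x = "\<lambda>z. Aaa z * Aa z" in exI) (auto intro: polyfun_mult)

lemma pdvd_refl: "pdvd P P"
  unfolding pdvd_def by (rule exI[of _ "\<lambda>z. 1"]) (auto intro: polyfun_const)

lemma pdvd_zero: "pdvd P (\<lambda>z. 0)"
  unfolding pdvd_def by (rule exI[of _ "\<lambda>z. 0"]) (auto intro: polyfun_const)

lemma pdvdD: "pdvd P R \<Longrightarrow> P z = 0 \<Longrightarrow> R z = 0"
  unfolding pdvd_def by auto

text \<open>If \<open>A\<close> is non-zero at some point of \<open>P = 0\<close>, then
  \<open>B\<close> vanishes on \<open>P = 0\<close> near it, and the local Nullstellensatz applies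
  to \<open>B\<close>.\<close>

lemma irr_prime:
  assumes P: "irr_form P d" and A: "polyfun A" and B: "polyfun B" and dvd: "pdvd P (\<lambda>z. A z * B z)"
  shows "pdvd P A \<or> pdvd P B"
proof (cases "\<forall>z. P z = 0 \<longrightarrow> A z = 0")
  case True
  then show ?thesis
    using irr_dvd_of_vanishing[OF P A open_UNIV UNIV_I irr_formD(4)[OF P]] by blast
next
  case False
  then obtain z0 where z0: "P z0 = 0" "A z0 \<noteq> 0" by blast
  have "B z = 0" if "z \<in> {z. A z \<noteq> 0}" "P z = 0" for z
    using pdvdD[OF dvd that(2)] that(1) by simp
  then have "pdvd P B"
    using irr_dvd_of_vanishing[OF P B open_polyfun_nonzero[OF A], of z0] z0 by blast
  then show ?thesis ..
qed

lemma irr_prime_power: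
  assumes P: "irr_form P d" and A: "polyfun A" and dvd: "pdvd P (\<lambda>z. A z ^ n)" and n: "n \<ge> 1"
  shows "pdvd P A"
  using dvd n
proof (induction n)
  case (Suc n)
  have "pdvd P A \<or> pdvd P (\<lambda>z. A z ^ n)"
    using irr_prime[OF P A polyfun_power[OF A], of n] Suc.prems(1) by simp
  then show ?case
  proof
    assume *: "pdvd P (\<lambda>z. A z ^ n)"
    show ?thesis
    proof (cases "n = 0")
      case True
      then have "(1::complex) = 0" using pdvdD[OF * irr_formD(4)[OF P]] by simp
      then show ?thesis by simp
    qed (use Suc.IH * in simp)
  qed
qed simp

lemma polyfun_cancel:
  assumes G: "polyfun G" "G z0 \<noteq> 0" and A: "polyfun A" and B: "polyfun B"
    and eq: "\<And>z. G z * A z = G z * B z"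
  shows "A = B"
  by (rule cothin_polyfun_eq[OF cothin_polyfun_nonzero[OF G] A B]) (use eq in auto)

lemma hom_fun_cofactor_irr:
  assumes R: "hom_fun d R" "R z0 \<noteq> 0" and P: "irr_form P e" and dvd: "pdvd P R"
  obtains A where "hom_fun (d - e) A" "R = (\<lambda>z. A z * P z)" "e \<le> d"
proof -
  obtain A a b where A: "hom_fun a A" "hom_fun b P" "R = (\<lambda>z. A z * P z)"
    using hom_fun_cofactor[OF R irr_formD(2)[OF P] dvd] by blast
  have "P z0 \<noteq> 0" using R(2) A(3) by auto
  then have "b = e" using hom_fun_degree_unique[OF A(2) irr_formD(1)[OF P]] by blast
  moreover have "hom_fun (a + b) R" using hom_fun_mult[OF A(1,2)] by (simp add: A(3))
  then have "a + b = d" using hom_fun_degree_unique[OF _ R(1) R(2)] by blast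
  ultimately show ?thesis using that[of A] A by auto
qed

text \<open>Descent to an irreducible factor for any property that behaves like membership in a
  prime ideal. It is applied to vanishing at a point, on an irreducible set, on some open piece of a
  set, and to divisibility after composition with an iterate.\<close>

lemma irr_factor_with:
  assumes const: "\<And>c. \<Phi> (\<lambda>z. c) \<Longrightarrow> c = 0"
    and prime: "\<And>A B a b. hom_fun a A \<Longrightarrow> hom_fun b B \<Longrightarrow> \<Phi> (\<lambda>z. A z * B z) \<Longrightarrow> \<Phi> A \<or> \<Phi> B"
  shows "hom_fun d R \<Longrightarrow> R z0 \<noteq> 0 \<Longrightarrow> \<Phi> R \<Longrightarrow> \<exists>P e. irr_form P e \<and> pdvd P R \<and> \<Phi> P"
proof (induction d arbitrary: R rule: less_induct)
  case (less d)
  show ?case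
  proof (cases "irr_form R d")
    case True
    then show ?thesis using pdvd_refl less.prems(3) by blast
  next
    case False
    have "d \<noteq> 0"
    proof
      assume "d = 0"
      then have "R z = R z0" for z using hom_fun_0 less.prems(1) by metis
      then have eq: "R = (\<lambda>z. R z0)" by (rule ext)
      have "\<Phi> (\<lambda>z. R z0)" by (rule subst[where P = \<Phi>, OF eq less.prems(3)])
      then show False using const less.prems(2) by blast
    qed
    then have "d \<ge> 1" by simp
    then obtain A B a b where AB: "hom_fun a A" "hom_fun b B" "R = (\<lambda>z. A z * B z)" "a \<noteq> 0" "b \<noteq> 0"
      using False less.prems(1,2) unfolding irr_form_def by blast
    have "hom_fun (a + b) R" using hom_fun_mult[OF AB(1,2)] by (simp add: AB(3))
    then have "a + b = d" using hom_fun_degree_unique less.prems(1,2) by blast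
    then have lt: "a < d" "b < d" using AB(4,5) by auto
    have nz: "A z0 \<noteq> 0" "B z0 \<noteq> 0" using less.prems(2) by (auto simp: AB(3))
    have "\<Phi> A \<or> \<Phi> B" by (rule prime[OF AB(1,2) less.prems(3)[unfolded AB(3)]])
    then show ?thesis
      using less.IH[OF lt(1) AB(1) nz(1)] less.IH[OF lt(2) AB(2) nz(2)]
        pdvd_mult2[OF hom_funD(1)[OF AB(2)]] pdvd_mult[OF hom_funD(1)[OF AB(1)]] unfolding AB(3) by blast
  qed
qed

lemma hom_fun_zero_factor:
  assumes "hom_fun d R" "R w0 \<noteq> 0" "R z = 0"
  shows "\<exists>P e. irr_form P e \<and> pdvd P R \<and> P z = 0"
  by (rule irr_factor_with[where \<Phi> = "\<lambda>R. R z = 0", OF _ _ assms]) auto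

lemma irr_factor_exists:
  assumes "hom_fun d R" "R z0 \<noteq> 0" "d \<ge> 1"
  shows "\<exists>P e. irr_form P e \<and> pdvd P R"
  using hom_fun_zero_factor[OF assms(1,2) hom_fun_at_0[OF assms(1,3)]] by blast

lemma remove_common_factor:
  assumes "hom_fun a A" "A z0 \<noteq> 0" "hom_fun b B" "B w0 \<noteq> 0"
  shows "\<exists>G A1 B1 g a1 b1. hom_fun g G \<and> hom_fun a1 A1 \<and> hom_fun b1 B1 \<and>
    A = (\<lambda>z. A1 z * G z) \<and> B = (\<lambda>z. B1 z * G z) \<and> (\<forall>P d. irr_form P d \<longrightarrow> \<not> (pdvd P A1 \<and> pdvd P B1))"
  using assms
proof (induction a arbitrary: A B b rule: less_induct)
  case (less a)
  show ?case
  proof (cases "\<forall>P d. irr_form P d \<longrightarrow> \<not> (pdvd P A \<and> pdvd P B)")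
    case True
    have "hom_fun 0 (\<lambda>z. 1)" by (simp add: hom_fun_def polyfun_const)
    then show ?thesis using True less.prems
      by (intro exI[of _ "\<lambda>z. 1"] exI[of _ A] exI[of _ B] exI[of _ 0] exI[of _ a] exI[of _ b]) auto
  next
    case False
    then obtain P d where P: "irr_form P d" "pdvd P A" "pdvd P B" by blast
    obtain A' where A': "hom_fun (a - d) A'" "A = (\<lambda>z. A' z * P z)" "d \<le> a"
      using hom_fun_cofactor_irr[OF less.prems(1,2) P(1,2)] by blast
    obtain B' where B': "hom_fun (b - d) B'" "B = (\<lambda>z. B' z * P z)"
      using hom_fun_cofactor_irr[OF less.prems(3,4) P(1,3)] by blast
    have "a - d < a" using irr_formD(3)[OF P(1)] A'(3) by simp
    moreover have "A' z0 \<noteq> 0" "B' w0 \<noteq> 0" using A' B' less.prems by auto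
    ultimately obtain G A1 B1 g a1 b1 where *: "hom_fun g G" "hom_fun a1 A1" "hom_fun b1 B1"
      "A' = (\<lambda>z. A1 z * G z)" "B' = (\<lambda>z. B1 z * G z)" "\<forall>P d. irr_form P d \<longrightarrow> \<not> (pdvd P A1 \<and> pdvd P B1)"
      using less.IH[OF _ A'(1) _ B'(1)] by blast
    have "A = (\<lambda>z. A1 z * (G z * P z))" "B = (\<lambda>z. B1 z * (G z * P z))"
      by (simp_all add: A'(2) B'(2) *(4,5) mult.assoc)
    then show ?thesis using *(2,3,6) hom_fun_mult[OF *(1) irr_formD(1)[OF P(1)]] by blast
  qed
qed

text \<open>The hypothesis says that \<open>A\<close> and \<open>B\<close> have the same order along
  every irreducible form dividing one of them. Once the common factor is removed, an irreducible
  divisor of one remaining factor would divide the other, so both are constant.\<close>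

lemma degree_eq_of_local_quotients:
  assumes A: "hom_fun a A" "A z0 \<noteq> 0" and B: "hom_fun b B" "B w0 \<noteq> 0"
    and loc: "\<And>P d. irr_form P d \<Longrightarrow> pdvd P A \<or> pdvd P B \<Longrightarrow>
      \<exists>C C'. polyfun C \<and> polyfun C' \<and> \<not> pdvd P C \<and> \<not> pdvd P C' \<and> (\<forall>z. C z * A z = C' z * B z)"
  shows "a = b"
proof -
  obtain G A1 B1 g a1 b1 where G: "hom_fun g G" and A1: "hom_fun a1 A1" and B1: "hom_fun b1 B1"
    and eqA: "A = (\<lambda>z. A1 z * G z)" and eqB: "B = (\<lambda>z. B1 z * G z)"
    and co: "\<And>P d. irr_form P d \<Longrightarrow> \<not> (pdvd P A1 \<and> pdvd P B1)"
    using remove_common_factor[OF A B] by blast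
  have nz: "A1 z0 \<noteq> 0" "G z0 \<noteq> 0" "B1 w0 \<noteq> 0" "G w0 \<noteq> 0" using A(2) B(2) by (auto simp: eqA eqB)
  have red: "\<exists>C C'. polyfun C \<and> polyfun C' \<and> \<not> pdvd P C \<and> \<not> pdvd P C' \<and> (\<lambda>z. C z * A1 z) = (\<lambda>z. C' z * B1 z)"
    if P: "irr_form P d" "pdvd P A1 \<or> pdvd P B1" for P d
  proof -
    have "pdvd P A \<or> pdvd P B"
      unfolding eqA eqB using P(2) pdvd_mult2[OF hom_funD(1)[OF G]] by blast
    from loc[OF P(1) this] obtain C C' where C: "polyfun C" "polyfun C'" "\<not> pdvd P C" "\<not> pdvd P C'"
      and eq: "\<And>z. C z * A z = C' z * B z" by blast
    have "(\<lambda>z. C z * A1 z) = (\<lambda>z. C' z * B1 z)"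
    proof (rule polyfun_cancel[OF hom_funD(1)[OF G] nz(2)])
      fix z show "G z * (C z * A1 z) = G z * (C' z * B1 z)" using eq[of z] by (simp add: eqA eqB mult_ac)
    qed (intro polyfun_mult C hom_funD(1)[OF A1] hom_funD(1)[OF B1])+
    then show ?thesis using C by blast
  qed
  have "a1 = 0"
  proof (rule ccontr)
    assume "a1 \<noteq> 0"
    then obtain P d where P: "irr_form P d" "pdvd P A1" using irr_factor_exists[OF A1 nz(1)] by auto
    then obtain C C' where C: "polyfun C" "polyfun C'" "\<not> pdvd P C" "\<not> pdvd P C'" "(\<lambda>z. C z * A1 z) = (\<lambda>z. C' z * B1 z)"
      using red by blast
    have "pdvd P (\<lambda>z. C' z * B1 z)" unfolding C(5)[symmetric] by (rule pdvd_mult[OF C(1) P(2)])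
    then show False using irr_prime[OF P(1) C(2) hom_funD(1)[OF B1]] C(4) co[OF P(1)] P(2) by blast
  qed
  moreover have "b1 = 0"
  proof (rule ccontr)
    assume "b1 \<noteq> 0"
    then obtain P d where P: "irr_form P d" "pdvd P B1" using irr_factor_exists[OF B1 nz(3)] by auto
    then obtain C C' where C: "polyfun C" "polyfun C'" "\<not> pdvd P C" "\<not> pdvd P C'" "(\<lambda>z. C z * A1 z) = (\<lambda>z. C' z * B1 z)"
      using red by blast
    have "pdvd P (\<lambda>z. C z * A1 z)" unfolding C(5) by (rule pdvd_mult[OF C(2) P(2)])
    then show False using irr_prime[OF P(1) C(1) hom_funD(1)[OF A1]] C(3) co[OF P(1)] P(2) by blast
  qed
  moreover have "hom_fun (a1 + g) A" "hom_fun (b1 + g) B"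
    using hom_fun_mult[OF A1 G] hom_fun_mult[OF B1 G] by (simp_all add: eqA eqB)
  then have "a1 + g = a" "b1 + g = b" using hom_fun_degree_unique A B by blast+
  ultimately show ?thesis by simp
qed

section \<open>Reduced forms\<close>

definition hom_map :: "nat \<Rightarrow> (complex ^ 'k::finite option \<Rightarrow> complex ^ 'k option) \<Rightarrow> bool" where
  "hom_map d E \<longleftrightarrow> (\<forall>j. hom_fun d (\<lambda>z. E z $ j))"

definition red_form :: "(complex ^ 'k::finite option \<Rightarrow> complex ^ 'k option) \<Rightarrow> nat \<Rightarrow> bool" where
  "red_form E d \<longleftrightarrow> hom_map d E \<and> (\<exists>z. E z \<noteq> 0) \<and>
     (\<forall>P e. irr_form P e \<longrightarrow> (\<exists>j. \<not> pdvd P (\<lambda>z. E z $ j)))"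

lemma hom_mapD: "hom_map d E \<Longrightarrow> hom_fun d (\<lambda>z. E z $ j)" "hom_map d E \<Longrightarrow> polyfun (\<lambda>z. E z $ j)"
  by (auto simp: hom_map_def hom_fun_def)

lemma hom_map_scale: "hom_map d E \<Longrightarrow> E (c *s z) = c ^ d *s E z"
  using hom_funD(2) by (fastforce simp: hom_map_def vec_eq_iff)

lemma hom_map_compose: "hom_map a A \<Longrightarrow> hom_map b B \<Longrightarrow> hom_map (b * a) (\<lambda>z. A (B z))"
  unfolding hom_map_def using hom_fun_compose by blast

lemma hom_map_smult: "hom_fun c C \<Longrightarrow> hom_map d E \<Longrightarrow> hom_map (c + d) (\<lambda>z. C z *s E z)"
  unfolding hom_map_def using hom_fun_mult[of c C d] by simp

lemma hom_map_continuous: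
  assumes "hom_map d E" shows "continuous_on S E"
proof -
  have "continuous_on S (\<lambda>z. \<chi> j. E z $ j)"
    by (intro continuous_on_vec_lambda polyfun_continuous hom_mapD(2)[OF assms])
  then show ?thesis by simp
qed

lemma red_formD: "red_form E d \<Longrightarrow> hom_map d E" "red_form E d \<Longrightarrow> \<exists>z. E z \<noteq> 0"
  "red_form E d \<Longrightarrow> irr_form P e \<Longrightarrow> \<exists>j. \<not> pdvd P (\<lambda>z. E z $ j)"
  by (auto simp: red_form_def)

text \<open>The cross products say that \<open>E\<close> and \<open>F\<close> define the same map.
  Removing the common factor in one coordinate gives \<open>A F = B E\<close> with coprime
  \<open>A\<close> and \<open>B\<close>; an irreducible factor of \<open>A\<close> would divide all
  coordinates of the reduced \<open>E\<close>, so \<open>A\<close> is constant.\<close>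

lemma proportional_form:
  assumes E: "red_form E d" and F: "hom_map e F" "F z0 \<noteq> 0"
    and cross: "\<And>z i j. F z $ i * E z $ j = F z $ j * E z $ i"
  shows "\<exists>C c. hom_fun c C \<and> F = (\<lambda>z. C z *s E z) \<and> e = c + d"
proof -
  note hE = red_formD(1)[OF E]
  obtain w0 where "E w0 \<noteq> 0" using red_formD(2)[OF E] by blast
  then obtain l where l: "E w0 $ l \<noteq> 0" by (auto simp: vec_eq_iff)
  have "\<exists>z. F z $ l \<noteq> 0"
  proof (rule ccontr)
    assume "\<not> ?thesis"
    then have *: "F z $ j * E z $ l = 0" for z j using cross[of z j l] by simp
    obtain j where j: "F z0 $ j \<noteq> 0" using F(2) by (auto simp: vec_eq_iff)
    show False
      using polyfun_zero_divisors[OF hom_mapD(2)[OF F(1)] hom_mapD(2)[OF hE] j l] * by auto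
  qed
  then obtain u0 where u0: "F u0 $ l \<noteq> 0" by blast
  obtain G A B g a b where G: "hom_fun g G" and A: "hom_fun a A" and B: "hom_fun b B"
    and eqA: "(\<lambda>z. E z $ l) = (\<lambda>z. A z * G z)" and eqB: "(\<lambda>z. F z $ l) = (\<lambda>z. B z * G z)"
    and co: "\<And>P d. irr_form P d \<Longrightarrow> \<not> (pdvd P A \<and> pdvd P B)"
    using remove_common_factor[OF hom_mapD(1)[OF hE] l hom_mapD(1)[OF F(1)] u0] by blast
  have eqA': "E z $ l = A z * G z" and eqB': "F z $ l = B z * G z" for z using eqA eqB by metis+
  have nz: "A w0 \<noteq> 0" "G w0 \<noteq> 0" using l eqA' by auto
  have AB: "(\<lambda>z. A z * F z $ j) = (\<lambda>z. B z * E z $ j)" for j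
  proof (rule polyfun_cancel[OF hom_funD(1)[OF G] nz(2)])
    fix z show "G z * (A z * F z $ j) = G z * (B z * E z $ j)"
      using cross[of z j l] by (simp add: eqA' eqB' mult_ac)
  qed (intro polyfun_mult hom_funD(1)[OF A] hom_funD(1)[OF B] hom_mapD(2)[OF F(1)] hom_mapD(2)[OF hE])+
  have "a = 0"
  proof (rule ccontr)
    assume "a \<noteq> 0"
    then obtain P p where P: "irr_form P p" "pdvd P A" using irr_factor_exists[OF A nz(1)] by auto
    have "pdvd P (\<lambda>z. E z $ j)" for j
    proof -
      have "pdvd P (\<lambda>z. B z * E z $ j)" unfolding AB[symmetric] by (rule pdvd_mult2[OF hom_mapD(2)[OF F(1)] P(2)])
      then show ?thesis using irr_prime[OF P(1) hom_funD(1)[OF B] hom_mapD(2)[OF hE]] co[OF P(1)] P(2) by blast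
    qed
    then show False using red_formD(3)[OF E P(1)] by blast
  qed
  then have A0: "A z = A 0" for z using hom_fun_0 A by blast
  then have c: "A 0 \<noteq> 0" using nz(1) by metis
  define C where "C z = inverse (A 0) * B z" for z
  have "hom_fun 0 (\<lambda>z. inverse (A 0))" by (simp add: hom_fun_def polyfun_const)
  from hom_fun_mult[OF this B] have C: "hom_fun b C" by (simp add: C_def[abs_def])
  have "F z $ j = C z * E z $ j" for z j
    using fun_cong[OF AB[of j], of z] c A0[of z] by (simp add: C_def field_simps)
  then have eq: "F z = C z *s E z" for z by (simp add: vec_eq_iff)
  then have FCE: "F = (\<lambda>z. C z *s E z)" by blast
  have "hom_fun (b + d) (\<lambda>z. F z $ l)" using hom_mapD(1)[OF hom_map_smult[OF C hE]] by (simp add: FCE)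
  then have "b + d = e" using hom_fun_degree_unique[OF _ hom_mapD(1)[OF F(1)] u0] by blast
  then show ?thesis using C FCE by blast
qed

lemma reduce_form:
  assumes "hom_map e F" "F z0 \<noteq> 0"
  shows "\<exists>C c E d. hom_fun c C \<and> red_form E d \<and> F = (\<lambda>z. C z *s E z) \<and> e = c + d"
  using assms
proof (induction e arbitrary: F rule: less_induct)
  case (less e)
  show ?case
  proof (cases "\<forall>P p. irr_form P p \<longrightarrow> (\<exists>j. \<not> pdvd P (\<lambda>z. F z $ j))")
    case True
    then have "red_form F e" using less.prems by (auto simp: red_form_def)
    moreover have "hom_fun 0 (\<lambda>z. 1)" by (simp add: hom_fun_def polyfun_const)
    ultimately show ?thesis by (intro exI[of _ "\<lambda>z. 1"] exI[of _ 0] exI[of _ F] exI[of _ e]) simp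
  next
    case False
    then obtain P p where P: "irr_form P p" "\<And>j. pdvd P (\<lambda>z. F z $ j)" by blast
    have ex: "\<exists>A. hom_fun (e - p) A \<and> (\<lambda>z. F z $ j) = (\<lambda>z. A z * P z)" for j
    proof (cases "\<exists>z. F z $ j \<noteq> 0")
      case True
      then obtain z where "F z $ j \<noteq> 0" by blast
      then show ?thesis using hom_fun_cofactor_irr[OF hom_mapD(1)[OF less.prems(1)] _ P(1) P(2)] by metis
    next
      case False
      have "hom_fun (e - p) (\<lambda>z. 0)" by (simp add: hom_fun_def polyfun_const)
      then show ?thesis using False by (intro exI[of _ "\<lambda>z. 0"]) auto
    qed
    then obtain A where A: "\<And>j. hom_fun (e - p) (A j)" "\<And>j. (\<lambda>z. F z $ j) = (\<lambda>z. A j z * P z)" by metis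
    define F' where "F' z = (\<chi> j. A j z)" for z
    have hF': "hom_map (e - p) F'" using A(1) by (simp add: hom_map_def F'_def)
    have "F z $ j = A j z * P z" for z j using fun_cong[OF A(2)[of j], of z] .
    then have FF': "F z = P z *s F' z" for z by (simp add: vec_eq_iff F'_def mult.commute)
    have F'z: "F' z0 \<noteq> 0" using FF'[of z0] less.prems(2) by auto
    obtain j where j: "F z0 $ j \<noteq> 0" using less.prems(2) by (auto simp: vec_eq_iff)
    have pe: "p \<le> e" using hom_fun_cofactor_irr[OF hom_mapD(1)[OF less.prems(1)] j P(1) P(2)] by blast
    then have "e - p < e" using irr_formD(3)[OF P(1)] by simp
    from less.IH[OF this hF' F'z] obtain C c E d where
      *: "hom_fun c C" "red_form E d" "F' = (\<lambda>z. C z *s E z)" "e - p = c + d" by blast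
    have "F = (\<lambda>z. (P z * C z) *s E z)" using FF' *(3) by (auto simp: vector_smult_assoc)
    moreover have "hom_fun (p + c) (\<lambda>z. P z * C z)" by (rule hom_fun_mult[OF irr_formD(1)[OF P(1)] *(1)])
    moreover have "e = (p + c) + d" using *(4) pe by simp
    ultimately show ?thesis using *(2) by blast
  qed
qed

lemma reduced_form_imp_red_form:
  fixes F :: "'k::finite option \<Rightarrow> 'k hpoly"
  assumes "reduced_form F d" shows "red_form (eval_form F) d"
proof -
  have h: "hom_map d (eval_form F)"
    using assms by (simp add: reduced_form_def hom_map_def eval_form_def hom_fun_homogeneous)
  have no: False if G: "\<And>j. polyfun G" "\<And>j. pdvd G (hpoly_eval (F j))" "G 0 = 0" for G
  proof -
    obtain g where g: "G = hpoly_eval g" using polyfun_imp_hpoly_eval G(1) by blast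
    have "g dvd F j" for j
    proof -
      obtain A where A: "polyfun A" "hpoly_eval (F j) = (\<lambda>z. A z * G z)" using G(2) unfolding pdvd_def by blast
      obtain a where a: "A = hpoly_eval a" using polyfun_imp_hpoly_eval A(1) by blast
      have "hpoly_eval (F j) = hpoly_eval (g * a)"
        unfolding A(2) by (rule ext) (simp add: hpoly_eval_mult a g mult.commute)
      then show ?thesis unfolding hpoly_eval_inj by simp
    qed
    then have "g dvd 1" using assms by (simp add: reduced_form_def)
    then obtain b where b: "1 = g * b" by (rule dvdE)
    have "hpoly_eval (1 :: 'k hpoly) 0 = G 0 * hpoly_eval b 0"
      using arg_cong[OF b, of "\<lambda>p. hpoly_eval p 0"] by (simp only: hpoly_eval_mult g)
    moreover have "hpoly_eval (1 :: 'k hpoly) 0 = 1"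
      using hpoly_eval_single[of 0 1 "0 :: complex ^ 'k option"] by simp
    ultimately show False using G(3) by simp
  qed
  have "\<exists>z. eval_form F z \<noteq> 0"
  proof (rule ccontr)
    assume "\<not> ?thesis"
    then have "hpoly_eval (F j) = (\<lambda>z. 0)" for j by (auto simp: eval_form_def vec_eq_iff)
    \<comment> \<open>The zero form would have a coordinate function as a common factor.\<close>
    then show False using no[of "\<lambda>z. z $ undefined"] pdvd_zero polyfun_coord by fastforce
  qed
  moreover have "\<exists>j. \<not> pdvd P (\<lambda>z. eval_form F z $ j)" if "irr_form P e" for P e
    using no[of P] irr_formD[OF that] by (auto simp: eval_form_def)
  ultimately show ?thesis using h unfolding red_form_def by blast
qed

lemma red_form_imp_reduced_form:
  fixes E :: "complex ^ 'k::finite option \<Rightarrow> complex ^ 'k option"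
  assumes E: "red_form E d" shows "\<exists>F. reduced_form F d \<and> eval_form F = E"
proof -
  have "\<exists>P. (\<lambda>z. E z $ j) = hpoly_eval P \<and> homogeneous_of_degree P d" for j
    using hom_fun_imp_homogeneous[OF hom_mapD(1)[OF red_formD(1)[OF E]]] by metis
  then obtain F where F: "\<And>j. (\<lambda>z. E z $ j) = hpoly_eval (F j)" "\<And>j. homogeneous_of_degree (F j) d" by metis
  have eF: "eval_form F = E"
    by (rule ext) (simp add: eval_form_def vec_eq_iff F(1)[symmetric])
  obtain z0 j where j: "E z0 $ j \<noteq> 0" using red_formD(2)[OF E] by (auto simp: vec_eq_iff)
  have "G dvd 1" if G: "\<And>j. G dvd F j" for G
  proof -
    obtain A where A: "\<And>j. F j = G * A j" using G unfolding dvd_def by metis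
    have eq: "(\<lambda>z. E z $ i) = (\<lambda>z. hpoly_eval G z * hpoly_eval (A i) z)" for i
      unfolding F(1) A by (rule ext) (simp add: hpoly_eval_mult)
    obtain e where e: "hom_fun e (hpoly_eval G)"
      using hom_fun_factor[OF hom_mapD(1)[OF red_formD(1)[OF E]] j polyfun_hpoly_eval polyfun_hpoly_eval eq] by blast
    have Gz: "hpoly_eval G z0 \<noteq> 0" using fun_cong[OF eq[of j], of z0] j by auto
    have "e = 0"
    proof (rule ccontr)
      assume "e \<noteq> 0"
      then obtain P p where P: "irr_form P p" "pdvd P (hpoly_eval G)" using irr_factor_exists[OF e Gz] by auto
      have "pdvd P (\<lambda>z. E z $ i)" for i unfolding eq by (rule pdvd_mult2[OF polyfun_hpoly_eval P(2)])
      then show False using red_formD(3)[OF E P(1)] by blast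
    qed
    then have "hpoly_eval G z = hpoly_eval G 0" for z using hom_fun_0 e by blast
    then have c: "hpoly_eval G z = hpoly_eval G z0" for z by metis
    have "hpoly_eval (G * Poly_Mapping.single 0 (inverse (hpoly_eval G z0))) = hpoly_eval 1"
    proof (rule ext)
      fix z :: "complex ^ 'k option"
      have "hpoly_eval (1 :: 'k hpoly) z = 1" using hpoly_eval_single[of 0 1 z] by simp
      then show "hpoly_eval (G * Poly_Mapping.single 0 (inverse (hpoly_eval G z0))) z = hpoly_eval 1 z"
        using Gz c[of z] by (simp add: hpoly_eval_mult hpoly_eval_single)
    qed
    then show "G dvd 1" unfolding hpoly_eval_inj by (metis dvdI)
  qed
  then have "reduced_form F d" using F(2) by (simp add: reduced_form_def)
  then show ?thesis using eF by blast
qed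

section \<open>Cones and charts\<close>

lemma rep_proj_nonzero: "rep_proj p \<noteq> 0"
  using Quotient3_rep_reflp[OF Quotient3_proj, of p] by (auto simp: proj_rel_def)

lemma abs_rep_proj: "abs_proj (rep_proj p) = p"
  by (rule Quotient3_abs_rep[OF Quotient3_proj])

lemma abs_proj_scale:
  assumes "c \<noteq> 0" "v \<noteq> 0" shows "abs_proj (c *s v) = abs_proj v"
proof -
  have "c *s v \<noteq> 0" using assms by (simp add: vec.scale_eq_0_iff)
  then have "abs_proj v = abs_proj (c *s v)" using abs_proj_eq_iff[OF assms(2), of "c *s v"] by blast
  then show ?thesis by simp
qed

lemma abs_proj_eqE:
  assumes "abs_proj v = abs_proj w" "v \<noteq> 0" "w \<noteq> 0"
  obtains c where "c \<noteq> 0" "w = c *s v"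
proof -
  obtain c where "w = c *s v" using abs_proj_eq_iff[OF assms(2,3)] assms(1) by blast
  then show ?thesis using that assms(3) by (cases "c = 0") auto
qed

lemma proj_cases:
  obtains v where "v \<noteq> 0" "p = abs_proj v"
  using that[OF rep_proj_nonzero abs_rep_proj[symmetric]] .

definition pcone :: "'k::finite proj set \<Rightarrow> (complex ^ 'k option) set" where
  "pcone A = {v. v \<noteq> 0 \<and> abs_proj v \<in> A}"

lemma open_iff_pcone: "open A \<longleftrightarrow> open (pcone A)"
  by (simp add: open_proj_def pcone_def)

lemma open_nonzero: "open {v :: complex ^ 'n::finite. v \<noteq> 0}"
proof -
  have "{v :: complex ^ 'n. v \<noteq> 0} = - {0}" by auto
  then show ?thesis by (simp add: open_Compl)
qed

text \<open>The projection from the punctured space is open, since the cone over the image is the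
  union of the rescalings of \<open>O'\<close>.\<close>

lemma open_abs_proj_image:
  assumes "open O'" "0 \<notin> O'" shows "open (abs_proj ` O')"
proof -
  have "pcone (abs_proj ` O') = (\<Union>c\<in>- {0}. {v. c *s v \<in> O'})"
  proof (intro set_eqI iffI)
    fix v assume "v \<in> pcone (abs_proj ` O')"
    then obtain w where w: "v \<noteq> 0" "w \<in> O'" "abs_proj v = abs_proj w" by (auto simp: pcone_def)
    then obtain c where "c \<noteq> 0" "w = c *s v" using abs_proj_eqE[of v w] assms(2) by metis
    then show "v \<in> (\<Union>c\<in>- {0}. {v. c *s v \<in> O'})" using w by auto
  next
    fix v assume "v \<in> (\<Union>c\<in>- {0}. {v. c *s v \<in> O'})"
    then obtain c where c: "c \<noteq> 0" "c *s v \<in> O'" by auto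
    then have "v \<noteq> 0" using assms(2) by auto
    have "abs_proj v \<in> abs_proj ` O'" using abs_proj_scale[OF c(1) \<open>v \<noteq> 0\<close>] c(2) by (metis imageI)
    then show "v \<in> pcone (abs_proj ` O')" using \<open>v \<noteq> 0\<close> by (simp add: pcone_def)
  qed
  moreover have "open {v. c *s v \<in> O'}" for c
  proof -
    have "continuous_on UNIV (\<lambda>v :: complex ^ 'a option. c *s v)" by (intro continuous_intros)
    then have "open ((\<lambda>v. c *s v) -` O')" using assms(1) by (simp add: open_vimage)
    then show ?thesis by (simp add: vimage_def)
  qed
  ultimately show ?thesis unfolding open_iff_pcone by (simp add: open_UN)
qed

text \<open>Formulated with the chosen representative; for a form the choice is immaterial by
  \<open>zset_abs_proj\<close>.\<close>

definition zset :: "(complex ^ 'k::finite option \<Rightarrow> complex) \<Rightarrow> 'k proj set" where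
  "zset P = {p. P (rep_proj p) = 0}"

lemma zset_abs_proj:
  assumes "hom_fun d P" "v \<noteq> 0" shows "abs_proj v \<in> zset P \<longleftrightarrow> P v = 0"
proof -
  obtain c where "c \<noteq> 0" "rep_proj (abs_proj v) = c *s v"
    using abs_proj_eqE[of v "rep_proj (abs_proj v)"] abs_rep_proj rep_proj_nonzero assms(2) by metis
  then show ?thesis using hom_funD(2)[OF assms(1)] by (simp add: zset_def)
qed

lemma closed_zset:
  assumes "hom_fun d P" shows "closed (zset P)"
proof -
  have "pcone (- zset P) = {v. v \<noteq> 0} \<inter> {v. P v \<noteq> 0}" using zset_abs_proj[OF assms] by (auto simp: pcone_def)
  then have "open (- zset P)" unfolding open_iff_pcone
    by (simp only:) (rule open_Int[OF open_nonzero open_polyfun_nonzero[OF hom_funD(1)[OF assms]]])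
  then show ?thesis by (simp add: closed_def)
qed

text \<open>The affine slice on which the coordinate \<open>\<sigma> None\<close> is 1. Its
  directions form the image of \<open>embed\<close>, the hyperplane where that coordinate is 0, and
  \<open>chartv\<close> is the chart on vectors.\<close>

definition lift :: "('k option \<Rightarrow> 'k option) \<Rightarrow> complex ^ 'k::finite \<Rightarrow> complex ^ 'k option" where
  "lift \<sigma> w = (\<chi> i. case inv \<sigma> i of None \<Rightarrow> 1 | Some j \<Rightarrow> w $ j)"

definition embed :: "('k option \<Rightarrow> 'k option) \<Rightarrow> complex ^ 'k::finite \<Rightarrow> complex ^ 'k option" where
  "embed \<sigma> w = (\<chi> i. case inv \<sigma> i of None \<Rightarrow> 0 | Some j \<Rightarrow> w $ j)"

definition chartv :: "('k option \<Rightarrow> 'k option) \<Rightarrow> complex ^ 'k::finite option \<Rightarrow> complex ^ 'k" where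
  "chartv \<sigma> v = (\<chi> j. v $ \<sigma> (Some j) / v $ \<sigma> None)"

lemma chart_inv_lift: "chart_inv \<sigma> w = abs_proj (lift \<sigma> w)"
  by (simp add: chart_inv_def lift_def)

lemma lift_nth [simp]:
  assumes "bij \<sigma>" shows "lift \<sigma> w $ \<sigma> None = 1" "lift \<sigma> w $ \<sigma> (Some j) = w $ j"
    "embed \<sigma> w $ \<sigma> None = 0" "embed \<sigma> w $ \<sigma> (Some j) = w $ j"
  using assms by (simp_all add: lift_def embed_def bij_is_inj)

lemma lift_nonzero: "bij \<sigma> \<Longrightarrow> lift \<sigma> w \<noteq> 0"
  using lift_nth(1)[of \<sigma> w] by (metis zero_index zero_neq_one)

lemma vec_eq_chart:
  assumes "bij \<sigma>" "v $ \<sigma> None = w $ \<sigma> None" "\<And>j. v $ \<sigma> (Some j) = w $ \<sigma> (Some j)"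
  shows "v = w"
  unfolding vec_eq_iff
proof
  fix i
  obtain l where "i = \<sigma> l" using assms(1) by (metis bij_pointE)
  then show "v $ i = w $ i" using assms(2,3) by (cases l) auto
qed

lemma lift_chartv:
  assumes "bij \<sigma>" "v $ \<sigma> None \<noteq> 0" shows "lift \<sigma> (chartv \<sigma> v) = inverse (v $ \<sigma> None) *s v"
  by (rule vec_eq_chart[OF assms(1)]) (use assms in \<open>auto simp: chartv_def field_simps\<close>)

lemma chart_inv_chartv:
  assumes "bij \<sigma>" "v $ \<sigma> None \<noteq> 0" shows "chart_inv \<sigma> (chartv \<sigma> v) = abs_proj v"
proof -
  have "v \<noteq> 0" using assms(2) by auto
  then show ?thesis unfolding chart_inv_lift lift_chartv[OF assms] using assms(2) by (intro abs_proj_scale) auto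
qed

lemma chartv_lift: "bij \<sigma> \<Longrightarrow> chartv \<sigma> (lift \<sigma> w) = w"
  by (simp add: chartv_def vec_eq_iff)

lemma lift_line: "bij \<sigma> \<Longrightarrow> lift \<sigma> (w + y *s u) = lift \<sigma> w + y *s embed \<sigma> u"
  by (rule vec_eq_chart) auto

lemma embed_line: "bij \<sigma> \<Longrightarrow> embed \<sigma> (w + y *s u) = embed \<sigma> w + y *s embed \<sigma> u"
  by (rule vec_eq_chart) auto

lemma ex_chart:
  fixes v :: "complex ^ 'k::finite option"
  assumes "v \<noteq> 0" shows "\<exists>\<sigma> :: 'k option \<Rightarrow> 'k option. bij \<sigma> \<and> v $ \<sigma> None \<noteq> 0"
proof -
  obtain i where i: "v $ i \<noteq> 0" using assms by (auto simp: vec_eq_iff)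
  let ?\<sigma> = "\<lambda>x. if x = None then i else if x = i then None else x"
  have "bij ?\<sigma>" by (rule involuntory_imp_bij) auto
  then show ?thesis using i by (intro exI[of _ ?\<sigma>]) simp
qed

lemma continuous_on_lift: "continuous_on S (lift \<sigma>)"
proof -
  have "continuous_on S (\<lambda>w. \<chi> i. case inv \<sigma> i of None \<Rightarrow> 1 | Some j \<Rightarrow> w $ j)"
  proof (intro continuous_on_vec_lambda)
    fix i show "continuous_on S (\<lambda>w. case inv \<sigma> i of None \<Rightarrow> 1 | Some j \<Rightarrow> w $ j)"
      by (cases "inv \<sigma> i") (auto intro!: continuous_intros)
  qed
  then show ?thesis by (simp add: lift_def[abs_def])
qed

lemma continuous_on_chartv: "continuous_on {v. v $ \<sigma> None \<noteq> 0} (chartv \<sigma>)"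
  unfolding chartv_def[abs_def] by (intro continuous_on_vec_lambda continuous_intros) auto

lemma open_chart_dom: "open {v :: complex ^ 'k::finite option. v $ i \<noteq> 0}"
  by (rule open_polyfun_nonzero[OF polyfun_coord])

lemma open_chartv_vimage:
  assumes "open U" shows "open {v. v $ \<sigma> None \<noteq> 0 \<and> chartv \<sigma> v \<in> U}"
proof -
  have "open ({v. v $ \<sigma> None \<noteq> 0} \<inter> chartv \<sigma> -` U)"
    by (rule continuous_open_preimage[OF continuous_on_chartv open_chart_dom assms])
  then show ?thesis by (simp add: Int_def vimage_def)
qed

lemma open_chart_inv_vimage:
  assumes "bij \<sigma>" "open U" shows "open (chart_inv \<sigma> -` U)"
proof -
  have "chart_inv \<sigma> -` U = lift \<sigma> -` pcone U"
    using lift_nonzero[OF assms(1)] by (auto simp: pcone_def chart_inv_lift)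
  moreover have "open (lift \<sigma> -` pcone U)"
    by (rule open_vimage[OF _ continuous_on_lift]) (use assms(2) open_iff_pcone in blast)
  ultimately show ?thesis by simp
qed

lemma chart_inv_zset: "bij \<sigma> \<Longrightarrow> hom_fun d P \<Longrightarrow> chart_inv \<sigma> w \<in> zset P \<longleftrightarrow> P (lift \<sigma> w) = 0"
  unfolding chart_inv_lift by (rule zset_abs_proj[OF _ lift_nonzero])

section \<open>Holomorphic functions of several variables\<close>

lemma holomorphic_fun_subset: "holomorphic_fun U g \<Longrightarrow> V \<subseteq> U \<Longrightarrow> holomorphic_fun V g"
  unfolding holomorphic_fun_def by blast

lemma holomorphic_fun_const: "holomorphic_fun U (\<lambda>z. c)"
  unfolding holomorphic_fun_def by (intro ballI exI[of _ "\<lambda>_. 0"]) auto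

lemma holomorphic_fun_coord: "holomorphic_fun U (\<lambda>z. z $ i)"
  unfolding holomorphic_fun_def
  by (intro ballI exI[of _ "\<lambda>v. v $ i"])
    (auto intro!: bounded_linear_imp_has_derivative bounded_linear_vec_nth)

lemma holomorphic_fun_add:
  assumes "holomorphic_fun U f" "holomorphic_fun U g" shows "holomorphic_fun U (\<lambda>z. f z + g z)"
  unfolding holomorphic_fun_def
proof
  fix z assume "z \<in> U"
  then obtain D E where "(f has_derivative D) (at z)" "\<forall>c v. D (c *s v) = c * D v"
    "(g has_derivative E) (at z)" "\<forall>c v. E (c *s v) = c * E v"
    using assms unfolding holomorphic_fun_def by blast
  then show "\<exists>D. ((\<lambda>z. f z + g z) has_derivative D) (at z) \<and> (\<forall>c v. D (c *s v) = c * D v)"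
    by (intro exI[of _ "\<lambda>v. D v + E v"]) (auto intro: has_derivative_add simp: algebra_simps)
qed

lemma holomorphic_fun_mult:
  assumes "holomorphic_fun U f" "holomorphic_fun U g" shows "holomorphic_fun U (\<lambda>z. f z * g z)"
  unfolding holomorphic_fun_def
proof
  fix z assume "z \<in> U"
  then obtain D E where "(f has_derivative D) (at z)" "\<forall>c v. D (c *s v) = c * D v"
    "(g has_derivative E) (at z)" "\<forall>c v. E (c *s v) = c * E v"
    using assms unfolding holomorphic_fun_def by blast
  then show "\<exists>D. ((\<lambda>z. f z * g z) has_derivative D) (at z) \<and> (\<forall>c v. D (c *s v) = c * D v)"
    by (intro exI[of _ "\<lambda>v. f z * E v + D v * g z"] conjI has_derivative_mult) (auto simp: algebra_simps)
qed

lemma holomorphic_fun_polyfun_lift: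
  assumes "polyfun P" shows "holomorphic_fun U (\<lambda>w. P (lift \<sigma> w))"
  using assms
proof (induction rule: polyfun.induct)
  case (polyfun_coord i)
  show ?case
    by (cases "inv \<sigma> i") (simp_all add: lift_def holomorphic_fun_const holomorphic_fun_coord)
qed (auto intro: holomorphic_fun_const holomorphic_fun_add holomorphic_fun_mult)

lemma has_derivative_vec:
  fixes f :: "'i::finite \<Rightarrow> 'a::real_normed_vector \<Rightarrow> 'b::real_normed_vector"
  assumes "\<And>i. (f i has_derivative f' i) F"
  shows "((\<lambda>x. \<chi> i. f i x) has_derivative (\<lambda>h. \<chi> i. f' i h)) F"
proof -
  have ax: "bounded_linear (axis i :: 'b \<Rightarrow> 'b ^ 'i)" for i
    by (rule bounded_linear_intro[of _ 1]) (auto simp: vec_eq_iff axis_def norm_vec_def L2_set_def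
        if_distrib[of norm] if_distrib[of "\<lambda>x. x\<^sup>2"] cong: if_cong)
  have eq: "(\<chi> i. g i) = (\<Sum>i\<in>UNIV. axis i (g i))" for g :: "'i \<Rightarrow> 'b"
    by (simp add: vec_eq_iff axis_def sum.delta)
  show ?thesis
    unfolding eq by (intro has_derivative_sum bounded_linear.has_derivative[OF ax] assms)
qed

lemma holomorphic_fun_chain:
  fixes \<eta> :: "complex \<Rightarrow> complex ^ 'k::finite"
  assumes g: "(g has_derivative D) (at (\<eta> t))" and lin: "\<And>c v. D (c *s v) = c * D v"
    and \<eta>: "\<And>i. ((\<lambda>s. \<eta> s $ i) has_field_derivative \<eta>' $ i) (at t)"
  shows "((\<lambda>s. g (\<eta> s)) has_field_derivative D \<eta>') (at t)"
proof -
  have "((\<lambda>s. \<chi> i. \<eta> s $ i) has_derivative (\<lambda>h. \<chi> i. \<eta>' $ i * h)) (at t)"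
    by (intro has_derivative_vec) (use \<eta> in \<open>simp add: has_field_derivative_def\<close>)
  then have "(\<eta> has_derivative (\<lambda>h. h *s \<eta>')) (at t)"
    by (simp add: vector_scalar_mult_def mult.commute)
  from diff_chain_at[OF this g] have "((\<lambda>s. g (\<eta> s)) has_derivative (\<lambda>h. h * D \<eta>')) (at t)"
    by (simp add: o_def lin)
  then show ?thesis by (simp add: has_field_derivative_def mult.commute[of _ "D \<eta>'"])
qed

lemma holomorphic_fun_continuous:
  assumes "holomorphic_fun U g" shows "continuous_on U g"
  unfolding continuous_on_eq_continuous_within
proof
  fix z assume "z \<in> U"
  then obtain D where "(g has_derivative D) (at z)" using assms unfolding holomorphic_fun_def by blast
  then have "isCont g z" by (rule has_derivative_continuous)
  then show "continuous (at z within U) g" by (rule continuous_at_imp_continuous_at_within)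
qed

lemma holomorphic_fun_line:
  assumes g: "holomorphic_fun U g" and "open U"
  shows "(\<lambda>y. g (z + y *s u)) holomorphic_on {y. z + y *s u \<in> U}"
  unfolding holomorphic_on_def
proof
  fix y assume "y \<in> {y. z + y *s u \<in> U}"
  then obtain D where D: "(g has_derivative D) (at (z + y *s u))" "\<forall>c v. D (c *s v) = c * D v"
    using g unfolding holomorphic_fun_def by blast
  have "((\<lambda>y. g (z + y *s u)) has_field_derivative D u) (at y)"
    by (rule holomorphic_fun_chain[of g D "\<lambda>y. z + y *s u"]) (use D in \<open>auto intro!: derivative_eq_intros\<close>)
  then show "(\<lambda>y. g (z + y *s u)) field_differentiable at y within {y. z + y *s u \<in> U}"
    using field_differentiable_at_within field_differentiable_def by blast
qed

lemma curve_holo_chart: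
  fixes \<sigma> :: "'k::finite option \<Rightarrow> 'k option"
  assumes g: "holomorphic_fun U0 g"
  shows "curve_holo {v. v $ \<sigma> None \<noteq> 0 \<and> chartv \<sigma> v \<in> U0} (\<lambda>v. g (chartv \<sigma> v))"
  unfolding curve_holo_def
proof (intro conjI allI impI)
  show "continuous_on {v. v $ \<sigma> None \<noteq> 0 \<and> chartv \<sigma> v \<in> U0} (\<lambda>v. g (chartv \<sigma> v))"
    by (rule continuous_on_compose2[OF holomorphic_fun_continuous[OF g]])
      (auto intro: continuous_on_subset[OF continuous_on_chartv])
  fix \<gamma> :: "complex \<Rightarrow> complex ^ 'k option" and S
  assume *: "open S \<and> (\<forall>i. (\<lambda>t. \<gamma> t $ i) holomorphic_on S) \<and> \<gamma> ` S \<subseteq> {v. v $ \<sigma> None \<noteq> 0 \<and> chartv \<sigma> v \<in> U0}"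
  show "(\<lambda>t. g (chartv \<sigma> (\<gamma> t))) holomorphic_on S"
    unfolding holomorphic_on_def
  proof
    fix t assume t: "t \<in> S"
    have "(\<lambda>t. \<gamma> t $ \<sigma> (Some j) / \<gamma> t $ \<sigma> None) holomorphic_on S" for j
      using * by (intro holomorphic_intros) auto
    then have "\<exists>D. ((\<lambda>t. chartv \<sigma> (\<gamma> t) $ j) has_field_derivative D) (at t)" for j
      using * t by (simp add: chartv_def holomorphic_on_open)
    then obtain D' where D': "\<And>j. ((\<lambda>t. chartv \<sigma> (\<gamma> t) $ j) has_field_derivative D' j) (at t)" by metis
    obtain D where D: "(g has_derivative D) (at (chartv \<sigma> (\<gamma> t)))" "\<forall>c v. D (c *s v) = c * D v"
      using g * t unfolding holomorphic_fun_def by blast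
    have "((\<lambda>t. g (chartv \<sigma> (\<gamma> t))) has_field_derivative D (\<chi> j. D' j)) (at t)"
      by (rule holomorphic_fun_chain[of g D "\<lambda>t. chartv \<sigma> (\<gamma> t)"]) (use D D' in auto)
    then show "(\<lambda>t. g (chartv \<sigma> (\<gamma> t))) field_differentiable at t within S"
      using field_differentiable_at_within field_differentiable_def by blast
  qed
qed

section \<open>Hypersurfaces defined by irreducible forms\<close>

text \<open>The local equations in a chart are pulled back to the cone; its apex lies over no chart,
  hence the condition on \<open>v\<close>.\<close>

lemma analytic_set_locally_analytic:
  fixes B :: "'k::finite proj set"
  assumes B: "analytic_set B" and v: "v \<noteq> 0"
  shows "locally_analytic_at (pcone B) v"
proof -
  obtain \<sigma> :: "'k option \<Rightarrow> 'k option" where \<sigma>: "bij \<sigma>" "v $ \<sigma> None \<noteq> 0" using ex_chart[OF v] by blast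
  have "local_analytic (chart_inv \<sigma> -` B)" using B \<sigma>(1) by (simp add: analytic_set_def)
  then obtain U0 G0 where U0: "open U0" "chartv \<sigma> v \<in> U0" "finite G0" "\<And>g. g \<in> G0 \<Longrightarrow> holomorphic_fun U0 g"
    "chart_inv \<sigma> -` B \<inter> U0 = {z\<in>U0. \<forall>g\<in>G0. g z = 0}"
    unfolding local_analytic_def by meson
  let ?U = "{v. v $ \<sigma> None \<noteq> 0 \<and> chartv \<sigma> v \<in> U0}"
  have "pcone B \<inter> ?U = {z\<in>?U. \<forall>g\<in>(\<lambda>g v. g (chartv \<sigma> v)) ` G0. g z = 0}"
  proof (intro set_eqI)
    fix z
    show "z \<in> pcone B \<inter> ?U \<longleftrightarrow> z \<in> {z\<in>?U. \<forall>g\<in>(\<lambda>g v. g (chartv \<sigma> v)) ` G0. g z = 0}"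
    proof (cases "z \<in> ?U")
      case True
      then have "z \<noteq> 0" by auto
      have "z \<in> pcone B \<longleftrightarrow> chart_inv \<sigma> (chartv \<sigma> z) \<in> B"
        using chart_inv_chartv[OF \<sigma>(1), of z] True \<open>z \<noteq> 0\<close> by (simp add: pcone_def)
      also have "\<dots> \<longleftrightarrow> chartv \<sigma> z \<in> chart_inv \<sigma> -` B \<inter> U0" using True by simp
      also have "\<dots> \<longleftrightarrow> (\<forall>g\<in>G0. g (chartv \<sigma> z) = 0)" unfolding U0(5) using True by simp
      finally show ?thesis using True by auto
    qed auto
  qed
  then show ?thesis
    unfolding locally_analytic_at_def
    using open_chartv_vimage[OF U0(1), of \<sigma>] \<sigma> U0(2,3) curve_holo_chart[OF U0(4)]
    by (intro exI[of _ ?U] exI[of _ "(\<lambda>g v. g (chartv \<sigma> v)) ` G0"]) auto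
qed

lemma locally_analytic_closed:
  assumes "locally_analytic_at T x" "x \<notin> T"
  shows "\<exists>V. open V \<and> x \<in> V \<and> V \<inter> T = {}"
proof -
  obtain U G where U: "open U" "x \<in> U" "finite G" "\<And>g. g \<in> G \<Longrightarrow> curve_holo U g" "T \<inter> U = {z\<in>U. \<forall>g\<in>G. g z = 0}"
    using assms(1) unfolding locally_analytic_at_def by blast
  have "x \<notin> {z\<in>U. \<forall>g\<in>G. g z = 0}" unfolding U(5)[symmetric] using assms(2) by blast
  then obtain g where g: "g \<in> G" "g x \<noteq> 0" using U(2) by blast
  have "continuous_on U g" using U(4)[OF g(1)] by (simp add: curve_holo_def)
  then have "open (U \<inter> g -` (- {0}))" using U(1) by (intro continuous_open_preimage) auto
  moreover have "z \<notin> T" if "z \<in> U \<inter> g -` (- {0})" for z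
  proof
    assume "z \<in> T"
    then have "z \<in> {z\<in>U. \<forall>g\<in>G. g z = 0}" unfolding U(5)[symmetric] using that by blast
    then show False using g that by blast
  qed
  ultimately show ?thesis using U(2) g by (intro exI[of _ "U \<inter> g -` (- {0})"]) auto
qed

lemma analytic_zset:
  assumes "hom_fun d P" shows "analytic_set (zset P)"
  unfolding analytic_set_def local_analytic_def
proof (intro allI impI)
  fix \<sigma> :: "'a option \<Rightarrow> 'a option" and p :: "complex ^ 'a"
  assume \<sigma>: "bij \<sigma>"
  show "\<exists>U G. open U \<and> p \<in> U \<and> finite G \<and> (\<forall>g\<in>G. holomorphic_fun U g) \<and>
      chart_inv \<sigma> -` zset P \<inter> U = {z\<in>U. \<forall>g\<in>G. g z = 0}"
    by (intro exI[of _ UNIV] exI[of _ "{\<lambda>w. P (lift \<sigma> w)}"])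
      (auto simp: chart_inv_zset[OF \<sigma> assms] holomorphic_fun_polyfun_lift[OF hom_funD(1)[OF assms]])
qed

lemma irr_has_zero:
  fixes P :: "complex ^ 'k::finite option \<Rightarrow> complex"
  assumes P: "irr_form P d" shows "\<exists>x. x \<noteq> 0 \<and> P x = 0"
proof -
  obtain v where v: "P v \<noteq> 0" using P unfolding irr_form_def by blast
  obtain \<Omega> where base: "root_base P v \<Omega>" using root_base_exists[OF irr_formD(1)[OF P] v irr_formD(3)[OF P]] by blast
  obtain x where x: "x \<in> \<Omega>" "P x = 0"
    using dense_root_base[OF irr_formD(1)[OF P] v base open_UNIV UNIV_I irr_formD(4)[OF P]] by blast
  have "0 \<notin> \<Omega>" using base by (simp add: root_base_def)
  then have "x \<noteq> 0" using x(1) by metis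
  then show ?thesis using x(2) by blast
qed

text \<open>If \<open>P = 0\<close> is not contained in \<open>B\<close>, it lies in
  \<open>C\<close> near a point outside \<open>B\<close>, and \<open>irr_connected\<close> carries
  this over to all of it.\<close>

lemma irreducible_zset:
  fixes P :: "complex ^ 'k::finite option \<Rightarrow> complex"
  assumes P: "irr_form P d" shows "irreducible_analytic (zset P)"
  unfolding irreducible_analytic_def
proof (intro conjI allI impI)
  note hP = irr_formD(1)[OF P]
  show "analytic_set (zset P)" by (rule analytic_zset[OF hP])
  show "zset P \<noteq> {}" using irr_has_zero[OF P] zset_abs_proj[OF hP] by blast
  fix B C assume *: "analytic_set B \<and> analytic_set C \<and> zset P = B \<union> C"
  show "B = zset P \<or> C = zset P"
  proof (cases "zset P \<subseteq> B")
    case True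
    then show ?thesis using * by blast
  next
    case False
    then obtain p where p: "p \<in> zset P" "p \<notin> B" by blast
    obtain v where v: "v \<noteq> 0" "p = abs_proj v" using proj_cases by blast
    have "locally_analytic_at (pcone B) v" using analytic_set_locally_analytic * v(1) by blast
    moreover have "v \<notin> pcone B" using p v by (simp add: pcone_def)
    ultimately obtain V where V: "open V" "v \<in> V" "V \<inter> pcone B = {}" using locally_analytic_closed by blast
    let ?U = "V \<inter> {v. v \<noteq> 0}"
    have U: "open ?U" "v \<in> ?U" "P v = 0"
      using V v open_nonzero p zset_abs_proj[OF hP v(1)] by (auto simp: open_Int)
    have UC: "z \<in> pcone C" if "z \<in> ?U" "P z = 0" for z
    proof -
      have "z \<noteq> 0" using that by simp
      then have "abs_proj z \<in> B \<union> C" using * zset_abs_proj[OF hP] that(2) by blast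
      moreover have "abs_proj z \<notin> B" using V(3) that(1) by (auto simp: pcone_def)
      ultimately show ?thesis using \<open>z \<noteq> 0\<close> by (simp add: pcone_def)
    qed
    have "x \<in> pcone C" if "x \<noteq> 0" "P x = 0" for x
      using irr_connected[OF P _ U UC that] analytic_set_locally_analytic * by blast
    then have "zset P \<subseteq> C"
      using proj_cases zset_abs_proj[OF hP] by (metis (no_types, lifting) pcone_def mem_Collect_eq subsetI)
    then show ?thesis using * by blast
  qed
qed

lemma open_subset_zset_imp_zero:
  fixes U :: "(complex ^ 'k::finite) set"
  assumes P: "hom_fun d P" and \<sigma>: "bij \<sigma>" and U: "open U" "w \<in> U" "\<And>z. z \<in> U \<Longrightarrow> P (lift \<sigma> z) = 0"
  shows "P x = 0"
proof (rule ccontr)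
  assume "P x \<noteq> 0"
  then have co: "cothin {x. P x \<noteq> 0}" by (rule cothin_polyfun_nonzero[OF hom_funD(1)[OF P]])
  have "lift \<sigma> w \<in> {v. v $ \<sigma> None \<noteq> 0 \<and> chartv \<sigma> v \<in> U}" using U(2) \<sigma> by (simp add: chartv_lift)
  then obtain v where v: "v $ \<sigma> None \<noteq> 0" "chartv \<sigma> v \<in> U" "P v \<noteq> 0"
    using cothin_dense[OF co open_chartv_vimage[OF U(1), of \<sigma>]] by blast
  have "P (inverse (v $ \<sigma> None) *s v) = 0" using U(3)[OF v(2)] lift_chartv[OF \<sigma> v(1)] by simp
  then show False using v hom_funD(2)[OF P] by simp
qed

lemma codim_le_iff:
  "codim A \<le> 1 \<longleftrightarrow> (\<exists>c \<sigma> p. c \<le> 1 \<and> bij \<sigma> \<and> regular_point (chart_inv \<sigma> -` A) p c)"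
proof -
  have "codim A \<le> 1 \<longleftrightarrow> codim A < 2"
    by (cases "codim A") (auto simp: one_enat_def numeral_eq_enat)
  also have "\<dots> \<longleftrightarrow> (\<exists>x\<in>{enat c | c \<sigma> p. bij \<sigma> \<and> regular_point (chart_inv \<sigma> -` A) p c}. x < 2)"
    unfolding codim_def by (rule Inf_less_iff)
  also have "\<dots> \<longleftrightarrow> (\<exists>c \<sigma> p. enat c < 2 \<and> bij \<sigma> \<and> regular_point (chart_inv \<sigma> -` A) p c)"
    by blast
  also have "\<dots> \<longleftrightarrow> (\<exists>c \<sigma> p. c \<le> 1 \<and> bij \<sigma> \<and> regular_point (chart_inv \<sigma> -` A) p c)"
  proof -
    have "enat c < 2 \<longleftrightarrow> c \<le> 1" for c by (auto simp: numeral_eq_enat)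
    then show ?thesis by simp
  qed
  finally show ?thesis .
qed

text \<open>Every open piece contains a point over the base, where the root in the direction
  \<open>v\<close> is simple. This excludes a zero differential in the chart, so the point is
  regular of codimension 1. A regular point of codimension 0 would make \<open>P\<close> vanish
  identically.\<close>

lemma hypersurface_zset:
  fixes P :: "complex ^ 'k::finite option \<Rightarrow> complex"
  assumes P: "irr_form P d" shows "hypersurface (zset P)"
  unfolding hypersurface_def
proof (intro conjI allI impI)
  note hP = irr_formD(1)[OF P] and pP = irr_formD(2)[OF P]
  show "analytic_set (zset P)" by (rule analytic_zset[OF hP])
  show "zset P \<noteq> {}" using irr_has_zero[OF P] zset_abs_proj[OF hP] by blast
  fix U :: "'k proj set" assume U: "open U \<and> zset P \<inter> U \<noteq> {}"
  obtain v where v: "P v \<noteq> 0" using P unfolding irr_form_def by blast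
  obtain \<Omega> where base: "root_base P v \<Omega>" using root_base_exists[OF hP v irr_formD(3)[OF P]] by blast
  obtain p where p: "p \<in> zset P" "p \<in> U" using U by blast
  obtain x where x: "x \<noteq> 0" "p = abs_proj x" using proj_cases by blast
  have "x \<in> pcone U" "P x = 0" "open (pcone U)" using x p U zset_abs_proj[OF hP x(1)] open_iff_pcone by (auto simp: pcone_def)
  then obtain x1 where x1: "x1 \<in> \<Omega>" "x1 \<in> pcone U" "P x1 = 0" using dense_root_base[OF hP v base] by blast
  have x10: "x1 \<noteq> 0" using x1(2) by (simp add: pcone_def)
  obtain \<sigma> :: "'k option \<Rightarrow> 'k option" where \<sigma>: "bij \<sigma>" "x1 $ \<sigma> None \<noteq> 0" using ex_chart[OF x10] by blast
  define c where "c = x1 $ \<sigma> None"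
  define w where "w = chartv \<sigma> x1"
  define g where "g = (\<lambda>w. P (lift \<sigma> w))"
  have lw: "lift \<sigma> w = inverse c *s x1" unfolding w_def c_def by (rule lift_chartv[OF \<sigma>])
  have x1c: "x1 = c *s lift \<sigma> w" unfolding lw using \<sigma>(2) by (simp add: c_def vector_smult_assoc)
  have gw: "g w = 0" unfolding g_def lw using hom_funD(2)[OF hP] x1(3) by simp
  have hg: "holomorphic_fun V g" for V unfolding g_def by (rule holomorphic_fun_polyfun_lift[OF pP])
  obtain D where D: "(g has_derivative D) (at w)" "\<And>c v. D (c *s v) = c * D v"
    using hg[of UNIV] unfolding holomorphic_fun_def by blast
  have fD: "frechet_derivative g (at w) = D" using frechet_derivative_at[OF D(1)] by simp
  have "\<exists>u. D u \<noteq> 0"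
  proof (rule ccontr)
    assume D0: "\<not> ?thesis"
    let ?s = "v $ \<sigma> None"
    define s where "s = ?s / c"
    define u where "u = (\<chi> j. v $ \<sigma> (Some j) / c - s * w $ j)"
    \<comment> \<open>\<open>v\<close> is split into a multiple of the point of the slice and a
      direction \<open>u\<close> of the chart, so the line through \<open>x1\<close> becomes, up to
      scaling, a curve in the chart with velocity \<open>u\<close> at \<open>y = 0\<close>.\<close>
    have vdec: "v = c *s (s *s lift \<sigma> w + embed \<sigma> u)"
      by (rule vec_eq_chart[OF \<sigma>(1)]) (use \<sigma> in \<open>auto simp: u_def s_def c_def algebra_simps\<close>)
    have Pg: "P (x1 + y *s v) = c ^ d * ((1 + y * s) ^ d * g (w + (y / (1 + y * s)) *s u))" if "1 + y * s \<noteq> 0" for y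
    proof -
      have e: "x1 + y *s v = c *s ((1 + y * s) *s lift \<sigma> (w + (y / (1 + y * s)) *s u))"
        using that unfolding lift_line[OF \<sigma>(1)]
        by (subst x1c, subst vdec) (simp add: vec_eq_iff field_simps)
      show ?thesis unfolding e g_def hom_funD(2)[OF hP] by (rule refl)
    qed
    have der1: "((\<lambda>y. g (w + (y / (1 + y * s)) *s u)) has_field_derivative D u) (at 0)"
      by (rule holomorphic_fun_chain[of g D "\<lambda>y. w + (y / (1 + y * s)) *s u"])
        (use D in \<open>auto intro!: derivative_eq_intros\<close>)
    have der2: "((\<lambda>y. c ^ d * ((1 + y * s) ^ d * g (w + (y / (1 + y * s)) *s u))) has_field_derivative 0) (at 0)"
      by (rule derivative_eq_intros der1 refl)+ (use gw D0 in auto)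
    have "((\<lambda>y. 1 + y * s) \<longlongrightarrow> 1 + 0 * s) (at 0)" by (intro tendsto_intros)
    have op: "open {y. 1 + y * s \<noteq> 0}" by (intro open_Collect_neq continuous_intros)
    have "((\<lambda>y. P (x1 + y *s v)) has_field_derivative 0) (at 0)"
      by (rule has_field_derivative_transform_within_open[OF der2 op]) (use Pg in auto)
    moreover have "((\<lambda>y. P (x1 + y *s v)) has_field_derivative poly (pderiv (upoly P v x1)) 0) (at 0)"
      using poly_DERIV[of "upoly P v x1" 0] by (simp add: poly_upoly[OF pP])
    ultimately have "poly (pderiv (upoly P v x1)) 0 = 0" using DERIV_unique by blast
    then show False using irr_simple_roots(2)[OF P v base x1(1), of 0] x1(3) by (simp add: roots_along_def)
  qed
  then obtain u where u: "D u \<noteq> 0" by blast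
  have one: "regular_point (chart_inv \<sigma> -` (zset P \<inter> U)) w 1"
    unfolding regular_point_def
  proof (intro conjI exI)
    have "chart_inv \<sigma> w = abs_proj x1" unfolding w_def by (rule chart_inv_chartv[OF \<sigma>])
    then have "chart_inv \<sigma> w \<in> U" using x1(2) by (simp add: pcone_def)
    moreover have "chart_inv \<sigma> w \<in> zset P" using chart_inv_zset[OF \<sigma>(1) hP] gw by (simp add: g_def)
    ultimately show "w \<in> chart_inv \<sigma> -` (zset P \<inter> U)" "w \<in> chart_inv \<sigma> -` U" by auto
    show "open (chart_inv \<sigma> -` U)" using open_chart_inv_vimage[OF \<sigma>(1)] U by blast
    show "\<forall>i<1. holomorphic_fun (chart_inv \<sigma> -` U) ((\<lambda>i::nat. g) i)" using hg by simp
    show "chart_inv \<sigma> -` (zset P \<inter> U) \<inter> chart_inv \<sigma> -` U = {z \<in> chart_inv \<sigma> -` U. \<forall>i<1. ((\<lambda>i::nat. g) i) z = 0}"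
      by (intro set_eqI) (simp add: chart_inv_zset[OF \<sigma>(1) hP] g_def conj_commute)
    show "\<forall>a. (\<forall>v. (\<Sum>i<1. a i * frechet_derivative ((\<lambda>i::nat. g) i) (at w) v) = 0) \<longrightarrow> (\<forall>i<1. a i = 0)"
    proof (intro allI impI)
      fix a :: "nat \<Rightarrow> complex" and i :: nat
      assume *: "\<forall>v. (\<Sum>i<1. a i * frechet_derivative g (at w) v) = 0" and "i < 1"
      have "a 0 * D u = 0" using *[rule_format, of u] fD by simp
      then show "a i = 0" using u \<open>i < 1\<close> by simp
    qed
  qed
  have zero: "\<not> regular_point (chart_inv \<tau> -` (zset P \<inter> U)) q 0" if \<tau>: "bij \<tau>" for \<tau> :: "'k option \<Rightarrow> 'k option" and q
  proof
    assume "regular_point (chart_inv \<tau> -` (zset P \<inter> U)) q 0"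
    then obtain V where V: "open V" "q \<in> V" "chart_inv \<tau> -` (zset P \<inter> U) \<inter> V = V"
      unfolding regular_point_def by auto
    have "P (lift \<tau> z) = 0" if "z \<in> V" for z using V(3) that chart_inv_zset[OF \<tau> hP, of z] by blast
    then have "P v = 0" by (rule open_subset_zset_imp_zero[OF hP \<tau> V(1,2)])
    then show False using v by simp
  qed
  let ?S = "{enat c | c \<sigma> p. bij \<sigma> \<and> regular_point (chart_inv \<sigma> -` (zset P \<inter> U)) p c}"
  have "1 \<in> ?S" using one \<sigma>(1) unfolding one_enat_def by blast
  then have "Inf ?S \<le> 1" by (rule Inf_lower)
  moreover have "1 \<le> Inf ?S"
  proof (rule Inf_greatest)
    fix x assume "x \<in> ?S"
    then obtain c \<tau> q where c: "x = enat c" "bij \<tau>" "regular_point (chart_inv \<tau> -` (zset P \<inter> U)) q c" by blast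
    then have "c \<noteq> 0" using zero by metis
    then show "1 \<le> x" using c(1) by (simp add: one_enat_def)
  qed
  ultimately show "codim (zset P \<inter> U) = 1" unfolding codim_def by (rule antisym)
qed

section \<open>Sets of codimension at most one\<close>

lemma finite_prod_zero_open:
  fixes h :: "'i \<Rightarrow> 'a::topological_space \<Rightarrow> complex"
  assumes "finite I" "open U" "U \<noteq> {}" "\<And>i. i \<in> I \<Longrightarrow> continuous_on U (h i)" "\<And>x. x \<in> U \<Longrightarrow> (\<Prod>i\<in>I. h i x) = 0"
  shows "\<exists>i\<in>I. \<exists>U'. open U' \<and> U' \<noteq> {} \<and> U' \<subseteq> U \<and> (\<forall>x\<in>U'. h i x = 0)"
  using assms
proof (induction I arbitrary: U rule: finite_induct)
  case (insert i I)
  show ?case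
  proof (cases "\<forall>x\<in>U. h i x = 0")
    case True
    then show ?thesis using insert.prems by blast
  next
    case False
    let ?V = "U \<inter> h i -` (- {0})"
    have V: "open ?V" using insert.prems by (intro continuous_open_preimage) auto
    have ne: "?V \<noteq> {}" using False by auto
    have c: "continuous_on ?V (h j)" if "j \<in> I" for j
      by (rule continuous_on_subset[OF insert.prems(3)]) (use that in auto)
    have z: "(\<Prod>i\<in>I. h i x) = 0" if "x \<in> ?V" for x
      using insert.prems(4)[of x] that insert.hyps by simp
    show ?thesis using insert.IH[OF V ne c z] by blast
  qed
qed auto

text \<open>A Hurwitz argument by the maximum principle. On a small circle in the direction
  \<open>u\<close> around \<open>z0\<close> the norm of \<open>g\<close> is at least
  \<open>m\<close>. Without a zero over a nearby \<open>z\<close>, the inverse of \<open>g\<close>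
  would be bounded by \<open>2 / m\<close> at the centre, where the norm of \<open>g\<close> is less
  than \<open>m / 2\<close>.\<close>

lemma isolated_zero_persists:
  fixes g :: "complex ^ 'k::finite \<Rightarrow> complex"
  assumes g: "holomorphic_fun U g" and U: "open U" "z0 \<in> U" and g0: "g z0 = 0"
    and D: "(g has_derivative D) (at z0)" "\<And>c v. D (c *s v) = c * D v" "D u \<noteq> 0"
  shows "\<exists>\<delta>>0. \<forall>z\<in>ball z0 \<delta>. \<exists>y. z + y *s u \<in> U \<and> g (z + y *s u) = 0"
proof -
  have "((\<lambda>y. g (z0 + y *s u)) has_field_derivative D u) (at 0)"
    by (rule holomorphic_fun_chain[of g D "\<lambda>y. z0 + y *s u"]) (use D in \<open>auto intro!: derivative_eq_intros\<close>)
  then have "((\<lambda>y. (g (z0 + y *s u) - g (z0 + 0 *s u)) / (y - 0)) \<longlongrightarrow> D u) (at 0)"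
    unfolding has_field_derivative_iff .
  then have "\<forall>\<^sub>F y in at 0. (g (z0 + y *s u) - g (z0 + 0 *s u)) / (y - 0) \<noteq> 0"
    using D(3) by (rule tendsto_imp_eventually_ne)
  then obtain r1 where r1: "r1 > 0" "\<And>y. y \<noteq> 0 \<Longrightarrow> dist y 0 < r1 \<Longrightarrow> (g (z0 + y *s u) - g (z0 + 0 *s u)) / (y - 0) \<noteq> 0"
    unfolding eventually_at by auto
  have nz: "g (z0 + y *s u) \<noteq> 0" if "y \<noteq> 0" "norm y < r1" for y
    using r1(2)[of y] that g0 by auto
  have "open {y. z0 + y *s u \<in> U}" by (rule open_line[OF U(1)])
  moreover have "0 \<in> {y. z0 + y *s u \<in> U}" using U(2) by simp
  ultimately obtain r2 where r2: "r2 > 0" "cball 0 r2 \<subseteq> {y. z0 + y *s u \<in> U}"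
    using open_contains_cball by blast
  define r where "r = min (r1 / 2) r2"
  have r: "r > 0" "r < r1" "r \<le> r2" using r1(1) r2(1) by (auto simp: r_def)
  let ?A = "(\<lambda>y. z0 + y *s u) ` cball 0 r"
  have "compact ?A" by (intro compact_continuous_image continuous_intros) auto
  moreover have "?A \<subseteq> U"
  proof (rule image_subsetI)
    fix y :: complex assume "y \<in> cball 0 r"
    then have "y \<in> cball 0 r2" using r(3) by simp
    then show "z0 + y *s u \<in> U" using r2(2) by blast
  qed
  ultimately obtain \<epsilon> where \<epsilon>: "\<epsilon> > 0" "(\<Union>x\<in>?A. cball x \<epsilon>) \<subseteq> U"
    using compact_subset_open_imp_cball_epsilon_subset[OF _ U(1)] by metis
  have inU: "z + y *s u \<in> U" if "z \<in> cball z0 \<epsilon>" "y \<in> cball 0 r" for z y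
  proof -
    have "z + y *s u \<in> cball (z0 + y *s u) \<epsilon>" using that(1) by simp
    then show ?thesis using \<epsilon>(2) that(2) by blast
  qed
  let ?K = "cball z0 \<epsilon> \<times> cball (0 :: complex) r"
  have gc: "continuous_on U g" by (rule holomorphic_fun_continuous[OF g])
  have "continuous_on ?K (\<lambda>p. g (fst p + snd p *s u))"
    by (rule continuous_on_compose2[OF gc]) (auto intro!: continuous_intros inU)
  then have uc: "uniformly_continuous_on ?K (\<lambda>p. g (fst p + snd p *s u))"
    by (rule compact_uniformly_continuous) (intro compact_Times compact_cball)
  have "continuous_on (sphere 0 r) (\<lambda>y. norm (g (z0 + y *s u)))"
    by (intro continuous_on_norm continuous_on_compose2[OF gc]) (use inU \<epsilon>(1) in \<open>auto intro!: continuous_intros\<close>)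
  moreover have "sphere (0::complex) r \<noteq> {}" using r(1) by simp
  ultimately obtain y0 where y0: "y0 \<in> sphere 0 r" "\<And>y. y \<in> sphere 0 r \<Longrightarrow> norm (g (z0 + y0 *s u)) \<le> norm (g (z0 + y *s u))"
    using continuous_attains_inf[OF compact_sphere] by blast
  define m where "m = norm (g (z0 + y0 *s u))"
  have m: "m > 0" unfolding m_def using nz[of y0] y0(1) r by auto
  then obtain d where d: "d > 0" "\<And>p q. p \<in> ?K \<Longrightarrow> q \<in> ?K \<Longrightarrow> dist q p < d \<Longrightarrow>
      dist (g (fst q + snd q *s u)) (g (fst p + snd p *s u)) < m / 2"
    using uc unfolding uniformly_continuous_on_def by (metis half_gt_zero)
  have "\<exists>y. z + y *s u \<in> U \<and> g (z + y *s u) = 0" if z: "z \<in> ball z0 (min \<epsilon> d)" for z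
  proof (rule ccontr)
    assume no: "\<not> ?thesis"
    have zK: "z \<in> cball z0 \<epsilon>" "z0 \<in> cball z0 \<epsilon>" using z \<epsilon>(1) by auto
    have close: "norm (g (z + y *s u) - g (z0 + y *s u)) < m / 2" if "y \<in> cball 0 r" for y
    proof -
      have "dist (z, y) (z0, y) < d" using z by (simp add: dist_Pair_Pair dist_commute)
      then show ?thesis using d(2)[of "(z0, y)" "(z, y)"] zK that by (simp add: dist_norm)
    qed
    have hol: "(\<lambda>y. inverse (g (z + y *s u))) holomorphic_on {y. z + y *s u \<in> U}"
      by (intro holomorphic_on_inverse holomorphic_fun_line[OF g U(1)]) (use no in auto)
    have sub: "cball 0 r \<subseteq> {y. z + y *s u \<in> U}" using inU zK(1) by auto
    have "norm (inverse (g (z + 0 *s u))) \<le> 2 / m"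
    proof (rule maximum_modulus_frontier[of "\<lambda>y. inverse (g (z + y *s u))" "cball 0 r"])
      show "(\<lambda>y. inverse (g (z + y *s u))) holomorphic_on interior (cball 0 r)"
        by (rule holomorphic_on_subset[OF hol]) (use sub interior_subset in blast)
      show "continuous_on (closure (cball 0 r)) (\<lambda>y. inverse (g (z + y *s u)))"
        using continuous_on_subset[OF holomorphic_on_imp_continuous_on[OF hol] sub] by simp
      show "bounded (cball (0::complex) r)" by simp
      show "(0::complex) \<in> cball 0 r" using r(1) by simp
      fix y :: complex assume "y \<in> frontier (cball 0 r)"
      then have y: "y \<in> sphere 0 r" using r(1) by (simp add: frontier_cball)
      have "m \<le> norm (g (z0 + y *s u))" using y0(2)[OF y] by (simp add: m_def)
      moreover have "norm (g (z + y *s u) - g (z0 + y *s u)) < m / 2" using close y by simp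
      ultimately have "m / 2 \<le> norm (g (z + y *s u))"
        using norm_triangle_ineq2[of "g (z0 + y *s u)" "g (z0 + y *s u) - g (z + y *s u)"]
        by (simp add: norm_minus_commute)
      then show "norm (inverse (g (z + y *s u))) \<le> 2 / m"
        using le_imp_inverse_le[of "m / 2" "norm (g (z + y *s u))"] m by (simp add: norm_inverse)
    qed
    moreover have "norm (g z) < m / 2" using close[of 0] g0 r(1) by simp
    moreover have "g z \<noteq> 0" using no inU[OF zK(1), of 0] r(1) by (auto dest: spec[of _ 0])
    ultimately show False using less_imp_inverse_less[of "norm (g z)" "m / 2"] by (simp add: norm_inverse)
  qed
  then show ?thesis using \<epsilon>(1) d(1) by (intro exI[of _ "min \<epsilon> d"]) auto
qed

lemma coordinate_irr: "irr_form (\<lambda>z :: complex ^ 'k::finite option. z $ i) 1"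
  unfolding irr_form_def
proof (intro conjI allI impI)
  show "hom_fun 1 (\<lambda>z :: complex ^ 'k option. z $ i)" by (simp add: hom_fun_def polyfun_coord)
  have ax: "(axis i 1 :: complex ^ 'k option) $ i \<noteq> 0" by (simp add: axis_def)
  then show "\<exists>z :: complex ^ 'k option. z $ i \<noteq> 0" ..
  fix A B :: "complex ^ 'k option \<Rightarrow> complex" and a b
  assume *: "hom_fun a A \<and> hom_fun b B \<and> (\<lambda>z. z $ i) = (\<lambda>z. A z * B z)"
  then have "hom_fun (a + b) (\<lambda>z. z $ i)" using hom_fun_mult[of a A b B] by simp
  then have "a + b = 1" using hom_fun_degree_unique[OF _ \<open>hom_fun 1 (\<lambda>z. z $ i)\<close>, of "a + b" "axis i 1"] ax by blast
  then show "a = 0 \<or> b = 0" by arith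
qed simp

text \<open>Otherwise the coordinate \<open>\<sigma> None\<close> divides \<open>Q\<close>, so
  \<open>Q\<close> is a constant multiple of it; but this coordinate is 1 at
  \<open>lift \<sigma> z0\<close>, where \<open>Q\<close> vanishes.\<close>

lemma irr_nonzero_on_hyperplane:
  fixes Q :: "complex ^ 'k::finite option \<Rightarrow> complex"
  assumes Q: "irr_form Q d" and \<sigma>: "bij \<sigma>" and zero: "Q (lift \<sigma> z0) = 0"
  shows "\<exists>u. Q (embed \<sigma> u) \<noteq> 0"
proof (rule ccontr)
  assume no: "\<not> ?thesis"
  let ?c = "\<lambda>z :: complex ^ 'k option. z $ \<sigma> None"
  have van: "Q z = 0" if "z $ \<sigma> None = 0" for z
  proof -
    have "z = embed \<sigma> (\<chi> j. z $ \<sigma> (Some j))" by (rule vec_eq_chart[OF \<sigma>]) (use that \<sigma> in auto)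
    then show ?thesis using no by metis
  qed
  have dvd: "pdvd ?c Q"
    by (rule irr_dvd_of_vanishing[OF coordinate_irr irr_formD(2)[OF Q] open_UNIV UNIV_I[of 0]]) (use van in auto)
  obtain v where v: "Q v \<noteq> 0" using Q unfolding irr_form_def by blast
  obtain A a b where A: "hom_fun a A" "hom_fun b ?c" "Q = (\<lambda>z. A z * ?c z)"
    using hom_fun_cofactor[OF irr_formD(1)[OF Q] v polyfun_coord dvd] by blast
  have "?c v \<noteq> 0" using v A(3) by auto
  then have "b = 1" using hom_fun_degree_unique[OF A(2)] irr_formD(1)[OF coordinate_irr] by blast
  then have "a = 0" using irr_form_factor[OF Q A] by simp
  then have "A v = A (lift \<sigma> z0)" using hom_fun_0 A(1) by metis
  then have "A v = 0" using zero A(3) \<sigma> by simp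
  then show False using v A(3) by simp
qed

lemma poly_pair_nonzero:
  fixes p q :: "complex poly"
  assumes "p \<noteq> 0" "q \<noteq> 0" shows "\<exists>t. poly p t \<noteq> 0 \<and> poly q t \<noteq> 0"
proof -
  have "p * q \<noteq> 0" using assms by simp
  then obtain t where "poly (p * q) t \<noteq> 0" using poly_all_0_iff_0 by blast
  then show ?thesis by auto
qed

text \<open>Near a regular point of codimension 1, every line in a transversal direction meets
  \<open>A\<close>, so \<open>Q1\<close> and \<open>Q2\<close> have a common root over an open set
  of base points. As \<open>Q1\<close> has finitely many sheets, \<open>Q2\<close> vanishes on one
  of them over a smaller open set, and the Nullstellensatz applies.\<close>

lemma codim_le_1_pdvd:
  fixes Q1 Q2 :: "complex ^ 'k::finite option \<Rightarrow> complex"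
  assumes codim: "codim A \<le> 1" and Q1: "irr_form Q1 d1" and Q2: "irr_form Q2 d2"
    and A1: "A \<subseteq> zset Q1" and A2: "A \<subseteq> zset Q2"
  shows "pdvd Q1 Q2"
proof -
  note h1 = irr_formD(1)[OF Q1] and h2 = irr_formD(1)[OF Q2]
  obtain c and \<sigma> :: "'k option \<Rightarrow> 'k option" and z0 where c: "c \<le> 1" and \<sigma>: "bij \<sigma>"
    and reg: "regular_point (chart_inv \<sigma> -` A) z0 c"
    using codim unfolding codim_le_iff by blast
  obtain U g where U: "open U" "z0 \<in> U" and g: "\<forall>i<c. holomorphic_fun U (g i)"
    and X: "chart_inv \<sigma> -` A \<inter> U = {z\<in>U. \<forall>i<c. g i z = 0}"
    and ind: "\<forall>a. (\<forall>v. (\<Sum>i<c. a i * frechet_derivative (g i) (at z0) v) = 0) \<longrightarrow> (\<forall>i<c. a i = 0)"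
    and z0: "z0 \<in> chart_inv \<sigma> -` A"
    using reg unfolding regular_point_def by blast
  have Q1A: "Q1 (lift \<sigma> z) = 0" "Q2 (lift \<sigma> z) = 0" if "chart_inv \<sigma> z \<in> A" for z
    using that A1 A2 chart_inv_zset[OF \<sigma> h1, of z] chart_inv_zset[OF \<sigma> h2, of z] by auto
  obtain e1 where e1: "Q1 e1 \<noteq> 0" using Q1 unfolding irr_form_def by blast
  have c1: "c = 1"
  proof (rule ccontr)
    assume "c \<noteq> 1"
    then have "c = 0" using c by simp
    then have "chart_inv \<sigma> z \<in> A" if "z \<in> U" for z using X that by auto
    then have "Q1 e1 = 0" using open_subset_zset_imp_zero[OF h1 \<sigma> U] Q1A by blast
    then show False using e1 by simp
  qed
  define G where "G = g 0"
  have G: "holomorphic_fun U G" using g c1 by (simp add: G_def)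
  have XG: "chart_inv \<sigma> z \<in> A \<longleftrightarrow> G z = 0" if "z \<in> U" for z
  proof -
    have "z \<in> chart_inv \<sigma> -` A \<inter> U \<longleftrightarrow> z \<in> {z\<in>U. \<forall>i<c. g i z = 0}" using X by simp
    then show ?thesis using that c1 by (simp add: G_def)
  qed
  obtain D where D: "(G has_derivative D) (at z0)" "\<And>c v. D (c *s v) = c * D v"
    using G U(2) unfolding holomorphic_fun_def by blast
  have fD: "frechet_derivative G (at z0) = D" using frechet_derivative_at[OF D(1)] by simp
  have Dadd: "D (x + y) = D x + D y" for x y
    using has_derivative_bounded_linear[OF D(1)] by (simp add: linear_simps)
  have "\<exists>u. D u \<noteq> 0"
  proof (rule ccontr)
    assume "\<not> ?thesis"
    then have *: "\<forall>v. (\<Sum>i<c. 1 * frechet_derivative (g i) (at z0) v) = 0"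
      using c1 fD by (simp add: G_def)
    have "\<forall>i<c. (1 :: complex) = 0" by (rule ind[THEN spec, of "\<lambda>_. 1", THEN mp, OF *])
    from this[THEN spec, of 0] show False using c1 by simp
  qed
  then obtain u3 where u3: "D u3 \<noteq> 0" by blast
  have z0A: "chart_inv \<sigma> z0 \<in> A" using z0 by simp
  \<comment> \<open>The direction has to avoid the zeros of \<open>Q1\<close>, \<open>Q2\<close> and
    \<open>D\<close> at once. Moving along lines, \<open>u4\<close> satisfies the first two
    conditions and \<open>u\<close> all three.\<close>
  obtain u1 where u1: "Q1 (embed \<sigma> u1) \<noteq> 0" using irr_nonzero_on_hyperplane[OF Q1 \<sigma>] Q1A(1)[OF z0A] by blast
  obtain u2 where u2: "Q2 (embed \<sigma> u2) \<noteq> 0" using irr_nonzero_on_hyperplane[OF Q2 \<sigma>] Q1A(2)[OF z0A] by blast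
  have polyl: "\<exists>p. \<forall>t. Q (embed \<sigma> (a + t *s b)) = poly p t" if "polyfun Q" for Q :: "complex ^ 'k option \<Rightarrow> complex" and a b
    unfolding embed_line[OF \<sigma>] using polyfun_lineE[OF that] by metis
  obtain p1 where p1: "\<And>t. Q1 (embed \<sigma> (u1 + t *s (u2 - u1))) = poly p1 t" using polyl[OF irr_formD(2)[OF Q1]] by blast
  obtain p2 where p2: "\<And>t. Q2 (embed \<sigma> (u1 + t *s (u2 - u1))) = poly p2 t" using polyl[OF irr_formD(2)[OF Q2]] by blast
  have "p1 \<noteq> 0" "p2 \<noteq> 0" using p1[of 0] p2[of 1] u1 u2 by auto
  then obtain t where "poly p1 t \<noteq> 0" "poly p2 t \<noteq> 0" using poly_pair_nonzero by blast
  then obtain u4 where u4: "Q1 (embed \<sigma> u4) \<noteq> 0" "Q2 (embed \<sigma> u4) \<noteq> 0" using p1 p2 by metis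
  obtain q1 where q1: "\<And>t. Q1 (embed \<sigma> (u4 + t *s (u3 - u4))) = poly q1 t" using polyl[OF irr_formD(2)[OF Q1]] by blast
  obtain q2 where q2: "\<And>t. Q2 (embed \<sigma> (u4 + t *s (u3 - u4))) = poly q2 t" using polyl[OF irr_formD(2)[OF Q2]] by blast
  let ?q3 = "[:D u4, D (u3 - u4):]"
  have q3: "D (u4 + t *s (u3 - u4)) = poly ?q3 t" for t by (simp only: Dadd D(2)) simp
  have "D (u4 + 1 *s (u3 - u4)) \<noteq> 0" using u3 by simp
  then have "?q3 \<noteq> 0" using q3[of 1] by (metis poly_0)
  moreover have "q1 \<noteq> 0" "q2 \<noteq> 0" using q1[of 0] q2[of 0] u4 by auto
  ultimately obtain t where "poly (q1 * q2) t \<noteq> 0" "poly ?q3 t \<noteq> 0" using poly_pair_nonzero[of "q1 * q2" ?q3] by auto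
  then have "Q1 (embed \<sigma> (u4 + t *s (u3 - u4))) \<noteq> 0 \<and> Q2 (embed \<sigma> (u4 + t *s (u3 - u4))) \<noteq> 0 \<and> D (u4 + t *s (u3 - u4)) \<noteq> 0"
    using q1 q2 q3 by simp
  then obtain u where u: "Q1 (embed \<sigma> u) \<noteq> 0" "Q2 (embed \<sigma> u) \<noteq> 0" "D u \<noteq> 0" by blast
  define v where "v = embed \<sigma> u"
  have v: "Q1 v \<noteq> 0" "Q2 v \<noteq> 0" using u by (simp_all add: v_def)
  have "G z0 = 0" using XG[OF U(2)] z0A by simp
  then obtain \<delta> where \<delta>: "\<delta> > 0" "\<And>z. z \<in> ball z0 \<delta> \<Longrightarrow> \<exists>y. z + y *s u \<in> U \<and> G (z + y *s u) = 0"
    using isolated_zero_persists[OF G U _ D u(3)] by blast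
  \<comment> \<open>The cone over the ball turns the statement about the chart into one about base
    points for roots in the direction \<open>v\<close>.\<close>
  let ?O = "{x. x $ \<sigma> None \<noteq> 0 \<and> chartv \<sigma> x \<in> ball z0 \<delta>}"
  have O: "open ?O" by (rule open_chartv_vimage) simp
  have "lift \<sigma> z0 \<in> ?O" using \<delta>(1) \<sigma> by (simp add: chartv_lift)
  then have Une: "?O \<noteq> {}" by blast
  have common: "\<exists>y. Q1 (x + y *s v) = 0 \<and> Q2 (x + y *s v) = 0" if x: "x \<in> ?O" for x
  proof -
    let ?s = "x $ \<sigma> None"
    have s: "?s \<noteq> 0" using x by simp
    obtain y where y: "chartv \<sigma> x + y *s u \<in> U" "G (chartv \<sigma> x + y *s u) = 0" using \<delta>(2) x by blast
    then have inA: "chart_inv \<sigma> (chartv \<sigma> x + y *s u) \<in> A" using XG by blast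
    have "lift \<sigma> (chartv \<sigma> x + y *s u) = inverse ?s *s (x + (?s * y) *s v)"
      unfolding lift_line[OF \<sigma>] lift_chartv[OF \<sigma> s] v_def using s by (simp add: vec_eq_iff field_simps)
    then have "Q1 (inverse ?s *s (x + (?s * y) *s v)) = 0" "Q2 (inverse ?s *s (x + (?s * y) *s v)) = 0"
      using Q1A[OF inA] by simp_all
    then have "inverse ?s ^ d1 * Q1 (x + (?s * y) *s v) = 0" "inverse ?s ^ d2 * Q2 (x + (?s * y) *s v) = 0"
      by (simp_all only: hom_funD(2)[OF h1] hom_funD(2)[OF h2])
    then have "Q1 (x + (?s * y) *s v) = 0" "Q2 (x + (?s * y) *s v) = 0" using s by simp_all
    then show ?thesis by blast
  qed
  obtain \<Omega> where base: "root_base Q1 v \<Omega>" using root_base_exists[OF h1 v(1) irr_formD(3)[OF Q1]] by blast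
  obtain x1 where x1: "x1 \<in> ?O" "x1 \<in> \<Omega>" using cothin_dense[OF _ O Une] base unfolding root_base_def by blast
  have *: "\<And>x. card (roots_along Q1 v x) \<le> card (roots_along Q1 v x1)"
    using base x1(2) by (auto simp: root_base_def maxroots_def)
  obtain \<epsilon> \<rho> \<phi> where sh: "root_sheets Q1 v x1 \<epsilon> \<rho> \<phi>" using root_sheets_exist[OF h1 v(1) *] by blast
  let ?R = "roots_along Q1 v x1"
  let ?V = "ball x1 \<epsilon> \<inter> ?O"
  have "x1 \<in> ?V" using x1(1) root_sheets.eps_pos[OF sh] by simp
  then have V: "open ?V" "?V \<noteq> {}" using open_Int[OF open_ball O] by blast+
  have fin: "finite ?R" by (rule finite_roots_along(1)[OF h1 v(1)])
  have "\<exists>r\<in>?R. \<exists>U'. open U' \<and> U' \<noteq> {} \<and> U' \<subseteq> ?V \<and> (\<forall>x\<in>U'. Q2 (x + \<phi> r x *s v) = 0)"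
  proof (rule finite_prod_zero_open[OF fin V])
    fix r assume r: "r \<in> ?R"
    have "continuous_on ?V (\<phi> r)" by (rule continuous_on_subset[OF root_sheets.sheet_continuous[OF sh r]]) auto
    then show "continuous_on ?V (\<lambda>x. Q2 (x + \<phi> r x *s v))"
      by (intro polyfun_continuous_compose[OF irr_formD(2)[OF Q2]] continuous_intros)
  next
    fix x assume x: "x \<in> ?V"
    then obtain y where y: "Q1 (x + y *s v) = 0" "Q2 (x + y *s v) = 0" using common by blast
    then have "y \<in> (\<lambda>r. \<phi> r x) ` ?R"
      using root_sheets.roots_sheets[OF sh, of x] x by (auto simp: roots_along_def)
    then obtain r where r: "r \<in> ?R" "y = \<phi> r x" by blast
    then have "Q2 (x + \<phi> r x *s v) = 0" using y(2) by simp
    then show "(\<Prod>r\<in>?R. Q2 (x + \<phi> r x *s v)) = 0" using fin r(1) by (intro prod_zero) blast+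
  qed
  then obtain r U' where r: "r \<in> ?R" and U': "open U'" "U' \<noteq> {}" "U' \<subseteq> ?V" "\<And>x. x \<in> U' \<Longrightarrow> Q2 (x + \<phi> r x *s v) = 0"
    by blast
  obtain x2 where x2: "x2 \<in> U'" using U'(2) by blast
  let ?y = "\<phi> r x2"
  \<comment> \<open>A zero \<open>z\<close> of \<open>Q1\<close> in \<open>?W\<close> has the root
    \<open>?y\<close> over \<open>z - ?y v\<close>, and the disc of radius \<rho> forces this root
    onto the sheet \<open>r\<close>, where \<open>Q2\<close> vanishes.\<close>
  let ?W = "(\<lambda>z. z - ?y *s v) -` U'"
  have x2b: "x2 \<in> ball x1 \<epsilon>" using x2 U'(3) by blast
  have y2: "Q1 (x2 + ?y *s v) = 0" "dist ?y r < \<rho>" using root_sheets.sheet_root[OF sh r x2b] by auto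
  have W: "open ?W" by (rule open_vimage[OF U'(1)]) (intro continuous_intros)
  show ?thesis
  proof (rule irr_dvd_of_vanishing[OF Q1 irr_formD(2)[OF Q2] W _ y2(1)])
    show "x2 + ?y *s v \<in> ?W" using x2 by simp
    fix z assume z: "z \<in> ?W" "Q1 z = 0"
    let ?x = "z - ?y *s v"
    have xU: "?x \<in> U'" using z by simp
    then have xb: "?x \<in> ball x1 \<epsilon>" using U'(3) by blast
    have eq: "?y = \<phi> r ?x" by (rule root_sheets.sheet_unique[OF sh r xb _ y2(2)]) (use z in simp)
    have "Q2 (?x + ?y *s v) = 0" using U'(4)[OF xU] by (simp only: eq[symmetric])
    then show "Q2 z = 0" by simp
  qed
qed

text \<open>Vanishing on some non-empty open piece is a prime property: where \<open>B\<close> is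
  non-zero, which is an open condition, \<open>A\<close> vanishes.\<close>

lemma irr_factor_on_piece:
  assumes R: "hom_fun d R" "R w0 \<noteq> 0" and U: "open U" "T \<inter> U \<noteq> {}" "T \<inter> U \<subseteq> zset R"
  shows "\<exists>Q e U'. irr_form Q e \<and> pdvd Q R \<and> open U' \<and> U' \<subseteq> U \<and> T \<inter> U' \<noteq> {} \<and> T \<inter> U' \<subseteq> zset Q"
proof -
  define \<Phi> where "\<Phi> R \<longleftrightarrow> (\<exists>U'. open U' \<and> U' \<subseteq> U \<and> T \<inter> U' \<noteq> {} \<and> T \<inter> U' \<subseteq> zset R)" for R
  have \<Phi>R: "\<Phi> R" unfolding \<Phi>_def using U by blast
  have const: "c = 0" if "\<Phi> (\<lambda>z. c)" for c using that by (auto simp: \<Phi>_def zset_def)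
  have prime: "\<Phi> A \<or> \<Phi> B" if A: "hom_fun a A" and B: "hom_fun b B" and AB: "\<Phi> (\<lambda>z. A z * B z)" for A B a b
  proof -
    obtain U' where U': "open U'" "U' \<subseteq> U" "T \<inter> U' \<noteq> {}" "T \<inter> U' \<subseteq> zset (\<lambda>z. A z * B z)"
      using AB unfolding \<Phi>_def by blast
    then have sub: "T \<inter> (U' - zset B) \<subseteq> zset A" by (auto simp: zset_def)
    have "open (U' - zset B)" using U'(1) closed_zset[OF B] by (simp add: open_Diff)
    then have "\<Phi> A" if "\<not> T \<inter> U' \<subseteq> zset B"
      unfolding \<Phi>_def using that sub U'(2) by (intro exI[of _ "U' - zset B"]) blast
    moreover have "\<Phi> B" if "T \<inter> U' \<subseteq> zset B" unfolding \<Phi>_def using that U' by blast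
    ultimately show ?thesis by blast
  qed
  have "\<exists>Q e. irr_form Q e \<and> pdvd Q R \<and> \<Phi> Q"
    by (rule irr_factor_with[where \<Phi> = \<Phi>, OF _ _ R \<Phi>R]) (rule const prime; assumption)+
  then show ?thesis unfolding \<Phi>_def by blast
qed

text \<open>One coordinate of \<open>E\<close> yields an irreducible \<open>Q\<close> vanishing on a
  piece of \<open>H\<close>, and any other non-zero one a \<open>Q'\<close> on a smaller piece. That
  piece still has codimension 1, so \<open>Q\<close> divides \<open>Q'\<close>, and \<open>Q\<close>
  would be a common factor of the reduced \<open>E\<close>.\<close>

lemma hypersurface_not_in_common_zeros:
  assumes E: "red_form E e" and H: "hypersurface H" and U: "open U" "H \<inter> U \<noteq> {}"
    and zero: "\<And>p. p \<in> H \<inter> U \<Longrightarrow> E (rep_proj p) = 0"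
  shows False
proof -
  note hE = red_formD(1)[OF E]
  obtain w0 l where l: "E w0 $ l \<noteq> 0" using red_formD(2)[OF E] by (auto simp: vec_eq_iff)
  have "H \<inter> U \<subseteq> zset (\<lambda>z. E z $ l)" using zero by (auto simp: zset_def)
  from irr_factor_on_piece[OF hom_mapD(1)[OF hE] l U this] obtain Q e U1 where
    Q: "irr_form Q e" "pdvd Q (\<lambda>z. E z $ l)" "open U1" "U1 \<subseteq> U" "H \<inter> U1 \<noteq> {}" "H \<inter> U1 \<subseteq> zset Q" by blast
  have "pdvd Q (\<lambda>z. E z $ j)" for j
  proof (cases "\<exists>z. E z $ j \<noteq> 0")
    case True
    then obtain z where z: "E z $ j \<noteq> 0" by blast
    have "H \<inter> U1 \<subseteq> zset (\<lambda>z. E z $ j)" using zero Q(4) by (auto simp: zset_def)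
    from irr_factor_on_piece[OF hom_mapD(1)[OF hE] z Q(3,5) this] obtain Q' e' U2 where
      Q': "irr_form Q' e'" "pdvd Q' (\<lambda>z. E z $ j)" "open U2" "U2 \<subseteq> U1" "H \<inter> U2 \<noteq> {}" "H \<inter> U2 \<subseteq> zset Q'" by blast
    have "codim (H \<inter> U2) \<le> 1" using H Q'(3,5) by (simp add: hypersurface_def)
    then have "pdvd Q Q'" by (rule codim_le_1_pdvd[OF _ Q(1) Q'(1)]) (use Q Q' in auto)
    then show ?thesis using Q'(2) pdvd_trans by blast
  next
    case False
    then have "(\<lambda>z. E z $ j) = (\<lambda>z. 0)" by auto
    then show ?thesis using pdvd_zero by simp
  qed
  then show False using red_formD(3)[OF E Q(1)] by blast
qed

section \<open>Meromorphic maps and reduced forms\<close>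

definition fmap :: "(complex ^ 'k option \<Rightarrow> complex ^ 'k::finite option) \<Rightarrow> 'k proj \<rightharpoonup> 'k proj" where
  "fmap E p = (let w = E (rep_proj p) in if w = 0 then None else Some (abs_proj w))"

lemma form_map_fmap: "form_map F = fmap (eval_form F)"
  by (rule ext) (simp add: form_map_def fmap_def)

lemma fmap_abs_proj:
  assumes E: "hom_map d E" and v: "v \<noteq> 0"
  shows "fmap E (abs_proj v) = (if E v = 0 then None else Some (abs_proj (E v)))"
proof -
  obtain c where c: "c \<noteq> 0" "rep_proj (abs_proj v) = c *s v"
    using abs_proj_eqE[of v "rep_proj (abs_proj v)"] abs_rep_proj rep_proj_nonzero v by metis
  have "E (rep_proj (abs_proj v)) = c ^ d *s E v" unfolding c(2) by (rule hom_map_scale[OF E])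
  then show ?thesis using c(1) abs_proj_scale[of "c ^ d" "E v"] by (simp add: fmap_def Let_def vec.scale_eq_0_iff)
qed

lemma fmap_SomeE:
  assumes "hom_map d E" "fmap E (abs_proj v) = Some q" "v \<noteq> 0"
  shows "E v \<noteq> 0" "q = abs_proj (E v)"
  using assms fmap_abs_proj[OF assms(1,3)] by (auto split: if_splits)

lemma meromorphic_map_iff: "meromorphic_map f \<longleftrightarrow> (\<exists>E d. red_form E d \<and> f = fmap E)"
  unfolding meromorphic_map_def form_map_fmap
  using reduced_form_imp_red_form red_form_imp_reduced_form by metis

lemma in_map_graph: "(a, b) \<in> Map.graph m \<longleftrightarrow> m a = Some b"
  by (auto simp: Map.graph_def)

text \<open>These cross products are closed conditions that hold on the graph. They determine the
  image point wherever \<open>E\<close> is non-zero.\<close>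

lemma graph_closure_cross:
  assumes E: "hom_map d E" and cl: "(abs_proj z, abs_proj w) \<in> closure (Map.graph (fmap E))"
    and z: "z \<noteq> 0" and w: "w \<noteq> 0"
  shows "w $ i * E z $ j = w $ j * E z $ i"
proof (rule ccontr)
  assume no: "\<not> ?thesis"
  let ?N = "{p. snd p $ i * E (fst p) $ j - snd p $ j * E (fst p) $ i \<noteq> 0} \<inter> ({v. v \<noteq> 0} \<times> {v. v \<noteq> 0})"
  have c: "continuous_on UNIV (\<lambda>p :: (complex ^ 'a option) \<times> (complex ^ 'a option). E (fst p) $ l)" for l
    by (rule polyfun_continuous_compose[OF hom_mapD(2)[OF E]]) (intro continuous_intros)
  have "open ?N"
    by (intro open_Int open_Times open_nonzero open_Collect_neq continuous_intros c)
  moreover have "(z, w) \<in> ?N" using no z w by simp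
  ultimately obtain A B where AB: "open A" "open B" "(z, w) \<in> A \<times> B" "A \<times> B \<subseteq> ?N"
    by (rule open_prod_elim)
  have A0: "0 \<notin> A" and B0: "0 \<notin> B" using AB(3,4) by auto
  let ?S = "(abs_proj ` A) \<times> (abs_proj ` B)"
  have "open ?S" by (intro open_Times open_abs_proj_image AB A0 B0)
  moreover have "(abs_proj z, abs_proj w) \<in> ?S" using AB(3) by auto
  ultimately have "?S \<inter> Map.graph (fmap E) \<noteq> {}"
    using cl open_Int_closure_eq_empty[of ?S "Map.graph (fmap E)"] by blast
  then obtain z' w' where *: "z' \<in> A" "w' \<in> B" "fmap E (abs_proj z') = Some (abs_proj w')"
    by (auto simp: in_map_graph)
  have z': "z' \<noteq> 0" and w': "w' \<noteq> 0" using * A0 B0 by auto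
  have "E z' \<noteq> 0" "abs_proj (E z') = abs_proj w'" using fmap_SomeE[OF E *(3) z'] by auto
  then obtain e where "w' = e *s E z'" using abs_proj_eqE[of "E z'" w'] w' by metis
  then have "w' $ i * E z' $ j - w' $ j * E z' $ i = 0" by simp
  moreover have "(z', w') \<in> ?N" using AB(4) * by blast
  ultimately show False by simp
qed

lemma hom_fun_0_scale:
  assumes "hom_fun 0 C" "E' = (\<lambda>z. C z *s E z)" "E' z0 \<noteq> 0" "hom_map d E"
  shows "fmap E' = fmap E"
proof
  fix p
  have C: "C z = C 0" for z using hom_fun_0[OF assms(1)] .
  have "C z0 \<noteq> 0" using assms(2,3) by auto
  then have "C (rep_proj p) \<noteq> 0" using C by metis
  then show "fmap E' p = fmap E p"
    using abs_proj_scale[of "C (rep_proj p)" "E (rep_proj p)"]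
    by (auto simp: fmap_def Let_def assms(2) vec.scale_eq_0_iff)
qed

text \<open>Makes the descriptions \<open>THE\<close> in the definitions of degree and composition
  unambiguous: two reduced forms with the same graph closure are multiples of each other, so the
  degrees agree and the factor is constant.\<close>

lemma fmap_unique:
  fixes E :: "complex ^ 'k::finite option \<Rightarrow> complex ^ 'k option"
  assumes E: "red_form E d" and E': "red_form E' d'" and graph: "mero_graph (fmap E) = mero_graph (fmap E')"
  shows "d = d'" "fmap E = fmap E'"
proof -
  note h = red_formD(1)[OF E] and h' = red_formD(1)[OF E']
  have cr: "E z $ i * E' z $ j = E z $ j * E' z $ i" if z: "z \<noteq> 0" for z i j
  proof (cases "E z = 0")
    case False
    have "fmap E (abs_proj z) = Some (abs_proj (E z))" using fmap_abs_proj[OF h z] False by simp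
    then have "(abs_proj z, abs_proj (E z)) \<in> closure (Map.graph (fmap E))"
      using closure_subset by (force simp: in_map_graph)
    then have "(abs_proj z, abs_proj (E z)) \<in> closure (Map.graph (fmap E'))" using graph by (simp add: mero_graph_def)
    then show ?thesis by (rule graph_closure_cross[OF h' _ z False])
  qed simp
  \<comment> \<open>Extends the cross identity to the origin, which represents no point.\<close>
  have co: "cothin {x :: complex ^ 'k option. x $ None \<noteq> 0}"
    by (rule cothin_polyfun_nonzero[OF polyfun_coord, of "axis None 1"]) (simp add: axis_def)
  have "(\<lambda>z. E z $ i * E' z $ j) = (\<lambda>z. E z $ j * E' z $ i)" for i j
  proof (rule cothin_polyfun_eq[OF co])
    fix x :: "complex ^ 'k option" assume "x \<in> {x. x $ None \<noteq> 0}"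
    then have "x \<noteq> 0" by auto
    then show "E x $ i * E' x $ j = E x $ j * E' x $ i" by (rule cr)
  qed (intro polyfun_mult hom_mapD(2)[OF h] hom_mapD(2)[OF h'])+
  then have cross: "E z $ i * E' z $ j = E z $ j * E' z $ i" for z i j by metis
  obtain z0 z1 where z0: "E z0 \<noteq> 0" and z1: "E' z1 \<noteq> 0" using red_formD(2) E E' by metis
  obtain C c where C: "hom_fun c C" "E = (\<lambda>z. C z *s E' z)" "d = c + d'"
    using proportional_form[OF E' h z0 cross] by blast
  have cross': "E' z $ i * E z $ j = E' z $ j * E z $ i" for z i j
    using cross[of z j i] by (simp add: mult.commute)
  obtain c' where "d' = c' + d" using proportional_form[OF E h' z1 cross'] by blast
  then have "c = 0" using C(3) by simp
  then show "d = d'" using C(3) by simp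
  show "fmap E = fmap E'" using hom_fun_0_scale[OF _ C(2) z0 h'] C(1) \<open>c = 0\<close> by simp
qed

lemma alg_degree_fmap:
  assumes E: "red_form E d" shows "alg_degree (fmap E) = d"
  unfolding alg_degree_def
proof (rule the_equality)
  show "\<exists>F. reduced_form F d \<and> fmap E = form_map F"
    using red_form_imp_reduced_form[OF E] by (auto simp: form_map_fmap)
  fix d' assume "\<exists>F. reduced_form F d' \<and> fmap E = form_map F"
  then obtain F where F: "reduced_form F d'" "fmap E = fmap (eval_form F)" by (auto simp: form_map_fmap)
  show "d' = d"
    using fmap_unique(1)[OF E reduced_form_imp_red_form[OF F(1)]] F(2) by simp
qed

lemma open_hom_map_vimage:
  assumes "hom_map d E" "open S" shows "open (E -` S)"
  by (rule open_vimage[OF assms(2) hom_map_continuous[OF assms(1)]])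

text \<open>One inclusion is cancellation of \<open>C\<close>. For the other, points where the
  composite is defined directly are dense, because \<open>A (B z0)\<close> is non-zero, and
  continuity of \<open>E\<close> approximates the remaining graph points by them.\<close>

lemma mero_comp_fmap:
  fixes A B :: "complex ^ 'k::finite option \<Rightarrow> complex ^ 'k option"
  assumes A: "red_form A a" and B: "red_form B b" and nz: "A (B z0) \<noteq> 0"
    and E: "red_form E e" and C: "(\<lambda>z. A (B z)) = (\<lambda>z. C z *s E z)"
  shows "mero_comp (fmap A) (fmap B) = fmap E"
proof -
  note hA = red_formD(1)[OF A] and hB = red_formD(1)[OF B] and hE = red_formD(1)[OF E]
  have AB: "A (B z) = C z *s E z" for z using fun_cong[OF C, of z] .
  have graph: "mero_graph (fmap E) = closure (Map.graph (fmap A \<circ>\<^sub>m fmap B))"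
    unfolding mero_graph_def
  proof (rule antisym)
    show "closure (Map.graph (fmap A \<circ>\<^sub>m fmap B)) \<subseteq> closure (Map.graph (fmap E))"
    proof (intro closure_mono subsetI)
      fix pq assume "pq \<in> Map.graph (fmap A \<circ>\<^sub>m fmap B)"
      then obtain p q r where pq: "pq = (p, q)" "fmap B p = Some r" "fmap A r = Some q"
        by (cases pq) (auto simp: in_map_graph map_comp_Some_iff)
      obtain z where z: "z \<noteq> 0" "p = abs_proj z" using proj_cases by blast
      have Bz: "B z \<noteq> 0" "r = abs_proj (B z)" using fmap_SomeE[OF hB _ z(1)] pq(2) z(2) by auto
      have Az: "A (B z) \<noteq> 0" "q = abs_proj (A (B z))" using fmap_SomeE[OF hA _ Bz(1)] pq(3) Bz(2) by auto
      have "C z \<noteq> 0" "E z \<noteq> 0" using Az(1) AB[of z] by auto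
      then have "fmap E p = Some q"
        using fmap_abs_proj[OF hE z(1)] z(2) Az(2) AB[of z] abs_proj_scale[of "C z" "E z"] by simp
      then show "pq \<in> Map.graph (fmap E)" using pq(1) by (simp add: in_map_graph)
    qed
    have "Map.graph (fmap E) \<subseteq> closure (Map.graph (fmap A \<circ>\<^sub>m fmap B))"
    proof (rule subsetI, rule ccontr)
      fix pq assume pq: "pq \<in> Map.graph (fmap E)" and no: "pq \<notin> closure (Map.graph (fmap A \<circ>\<^sub>m fmap B))"
      obtain p q where [simp]: "pq = (p, q)" by (cases pq)
      obtain z where z: "z \<noteq> 0" "p = abs_proj z" using proj_cases by blast
      have "fmap E (abs_proj z) = Some q" using pq z(2) by (simp add: in_map_graph)
      then have Ez: "E z \<noteq> 0" "q = abs_proj (E z)" using fmap_SomeE[OF hE _ z(1)] by auto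
      let ?S = "- closure (Map.graph (fmap A \<circ>\<^sub>m fmap B))"
      have "open ?S" by (rule open_Compl[OF closed_closure])
      moreover have "(p, q) \<in> ?S" using no by simp
      ultimately obtain A1 B1 where AB1: "open A1" "open B1" "(p, q) \<in> A1 \<times> B1" "A1 \<times> B1 \<subseteq> ?S" by (rule open_prod_elim)
      let ?O = "pcone A1 \<inter> E -` pcone B1"
      have O: "open ?O" using AB1(1,2) open_hom_map_vimage[OF hE] unfolding open_iff_pcone by (simp add: open_Int)
      have "z \<in> ?O" using z Ez AB1(3) by (simp add: pcone_def)
      then have One: "?O \<noteq> {}" by blast
      obtain l where l: "A (B z0) $ l \<noteq> 0" using nz by (auto simp: vec_eq_iff)
      obtain z1 m where m: "B z1 $ m \<noteq> 0" using red_formD(2)[OF B] by (auto simp: vec_eq_iff)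
      have "cothin ({x. A (B x) $ l \<noteq> 0} \<inter> {x. B x $ m \<noteq> 0})"
        by (intro cothin_Int cothin_polyfun_nonzero[where z = z0] cothin_polyfun_nonzero[where z = z1] hom_mapD(2)[OF hB]
            hom_mapD(2)[OF hom_map_compose[OF hA hB]] l m)
      then obtain x where x: "x \<in> ?O" "A (B x) $ l \<noteq> 0" "B x $ m \<noteq> 0" using cothin_dense[OF _ O One] by blast
      have x0: "x \<noteq> 0" "abs_proj x \<in> A1" "E x \<noteq> 0" "abs_proj (E x) \<in> B1" using x(1) by (auto simp: pcone_def)
      have Bx: "B x \<noteq> 0" "A (B x) \<noteq> 0" using x(2,3) by auto
      have "C x \<noteq> 0" using Bx(2) AB[of x] by auto
      then have "abs_proj (A (B x)) = abs_proj (E x)" using AB[of x] abs_proj_scale[of "C x" "E x"] x0(3) by simp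
      then have "(fmap A \<circ>\<^sub>m fmap B) (abs_proj x) = Some (abs_proj (E x))"
        using fmap_abs_proj[OF hB x0(1)] fmap_abs_proj[OF hA Bx(1)] Bx by (simp add: map_comp_def)
      then have "(abs_proj x, abs_proj (E x)) \<in> Map.graph (fmap A \<circ>\<^sub>m fmap B)" by (rule in_map_graph[THEN iffD2])
      then have "(abs_proj x, abs_proj (E x)) \<notin> ?S" using closure_subset by blast
      then show False using AB1(4) x0 by blast
    qed
    then show "closure (Map.graph (fmap E)) \<subseteq> closure (Map.graph (fmap A \<circ>\<^sub>m fmap B))"
      by (intro closure_minimal) auto
  qed
  show ?thesis
    unfolding mero_comp_def
  proof (rule the_equality)
    show "meromorphic_map (fmap E) \<and> mero_graph (fmap E) = closure (Map.graph (fmap A \<circ>\<^sub>m fmap B))"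
      using graph E meromorphic_map_iff by blast
    fix h assume h: "meromorphic_map h \<and> mero_graph h = closure (Map.graph (fmap A \<circ>\<^sub>m fmap B))"
    then obtain E' d' where "red_form E' d'" "h = fmap E'" using meromorphic_map_iff by blast
    then show "h = fmap E" using fmap_unique(2)[OF _ E] h graph by auto
  qed
qed

section \<open>Dominating maps\<close>

lemma has_derivative_complex_linear_surj:
  fixes D :: "complex ^ 'k::finite \<Rightarrow> complex ^ 'k"
  assumes add: "\<And>x y. D (x + y) = D x + D y" and lin: "\<And>c v. D (c *s v) = c *s D v"
    and det: "det (matrix D) \<noteq> 0"
  shows "\<exists>g. bounded_linear g \<and> D \<circ> g = id"
proof -
  have "Vector_Spaces.linear (*s) (*s) D" by unfold_locales (simp_all add: add lin)
  then have works: "matrix D *v x = D x" for x by (rule matrix_works)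
  obtain M where M: "matrix D ** M = mat 1"
    using det invertible_det_nz[of "matrix D"] unfolding invertible_def by blast
  have "linear (\<lambda>v. M *v v)"
  proof (rule linearI)
    fix x y :: "complex ^ 'k" and r :: real
    show "M *v (x + y) = M *v x + M *v y" by (rule matrix_vector_right_distrib)
    show "M *v (r *\<^sub>R x) = r *\<^sub>R (M *v x)" by (simp add: vec_eq_iff matrix_vector_mult_def scaleR_sum_right)
  qed
  then have "bounded_linear (\<lambda>v. M *v v)" by (simp add: linear_conv_bounded_linear)
  moreover have "D (M *v v) = v" for v unfolding works[symmetric] matrix_vector_mul_assoc M by simp
  ultimately show ?thesis by (intro exI[of _ "\<lambda>v. M *v v"]) auto
qed

text \<open>At a point with non-zero Jacobian the open mapping theorem yields an open set in the
  image, on which a non-zero form cannot vanish.\<close>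

lemma dominating_compose_nonzero:
  fixes B :: "complex ^ 'k::finite option \<Rightarrow> complex ^ 'k option"
  assumes B: "red_form B b" and dom: "dominating (fmap B)" and R: "hom_fun e R" "R w0 \<noteq> 0"
  shows "\<exists>z. R (B z) \<noteq> 0"
proof (rule ccontr)
  assume "\<not> ?thesis"
  then have RB: "R (B z) = 0" for z by blast
  note hB = red_formD(1)[OF B]
  let ?i = "id :: 'k option \<Rightarrow> 'k option"
  define h where "h = (\<lambda>z. chart ?i (the (fmap B (chart_inv ?i z))))"
  obtain w q where w: "fmap B (chart_inv ?i w) = Some q" "chart_dom ?i q"
    and det: "det (matrix (frechet_derivative h (at w))) \<noteq> 0"
    using dom[unfolded dominating_def, rule_format, of ?i ?i] unfolding h_def by auto
  have rel: "proj_rel v v" if "v \<noteq> 0" for v :: "complex ^ 'k option" by (rule proj_rel_refl[OF that])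
  define L where "L = lift ?i"
  have L0: "L z \<noteq> 0" for z unfolding L_def by (rule lift_nonzero) simp
  have ci: "chart_inv ?i z = abs_proj (L z)" for z by (simp add: chart_inv_lift L_def)
  have Bw: "B (L w) \<noteq> 0" "q = abs_proj (B (L w))" using fmap_SomeE[OF hB w(1)[unfolded ci] L0] by auto
  have Bw0: "B (L w) $ None \<noteq> 0" using w(2) chart_dom.abs_eq[OF rel[OF Bw(1)], of ?i] Bw(2) by simp
  define N where "N = {z. B (L z) $ None \<noteq> 0}"
  define k where "k = (\<lambda>z. chartv ?i (B (L z)))"
  have hk: "h z = k z" if z: "z \<in> N" for z
  proof -
    have nz: "B (L z) \<noteq> 0" using z by (auto simp: N_def)
    then have "fmap B (chart_inv ?i z) = Some (abs_proj (B (L z)))" using fmap_abs_proj[OF hB L0] by (simp add: ci)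
    then show ?thesis using chart.abs_eq[OF rel[OF nz], of ?i] by (simp add: h_def k_def chartv_def)
  qed
  have fB: "holomorphic_fun UNIV (\<lambda>z. B (L z) $ j)" for j
    unfolding L_def by (rule holomorphic_fun_polyfun_lift[OF hom_mapD(2)[OF hB]])
  have cB: "continuous_on S (\<lambda>z. B (L z) $ j)" for S j
    using holomorphic_fun_continuous[OF fB] continuous_on_subset by blast
  have N: "open N" unfolding N_def by (intro open_Collect_neq cB continuous_on_const)
  have wN: "w \<in> N" using Bw0 by (simp add: N_def)
  have "\<exists>D. ((\<lambda>z. B (L z) $ j) has_derivative D) (at w) \<and> (\<forall>c v. D (c *s v) = c * D v)" for j
    using fB unfolding holomorphic_fun_def by blast
  then obtain Dj where Dj: "\<And>j. ((\<lambda>z. B (L z) $ j) has_derivative Dj j) (at w)" "\<And>j c v. Dj j (c *s v) = c * Dj j v"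
    by metis
  define D where "D v = (\<chi> j. - (B (L w) $ Some j) * (inverse (B (L w) $ None) * Dj None v * inverse (B (L w) $ None))
      + Dj (Some j) v / B (L w) $ None)" for v
  have "(k has_derivative D) (at w)"
    unfolding k_def chartv_def D_def id_apply
    by (intro has_derivative_vec has_derivative_divide Dj(1) Bw0)
  note kD = this
  have hD: "(h has_derivative D) (at w)"
    by (rule has_derivative_transform_within_open[OF kD N wN]) (simp add: hk)
  have "frechet_derivative h (at w) = D" using frechet_derivative_at[OF hD] by simp
  then have detD: "det (matrix D) \<noteq> 0" using det by simp
  have add: "D (x + y) = D x + D y" for x y
    using has_derivative_bounded_linear[OF kD] by (simp add: linear_simps)
  have lin: "D (c *s v) = c *s D v" for c v by (simp add: D_def vec_eq_iff Dj(2) algebra_simps)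
  obtain g where g: "bounded_linear g" "D \<circ> g = id" using has_derivative_complex_linear_surj[OF add lin detD] by blast
  have kc: "continuous_on N k"
    unfolding k_def chartv_def id_apply by (intro continuous_on_vec_lambda continuous_on_divide cB) (simp add: N_def)
  have "w \<in> interior N" using wN N by (simp add: interior_open)
  then have int: "k w \<in> interior (k ` N)" by (rule sussmann_open_mapping[OF N kc wN kD g subset_refl])
  have "R w0 = 0"
  proof (rule open_subset_zset_imp_zero[OF R(1) bij_id open_interior int])
    fix y assume "y \<in> interior (k ` N)"
    then obtain z where z: "z \<in> N" "y = k z" using interior_subset by blast
    have "lift ?i y = inverse (B (L z) $ ?i None) *s B (L z)"
      unfolding z(2) k_def by (rule lift_chartv[OF bij_id]) (use z(1) in \<open>simp add: N_def\<close>)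
    then show "R (lift ?i y) = 0" using hom_funD(2)[OF R(1)] RB by simp
  qed
  then show False using R(2) by simp
qed

section \<open>The degree recurrence\<close>

text \<open>Decreasing ratios stay above their limit, so \<open>a 0 = 1\<close> gives
  \<open>L ^ n \<le> a n\<close>. An eventual bound of the ratios by \<open>c > L\<close> gives
  \<open>a n \<le> K c ^ n\<close>, and the constant disappears in the root.\<close>

lemma root_limit_of_ratio_limit:
  fixes a :: "nat \<Rightarrow> real"
  assumes a0: "a 0 = 1" and pos: "\<And>n. a n > 0" and dec: "decseq (\<lambda>n. a (Suc n) / a n)"
    and lim: "(\<lambda>n. a (Suc n) / a n) \<longlonglongrightarrow> L" and L: "L > 0"
  shows "(\<lambda>n. a n powr (1 / real n)) \<longlonglongrightarrow> L"
proof (rule order_tendstoI)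
  let ?r = "\<lambda>n. a (Suc n) / a n"
  have step: "a (Suc n) = ?r n * a n" for n using pos[of n] by simp
  have Lr: "L \<le> ?r n" for n by (rule decseq_ge[OF dec lim])
  have lower: "L ^ n \<le> a n" for n
  proof (induction n)
    case (Suc n)
    have "L * L ^ n \<le> ?r n * a n" using Lr[of n] Suc L pos[of n] by (intro mult_mono) auto
    then show ?case using step[of n] by simp
  qed (simp add: a0)
  have lower': "L \<le> a n powr (1 / real n)" if "n \<ge> 1" for n
  proof -
    have "L = (L ^ n) powr (1 / real n)" using that L by (simp add: powr_realpow[symmetric] powr_powr)
    also have "\<dots> \<le> a n powr (1 / real n)" using lower[of n] L by (intro powr_mono2) auto
    finally show ?thesis .
  qed
  fix l assume "l < L"
  then have "l < a n powr (1 / real n)" if "n \<ge> 1" for n using lower'[OF that] by simp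
  then show "\<forall>\<^sub>F n in sequentially. l < a n powr (1 / real n)"
    unfolding eventually_sequentially by blast
next
  let ?r = "\<lambda>n. a (Suc n) / a n"
  have step: "a (Suc n) = ?r n * a n" for n using pos[of n] by simp
  fix u assume u: "L < u"
  obtain c where c: "L < c" "c < u" using dense[OF u] by blast
  have c0: "c > 0" using c L by simp
  obtain N where N: "\<And>n. n \<ge> N \<Longrightarrow> ?r n < c"
    using order_tendstoD(2)[OF lim c(1)] unfolding eventually_sequentially by blast
  have upper: "a (N + k) \<le> a N * c ^ k" for k
  proof (induction k)
    case (Suc k)
    have "?r (N + k) * a (N + k) \<le> c * (a N * c ^ k)"
      using N[of "N + k"] Suc c0 pos[of "N + k"] by (intro mult_mono) auto
    then show ?case using step[of "N + k"] by (simp add: mult_ac)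
  qed simp
  define K where "K = a N / c ^ N"
  have K: "K > 0" using pos[of N] c0 by (simp add: K_def)
  have bound: "a n \<le> K * c ^ n" if "n \<ge> N" for n
    using upper[of "n - N"] that c0 by (simp add: K_def power_diff)
  have bound': "a n powr (1 / real n) \<le> K powr (1 / real n) * c" if n: "n \<ge> max N 1" for n
  proof -
    have "a n powr (1 / real n) \<le> (K * c ^ n) powr (1 / real n)"
      using bound[of n] n pos[of n] by (intro powr_mono2) auto
    also have "\<dots> = K powr (1 / real n) * (c ^ n) powr (1 / real n)" using K c0 by (simp add: powr_mult)
    also have "(c ^ n) powr (1 / real n) = c" using n c0 by (simp add: powr_realpow[symmetric] powr_powr)
    finally show ?thesis .
  qed
  have "(\<lambda>n. K powr (1 / real n) * c) \<longlonglongrightarrow> K powr 0 * c"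
    using K by (intro tendsto_intros lim_1_over_n) auto
  then have "(\<lambda>n. K powr (1 / real n) * c) \<longlonglongrightarrow> c" using K by simp
  then have "\<forall>\<^sub>F n in sequentially. K powr (1 / real n) * c < u" using c(2) by (rule order_tendstoD)
  moreover have "\<forall>\<^sub>F n in sequentially. n \<ge> max N 1" by (rule eventually_ge_at_top)
  ultimately show "\<forall>\<^sub>F n in sequentially. a n powr (1 / real n) < u"
    by eventually_elim (use bound' in force)
qed

text \<open>The ratios \<open>r n = a (n + 1) / a n\<close> satisfy \<open>r n = d - h / (r (n - 1) \<dots> r (n - p))\<close>, so they decrease.\<close>

lemma recurrence_limit:
  fixes a :: "nat \<Rightarrow> nat" and d h p :: nat
  assumes pow: "\<And>n. n \<le> p \<Longrightarrow> a n = d ^ n" and p: "p \<ge> 1"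
    and rec: "\<And>n. a (Suc (n + p)) + h * a n = d * a (n + p)" and pos: "\<And>n. a n \<ge> 1"
  shows "\<exists>L. (\<lambda>n. real (a n) powr (1 / real n)) \<longlonglongrightarrow> L \<and> algebraic_int L \<and>
    (\<lambda>n. real (a (n + 1)) / real (a n)) \<longlonglongrightarrow> L"
proof -
  define r where "r n = real (a (Suc n)) / real (a n)" for n
  have apos: "real (a n) > 0" for n using pos[of n] by simp
  have rpos: "r n > 0" for n unfolding r_def using apos by simp
  have rd: "r n = d" if "n < p" for n
    using pow[of n] pow[of "Suc n"] that apos[of n] by (simp add: r_def)
  have rr: "r (n + p) = d - h * (a n / a (n + p))" for n
  proof -
    have "real (a (Suc (n + p))) + real h * real (a n) = real d * real (a (n + p))"
      using rec[of n] by (metis of_nat_add of_nat_mult)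
    then have "real (a (Suc (n + p))) = real d * real (a (n + p)) - real h * real (a n)" by simp
    then show ?thesis using apos[of "n + p"] by (simp add: r_def diff_divide_distrib)
  qed
  have dec: "r (Suc n) \<le> r n" for n
  proof (induction n rule: less_induct)
    case (less n)
    have mono: "k \<le> n \<Longrightarrow> r n \<le> r (n - k)" for k
    proof (induction k)
      case (Suc k)
      then have "r n \<le> r (n - k)" by simp
      also have "n - k = Suc (n - Suc k)" using Suc.prems by simp
      also have "r (Suc (n - Suc k)) \<le> r (n - Suc k)" by (rule less) (use Suc.prems in simp)
      finally show ?case .
    qed simp
    consider "Suc n < p" | "Suc n = p" | "p \<le> n" by linarith
    then show ?case
    proof cases
      case 1
      then show ?thesis using rd[of n] rd[of "Suc n"] by simp
    next
      case 2
      have "r (0 + p) \<le> d" unfolding rr by simp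
      then show ?thesis using 2 rd[of n] by simp
    next
      case 3
      define m where "m = n - p"
      have n: "n = m + p" using 3 by (simp add: m_def)
      \<comment> \<open>Comparing the ratios at \<open>m\<close> and \<open>n = m + p\<close> shows
        that \<open>a m / a (m + p)\<close> does not decrease in this step, so by \<open>rr\<close>
        the next ratio does not increase.\<close>
      have "r n \<le> r m" using mono[of p] 3 by (simp add: m_def)
      then have "real (a (Suc n)) * real (a m) \<le> real (a (Suc m)) * real (a n)"
        using apos[of n] apos[of m] by (simp add: r_def divide_le_eq field_simps)
      then have "a m / a n \<le> a (Suc m) / a (Suc n)"
        using apos[of n] apos[of "Suc n"] by (simp add: frac_le_eq field_simps)
      then have "h * (a m / a n) \<le> h * (a (Suc m) / a (Suc n))" by (intro mult_left_mono) auto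
      then show ?thesis using rr[of m] rr[of "Suc m"] by (simp add: n)
    qed
  qed
  then have decs: "decseq r" by (simp add: decseq_Suc_iff)
  obtain L where L: "r \<longlonglongrightarrow> L" using decseq_convergent[OF decs, of 0] rpos less_imp_le by metis
  \<comment> \<open>A limit below 1 would make the positive integers \<open>a n\<close> strictly
    decreasing from some index on.\<close>
  have L1: "L \<ge> 1"
  proof (rule ccontr)
    assume "\<not> L \<ge> 1"
    then have "\<forall>\<^sub>F n in sequentially. r n < 1" using order_tendstoD(2)[OF L, of 1] by simp
    then obtain N where N: "\<And>n. n \<ge> N \<Longrightarrow> r n < 1" unfolding eventually_sequentially by blast
    have less: "a (Suc n) < a n" if "n \<ge> N" for n using N[OF that] apos[of n] by (simp add: r_def)
    have "a (N + k) + k \<le> a N" for k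
    proof (induction k)
      case (Suc k)
      then show ?case using less[of "N + k"] by simp
    qed simp
    from this[of "Suc (a N)"] show False by simp
  qed
  have prod: "real (a (n + k)) / real (a n) = (\<Prod>i<k. r (n + i))" for n k
  proof (induction k)
    case 0
    then show ?case using apos[of n] by simp
  next
    case (Suc k)
    have "real (a (n + Suc k)) / real (a n) = real (a (n + k)) / real (a n) * r (n + k)"
      using apos[of "n + k"] by (simp add: r_def)
    then show ?case using Suc by simp
  qed
  have limprod: "(\<lambda>n. \<Prod>i<k. r (n + i)) \<longlonglongrightarrow> L ^ k" for k
  proof -
    have "(\<lambda>n. \<Prod>i<k. r (n + i)) \<longlonglongrightarrow> (\<Prod>i<k. L)"
      by (intro tendsto_prod LIMSEQ_ignore_initial_segment[OF L])
    then show ?thesis by simp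
  qed
  \<comment> \<open>The recurrence divided by \<open>a n\<close>. In the limit each ratio becomes
    \<open>L\<close>, which gives a monic integer equation for \<open>L\<close>.\<close>
  have eq: "(\<Prod>i<Suc p. r (n + i)) + h = d * (\<Prod>i<p. r (n + i))" for n
  proof -
    have "real (a (Suc (n + p))) + real h * real (a n) = real d * real (a (n + p))"
      using rec[of n] by (metis of_nat_add of_nat_mult)
    then have "(real (a (n + Suc p)) + real h * real (a n)) / real (a n) = real d * real (a (n + p)) / real (a n)" by simp
    then have "real (a (n + Suc p)) / real (a n) + h = d * (real (a (n + p)) / real (a n))"
      using apos[of n] by (simp add: add_divide_distrib)
    then show ?thesis unfolding prod .
  qed
  have "(\<lambda>n. (\<Prod>i<Suc p. r (n + i)) + h) \<longlonglongrightarrow> L ^ Suc p + h" by (intro tendsto_add limprod tendsto_const)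
  moreover have "(\<lambda>n. (\<Prod>i<Suc p. r (n + i)) + h) \<longlonglongrightarrow> d * L ^ p"
    unfolding eq by (intro tendsto_mult limprod tendsto_const)
  ultimately have root: "L ^ Suc p + h = d * L ^ p" by (rule LIMSEQ_unique)
  have alg: "algebraic_int L"
  proof -
    define q :: "real poly" where "q = monom 1 (Suc p) + monom (- real d) p + monom (real h) 0"
    have co: "coeff q i = (if i = Suc p then 1 else 0) + (if i = p then - real d else 0) + (if i = 0 then real h else 0)" for i
      by (auto simp: q_def)
    have "degree q \<le> Suc p" by (rule degree_le) (auto simp: co)
    moreover have "coeff q (Suc p) = 1" by (simp add: co)
    ultimately have "lead_coeff q = 1" by (metis le_antisym le_degree zero_neq_one)
    moreover have "\<forall>i. coeff q i \<in> \<int>" by (simp add: co)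
    moreover have "poly q L = 0" using root by (simp add: q_def poly_monom)
    ultimately show ?thesis by (rule algebraic_int.intros)
  qed
  have "(\<lambda>n. real (a n) powr (1 / real n)) \<longlonglongrightarrow> L"
    by (rule root_limit_of_ratio_limit) (use pow[of 0] apos decs L L1 in \<open>auto simp: r_def[abs_def]\<close>)
  then show ?thesis using alg L by (intro exI[of _ L]) (simp add: r_def[abs_def])
qed

section \<open>Iterates of a dominating map\<close>

lemma id_red_form: "red_form (\<lambda>z :: complex ^ 'k::finite option. z) 1"
  unfolding red_form_def
proof (intro conjI allI impI)
  show "hom_map 1 (\<lambda>z :: complex ^ 'k option. z)" by (simp add: hom_map_def hom_fun_def polyfun_coord)
  show "\<exists>z :: complex ^ 'k option. z \<noteq> 0" by (rule exI[of _ "axis None 1"]) (simp add: axis_eq_0_iff)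
  fix P :: "complex ^ 'k option \<Rightarrow> complex" and e assume P: "irr_form P e"
  obtain x where x: "x \<noteq> 0" "P x = 0" using irr_has_zero[OF P] by blast
  then obtain j where "x $ j \<noteq> 0" by (auto simp: vec_eq_iff)
  then have "\<not> pdvd P (\<lambda>z. z $ j)" using pdvdD[of P "\<lambda>z. z $ j" x] x(2) by blast
  then show "\<exists>j. \<not> pdvd P (\<lambda>z. z $ j)" ..
qed

lemma proportional_cancel:
  assumes E: "red_form E d" and F: "hom_map e F" "F z0 \<noteq> 0" and X: "polyfun X" "X z1 \<noteq> 0"
    and eq: "\<And>z. X z *s F z = Y z *s E z"
  shows "\<exists>C c. hom_fun c C \<and> F = (\<lambda>z. C z *s E z) \<and> e = c + d"
proof (rule proportional_form[OF E F])
  have eq': "X z * F z $ i = Y z * E z $ i" for z i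
    using arg_cong[OF eq[of z], of "\<lambda>v. v $ i"] by simp
  have "(\<lambda>z. F z $ i * E z $ j) = (\<lambda>z. F z $ j * E z $ i)" for i j
  proof (rule polyfun_cancel[OF X])
    fix z
    have "X z * (F z $ i * E z $ j) = Y z * E z $ i * E z $ j" using eq'[of z i] by (simp add: mult.assoc[symmetric])
    also have "\<dots> = X z * (F z $ j * E z $ i)" using eq'[of z j] by (simp add: mult_ac)
    finally show "X z * (F z $ i * E z $ j) = X z * (F z $ j * E z $ i)" .
  qed (intro polyfun_mult hom_mapD(2)[OF F(1)] hom_mapD(2)[OF red_formD(1)[OF E]])+
  then show "F z $ i * E z $ j = F z $ j * E z $ i" for z i j by metis
qed

locale dominating_form =
  fixes F :: "complex ^ 'k::finite option \<Rightarrow> complex ^ 'k option" and d :: nat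
  assumes red: "red_form F d" and dom: "dominating (fmap F)"
begin

definition dg :: "nat \<Rightarrow> nat" where
  "dg n = alg_degree (mero_iter (fmap F) n)"

lemma hF: "hom_map d F"
  by (rule red_formD(1)[OF red])

lemma compose_funpow_nonzero:
  assumes R: "hom_fun e R" "R w0 \<noteq> 0" shows "\<exists>z. R ((F ^^ n) z) \<noteq> 0"
  using assms
proof (induction n arbitrary: R w0 e)
  case 0
  then show ?case by auto
next
  case (Suc n)
  obtain w1 where w1: "R (F w1) \<noteq> 0" using dominating_compose_nonzero[OF red dom Suc.prems] by blast
  have "hom_fun (d * e) (\<lambda>z. R (F z))" by (rule hom_fun_compose[OF Suc.prems(1) hom_mapD(1)[OF hF]])
  from Suc.IH[OF this w1] show ?case by simp
qed

text \<open>The formal iterate \<open>F ^^ n\<close> and the reduced form differ by a scalar factor,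
  so identities between reduced forms can be checked on formal iterates. As a reduced form is fixed
  only up to a constant, the last conjunct selects the identity for \<open>n = 0\<close>.\<close>

lemma iterate_form_exists:
  "\<exists>E e A c. red_form E e \<and> mero_iter (fmap F) n = fmap E \<and> hom_fun c A \<and> (\<forall>z. (F ^^ n) z = A z *s E z) \<and>
     (n = 0 \<longrightarrow> E = (\<lambda>z. z))"
proof (induction n)
  case 0
  have "mero_iter (fmap F) 0 = fmap (\<lambda>z. z)"
    by (rule ext) (simp add: fmap_def Let_def rep_proj_nonzero abs_rep_proj)
  moreover have "hom_fun 0 (\<lambda>z. 1)" by (simp add: hom_fun_def polyfun_const)
  ultimately show ?case using id_red_form
    by (intro exI[of _ "\<lambda>z. z"] exI[of _ 1] exI[of _ "\<lambda>z. 1"] exI[of _ 0]) auto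
next
  case (Suc n)
  then obtain E e A c where E: "red_form E e" "mero_iter (fmap F) n = fmap E" "hom_fun c A" "\<And>z. (F ^^ n) z = A z *s E z" by blast
  note hE = red_formD(1)[OF E(1)]
  obtain w0 l where l: "E w0 $ l \<noteq> 0" using red_formD(2)[OF E(1)] by (auto simp: vec_eq_iff)
  obtain z0 where "E (F z0) $ l \<noteq> 0" using dominating_compose_nonzero[OF red dom hom_mapD(1)[OF hE] l] by blast
  then have z0: "E (F z0) \<noteq> 0" by auto
  obtain C c' E' e' where *: "hom_fun c' C" "red_form E' e'" "(\<lambda>z. E (F z)) = (\<lambda>z. C z *s E' z)"
    using reduce_form[OF hom_map_compose[OF hE hF] z0] by blast
  have EF: "E (F z) = C z *s E' z" for z using fun_cong[OF *(3), of z] .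
  have it: "mero_iter (fmap F) (Suc n) = fmap E'"
    using mero_comp_fmap[OF E(1) red z0 *(2,3)] E(2) by simp
  have "hom_fun (d * c + c') (\<lambda>z. A (F z) * C z)"
    by (rule hom_fun_mult[OF hom_fun_compose[OF E(3) hom_mapD(1)[OF hF]] *(1)])
  moreover have "(F ^^ Suc n) z = (A (F z) * C z) *s E' z" for z
  proof -
    have "(F ^^ Suc n) z = (F ^^ n) (F z)" by (simp add: funpow_swap1)
    then show ?thesis using E(4) EF by (simp add: vector_smult_assoc)
  qed
  ultimately show ?case using it *(2) by blast
qed

text \<open>\<open>it n\<close> and \<open>loss n\<close> are \<open>F\<^sub>n\<close> and \<open>L\<^sub>n\<close> of the introduction.\<close>

definition it :: "nat \<Rightarrow> complex ^ 'k option \<Rightarrow> complex ^ 'k option" where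
  "it n = (SOME E. \<exists>e A c. red_form E e \<and> mero_iter (fmap F) n = fmap E \<and> hom_fun c A \<and>
     (\<forall>z. (F ^^ n) z = A z *s E z) \<and> (n = 0 \<longrightarrow> E = (\<lambda>z. z)))"

lemma it_props:
  "\<exists>e A c. red_form (it n) e \<and> mero_iter (fmap F) n = fmap (it n) \<and> hom_fun c A \<and>
     (\<forall>z. (F ^^ n) z = A z *s it n z) \<and> (n = 0 \<longrightarrow> it n = (\<lambda>z. z))"
  unfolding it_def by (rule someI_ex[OF iterate_form_exists])

lemma it_red: "red_form (it n) (dg n)" and mero_iter_it: "mero_iter (fmap F) n = fmap (it n)"
  using it_props[of n] alg_degree_fmap by (auto simp: dg_def)

lemma it_0: "it 0 z = z"
  using it_props[of 0] by metis

lemma hit: "hom_map (dg n) (it n)"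
  by (rule red_formD(1)[OF it_red])

lemma funpow_it:
  "\<exists>A c. hom_fun c A \<and> (\<forall>z. (F ^^ n) z = A z *s it n z) \<and> (\<exists>z. A z \<noteq> 0)"
proof -
  obtain A c where A: "hom_fun c A" "\<And>z. (F ^^ n) z = A z *s it n z" using it_props[of n] by blast
  have "hom_fun 1 (\<lambda>z :: complex ^ 'k option. z $ None)" by (simp add: hom_fun_def polyfun_coord)
  moreover have "(axis None 1 :: complex ^ 'k option) $ None \<noteq> 0" by (simp add: axis_def)
  ultimately obtain z where "(F ^^ n) z $ None \<noteq> 0" using compose_funpow_nonzero by blast
  then have "A z \<noteq> 0" using A(2)[of z] by auto
  then show ?thesis using A by blast
qed

lemma compose_it_nonzero:
  assumes R: "hom_fun e R" "R w0 \<noteq> 0" shows "\<exists>z. R (it n z) \<noteq> 0"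
proof -
  obtain z where z: "R ((F ^^ n) z) \<noteq> 0" using compose_funpow_nonzero[OF R] by blast
  obtain A c where "hom_fun c A" "\<And>z. (F ^^ n) z = A z *s it n z" using funpow_it[of n] by blast
  then have "R (it n z) \<noteq> 0" using z hom_funD(2)[OF R(1)] by auto
  then show ?thesis by blast
qed

text \<open>Both sides are proportional to \<open>F ^^ (a + b)\<close>. The factor \<open>C\<close>
  is what cancels when the composite is reduced.\<close>

lemma it_compose:
  "\<exists>C c. hom_fun c C \<and> (\<forall>z. it a (it b z) = C z *s it (a + b) z)"
proof -
  obtain w0 l where l: "it a w0 $ l \<noteq> 0" using red_formD(2)[OF it_red] by (force simp: vec_eq_iff)
  obtain z0 where "it a (it b z0) $ l \<noteq> 0" using compose_it_nonzero[OF hom_mapD(1)[OF hit] l] by blast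
  then have z0: "it a (it b z0) \<noteq> 0" by auto
  obtain A\<^sub>a ca where Aa: "hom_fun ca A\<^sub>a" "\<And>z. (F ^^ a) z = A\<^sub>a z *s it a z" "\<exists>z. A\<^sub>a z \<noteq> 0" using funpow_it[of "a"] by blast
  obtain A\<^sub>b cb where Ab: "hom_fun cb A\<^sub>b" "\<And>z. (F ^^ b) z = A\<^sub>b z *s it b z" "\<exists>z. A\<^sub>b z \<noteq> 0" using funpow_it[of "b"] by blast
  obtain A\<^sub>c cc where Ac: "hom_fun cc A\<^sub>c" "\<And>z. (F ^^ (a + b)) z = A\<^sub>c z *s it (a + b) z" using funpow_it[of "a + b"] by blast
  obtain w1 where w1: "A\<^sub>a w1 \<noteq> 0" using Aa(3) by blast
  obtain w2 where w2: "A\<^sub>a (it b w2) \<noteq> 0" using compose_it_nonzero[OF Aa(1) w1] by blast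
  obtain w3 where w3: "A\<^sub>b w3 \<noteq> 0" using Ab(3) by blast
  \<comment> \<open>The scalar between \<open>it a \<circ> it b\<close> and the formal iterate; the
    exponent collects the degrees of the two forms through which the scalar \<open>A\<^sub>b\<close>
    is pulled.\<close>
  define X where "X z = A\<^sub>b z ^ (ca + dg a) * A\<^sub>a (it b z)" for z
  have pX1: "polyfun (\<lambda>z. A\<^sub>b z ^ (ca + dg a))" by (rule polyfun_power[OF hom_funD(1)[OF Ab(1)]])
  have pX2: "polyfun (\<lambda>z. A\<^sub>a (it b z))" by (rule polyfun_compose[OF hom_funD(1)[OF Aa(1)] hom_mapD(2)[OF hit]])
  have pX: "polyfun X" unfolding X_def[abs_def] by (rule polyfun_mult[OF pX1 pX2])
  obtain z1 where "A\<^sub>b z1 ^ (ca + dg a) \<noteq> 0" "A\<^sub>a (it b z1) \<noteq> 0"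
    using polyfun_zero_divisors[OF pX1 pX2 _ w2, of w3] w3 by auto
  then have z1: "X z1 \<noteq> 0" by (simp add: X_def)
  have "X z *s it a (it b z) = A\<^sub>c z *s it (a + b) z" for z
  proof -
    have "A\<^sub>c z *s it (a + b) z = (F ^^ a) ((F ^^ b) z)" using Ac(2)[of z] by (simp add: funpow_add)
    also have "\<dots> = A\<^sub>a (A\<^sub>b z *s it b z) *s it a (A\<^sub>b z *s it b z)" using Aa(2) Ab(2) by simp
    also have "\<dots> = X z *s it a (it b z)"
      unfolding X_def hom_funD(2)[OF Aa(1)] hom_map_scale[OF hit]
      by (simp add: vector_smult_assoc power_add mult_ac)
    finally show ?thesis by simp
  qed
  from proportional_cancel[OF it_red hom_map_compose[OF hit hit] z0 pX z1 this]
  obtain C c where "hom_fun c C" "(\<lambda>z. it a (it b z)) = (\<lambda>z. C z *s it (a + b) z)" by blast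
  then show ?thesis by metis
qed

lemma loss_exists:
  "\<exists>B b. hom_fun b B \<and> (\<forall>z. F (it n z) = B z *s it (Suc n) z) \<and> d * dg n = b + dg (Suc n) \<and> (\<exists>z. B z \<noteq> 0)"
proof -
  obtain w0 l where l: "F w0 $ l \<noteq> 0" using red_formD(2)[OF red] by (force simp: vec_eq_iff)
  obtain z0 where "F (it n z0) $ l \<noteq> 0" using compose_it_nonzero[OF hom_mapD(1)[OF hF] l] by blast
  then have z0: "F (it n z0) \<noteq> 0" by auto
  obtain A a where A: "hom_fun a A" "\<And>z. (F ^^ n) z = A z *s it n z" "\<exists>z. A z \<noteq> 0" using funpow_it[of "n"] by blast
  obtain A' a' where A': "hom_fun a' A'" "\<And>z. (F ^^ Suc n) z = A' z *s it (Suc n) z" using funpow_it[of "Suc n"] by blast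
  obtain z1 where z1: "A z1 ^ d \<noteq> 0" using A(3) by auto
  have "A z ^ d *s F (it n z) = A' z *s it (Suc n) z" for z
    using A(2)[of z] A'(2)[of z] hom_map_scale[OF hF] by simp
  from proportional_cancel[OF it_red hom_map_compose[OF hF hit] z0 polyfun_power[OF hom_funD(1)[OF A(1)]] z1 this]
  obtain B b where B: "hom_fun b B" "(\<lambda>z. F (it n z)) = (\<lambda>z. B z *s it (Suc n) z)" "dg n * d = b + dg (Suc n)" by blast
  have B2: "F (it n z) = B z *s it (Suc n) z" for z using fun_cong[OF B(2), of z] .
  then have "B z0 \<noteq> 0" using z0 by auto
  then show ?thesis using B B2 by (auto simp: mult.commute)
qed

definition loss :: "nat \<Rightarrow> complex ^ 'k option \<Rightarrow> complex" where
  "loss n = (SOME B. \<exists>b. hom_fun b B \<and> (\<forall>z. F (it n z) = B z *s it (Suc n) z) \<and> d * dg n = b + dg (Suc n) \<and> (\<exists>z. B z \<noteq> 0))"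

text \<open>The subtraction is not truncated, by the third part of \<open>loss\<close>.\<close>

definition lossdeg :: "nat \<Rightarrow> nat" where
  "lossdeg n = d * dg n - dg (Suc n)"

lemma loss: "hom_fun (lossdeg n) (loss n)" "F (it n z) = loss n z *s it (Suc n) z"
  "d * dg n = lossdeg n + dg (Suc n)" "\<exists>z. loss n z \<noteq> 0"
proof -
  have "\<exists>b. hom_fun b (loss n) \<and> (\<forall>z. F (it n z) = loss n z *s it (Suc n) z) \<and> d * dg n = b + dg (Suc n) \<and> (\<exists>z. loss n z \<noteq> 0)"
    unfolding loss_def by (rule someI_ex[OF loss_exists])
  then show "hom_fun (lossdeg n) (loss n)" "F (it n z) = loss n z *s it (Suc n) z"
    "d * dg n = lossdeg n + dg (Suc n)" "\<exists>z. loss n z \<noteq> 0"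
    by (auto simp: lossdeg_def)
qed

lemma dg_0: "dg 0 = 1"
proof -
  have "it 0 = (\<lambda>z. z)" using it_0 by blast
  then show ?thesis unfolding dg_def mero_iter_it using alg_degree_fmap[OF id_red_form] by simp
qed

text \<open>A form of degree 0 is constant, so its values satisfy a non-trivial linear equation
  \<open>L = 0\<close>, against dominance.\<close>

lemma dominant_degree_pos:
  fixes E :: "complex ^ 'k option \<Rightarrow> complex ^ 'k option"
  assumes E: "hom_map e E" "E w0 \<noteq> 0" and dominant: "\<And>R a w. hom_fun a R \<Longrightarrow> R w \<noteq> 0 \<Longrightarrow> \<exists>z. R (E z) \<noteq> 0"
  shows "e \<ge> 1"
proof (rule ccontr)
  assume "\<not> e \<ge> 1"
  then have "e = 0" by simp
  then have const: "E z = E 0" for z using hom_fun_0[of "\<lambda>z. E z $ j" z for j] hom_mapD(1)[OF E(1)] by (auto simp: vec_eq_iff)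
  let ?c = "E 0"
  have "?c \<noteq> 0" using E(2) const by metis
  then obtain j where j: "?c $ j \<noteq> 0" by (auto simp: vec_eq_iff)
  obtain i :: "'k option" where i: "i \<noteq> j" by (metis option.distinct(1))
  define L where "L x = x $ i * ?c $ j - x $ j * ?c $ i" for x :: "complex ^ 'k option"
  have "polyfun L" unfolding L_def[abs_def] by (intro polyfun_intros)
  then have "hom_fun 1 L" by (simp add: hom_fun_def L_def algebra_simps)
  moreover have "L (axis i 1) \<noteq> 0" using i j by (simp add: L_def axis_def)
  ultimately obtain z where "L (E z) \<noteq> 0" using dominant by blast
  then show False using const[of z] by (simp add: L_def)
qed

lemma d_pos: "d \<ge> 1"
proof -
  obtain w0 where "F w0 \<noteq> 0" using red_formD(2)[OF red] by blast
  then show ?thesis by (rule dominant_degree_pos[OF hF]) (rule dominating_compose_nonzero[OF red dom])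
qed

lemma dg_pos: "dg n \<ge> 1"
proof -
  obtain w0 where "it n w0 \<noteq> 0" using red_formD(2)[OF it_red] by blast
  then show ?thesis by (rule dominant_degree_pos[OF hit]) (rule compose_it_nonzero)
qed

end

section \<open>Components of hypersurfaces\<close>

lemma analytic_set_Int:
  assumes "analytic_set A" "analytic_set B" shows "analytic_set (A \<inter> B)"
  unfolding analytic_set_def local_analytic_def
proof (intro allI impI)
  fix \<sigma> :: "'a option \<Rightarrow> 'a option" and p :: "complex ^ 'a"
  assume \<sigma>: "bij \<sigma>"
  obtain U G where U: "open U" "p \<in> U" "finite G" "\<forall>g\<in>G. holomorphic_fun U g" "chart_inv \<sigma> -` A \<inter> U = {z\<in>U. \<forall>g\<in>G. g z = 0}"
    using assms(1) \<sigma> unfolding analytic_set_def local_analytic_def by meson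
  obtain V H where V: "open V" "p \<in> V" "finite H" "\<forall>g\<in>H. holomorphic_fun V g" "chart_inv \<sigma> -` B \<inter> V = {z\<in>V. \<forall>g\<in>H. g z = 0}"
    using assms(2) \<sigma> unfolding analytic_set_def local_analytic_def by meson
  have "\<forall>g\<in>G \<union> H. holomorphic_fun (U \<inter> V) g"
    using U(4) V(4) holomorphic_fun_subset[of U _ "U \<inter> V"] holomorphic_fun_subset[of V _ "U \<inter> V"] by blast
  moreover have "chart_inv \<sigma> -` (A \<inter> B) \<inter> (U \<inter> V) = (chart_inv \<sigma> -` A \<inter> U) \<inter> (chart_inv \<sigma> -` B \<inter> V)" by blast
  then have "chart_inv \<sigma> -` (A \<inter> B) \<inter> (U \<inter> V) = {z\<in>U \<inter> V. \<forall>g\<in>G \<union> H. g z = 0}"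
    unfolding U(5) V(5) by blast
  ultimately show "\<exists>U G. open U \<and> p \<in> U \<and> finite G \<and> (\<forall>g\<in>G. holomorphic_fun U g) \<and>
      chart_inv \<sigma> -` (A \<inter> B) \<inter> U = {z\<in>U. \<forall>g\<in>G. g z = 0}"
    using U(1-3) V(1-3) by (intro exI[of _ "U \<inter> V"] exI[of _ "G \<union> H"]) (simp add: open_Int)
qed

lemma irreducible_in_zset:
  assumes A: "irreducible_analytic A" and R: "hom_fun e R" "R w0 \<noteq> 0" "A \<subseteq> zset R"
  shows "\<exists>P p. irr_form P p \<and> pdvd P R \<and> A \<subseteq> zset P"
proof (rule irr_factor_with[where \<Phi> = "\<lambda>R. A \<subseteq> zset R", OF _ _ R])
  have aA: "analytic_set A" "A \<noteq> {}" using A by (auto simp: irreducible_analytic_def)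
  show "c = 0" if "A \<subseteq> zset (\<lambda>z. c)" for c using that aA(2) by (auto simp: zset_def)
  fix B C b c assume BC: "hom_fun b B" "hom_fun c C" "A \<subseteq> zset (\<lambda>z. B z * C z)"
  have "A = (A \<inter> zset B) \<union> (A \<inter> zset C)" using BC(3) by (auto simp: zset_def)
  moreover have "analytic_set (A \<inter> zset B)" "analytic_set (A \<inter> zset C)"
    by (intro analytic_set_Int aA(1) analytic_zset[OF BC(1)] analytic_zset[OF BC(2)])+
  ultimately have "A \<inter> zset B = A \<or> A \<inter> zset C = A" using A unfolding irreducible_analytic_def by blast
  then show "A \<subseteq> zset B \<or> A \<subseteq> zset C" by blast
qed

lemma irr_zset_subset:
  fixes P Q :: "complex ^ 'k::finite option \<Rightarrow> complex"
  assumes P: "irr_form P p" and Q: "irr_form Q q" and sub: "zset P \<subseteq> zset Q"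
  shows "zset Q = zset P"
proof -
  obtain x where x: "x \<noteq> 0" "P x = 0" using irr_has_zero[OF P] by blast
  have "pdvd P Q"
  proof (rule irr_dvd_of_vanishing[OF P irr_formD(2)[OF Q] open_nonzero _ x(2)])
    show "x \<in> {v. v \<noteq> 0}" using x(1) by simp
    fix z assume "z \<in> {v :: complex ^ 'k option. v \<noteq> 0}" "P z = 0"
    then show "Q z = 0"
      using sub zset_abs_proj[OF irr_formD(1)[OF P], of z] zset_abs_proj[OF irr_formD(1)[OF Q], of z] by auto
  qed
  obtain v where v: "Q v \<noteq> 0" using Q unfolding irr_form_def by blast
  obtain A a b where A: "hom_fun a A" "hom_fun b P" "Q = (\<lambda>z. A z * P z)"
    using hom_fun_cofactor[OF irr_formD(1)[OF Q] v irr_formD(2)[OF P] \<open>pdvd P Q\<close>] by blast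
  have "P v \<noteq> 0" using v A(3) by auto
  then have "b = p" using hom_fun_degree_unique[OF A(2) irr_formD(1)[OF P]] by blast
  then have "a = 0" using irr_form_factor[OF Q A] irr_formD(3)[OF P] by simp
  then have "A z = A v" for z using hom_fun_0 A(1) by metis
  moreover have "A v \<noteq> 0" using v A(3) by auto
  ultimately have "A z \<noteq> 0" for z by metis
  then show ?thesis using A(3) by (auto simp: zset_def)
qed

lemma irr_dvd_of_vanishing_off_zero:
  fixes P :: "complex ^ 'k::finite option \<Rightarrow> complex"
  assumes P: "irr_form P p" and R: "polyfun R" and van: "\<And>z. z \<noteq> 0 \<Longrightarrow> P z = 0 \<Longrightarrow> R z = 0"
  shows "pdvd P R"
proof -
  obtain x where x: "x \<noteq> 0" "P x = 0" using irr_has_zero[OF P] by blast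
  show ?thesis
    by (rule irr_dvd_of_vanishing[OF P R open_nonzero _ x(2)]) (use x van in auto)
qed

section \<open>Degree lowering hypersurfaces\<close>

context dominating_form
begin

abbreviation f :: "'k proj \<rightharpoonup> 'k proj" where "f \<equiv> fmap F"

text \<open>Algebraic form of: \<open>f\<^sup>j\<close> maps \<open>{P = 0}\<close> onto a dense subset of \<open>{Q = 0}\<close>.\<close>

definition dominates :: "(complex ^ 'k option \<Rightarrow> complex) \<Rightarrow> nat \<Rightarrow> (complex ^ 'k option \<Rightarrow> complex) \<Rightarrow> bool" where
  "dominates P j Q \<longleftrightarrow> (\<forall>R e. hom_fun e R \<longrightarrow> (pdvd P (\<lambda>z. R (it j z)) \<longleftrightarrow> pdvd Q R))"

lemma polyfun_it: "polyfun R \<Longrightarrow> polyfun (\<lambda>z. R (it n z))"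
  by (rule polyfun_compose[OF _ hom_mapD(2)[OF hit]])

lemma hom_fun_it: "hom_fun e R \<Longrightarrow> hom_fun (dg n * e) (\<lambda>z. R (it n z))"
  by (rule hom_fun_compose[OF _ hom_mapD(1)[OF hit]])

text \<open>\<open>F \<circ> it n\<close> is \<open>loss n\<close> times the reduced
  \<open>it (Suc n)\<close>, so an irreducible common factor of its coordinates can only come from
  the loss.\<close>

lemma pdvd_loss_iff:
  assumes P: "irr_form P p"
  shows "(\<forall>j. pdvd P (\<lambda>z. F (it n z) $ j)) \<longleftrightarrow> pdvd P (loss n)"
proof
  have eq: "(\<lambda>z. F (it n z) $ j) = (\<lambda>z. loss n z * it (Suc n) z $ j)" for j using loss(2) by simp
  note pl = hom_funD(1)[OF loss(1), of n]
  {
    assume *: "\<forall>j. pdvd P (\<lambda>z. F (it n z) $ j)"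
    obtain j where j: "\<not> pdvd P (\<lambda>z. it (Suc n) z $ j)" using red_formD(3)[OF it_red P] by blast
    have "pdvd P (\<lambda>z. loss n z * it (Suc n) z $ j)" using * unfolding eq by blast
    then show "pdvd P (loss n)" using irr_prime[OF P pl hom_mapD(2)[OF hit]] j by blast
  next
    assume "pdvd P (loss n)"
    then show "\<forall>j. pdvd P (\<lambda>z. F (it n z) $ j)"
      unfolding eq using pdvd_mult2[OF hom_mapD(2)[OF hit]] by blast
  }
qed

lemma closure_subset_iff: "closed S \<Longrightarrow> closure T \<subseteq> S \<longleftrightarrow> T \<subseteq> S"
  by (meson closure_minimal closure_subset subset_trans)

lemma image_subset_iff:
  assumes "closed S"
  shows "mero_image (mero_iter f n) A \<subseteq> S \<longleftrightarrow>
    (\<forall>v. v \<noteq> 0 \<longrightarrow> abs_proj v \<in> A \<longrightarrow> it n v \<noteq> 0 \<longrightarrow> abs_proj (it n v) \<in> S)"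
proof -
  have "mero_image (mero_iter f n) A \<subseteq> S \<longleftrightarrow> {w. \<exists>z\<in>A. fmap (it n) z = Some w} \<subseteq> S"
    unfolding mero_image_def mero_iter_it by (rule closure_subset_iff[OF assms])
  also have "\<dots> \<longleftrightarrow> (\<forall>v. v \<noteq> 0 \<longrightarrow> abs_proj v \<in> A \<longrightarrow> it n v \<noteq> 0 \<longrightarrow> abs_proj (it n v) \<in> S)"
  proof
    assume *: "{w. \<exists>z\<in>A. fmap (it n) z = Some w} \<subseteq> S"
    show "\<forall>v. v \<noteq> 0 \<longrightarrow> abs_proj v \<in> A \<longrightarrow> it n v \<noteq> 0 \<longrightarrow> abs_proj (it n v) \<in> S"
    proof (intro allI impI)
      fix v assume v: "v \<noteq> 0" "abs_proj v \<in> A" "it n v \<noteq> 0"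
      have "fmap (it n) (abs_proj v) = Some (abs_proj (it n v))" using fmap_abs_proj[OF hit v(1)] v(3) by simp
      then show "abs_proj (it n v) \<in> S" using * v(2) by blast
    qed
  next
    assume *: "\<forall>v. v \<noteq> 0 \<longrightarrow> abs_proj v \<in> A \<longrightarrow> it n v \<noteq> 0 \<longrightarrow> abs_proj (it n v) \<in> S"
    show "{w. \<exists>z\<in>A. fmap (it n) z = Some w} \<subseteq> S"
    proof clarify
      fix w z assume z: "z \<in> A" "fmap (it n) z = Some w"
      obtain v where v: "v \<noteq> 0" "z = abs_proj v" using proj_cases by blast
      then show "w \<in> S" using fmap_SomeE[OF hit _ v(1)] z * by blast
    qed
  qed
  finally show ?thesis .
qed

text \<open>The image ignores points where \<open>it n\<close> vanishes. Multiplying by a coordinate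
  of \<open>it n\<close> that \<open>P\<close> does not divide covers these points too, and
  primality removes the coordinate again.\<close>

lemma image_zset_subset_zset:
  assumes P: "irr_form P p" and R: "hom_fun e R"
  shows "mero_image (mero_iter f n) (zset P) \<subseteq> zset R \<longleftrightarrow> pdvd P (\<lambda>z. R (it n z))"
proof -
  have "mero_image (mero_iter f n) (zset P) \<subseteq> zset R \<longleftrightarrow>
      (\<forall>v. v \<noteq> 0 \<longrightarrow> P v = 0 \<longrightarrow> it n v \<noteq> 0 \<longrightarrow> R (it n v) = 0)"
    unfolding image_subset_iff[OF closed_zset[OF R]] using zset_abs_proj[OF irr_formD(1)[OF P]] zset_abs_proj[OF R] by blast
  also have "\<dots> \<longleftrightarrow> pdvd P (\<lambda>z. R (it n z))"
  proof
    assume *: "\<forall>v. v \<noteq> 0 \<longrightarrow> P v = 0 \<longrightarrow> it n v \<noteq> 0 \<longrightarrow> R (it n v) = 0"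
    obtain j where j: "\<not> pdvd P (\<lambda>z. it n z $ j)" using red_formD(3)[OF it_red P] by blast
    have pR: "polyfun (\<lambda>z. R (it n z))" by (rule polyfun_it[OF hom_funD(1)[OF R]])
    have "pdvd P (\<lambda>z. R (it n z) * it n z $ j)"
    proof (rule irr_dvd_of_vanishing_off_zero[OF P polyfun_mult[OF pR hom_mapD(2)[OF hit]]])
      fix z assume "z \<noteq> 0" "P z = 0"
      then show "R (it n z) * it n z $ j = 0" using * by (cases "it n z = 0") auto
    qed
    then show "pdvd P (\<lambda>z. R (it n z))" using irr_prime[OF P pR hom_mapD(2)[OF hit]] j by blast
  next
    assume *: "pdvd P (\<lambda>z. R (it n z))"
    show "\<forall>v. v \<noteq> 0 \<longrightarrow> P v = 0 \<longrightarrow> it n v \<noteq> 0 \<longrightarrow> R (it n v) = 0"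
      using pdvdD[OF *] by blast
  qed
  finally show ?thesis .
qed

lemma indeterminacy_zset: "indeterminacy f = (\<Inter>j. zset (\<lambda>z. F z $ j))"
  by (auto simp: indeterminacy_def fmap_def Let_def zset_def vec_eq_iff dom_def split: if_splits)

lemma closed_indeterminacy: "closed (indeterminacy f)"
  unfolding indeterminacy_zset by (intro closed_INT ballI closed_zset[OF hom_mapD(1)[OF hF]])

lemma indeterminacy_abs_proj:
  assumes "v \<noteq> 0" shows "abs_proj v \<in> indeterminacy f \<longleftrightarrow> F v = 0"
  unfolding indeterminacy_zset using zset_abs_proj[OF hom_mapD(1)[OF hF] assms] by (auto simp: vec_eq_iff)

lemma image_zset_indeterminacy:
  assumes P: "irr_form P p"
  shows "mero_image (mero_iter f n) (zset P) \<subseteq> indeterminacy f \<longleftrightarrow> pdvd P (loss n)"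
proof -
  have "mero_image (mero_iter f n) (zset P) \<subseteq> indeterminacy f \<longleftrightarrow>
      (\<forall>j. mero_image (mero_iter f n) (zset P) \<subseteq> zset (\<lambda>z. F z $ j))"
    unfolding indeterminacy_zset by blast
  then show ?thesis
    using image_zset_subset_zset[OF P hom_mapD(1)[OF hF]] pdvd_loss_iff[OF P] by simp
qed

text \<open>Off \<open>loss n = 0\<close> the hypothesis makes \<open>it (Suc n)\<close> vanish on
  an open piece of \<open>H\<close>, which a reduced form cannot do. Here \<open>H\<close> is an
  arbitrary analytic hypersurface.\<close>

lemma lowering_subset_loss:
  assumes H: "hypersurface H" and img: "mero_image (mero_iter f n) H \<subseteq> indeterminacy f"
  shows "H \<subseteq> zset (loss n)"
proof (rule subsetI, rule ccontr)
  fix p assume p: "p \<in> H" "p \<notin> zset (loss n)"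
  let ?U = "- zset (loss n)"
  have U: "open ?U" by (rule open_Compl[OF closed_zset[OF loss(1)]])
  have "H \<inter> ?U \<noteq> {}" using p by blast
  then show False
  proof (rule hypersurface_not_in_common_zeros[OF it_red[of "Suc n"] H U])
    fix q assume q: "q \<in> H \<inter> ?U"
    let ?v = "rep_proj q"
    have v: "?v \<noteq> 0" "abs_proj ?v = q" using rep_proj_nonzero abs_rep_proj by blast+
    have l: "loss n ?v \<noteq> 0" using q by (simp add: zset_def)
    have "F (it n ?v) = 0"
    proof (cases "it n ?v = 0")
      case True
      have "F 0 = 0" using hom_fun_at_0[OF hom_mapD(1)[OF hF] d_pos] by (auto simp: vec_eq_iff)
      then show ?thesis using True by simp
    next
      case False
      then have "abs_proj (it n ?v) \<in> indeterminacy f"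
        using img[unfolded image_subset_iff[OF closed_indeterminacy]] v q by auto
      then show ?thesis using indeterminacy_abs_proj[OF False] by simp
    qed
    then show "it (Suc n) ?v = 0" using loss(2)[of n ?v] l by (simp add: vec.scale_eq_0_iff)
  qed
qed

lemma loss_0: "irr_form P p \<Longrightarrow> \<not> pdvd P (loss 0)"
  using pdvd_loss_iff[of P p 0] red_formD(3)[OF red, of P p] it_0 by auto

lemma degree_lowering_zset:
  assumes P: "irr_form P p" and n: "pdvd P (loss n)"
  shows "n \<ge> 1" "degree_lowering f (zset P)" "dl_height f (zset P) \<le> n" "dl_height f (zset P) \<ge> 1"
    "pdvd P (loss (dl_height f (zset P)))"
proof -
  show n1: "n \<ge> 1" using loss_0[OF P] n by (cases n) auto
  have img: "n \<ge> 1 \<and> mero_image (mero_iter f n) (zset P) \<subseteq> indeterminacy f"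
    using n1 image_zset_indeterminacy[OF P] n by blast
  then show "degree_lowering f (zset P)" using hypersurface_zset[OF P] by (auto simp: degree_lowering_def)
  show "dl_height f (zset P) \<le> n" unfolding dl_height_def by (rule Least_le[of "\<lambda>m. m \<ge> 1 \<and> mero_image (mero_iter f m) (zset P) \<subseteq> indeterminacy f", OF img])
  have "dl_height f (zset P) \<ge> 1 \<and> mero_image (mero_iter f (dl_height f (zset P))) (zset P) \<subseteq> indeterminacy f"
    unfolding dl_height_def by (rule LeastI[of "\<lambda>m. m \<ge> 1 \<and> mero_image (mero_iter f m) (zset P) \<subseteq> indeterminacy f", OF img])
  then show "dl_height f (zset P) \<ge> 1" "pdvd P (loss (dl_height f (zset P)))"
    using image_zset_indeterminacy[OF P] by blast+
qed

lemma irr_factor_pullback: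
  assumes P: "irr_form P p" and R: "hom_fun e R" "R w0 \<noteq> 0" "pdvd P (\<lambda>z. R (it j z))"
  shows "\<exists>Q q. irr_form Q q \<and> pdvd Q R \<and> pdvd P (\<lambda>z. Q (it j z))"
proof (rule irr_factor_with[where \<Phi> = "\<lambda>R. pdvd P (\<lambda>z. R (it j z))", OF _ _ R])
  show "c = 0" if "pdvd P (\<lambda>z. c)" for c using pdvdD[OF that irr_formD(4)[OF P]] .
  show "pdvd P (\<lambda>z. A (it j z)) \<or> pdvd P (\<lambda>z. B (it j z))"
    if "hom_fun a A" "hom_fun b B" "pdvd P (\<lambda>z. A (it j z) * B (it j z))" for A B a b
    by (rule irr_prime[OF P polyfun_it[OF hom_funD(1)[OF that(1)]] polyfun_it[OF hom_funD(1)[OF that(2)]] that(3)])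
qed

lemma pdvd_pullback:
  assumes "pdvd Q R" "irr_form Q q" "pdvd P (\<lambda>z. Q (it j z))" shows "pdvd P (\<lambda>z. R (it j z))"
proof -
  obtain A where A: "polyfun A" "R = (\<lambda>z. A z * Q z)" using assms(1) unfolding pdvd_def by blast
  show ?thesis unfolding A(2) by (rule pdvd_mult[OF polyfun_it[OF A(1)] assms(3)])
qed

text \<open>\<open>F \<circ> it (i - j)\<close> vanishes on the image of \<open>P = 0\<close> under
  the iterate \<open>j\<close>, hence so does some irreducible \<open>Q\<close>. The codimension
  bound makes \<open>Q\<close> divide every form vanishing there. This is domination, and it applies
  in particular to the coordinates of \<open>F \<circ> it (i - j)\<close>.\<close>

lemma image_divisor:
  assumes P: "irr_form P p" and i: "pdvd P (loss i)" and j: "j \<le> i"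
    and codim: "codim (mero_image (mero_iter f j) (zset P)) \<le> 1"
  shows "\<exists>Q q. irr_form Q q \<and> dominates P j Q \<and> pdvd Q (loss (i - j))"
proof -
  let ?R = "\<lambda>l z. F (it (i - j) z) $ l"
  have hR: "hom_fun (dg (i - j) * d) (?R l)" for l by (rule hom_fun_it[OF hom_mapD(1)[OF hF]])
  obtain C c where C: "hom_fun c C" "\<And>z. it (i - j) (it j z) = C z *s it i z"
    using it_compose[of "i - j" j] j by auto
  have PR: "pdvd P (\<lambda>z. ?R l (it j z))" for l
  proof -
    have "(\<lambda>z. ?R l (it j z)) = (\<lambda>z. C z ^ d * F (it i z) $ l)"
      unfolding C(2) hom_map_scale[OF hF] by simp
    moreover have "pdvd P (\<lambda>z. F (it i z) $ l)" using pdvd_loss_iff[OF P] i by blast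
    ultimately show ?thesis using pdvd_mult[OF polyfun_power[OF hom_funD(1)[OF C(1)]]] by simp
  qed
  obtain w l where wl: "F w $ l \<noteq> 0" using red_formD(2)[OF red] by (force simp: vec_eq_iff)
  obtain w0 where w0: "?R l w0 \<noteq> 0" using compose_it_nonzero[OF hom_mapD(1)[OF hF] wl] by blast
  obtain Q q where Q: "irr_form Q q" "pdvd P (\<lambda>z. Q (it j z))"
    using irr_factor_pullback[OF P hR w0 PR] by blast
  have dom: "dominates P j Q"
    unfolding dominates_def
  proof (intro allI impI iffI)
    fix R :: "complex ^ 'k option \<Rightarrow> complex" and e assume R: "hom_fun e R" and PRj: "pdvd P (\<lambda>z. R (it j z))"
    show "pdvd Q R"
    proof (cases "\<exists>w. R w \<noteq> 0")
      case True
      then obtain w where w: "R w \<noteq> 0" by blast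
      obtain Q' q' where Q': "irr_form Q' q'" "pdvd Q' R" "pdvd P (\<lambda>z. Q' (it j z))"
        using irr_factor_pullback[OF P R w PRj] by blast
      have "pdvd Q Q'"
        by (rule codim_le_1_pdvd[OF codim Q(1) Q'(1)])
          (use image_zset_subset_zset[OF P irr_formD(1)[OF Q(1)]] Q(2)
            image_zset_subset_zset[OF P irr_formD(1)[OF Q'(1)]] Q'(3) in auto)
      then show ?thesis using Q'(2) pdvd_trans by blast
    next
      case False
      then have "R = (\<lambda>z. 0)" by auto
      then show ?thesis using pdvd_zero by simp
    qed
  next
    fix R :: "complex ^ 'k option \<Rightarrow> complex" and e :: nat assume "pdvd Q R"
    then show "pdvd P (\<lambda>z. R (it j z))" using pdvd_pullback Q by blast
  qed
  have "pdvd Q (?R l)" for l using dom hR PR unfolding dominates_def by blast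
  then have "pdvd Q (loss (i - j))" using pdvd_loss_iff[OF Q(1)] by blast
  then show ?thesis using Q(1) dom by blast
qed

text \<open>If \<open>P\<close> divided \<open>C\<close>, then \<open>it b\<close> would vanish on
  the image of \<open>P = 0\<close>, hence on \<open>Q = 0\<close>, although it is reduced.\<close>

lemma not_pdvd_compose_factor:
  assumes P: "irr_form P p" and Q: "irr_form Q q" and dom: "dominates P a Q"
    and C: "\<And>z. it b (it a z) = C z *s it (b + a) z" "polyfun C"
  shows "\<not> pdvd P C"
proof
  assume PC: "pdvd P C"
  obtain l where l: "\<not> pdvd Q (\<lambda>z. it b z $ l)" using red_formD(3)[OF it_red Q] by blast
  have "(\<lambda>z. it b (it a z) $ l) = (\<lambda>z. C z * it (b + a) z $ l)" using C(1) by simp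
  then have "pdvd P (\<lambda>z. it b (it a z) $ l)" using pdvd_mult2[OF hom_mapD(2)[OF hit] PC] by simp
  then show False using dom hom_mapD(1)[OF hit] l unfolding dominates_def by blast
qed

lemma irr_not_pdvd_power_mult:
  assumes P: "irr_form P p" and C: "polyfun C" "\<not> pdvd P C" and X: "polyfun X" and dvd: "pdvd P (\<lambda>z. C z ^ n * X z)"
  shows "pdvd P X"
proof (cases "n = 0")
  case True
  then show ?thesis using dvd by simp
next
  case False
  then have "n \<ge> 1" by simp
  then have "\<not> pdvd P (\<lambda>z. C z ^ n)" using irr_prime_power[OF P C(1) _ \<open>n \<ge> 1\<close>] C(2) by blast
  then show ?thesis using irr_prime[OF P polyfun_power[OF C(1)] X dvd] by blast
qed

text \<open>Passing from \<open>it b \<circ> it a\<close> to \<open>it (a + b)\<close> costs a power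
  of \<open>C\<close>, which \<open>P\<close> does not divide.\<close>

lemma dominates_compose:
  fixes S :: "complex ^ 'k option \<Rightarrow> complex"
  assumes P: "irr_form P p" and Q: "irr_form Q q" and PQ: "dominates P a Q" and QS: "dominates Q b S"
  shows "dominates P (a + b) S"
  unfolding dominates_def
proof (intro allI impI)
  fix R :: "complex ^ 'k option \<Rightarrow> complex" and e assume R: "hom_fun e R"
  obtain C c where C: "hom_fun c C" "\<And>z. it b (it a z) = C z *s it (b + a) z" using it_compose by blast
  have nC: "\<not> pdvd P C" by (rule not_pdvd_compose_factor[OF P Q PQ C(2) hom_funD(1)[OF C(1)]])
  have eq: "(\<lambda>z. R (it b (it a z))) = (\<lambda>z. C z ^ e * R (it (a + b) z))"
    unfolding C(2) hom_funD(2)[OF R] by (simp add: add.commute)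
  have pR: "polyfun (\<lambda>z. R (it (a + b) z))" by (rule polyfun_it[OF hom_funD(1)[OF R]])
  have "pdvd P (\<lambda>z. R (it (a + b) z)) \<longleftrightarrow> pdvd P (\<lambda>z. R (it b (it a z)))"
    unfolding eq using irr_not_pdvd_power_mult[OF P hom_funD(1)[OF C(1)] nC pR]
      pdvd_mult[OF polyfun_power[OF hom_funD(1)[OF C(1)]]] by blast
  also have "\<dots> \<longleftrightarrow> pdvd Q (\<lambda>z. R (it b z))"
    using PQ hom_fun_it[OF R] unfolding dominates_def by blast
  also have "\<dots> \<longleftrightarrow> pdvd S R" using QS R unfolding dominates_def by blast
  finally show "pdvd P (\<lambda>z. R (it (a + b) z)) \<longleftrightarrow> pdvd S R" .
qed

lemma stable_no_loss:
  assumes "alg_stable f" "irr_form P p" shows "\<not> pdvd P (loss n)"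
  using assms degree_lowering_zset(2)[OF assms(2)] unfolding alg_stable_def degree_lowering_def by blast

lemma no_loss_degree:
  assumes "\<And>P p. irr_form P p \<Longrightarrow> \<not> pdvd P (loss n)" shows "lossdeg n = 0"
proof (rule ccontr)
  assume "lossdeg n \<noteq> 0"
  moreover obtain z where "loss n z \<noteq> 0" using loss(4) by blast
  ultimately show False using irr_factor_exists[OF loss(1), of n z] assms by auto
qed

text \<open>At the first time \<open>n\<close> when a loss has an irreducible divisor, an
  intermediate image of codimension at most 1 would yield a divisor of the earlier
  \<open>loss (n - m)\<close>.\<close>

lemma primitive_family:
  assumes P: "irr_form P p" and n: "pdvd P (loss n)" and min: "\<And>m Q q. m < n \<Longrightarrow> irr_form Q q \<Longrightarrow> \<not> pdvd Q (loss m)"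
  shows "zset P \<in> dl_family f" "dl_height f (zset P) = n"
proof -
  note dl = degree_lowering_zset[OF P n]
  have "\<not> dl_height f (zset P) < n" using min[OF _ P] dl(5) by blast
  then show h: "dl_height f (zset P) = n" using dl(3) by simp
  have "codim (mero_image (mero_iter f m) (zset P)) > 1" if m: "m \<in> {1..n}" for m
  proof (rule ccontr)
    assume "\<not> ?thesis"
    then have "codim (mero_image (mero_iter f m) (zset P)) \<le> 1" by simp
    moreover have "m \<le> n" using m by simp
    ultimately obtain Q q where "irr_form Q q" "pdvd Q (loss (n - m))" using image_divisor[OF P n] by blast
    moreover have "n - m < n" using m by auto
    ultimately show False using min by blast
  qed
  then show "zset P \<in> dl_family f"
    using irreducible_zset[OF P] dl(2) h by (simp add: dl_family_def)
qed

end

section \<open>Degrees of the iterates\<close>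

context dominating_form
begin

lemma dg_power:
  assumes "\<And>m. m < n \<Longrightarrow> lossdeg m = 0" shows "dg n = d ^ n"
  using assms
proof (induction n)
  case 0
  then show ?case by (simp add: dg_0)
next
  case (Suc n)
  have "dg n = d ^ n" by (rule Suc.IH) (use Suc.prems in auto)
  moreover have "lossdeg n = 0" using Suc.prems by simp
  ultimately show ?case using loss(3)[of n] by simp
qed

text \<open>\<open>X\<close> accumulates the losses from time \<open>m\<close> to
  \<open>m + k - 1\<close>, raised to powers of \<open>d\<close>; only its irreducible divisors are
  recorded.\<close>

lemma funpow_it_loss:
  "\<exists>X. polyfun X \<and> (\<forall>z. (F ^^ k) (it m z) = X z *s it (m + k) z) \<and>
     (\<forall>P p. irr_form P p \<longrightarrow> pdvd P X \<longrightarrow> (\<exists>i<k. pdvd P (loss (m + i))))"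
proof (induction k)
  case 0
  have "\<not> pdvd P (\<lambda>z. 1)" if P: "irr_form P p" for P :: "complex ^ 'k option \<Rightarrow> complex" and p
    using pdvdD[of P "\<lambda>z. 1" 0] irr_formD(4)[OF P] by auto
  then show ?case by (intro exI[of _ "\<lambda>z. 1"]) (auto simp: polyfun_const)
next
  case (Suc k)
  then obtain X where X: "polyfun X" "\<And>z. (F ^^ k) (it m z) = X z *s it (m + k) z"
    "\<And>P p. irr_form P p \<Longrightarrow> pdvd P X \<Longrightarrow> \<exists>i<k. pdvd P (loss (m + i))" by blast
  let ?Y = "\<lambda>z. X z ^ d * loss (m + k) z"
  note pl = hom_funD(1)[OF loss(1), of "m + k"]
  have "polyfun ?Y" by (rule polyfun_mult[OF polyfun_power[OF X(1)] pl])
  moreover have "(F ^^ Suc k) (it m z) = ?Y z *s it (m + Suc k) z" for z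
    using X(2) hom_map_scale[OF hF] loss(2)[of "m + k" z] by (simp add: vector_smult_assoc)
  moreover have "\<exists>i<Suc k. pdvd P (loss (m + i))" if P: "irr_form P p" and dvd: "pdvd P ?Y" for P p
    using irr_prime[OF P polyfun_power[OF X(1)] pl dvd]
  proof
    assume "pdvd P (\<lambda>z. X z ^ d)"
    then have "pdvd P X" using irr_prime_power[OF P X(1) _ d_pos] by blast
    then show ?thesis using X(3)[OF P] less_SucI by blast
  qed blast
  ultimately show ?case by blast
qed

end

text \<open>\<open>primitive\<close>, \<open>no_return\<close> and \<open>fate\<close> are the
  conditions (i), (ii) and (iii) of quasi-algebraic stability.\<close>

locale single_primitive_form = dominating_form F d
  for F :: "complex ^ 'k::finite option \<Rightarrow> complex ^ 'k option" and d :: nat +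
  fixes H\<^sub>0 :: "'k proj set" and n\<^sub>0 :: nat
  assumes primitive: "\<And>H n. primitive_dl (fmap F) H n \<longleftrightarrow> H = H\<^sub>0 \<and> n = n\<^sub>0"
    and no_return: "\<And>H m. irreducible_component H H\<^sub>0 \<Longrightarrow> m \<in> {1..n\<^sub>0} \<Longrightarrow>
      \<not> mero_image (mero_iter (fmap F) m) H \<subseteq> H\<^sub>0"
    and fate: "\<And>H. irreducible_component H H\<^sub>0 \<Longrightarrow>
      (\<forall>m\<ge>n\<^sub>0 + 1. \<not> mero_image (mero_iter (fmap F) m) H \<subseteq> indeterminacy (fmap F)) \<or>
      (\<exists>m0\<ge>n\<^sub>0. hypersurface (mero_image (mero_iter (fmap F) (m0 + 1)) H) \<and>
        (\<forall>m\<in>{n\<^sub>0 + 1..m0}. \<not> mero_image (mero_iter (fmap F) m) H \<subseteq> indeterminacy (fmap F)))"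
begin

lemma family_height:
  assumes H: "H \<in> dl_family f" shows "dl_height f H = n\<^sub>0" "H \<subseteq> H\<^sub>0"
proof -
  have "primitive_dl f (\<Union>{H'\<in>dl_family f. dl_height f H' = dl_height f H}) (dl_height f H)"
    unfolding primitive_dl_def using H by blast
  then have eq: "\<Union>{H'\<in>dl_family f. dl_height f H' = dl_height f H} = H\<^sub>0 \<and> dl_height f H = n\<^sub>0"
    unfolding primitive .
  then show "dl_height f H = n\<^sub>0" ..
  show "H \<subseteq> H\<^sub>0" using eq H by blast
qed

lemma H\<^sub>0_family: "\<exists>H\<in>dl_family f. dl_height f H = n\<^sub>0" "H\<^sub>0 = \<Union>{H\<in>dl_family f. dl_height f H = n\<^sub>0}"
  using primitive[of H\<^sub>0 n\<^sub>0] unfolding primitive_dl_def by blast+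

lemma family_loss:
  assumes H: "H \<in> dl_family f" shows "n\<^sub>0 \<ge> 1" "H \<subseteq> zset (loss n\<^sub>0)"
proof -
  have dl: "degree_lowering f H" using H by (simp add: dl_family_def)
  then obtain n where "n \<ge> 1 \<and> mero_image (mero_iter f n) H \<subseteq> indeterminacy f"
    unfolding degree_lowering_def by blast
  then have "n\<^sub>0 \<ge> 1 \<and> mero_image (mero_iter f n\<^sub>0) H \<subseteq> indeterminacy f"
    unfolding family_height(1)[OF H, symmetric] dl_height_def
    by (rule LeastI[of "\<lambda>m. m \<ge> 1 \<and> mero_image (mero_iter f m) H \<subseteq> indeterminacy f"])
  then show "n\<^sub>0 \<ge> 1" "H \<subseteq> zset (loss n\<^sub>0)"
    using lowering_subset_loss dl unfolding degree_lowering_def by blast+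
qed

lemma n\<^sub>0_pos: "n\<^sub>0 \<ge> 1"
  using H\<^sub>0_family(1) family_loss(1) by blast

text \<open>By \<open>primitive_family\<close>, the least time at which a loss has an irreducible
  divisor is the height of a member of the family, and all these heights equal
  \<open>n\<^sub>0\<close>.\<close>

lemma no_early_loss:
  assumes P: "irr_form P p" and m: "m < n\<^sub>0" shows "\<not> pdvd P (loss m)"
proof
  assume *: "pdvd P (loss m)"
  define divides where "divides n \<longleftrightarrow> (\<exists>P p. irr_form P p \<and> pdvd P (loss n))" for n
  have d: "divides m" unfolding divides_def using P * by blast
  define N where "N = (LEAST n. divides n)"
  have "divides N" unfolding N_def by (rule LeastI[of divides, OF d])
  then obtain Q q where Q: "irr_form Q q" "pdvd Q (loss N)" unfolding divides_def by blast
  have "\<not> divides i" if "i < N" for i using that not_less_Least[of i divides] unfolding N_def by blast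
  then have min: "\<And>i Q q. i < N \<Longrightarrow> irr_form Q q \<Longrightarrow> \<not> pdvd Q (loss i)" unfolding divides_def by blast
  have "zset Q \<in> dl_family f" "dl_height f (zset Q) = N"
    by (rule primitive_family[OF Q], rule min, assumption+)+
  then have "N = n\<^sub>0" using family_height(1) by blast
  moreover have "N \<le> m" unfolding N_def by (rule Least_le[of divides, OF d])
  ultimately show False using m by simp
qed

lemma loss_family:
  assumes "irr_form P p" "pdvd P (loss n\<^sub>0)" shows "zset P \<in> dl_family f"
  by (rule primitive_family(1)[OF assms]) (rule no_early_loss)

lemma H\<^sub>0_zset: "H\<^sub>0 = zset (loss n\<^sub>0)"
proof
  show "H\<^sub>0 \<subseteq> zset (loss n\<^sub>0)" using H\<^sub>0_family(2) family_loss(2) by blast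
  show "zset (loss n\<^sub>0) \<subseteq> H\<^sub>0"
  proof
    fix x assume "x \<in> zset (loss n\<^sub>0)"
    then have x: "loss n\<^sub>0 (rep_proj x) = 0" by (simp add: zset_def)
    obtain w where w: "loss n\<^sub>0 w \<noteq> 0" using loss(4) by blast
    obtain P p where P: "irr_form P p" "pdvd P (loss n\<^sub>0)" "P (rep_proj x) = 0"
      using hom_fun_zero_factor[OF loss(1) w x] by blast
    have "x \<in> zset P" using P(3) by (simp add: zset_def)
    then show "x \<in> H\<^sub>0" using family_height(2)[OF loss_family[OF P(1,2)]] by blast
  qed
qed

text \<open>An irreducible analytic \<open>B\<close> between \<open>P = 0\<close> and
  \<open>H\<^sub>0\<close> lies in the zero set of an irreducible factor of the loss, and nested
  zero sets of irreducible forms coincide.\<close>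

lemma loss_component:
  assumes P: "irr_form P p" "pdvd P (loss n\<^sub>0)" shows "irreducible_component (zset P) H\<^sub>0"
  unfolding irreducible_component_def
proof (intro conjI allI impI)
  show "irreducible_analytic (zset P)" by (rule irreducible_zset[OF P(1)])
  show "zset P \<subseteq> H\<^sub>0" by (rule family_height(2)[OF loss_family[OF P]])
  fix B assume B: "irreducible_analytic B \<and> zset P \<subseteq> B \<and> B \<subseteq> H\<^sub>0"
  obtain w where w: "loss n\<^sub>0 w \<noteq> 0" using loss(4) by blast
  have "B \<subseteq> zset (loss n\<^sub>0)" using B H\<^sub>0_zset by simp
  then obtain Q q where Q: "irr_form Q q" "B \<subseteq> zset Q"
    using irreducible_in_zset[OF _ loss(1) w] B by blast
  have "zset Q = zset P" by (rule irr_zset_subset[OF P(1) Q(1)]) (use B Q(2) in blast)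
  then show "B = zset P" using B Q(2) by blast
qed

text \<open>If \<open>i\<close> exceeds \<open>n\<^sub>0\<close>, some image at a time
  \<open>j\<close> from 1 to \<open>i\<close> has codimension at most 1. Then
  \<open>image_divisor\<close> leads to a divisor of \<open>loss (i - j)\<close>, and the induction
  continues from there.\<close>

lemma loss_divisor_orbit:
  "irr_form P p \<Longrightarrow> pdvd P (loss i) \<Longrightarrow>
    \<exists>Q q. irr_form Q q \<and> pdvd Q (loss n\<^sub>0) \<and> dominates P (i - n\<^sub>0) Q"
proof (induction i arbitrary: P p rule: less_induct)
  case (less i)
  note P = less.prems(1) and i = less.prems(2)
  have ge: "n\<^sub>0 \<le> i" using no_early_loss[OF P] i not_less by blast
  show ?case
  proof (cases "i = n\<^sub>0")
    case True
    have "dominates P 0 P" by (simp add: dominates_def it_0)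
    then show ?thesis using P i True by auto
  next
    case False
    note dl = degree_lowering_zset[OF P i]
    \<comment> \<open>For a member of the family, the image at time \<open>i > n\<^sub>0\<close>
      lies in the indeterminacy locus, so the second alternative of \<open>fate\<close> holds with
      \<open>m0 < i\<close>. Otherwise the failing codimension condition of the family provides
      \<open>j\<close>.\<close>
    have "\<exists>j\<in>{1..i}. codim (mero_image (mero_iter f j) (zset P)) \<le> 1"
    proof (cases "zset P \<in> dl_family f")
      case True
      have "pdvd P (loss n\<^sub>0)" using dl(5) family_height(1)[OF True] by simp
      note comp = fate[OF loss_component[OF P this]]
      have img: "mero_image (mero_iter f i) (zset P) \<subseteq> indeterminacy f"
        using image_zset_indeterminacy[OF P] i by blast
      have "i \<ge> n\<^sub>0 + 1" using ge False by simp
      then obtain m0 where m0: "m0 \<ge> n\<^sub>0" "hypersurface (mero_image (mero_iter f (m0 + 1)) (zset P))"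
        "\<forall>m\<in>{n\<^sub>0 + 1..m0}. \<not> mero_image (mero_iter f m) (zset P) \<subseteq> indeterminacy f"
        using comp img by blast
      have "\<not> i \<le> m0" using m0(3) img \<open>i \<ge> n\<^sub>0 + 1\<close> by auto
      then have "m0 + 1 \<in> {1..i}" by simp
      moreover have "codim (mero_image (mero_iter f (m0 + 1)) (zset P) \<inter> UNIV) = 1"
        using m0(2) unfolding hypersurface_def using open_UNIV Int_UNIV_right by metis
      then have "codim (mero_image (mero_iter f (m0 + 1)) (zset P)) \<le> 1" by simp
      ultimately show ?thesis by blast
    next
      case False
      then obtain m where "m \<in> {1..dl_height f (zset P)}" "\<not> codim (mero_image (mero_iter f m) (zset P)) > 1"
        using irreducible_zset[OF P] dl(2) unfolding dl_family_def by blast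
      then have "m \<in> {1..i}" "codim (mero_image (mero_iter f m) (zset P)) \<le> 1" using dl(3) by auto
      then show ?thesis by blast
    qed
    then obtain j where j: "j \<in> {1..i}" "codim (mero_image (mero_iter f j) (zset P)) \<le> 1" by blast
    have "j \<le> i" "i - j < i" using j(1) by auto
    obtain Q q where Q: "irr_form Q q" "dominates P j Q" "pdvd Q (loss (i - j))"
      using image_divisor[OF P i \<open>j \<le> i\<close> j(2)] by blast
    have "n\<^sub>0 \<le> i - j" using no_early_loss[OF Q(1)] Q(3) not_less by blast
    then have eq: "j + (i - j - n\<^sub>0) = i - n\<^sub>0" using \<open>j \<le> i\<close> by simp
    obtain S s where S: "irr_form S s" "pdvd S (loss n\<^sub>0)" "dominates Q (i - j - n\<^sub>0) S"
      using less.IH[OF \<open>i - j < i\<close> Q(1,3)] by blast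
    have "dominates P (i - n\<^sub>0) S" using dominates_compose[OF P Q(1,2) S(3)] unfolding eq .
    then show ?thesis using S(1,2) by blast
  qed
qed

text \<open>Suppose \<open>P\<close> does not divide \<open>loss n\<close>. Then it divides a loss
  at some time \<open>m + i\<close> with \<open>i < n\<^sub>0\<close>, so its orbit reaches a
  component \<open>Q\<close> of \<open>H\<^sub>0\<close> before time \<open>m\<close>. By the
  pullback it is in \<open>H\<^sub>0\<close> again at time \<open>m\<close>, a return within
  \<open>n\<^sub>0\<close> steps that \<open>no_return\<close> excludes.\<close>

lemma loss_pullback:
  assumes P: "irr_form P p" and n: "n\<^sub>0 \<le> n" and dvd: "pdvd P (\<lambda>z. loss n\<^sub>0 (it (n - n\<^sub>0) z))"
  shows "pdvd P (loss n)"
proof (rule ccontr)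
  assume nP: "\<not> pdvd P (loss n)"
  define m where "m = n - n\<^sub>0"
  obtain A where A: "polyfun A" "\<And>z. (F ^^ n\<^sub>0) (it 0 z) = A z *s it (0 + n\<^sub>0) z" using funpow_it_loss[of n\<^sub>0 0] by blast
  obtain X where X: "polyfun X" "\<And>z. (F ^^ Suc n\<^sub>0) (it m z) = X z *s it (m + Suc n\<^sub>0) z"
    "\<And>P p. irr_form P p \<Longrightarrow> pdvd P X \<Longrightarrow> \<exists>i<Suc n\<^sub>0. pdvd P (loss (m + i))" using funpow_it_loss[of "Suc n\<^sub>0" m] by blast
  \<comment> \<open>Comparison with the accumulated factor \<open>X\<close> forces \<open>P\<close>
    into a loss between the times \<open>m\<close> and \<open>m + n\<^sub>0\<close>, since
    \<open>it (m + Suc n\<^sub>0)\<close> has a coordinate that \<open>P\<close> does not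
    divide.\<close>
  have FA: "(F ^^ Suc n\<^sub>0) w = (A w ^ d * loss n\<^sub>0 w) *s it (Suc n\<^sub>0) w" for w
    using A(2)[of w] hom_map_scale[OF hF] loss(2)[of n\<^sub>0 w] by (simp add: it_0 vector_smult_assoc)
  obtain l where l: "\<not> pdvd P (\<lambda>z. it (m + Suc n\<^sub>0) z $ l)" using red_formD(3)[OF it_red P] by blast
  have "(\<lambda>z. X z * it (m + Suc n\<^sub>0) z $ l) = (\<lambda>z. (A (it m z) ^ d * it (Suc n\<^sub>0) (it m z) $ l) * loss n\<^sub>0 (it m z))"
  proof
    fix z
    have "X z *s it (m + Suc n\<^sub>0) z = (A (it m z) ^ d * loss n\<^sub>0 (it m z)) *s it (Suc n\<^sub>0) (it m z)"
      using X(2) FA by metis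
    from arg_cong[OF this, of "\<lambda>v. v $ l"]
    show "X z * it (m + Suc n\<^sub>0) z $ l = (A (it m z) ^ d * it (Suc n\<^sub>0) (it m z) $ l) * loss n\<^sub>0 (it m z)"
      by (simp add: mult_ac)
  qed
  moreover have "polyfun (\<lambda>z. A (it m z) ^ d * it (Suc n\<^sub>0) (it m z) $ l)"
    by (rule polyfun_mult[OF polyfun_power[OF polyfun_it[OF A(1)]] polyfun_it[OF hom_mapD(2)[OF hit]]])
  ultimately have "pdvd P (\<lambda>z. X z * it (m + Suc n\<^sub>0) z $ l)"
    using pdvd_mult dvd[folded m_def] by simp
  then have "pdvd P X" using irr_prime[OF P X(1) hom_mapD(2)[OF hit]] l by blast
  then obtain i where i: "i < Suc n\<^sub>0" "pdvd P (loss (m + i))" using X(3)[OF P] by blast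
  have "m + n\<^sub>0 = n" using n by (simp add: m_def)
  then have "i \<noteq> n\<^sub>0" using i(2) nP by auto
  then have in0: "i < n\<^sub>0" using i(1) by simp
  have ge: "n\<^sub>0 \<le> m + i" using no_early_loss[OF P] i(2) not_less by blast
  obtain Q q where Q: "irr_form Q q" "pdvd Q (loss n\<^sub>0)" "dominates P (m + i - n\<^sub>0) Q"
    using loss_divisor_orbit[OF P i(2)] by blast
  \<comment> \<open>\<open>a\<close> is the time of arrival in \<open>Q\<close>, and
    \<open>e\<close> is the number of steps from there to time \<open>m\<close>.\<close>
  define a e where "a = m + i - n\<^sub>0" and "e = n\<^sub>0 - i"
  have m: "m = e + a" and e: "e \<in> {1..n\<^sub>0}" using in0 ge by (auto simp: a_def e_def)
  obtain C c where C: "hom_fun c C" "\<And>z. it e (it a z) = C z *s it (e + a) z" using it_compose by blast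
  have "(\<lambda>z. loss n\<^sub>0 (it e (it a z))) = (\<lambda>z. C z ^ lossdeg n\<^sub>0 * loss n\<^sub>0 (it m z))"
    unfolding C(2) m hom_funD(2)[OF loss(1)] ..
  then have "pdvd P (\<lambda>z. loss n\<^sub>0 (it e (it a z)))"
    using pdvd_mult[OF polyfun_power[OF hom_funD(1)[OF C(1)]]] dvd[folded m_def] by simp
  then have "pdvd Q (\<lambda>z. loss n\<^sub>0 (it e z))"
    using Q(3) hom_fun_it[OF loss(1), of e n\<^sub>0] unfolding dominates_def a_def[symmetric] by blast
  then have "mero_image (mero_iter f e) (zset Q) \<subseteq> H\<^sub>0"
    using image_zset_subset_zset[OF Q(1) loss(1)] H\<^sub>0_zset by simp
  then show False using no_return[OF loss_component[OF Q(1,2)] e] by blast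
qed

text \<open>Reducing \<open>F \<circ> it n\<^sub>0 \<circ> it m\<close> in two ways relates
  \<open>C ^ d\<close> times \<open>loss n\<close> to \<open>C'\<close> times
  \<open>loss n\<^sub>0 \<circ> it m\<close>. The iterate \<open>m\<close> takes each relevant
  \<open>P = 0\<close> densely onto a hypersurface, so \<open>P\<close> divides neither
  \<open>C\<close> nor \<open>C'\<close>, and both sides have the same order along
  \<open>P\<close>.\<close>

lemma lossdeg_eq:
  assumes n: "n\<^sub>0 \<le> n" shows "lossdeg n = dg (n - n\<^sub>0) * lossdeg n\<^sub>0"
proof -
  define m where "m = n - n\<^sub>0"
  have nm: "n\<^sub>0 + m = n" using n by (simp add: m_def)
  obtain z0 where z0: "loss n z0 \<noteq> 0" using loss(4) by blast
  obtain w where w: "loss n\<^sub>0 w \<noteq> 0" using loss(4) by blast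
  obtain w0 where w0: "loss n\<^sub>0 (it m w0) \<noteq> 0" using compose_it_nonzero[OF loss(1) w] by blast
  have "lossdeg n = dg m * lossdeg n\<^sub>0"
  proof (rule degree_eq_of_local_quotients[OF loss(1) z0 hom_fun_it[OF loss(1)] w0])
    fix P :: "complex ^ 'k option \<Rightarrow> complex" and p
    assume P: "irr_form P p" and dvd: "pdvd P (loss n) \<or> pdvd P (\<lambda>z. loss n\<^sub>0 (it m z))"
    have "pdvd P (loss n)" using dvd loss_pullback[OF P n] unfolding m_def by blast
    then obtain Q q where Q: "irr_form Q q" "dominates P m Q"
      using loss_divisor_orbit[OF P] unfolding m_def by blast
    obtain C c where C: "hom_fun c C" "\<And>z. it n\<^sub>0 (it m z) = C z *s it (n\<^sub>0 + m) z" using it_compose by blast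
    obtain C' c' where C': "hom_fun c' C'" "\<And>z. it (Suc n\<^sub>0) (it m z) = C' z *s it (Suc n\<^sub>0 + m) z" using it_compose by blast
    have nC: "\<not> pdvd P C" by (rule not_pdvd_compose_factor[OF P Q C(2) hom_funD(1)[OF C(1)]])
    have nC': "\<not> pdvd P C'" by (rule not_pdvd_compose_factor[OF P Q C'(2) hom_funD(1)[OF C'(1)]])
    have nCd: "\<not> pdvd P (\<lambda>z. C z ^ d)" using irr_prime_power[OF P hom_funD(1)[OF C(1)] _ d_pos] nC by blast
    have vec: "(C z ^ d * loss n z) *s it (Suc n) z = (C' z * loss n\<^sub>0 (it m z)) *s it (Suc n) z" for z
    proof -
      have "(C z ^ d * loss n z) *s it (Suc n) z = F (C z *s it n z)"
        using hom_map_scale[OF hF] loss(2)[of n z] by (simp add: vector_smult_assoc)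
      also have "\<dots> = F (it n\<^sub>0 (it m z))" using C(2) nm by simp
      also have "\<dots> = loss n\<^sub>0 (it m z) *s it (Suc n\<^sub>0) (it m z)" by (rule loss(2))
      also have "\<dots> = (C' z * loss n\<^sub>0 (it m z)) *s it (Suc n) z"
        using C'(2) nm by (simp add: vector_smult_assoc mult.commute)
      finally show ?thesis .
    qed
    obtain v l where v: "it (Suc n) v $ l \<noteq> 0" using red_formD(2)[OF it_red] by (force simp: vec_eq_iff)
    have "(\<lambda>z. C z ^ d * loss n z) = (\<lambda>z. C' z * loss n\<^sub>0 (it m z))"
    proof (rule polyfun_cancel[OF hom_mapD(2)[OF hit] v])
      show "polyfun (\<lambda>z. C z ^ d * loss n z)"
        by (rule polyfun_mult[OF polyfun_power[OF hom_funD(1)[OF C(1)]] hom_funD(1)[OF loss(1)]])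
      show "polyfun (\<lambda>z. C' z * loss n\<^sub>0 (it m z))"
        by (rule polyfun_mult[OF hom_funD(1)[OF C'(1)] polyfun_it[OF hom_funD(1)[OF loss(1)]]])
      show "it (Suc n) z $ l * (C z ^ d * loss n z) = it (Suc n) z $ l * (C' z * loss n\<^sub>0 (it m z))" for z
        using arg_cong[OF vec[of z], of "\<lambda>v. v $ l"] by (simp add: mult_ac)
    qed
    then have "\<forall>z. C z ^ d * loss n z = C' z * loss n\<^sub>0 (it m z)" by metis
    then show "\<exists>C C'. polyfun C \<and> polyfun C' \<and> \<not> pdvd P C \<and> \<not> pdvd P C' \<and>
        (\<forall>z. C z * loss n z = C' z * loss n\<^sub>0 (it m z))"
      using nCd nC' polyfun_power[OF hom_funD(1)[OF C(1)]] hom_funD(1)[OF C'(1)]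
      by (intro exI[of _ "\<lambda>z. C z ^ d"] exI[of _ C']) blast
  qed
  then show ?thesis unfolding m_def .
qed

lemma degree_recurrence:
  shows "n \<le> n\<^sub>0 \<Longrightarrow> dg n = d ^ n" and "dg (Suc (n + n\<^sub>0)) + lossdeg n\<^sub>0 * dg n = d * dg (n + n\<^sub>0)"
proof -
  show "dg n = d ^ n" if "n \<le> n\<^sub>0"
    by (rule dg_power, rule no_loss_degree) (use that no_early_loss in auto)
  show "dg (Suc (n + n\<^sub>0)) + lossdeg n\<^sub>0 * dg n = d * dg (n + n\<^sub>0)"
    using loss(3)[of "n + n\<^sub>0"] lossdeg_eq[of "n + n\<^sub>0"] by (simp add: mult.commute)
qed

end

theorem theorem4p2:
  fixes f :: "'k::finite proj \<rightharpoonup> 'k proj"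
  assumes "CARD('k) \<ge> 2"
    and "meromorphic_map f"
    and "dominating f"
    and "quasi_alg_stable f"
  shows "(\<lambda>n. real (alg_degree (mero_iter f n)) powr (1 / real n)) \<longlonglongrightarrow> dyn_degree1 f \<and>
    algebraic_int (dyn_degree1 f) \<and>
    (\<lambda>n. real (alg_degree (mero_iter f (n + 1))) / real (alg_degree (mero_iter f n)))
      \<longlonglongrightarrow> dyn_degree1 f"
proof -
  obtain F d where F: "red_form F d" "f = fmap F" using assms(2) meromorphic_map_iff by blast
  interpret dominating_form F d by unfold_locales (use F assms(3) in auto)
  have dg: "alg_degree (mero_iter f n) = dg n" for n unfolding dg_def F(2) ..
  have "\<exists>p h. p \<ge> 1 \<and> (\<forall>n\<le>p. dg n = d ^ n) \<and> (\<forall>n. dg (Suc (n + p)) + h * dg n = d * dg (n + p))"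
  proof (cases "alg_stable f")
    case True
    then have "lossdeg n = 0" for n using no_loss_degree stable_no_loss unfolding F(2) by blast
    then have "dg n = d ^ n" for n using dg_power by blast
    \<comment> \<open>Without losses the recurrence holds with \<open>h = 0\<close>;
      \<open>p = 1\<close> is the smallest value that \<open>recurrence_limit\<close>
      accepts.\<close>
    then show ?thesis by (intro exI[of _ 1] exI[of _ 0]) simp
  next
    case False
    then obtain H0 n0 where *: "\<forall>H n. primitive_dl f H n \<longleftrightarrow> H = H0 \<and> n = n0"
      "\<forall>H. irreducible_component H H0 \<longrightarrow> (\<forall>m\<in>{1..n0}. \<not> mero_image (mero_iter f m) H \<subseteq> H0)"
      "\<forall>H. irreducible_component H H0 \<longrightarrow>
           (\<forall>m\<ge>n0 + 1. \<not> mero_image (mero_iter f m) H \<subseteq> indeterminacy f) \<or>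
           (\<exists>m0\<ge>n0. hypersurface (mero_image (mero_iter f (m0 + 1)) H) \<and>
              (\<forall>m\<in>{n0 + 1..m0}. \<not> mero_image (mero_iter f m) H \<subseteq> indeterminacy f))"
      using assms(4) unfolding quasi_alg_stable_def by blast
    interpret single_primitive_form F d H0 n0
      by unfold_locales (use * in \<open>unfold F(2), blast+\<close>)
    show ?thesis using degree_recurrence n\<^sub>0_pos by blast
  qed
  then obtain p h where "p \<ge> 1" "\<And>n. n \<le> p \<Longrightarrow> dg n = d ^ n" "\<And>n. dg (Suc (n + p)) + h * dg n = d * dg (n + p)"
    by blast
  from recurrence_limit[of p dg d h, OF this(2,1,3) dg_pos]
  obtain L where L: "(\<lambda>n. real (dg n) powr (1 / real n)) \<longlonglongrightarrow> L" "algebraic_int L"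
    "(\<lambda>n. real (dg (n + 1)) / real (dg n)) \<longlonglongrightarrow> L" by blast
  have "dyn_degree1 f = L" unfolding dyn_degree1_def dg by (rule limI[OF L(1)])
  then show ?thesis using L unfolding dg by simp
qed

end
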